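(* Let $(\mathscr{M},g)$ be a globally hyperbolic space-time and $\mathscr{U}\subset\mathscr{C}^\infty(\mathscr{M})$ open in the compact-open topology. Given microcausal functionals $F_1,\dots,F_n\in\mathscr{F}((\mathscr{M},g),\mathscr{U})$, let $V\subset\mathbb{R}^{2n}\cong\mathbb{C}^n$ be an open set containing the range of $(F_1,\dots,F_n):\mathscr{U}\to\mathbb{C}^n$, and let $\psi:V\to\mathbb{C}$ be a smooth map (in the real sense). Then $\psi\circ(F_1,\dots,F_n)\in\mathscr{F}((\mathscr{M},g),\mathscr{U})$, and $$\mathrm{supp}\,(\psi\circ(F_1,\dots,F_n))\subset\bigcup_{j=1}^n\mathrm{supp}\,F_j.$$
   Context: Setting. $\mathscr{M}$ is a smooth, Hausdorff, paracompact, second countable, oriented $d$-dimensional manifold; $g$ is a smooth, time-oriented, globally hyperbolic Lorentzian metric. $\mathscr{C}^\infty(\mathscr{M})$ is the space of real-valued smooth functions; the compact-open topology is the Fréchet topology of uniform convergence of all derivatives on compact sets. A functional on $\mathscr{U}$ is a map $F:\mathscr{U}\to\mathbb{C}$. Its space-time support $\mathrm{supp}\,F$ is the set of $p\in\mathscr{M}$ such that for every neighborhood $U$ of $p$ there are $\psi\in\mathscr{U}$ and $\varphi\in\mathscr{U}-\psi$ with $\mathrm{supp}\,\varphi\subset U$ and $F(\varphi+\psi)\neq F(\psi)$. $F$ is smooth if it is continuous and for every $k\ge1$ the Gâteaux derivatives $F^{(k)}[\varphi](\vec\varphi_1,\dots,\vec\varphi_k)=\partial_{\lambda_1}\cdots\partial_{\lambda_k}|_{\lambda=0}F(\varphi+\sum_j\lambda_j\vec\varphi_j)$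 exist as jointly continuous maps $\mathscr{U}\times\mathscr{C}^\infty(\mathscr{M})^k\to\mathbb{C}$; then $F^{(k)}[\varphi]$ is a compactly supported distribution density on $\mathscr{M}^k$. $\overline V_{\pm,g}(x)\subset T^*_x\mathscr{M}$ is the closed forward/backward light cone of $g^{-1}(x)$ (containing $0$). $\Upsilon_{k,g}$ is the set of $(x_1,\dots,x_k;\xi_1,\dots,\xi_k)\in T^*\mathscr{M}^k\setminus0$ with $(\xi_1,\dots,\xi_k)\notin\prod_j\overline V_{+,g}(x_j)\cup\prod_j\overline V_{-,g}(x_j)$. The space $\mathscr{F}((\mathscr{M},g),\mathscr{U})$ of microcausal functionals consists of the smooth functionals $F$ on $\mathscr{U}$ with compact space-time support such that $\mathrm{WF}(F^{(k)}[\varphi])\subset\Upsilon_{k,g}$ for all $\varphi\in\mathscr{U}$, $k\ge1$, where $\mathrm{WF}$ is the wave front set. *)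

theory Defs
  imports "HOL-Analysis.Analysis" "HOL-Combinatorics.Permutations"
begin

section \<open>Smooth functions of finitely many real variables\<close>

text \<open>
  The dimension of \<open>M\<^sup>k\<close> depends on \<open>k\<close>, so dimensions cannot be types. \<open>\<real>\<^sup>n\<close> is the
  \<^const>\<open>Euclidean_space\<close> of HOL-Analysis: sequences vanishing from index \<open>n\<close> on.
\<close>

definition partial_deriv ::
    "nat \<Rightarrow> ((nat \<Rightarrow> real) \<Rightarrow> 'b::real_normed_vector) \<Rightarrow> (nat \<Rightarrow> real) \<Rightarrow> 'b" where
  "partial_deriv i f y = vector_derivative (\<lambda>t. f (y(i := t))) (at (y i))"

primrec iter_partial ::
    "nat list \<Rightarrow> ((nat \<Rightarrow> real) \<Rightarrow> 'b::real_normed_vector) \<Rightarrow> (nat \<Rightarrow> real) \<Rightarrow> 'b" where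
  "iter_partial [] f = f"
| "iter_partial (i # js) f = partial_deriv i (iter_partial js f)"

text \<open>Meant for open \<open>V\<close>: all iterated partial derivatives exist and are continuous on \<open>V\<close>.\<close>

definition smooth_on_Rn ::
    "nat \<Rightarrow> (nat \<Rightarrow> real) set \<Rightarrow> ((nat \<Rightarrow> real) \<Rightarrow> 'b::real_normed_vector) \<Rightarrow> bool" where
  "smooth_on_Rn n V f \<longleftrightarrow>
     (\<forall>js. set js \<subseteq> {..<n} \<longrightarrow>
        continuous_map (subtopology (Euclidean_space n) V) euclidean (iter_partial js f) \<and>
        (\<forall>i<n. \<forall>y\<in>V. (\<lambda>t. iter_partial js f (y(i := t))) differentiable (at (y i))))"


section \<open>Smooth manifolds\<close>

text \<open>A chart is a pair of its domain and its coordinate map.\<close>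

type_synonym 'a chart = "'a set \<times> ('a \<Rightarrow> nat \<Rightarrow> real)"

record 'a manifold =
  mtop :: "'a topology"
  mdim :: nat
  atlas :: "'a chart set"

definition chart_image :: "'a chart \<Rightarrow> (nat \<Rightarrow> real) set" where
  "chart_image c = snd c ` fst c"

definition chart_inv :: "'a chart \<Rightarrow> (nat \<Rightarrow> real) \<Rightarrow> 'a" where
  "chart_inv c = inv_into (fst c) (snd c)"

definition charts_at :: "('a, 'z) manifold_scheme \<Rightarrow> 'a \<Rightarrow> 'a chart set" where
  "charts_at M x = {c \<in> atlas M. x \<in> fst c}"

definition paracompact_space :: "'a topology \<Rightarrow> bool" where
  "paracompact_space X \<longleftrightarrow>
     (\<forall>\<C>. (\<forall>C\<in>\<C>. openin X C) \<and> \<Union>\<C> = topspace X \<longrightarrow>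
       (\<exists>\<D>. (\<forall>D\<in>\<D>. openin X D \<and> (\<exists>C\<in>\<C>. D \<subseteq> C)) \<and> \<Union>\<D> = topspace X \<and> locally_finite_in X \<D>))"

definition smooth_manifold :: "('a, 'z) manifold_scheme \<Rightarrow> bool" where
  "smooth_manifold M \<longleftrightarrow>
     Hausdorff_space (mtop M) \<and> paracompact_space (mtop M) \<and> second_countable (mtop M) \<and>
     (\<Union>c\<in>atlas M. fst c) = topspace (mtop M) \<and>
     (\<forall>c\<in>atlas M.
        openin (mtop M) (fst c) \<and>
        openin (Euclidean_space (mdim M)) (chart_image c) \<and>
        homeomorphic_map (subtopology (mtop M) (fst c))
          (subtopology (Euclidean_space (mdim M)) (chart_image c)) (snd c)) \<and>
     (\<forall>c\<in>atlas M. \<forall>c'\<in>atlas M. \<forall>i<mdim M.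
        smooth_on_Rn (mdim M) (snd c ` (fst c \<inter> fst c')) (\<lambda>y. snd c' (chart_inv c y) i))"

definition jacobian_det ::
    "('a, 'z) manifold_scheme \<Rightarrow> 'a chart \<Rightarrow> 'a chart \<Rightarrow> 'a \<Rightarrow> real" where
  "jacobian_det M c c' x =
     (\<Sum>p | p permutes {..<mdim M}. of_int (sign p) *
        (\<Prod>i<mdim M. partial_deriv i (\<lambda>y. snd c' (chart_inv c y) (p i)) (snd c x)))"

text \<open>An oriented manifold is one presented by an oriented atlas.\<close>

definition oriented_manifold :: "('a, 'z) manifold_scheme \<Rightarrow> bool" where
  "oriented_manifold M \<longleftrightarrow> smooth_manifold M \<and>
     (\<forall>c\<in>atlas M. \<forall>c'\<in>atlas M. \<forall>x\<in>fst c \<inter> fst c'. 0 < jacobian_det M c c' x)"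

text \<open>
  \<open>M\<^sup>k\<close>: points are families indexed by \<open>{..<k}\<close> (\<^const>\<open>undefined\<close> elsewhere); in a product
  chart, the \<open>i\<close>-th coordinate of the \<open>j\<close>-th point has index \<open>j * mdim M + i\<close>.
\<close>

definition product_chart ::
    "('a, 'z) manifold_scheme \<Rightarrow> nat \<Rightarrow> (nat \<Rightarrow> 'a chart) \<Rightarrow> (nat \<Rightarrow> 'a) chart" where
  "product_chart M k c =
     (PiE {..<k} (\<lambda>j. fst (c j)),
      \<lambda>x m. if m < k * mdim M
            then snd (c (m div mdim M)) (x (m div mdim M)) (m mod mdim M) else 0)"

definition power_manifold :: "('a, 'z) manifold_scheme \<Rightarrow> nat \<Rightarrow> (nat \<Rightarrow> 'a) manifold" where
  "power_manifold M k =
     \<lparr> mtop = product_topology (\<lambda>_. mtop M) {..<k},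
       mdim = k * mdim M,
       atlas = {product_chart M k c | c. \<forall>j<k. c j \<in> atlas M} \<rparr>"


section \<open>Smooth functions on a manifold\<close>

text \<open>
  Functions on \<open>M\<close> are represented by their extension by \<open>0\<close> to the whole type, so that equality
  of functions on \<open>M\<close> is equality in HOL.
\<close>

definition smooth_functions ::
    "('a, 'z) manifold_scheme \<Rightarrow> ('a \<Rightarrow> 'b::real_normed_vector) set" where
  "smooth_functions M =
     {f. (\<forall>x. x \<notin> topspace (mtop M) \<longrightarrow> f x = 0) \<and>
         (\<forall>c\<in>atlas M. smooth_on_Rn (mdim M) (chart_image c) (\<lambda>y. f (chart_inv c y)))}"

definition fun_support :: "('a, 'z) manifold_scheme \<Rightarrow> ('a \<Rightarrow> 'b::zero) \<Rightarrow> 'a set" where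
  "fun_support M f = mtop M closure_of {x \<in> topspace (mtop M). f x \<noteq> 0}"

text \<open>
  Uniform convergence of all derivatives on compact sets. Compact sets inside a single chart
  suffice, since every compact set js a finite union of such sets.
\<close>

definition smooth_topology ::
    "('a, 'z) manifold_scheme \<Rightarrow> ('a \<Rightarrow> 'b::real_normed_vector) topology" where
  "smooth_topology M = topology_generated_by
     (insert (smooth_functions M)
       {{h \<in> smooth_functions M. \<forall>x\<in>K.
           norm (iter_partial js (\<lambda>y. h (chart_inv c y) - f (chart_inv c y)) (snd c x)) < e}
        | f c K js e. f \<in> smooth_functions M \<and> c \<in> atlas M \<and>
            compactin (mtop M) K \<and> K \<subseteq> fst c \<and> set js \<subseteq> {..<mdim M} \<and> 0 < e})"


section \<open>Tangent and cotangent spaces\<close>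

text \<open>
  Tangent vectors at \<open>x\<close> are the derivations \<open>f \<mapsto> (\<Sum>i<d. a\<^sub>i \<partial>f/\<partial>x\<^sub>i)(x)\<close> on real smooth
  functions; cotangent vectors are linear forms on the tangent space, extended by \<open>0\<close>.
\<close>

type_synonym 'a tangent = "('a \<Rightarrow> real) \<Rightarrow> real"
type_synonym 'a cotangent = "'a tangent \<Rightarrow> real"

definition chart_vector ::
    "('a, 'z) manifold_scheme \<Rightarrow> 'a chart \<Rightarrow> 'a \<Rightarrow> (nat \<Rightarrow> real) \<Rightarrow> 'a tangent" where
  "chart_vector M c x a = (\<lambda>f. if f \<in> smooth_functions M
     then \<Sum>i<mdim M. a i * partial_deriv i (\<lambda>y. f (chart_inv c y)) (snd c x) else 0)"

definition coord_vector ::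
    "('a, 'z) manifold_scheme \<Rightarrow> 'a chart \<Rightarrow> 'a \<Rightarrow> nat \<Rightarrow> 'a tangent" where
  "coord_vector M c x i = chart_vector M c x (\<lambda>j. if j = i then 1 else 0)"

definition tangent_space :: "('a, 'z) manifold_scheme \<Rightarrow> 'a \<Rightarrow> 'a tangent set" where
  "tangent_space M x = {chart_vector M c x a | c a. c \<in> charts_at M x}"

definition linear_form_on :: "('a tangent) set \<Rightarrow> ('a tangent \<Rightarrow> real) \<Rightarrow> bool" where
  "linear_form_on S \<xi> \<longleftrightarrow>
     (\<forall>v\<in>S. \<forall>w\<in>S. \<xi> (\<lambda>f. v f + w f) = \<xi> v + \<xi> w) \<and>
     (\<forall>v\<in>S. \<forall>a. \<xi> (\<lambda>f. a * v f) = a * \<xi> v)"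

definition cotangent_space :: "('a, 'z) manifold_scheme \<Rightarrow> 'a \<Rightarrow> 'a cotangent set" where
  "cotangent_space M x =
     {\<xi>. linear_form_on (tangent_space M x) \<xi> \<and> (\<forall>v. v \<notin> tangent_space M x \<longrightarrow> \<xi> v = 0)}"

definition cotangent_coords ::
    "('a, 'z) manifold_scheme \<Rightarrow> 'a chart \<Rightarrow> 'a \<Rightarrow> 'a cotangent \<Rightarrow> nat \<Rightarrow> real" where
  "cotangent_coords M c x \<xi> = (\<lambda>i. if i < mdim M then \<xi> (coord_vector M c x i) else 0)"

text \<open>
  The component \<open>\<xi>\<^sub>j\<close> at \<open>x\<^sub>j\<close> of \<open>\<xi> = (\<xi>\<^sub>1, \<dots>, \<xi>\<^sub>k)\<close> at \<open>x\<close> in \<open>T\<^sup>*M\<^sup>k\<close>: the pullback of \<open>\<xi>\<close>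
  along the inclusion \<open>y \<mapsto> (x\<^sub>1, \<dots>, y, \<dots>, x\<^sub>k)\<close> of the \<open>j\<close>-th factor.
\<close>

definition slot_covector ::
    "('a, 'z) manifold_scheme \<Rightarrow> nat \<Rightarrow> (nat \<Rightarrow> 'a) \<Rightarrow> (nat \<Rightarrow> 'a) cotangent \<Rightarrow> nat \<Rightarrow> 'a cotangent" where
  "slot_covector M k x \<xi> j = (\<lambda>v. if v \<in> tangent_space M (x j)
     then \<xi> (\<lambda>f. if f \<in> smooth_functions (power_manifold M k) then v (\<lambda>y. f (x(j := y))) else 0)
     else 0)"


section \<open>Globally hyperbolic space-times\<close>

text \<open>
  The signature is \<open>(-,+,\<dots>,+)\<close>. The time orientation is given by a smooth timelike vector field,
  which is future directed by definition.
\<close>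

record 'a spacetime = "'a manifold" +
  metric :: "'a \<Rightarrow> 'a tangent \<Rightarrow> 'a tangent \<Rightarrow> real"
  time_field :: "'a \<Rightarrow> 'a tangent"

definition lorentzian_at :: "'a spacetime \<Rightarrow> 'a \<Rightarrow> bool" where
  "lorentzian_at M x \<longleftrightarrow>
     (\<forall>v\<in>tangent_space M x. linear_form_on (tangent_space M x) (metric M x v)) \<and>
     (\<forall>v\<in>tangent_space M x. \<forall>w\<in>tangent_space M x. metric M x v w = metric M x w v) \<and>
     0 < mdim M \<and>
     (\<exists>e. (\<forall>i<mdim M. e i \<in> tangent_space M x) \<and>
          (\<forall>v\<in>tangent_space M x. \<exists>a. v = (\<lambda>f. \<Sum>i<mdim M. a i * e i f)) \<and>
          (\<forall>i<mdim M. \<forall>j<mdim M. metric M x (e i) (e j) =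
             (if i \<noteq> j then 0 else if i = 0 then - 1 else 1)))"

definition lorentzian_metric :: "'a spacetime \<Rightarrow> bool" where
  "lorentzian_metric M \<longleftrightarrow>
     (\<forall>x\<in>topspace (mtop M). lorentzian_at M x) \<and>
     (\<forall>c\<in>atlas M. \<forall>i<mdim M. \<forall>j<mdim M.
        smooth_on_Rn (mdim M) (chart_image c)
          (\<lambda>y. metric M (chart_inv c y) (coord_vector M c (chart_inv c y) i)
                                        (coord_vector M c (chart_inv c y) j)))"

definition time_oriented :: "'a spacetime \<Rightarrow> bool" where
  "time_oriented M \<longleftrightarrow>
     (\<forall>x\<in>topspace (mtop M). time_field M x \<in> tangent_space M x \<and>
        metric M x (time_field M x) (time_field M x) < 0) \<and>
     (\<forall>f\<in>smooth_functions M.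
        (\<lambda>x. if x \<in> topspace (mtop M) then time_field M x f else 0) \<in> smooth_functions M)"

definition future_causal :: "'a spacetime \<Rightarrow> 'a \<Rightarrow> 'a tangent set" where
  "future_causal M x = {v \<in> tangent_space M x. v \<noteq> (\<lambda>_. 0) \<and> metric M x v v \<le> 0 \<and>
     metric M x (time_field M x) v < 0}"

definition velocity :: "('a, 'z) manifold_scheme \<Rightarrow> (real \<Rightarrow> 'a) \<Rightarrow> real \<Rightarrow> 'a tangent" where
  "velocity M \<gamma> t = (\<lambda>f. if f \<in> smooth_functions M then deriv (\<lambda>s. f (\<gamma> s)) t else 0)"

definition smooth_curve_on :: "('a, 'z) manifold_scheme \<Rightarrow> real set \<Rightarrow> (real \<Rightarrow> 'a) \<Rightarrow> bool" where
  "smooth_curve_on M J \<gamma> \<longleftrightarrow>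
     continuous_map (top_of_set J) (mtop M) \<gamma> \<and>
     (\<forall>f\<in>smooth_functions M. \<forall>m. (deriv ^^ m) (\<lambda>s. f (\<gamma> s)) differentiable_on J)"

definition causal_segment :: "'a spacetime \<Rightarrow> real \<Rightarrow> real \<Rightarrow> (real \<Rightarrow> 'a) \<Rightarrow> bool" where
  "causal_segment M a b \<gamma> \<longleftrightarrow> a < b \<and>
     (\<exists>e>0. smooth_curve_on M {a - e<..<b + e} \<gamma>) \<and>
     (\<forall>t\<in>{a..b}. velocity M \<gamma> t \<in> future_causal M (\<gamma> t))"

text \<open>
  \<open>causal_trace M p C q\<close>: \<open>C\<close> is the image of a piecewise smooth future directed causal curve
  from \<open>p\<close> to \<open>q\<close>.
\<close>

inductive causal_trace :: "'a spacetime \<Rightarrow> 'a \<Rightarrow> 'a set \<Rightarrow> 'a \<Rightarrow> bool" for M where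
  segment: "causal_segment M a b \<gamma> \<Longrightarrow> causal_trace M (\<gamma> a) (\<gamma> ` {a..b}) (\<gamma> b)"
| join: "causal_trace M p C q \<Longrightarrow> causal_trace M q D r \<Longrightarrow> causal_trace M p (C \<union> D) r"

definition causal_future :: "'a spacetime \<Rightarrow> 'a \<Rightarrow> 'a set" where
  "causal_future M p = {q \<in> topspace (mtop M). q = p \<or> (\<exists>C. causal_trace M p C q)}"

definition causal_past :: "'a spacetime \<Rightarrow> 'a \<Rightarrow> 'a set" where
  "causal_past M p = {q \<in> topspace (mtop M). q = p \<or> (\<exists>C. causal_trace M q C p)}"

definition strongly_causal :: "'a spacetime \<Rightarrow> bool" where
  "strongly_causal M \<longleftrightarrow>
     (\<forall>p U. openin (mtop M) U \<and> p \<in> U \<longrightarrow>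
       (\<exists>W. openin (mtop M) W \<and> p \<in> W \<and> W \<subseteq> U \<and>
          (\<forall>q C r. causal_trace M q C r \<and> q \<in> W \<and> r \<in> W \<longrightarrow> C \<subseteq> U)))"

definition globally_hyperbolic_spacetime :: "'a spacetime \<Rightarrow> bool" where
  "globally_hyperbolic_spacetime M \<longleftrightarrow>
     oriented_manifold M \<and> lorentzian_metric M \<and> time_oriented M \<and> strongly_causal M \<and>
     (\<forall>p\<in>topspace (mtop M). \<forall>q\<in>topspace (mtop M).
        compactin (mtop M) (causal_future M p \<inter> causal_past M q))"


section \<open>Light cones in the cotangent bundle\<close>

definition sharp :: "'a spacetime \<Rightarrow> 'a \<Rightarrow> 'a cotangent \<Rightarrow> 'a tangent" where
  "sharp M x \<xi> = (THE v. v \<in> tangent_space M x \<and> (\<forall>w\<in>tangent_space M x. metric M x v w = \<xi> w))"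

definition inverse_metric :: "'a spacetime \<Rightarrow> 'a \<Rightarrow> 'a cotangent \<Rightarrow> 'a cotangent \<Rightarrow> real" where
  "inverse_metric M x \<xi> \<eta> = metric M x (sharp M x \<xi>) (sharp M x \<eta>)"

text \<open>
  A covector is forward if the corresponding tangent vector is future directed. Both cones
  contain \<open>0\<close>; a nonzero causal vector is never orthogonal to the time field, so the non-strict
  inequalities below add nothing else.
\<close>

definition forward_cone :: "'a spacetime \<Rightarrow> 'a \<Rightarrow> 'a cotangent set" where
  "forward_cone M x = {\<xi> \<in> cotangent_space M x. inverse_metric M x \<xi> \<xi> \<le> 0 \<and>
     metric M x (time_field M x) (sharp M x \<xi>) \<le> 0}"

definition backward_cone :: "'a spacetime \<Rightarrow> 'a \<Rightarrow> 'a cotangent set" where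
  "backward_cone M x = {\<xi> \<in> cotangent_space M x. inverse_metric M x \<xi> \<xi> \<le> 0 \<and>
     metric M x (time_field M x) (sharp M x \<xi>) \<ge> 0}"

definition Upsilon :: "'a spacetime \<Rightarrow> nat \<Rightarrow> ((nat \<Rightarrow> 'a) \<times> (nat \<Rightarrow> 'a) cotangent) set" where
  "Upsilon M k = {(x, \<xi>). x \<in> topspace (mtop (power_manifold M k)) \<and>
     \<xi> \<in> cotangent_space (power_manifold M k) x \<and> \<xi> \<noteq> (\<lambda>_. 0) \<and>
     \<not> ((\<forall>j<k. slot_covector M k x \<xi> j \<in> forward_cone M (x j)) \<or>
        (\<forall>j<k. slot_covector M k x \<xi> j \<in> backward_cone M (x j)))}"


section \<open>Compactly supported distributions and wave front sets\<close>

text \<open>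
  Compactly supported distribution densities are the continuous complex linear functionals on the
  space of all complex valued smooth functions.
\<close>

definition compact_distribution ::
    "('a, 'z) manifold_scheme \<Rightarrow> (('a \<Rightarrow> complex) \<Rightarrow> complex) \<Rightarrow> bool" where
  "compact_distribution N u \<longleftrightarrow>
     (\<forall>f\<in>smooth_functions N. \<forall>h\<in>smooth_functions N. u (\<lambda>x. f x + h x) = u f + u h) \<and>
     (\<forall>f\<in>smooth_functions N. \<forall>a. u (\<lambda>x. a * f x) = a * u f) \<and>
     continuous_map (smooth_topology N) euclidean u"

text \<open>The Fourier transform, in the coordinates of a chart, of \<open>u\<close> multiplied by a cutoff \<open>\<rho>\<close>.\<close>

definition local_fourier ::
    "('a, 'z) manifold_scheme \<Rightarrow> 'a chart \<Rightarrow> (('a \<Rightarrow> complex) \<Rightarrow> complex) \<Rightarrow> ('a \<Rightarrow> complex) \<Rightarrow>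
     (nat \<Rightarrow> real) \<Rightarrow> complex" where
  "local_fourier N c u \<rho> \<eta> = u (\<lambda>y. \<rho> y * cis (- (\<Sum>i<mdim N. snd c y i * \<eta> i)))"

definition regular_direction :: "nat \<Rightarrow> ((nat \<Rightarrow> real) \<Rightarrow> complex) \<Rightarrow> (nat \<Rightarrow> real) \<Rightarrow> bool" where
  "regular_direction n w \<eta>0 \<longleftrightarrow>
     (\<exists>\<Gamma>. openin (Euclidean_space n) \<Gamma> \<and> \<eta>0 \<in> \<Gamma> \<and> (\<forall>\<eta>\<in>\<Gamma>. \<forall>t>0. (\<lambda>i. t * \<eta> i) \<in> \<Gamma>) \<and>
       (\<forall>m::nat. \<exists>C. \<forall>\<eta>\<in>\<Gamma>. norm (w \<eta>) * (1 + L2_set \<eta> {..<n}) ^ m \<le> C))"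

text \<open>
  Hoermander's definition: \<open>(x, \<xi>)\<close> is in the wave front set if in some chart around \<open>x\<close>,
  whatever the cutoff \<open>\<rho>\<close> with \<open>\<rho>(x) \<noteq> 0\<close>, the Fourier transform of \<open>\<rho>u\<close> is not rapidly
  decreasing in any conic neighbourhood of \<open>\<xi>\<close>. That is, the wave front set is the union of the
  pullbacks of the local wave front sets along all charts.
\<close>

definition wavefront_set ::
    "('a, 'z) manifold_scheme \<Rightarrow> (('a \<Rightarrow> complex) \<Rightarrow> complex) \<Rightarrow> ('a \<times> 'a cotangent) set" where
  "wavefront_set N u = {(x, \<xi>). x \<in> topspace (mtop N) \<and>
     \<xi> \<in> cotangent_space N x \<and> \<xi> \<noteq> (\<lambda>_. 0) \<and>
     (\<exists>c\<in>charts_at N x. \<forall>\<rho>\<in>smooth_functions N.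
        compactin (mtop N) (fun_support N \<rho>) \<and> fun_support N \<rho> \<subseteq> fst c \<and> \<rho> x \<noteq> 0 \<longrightarrow>
        \<not> regular_direction (mdim N) (local_fourier N c u \<rho>) (cotangent_coords N c x \<xi>))}"


section \<open>Microcausal functionals\<close>

text \<open>Only the values of a functional on its domain \<open>\<U>\<close> are ever used.\<close>

type_synonym 'a functional = "('a \<Rightarrow> real) \<Rightarrow> complex"

definition functional_support ::
    "('a, 'z) manifold_scheme \<Rightarrow> ('a \<Rightarrow> real) set \<Rightarrow> 'a functional \<Rightarrow> 'a set" where
  "functional_support M \<U> F = {p \<in> topspace (mtop M). \<forall>U. openin (mtop M) U \<and> p \<in> U \<longrightarrow>
     (\<exists>\<psi>\<in>\<U>. \<exists>\<phi>. (\<lambda>x. \<phi> x + \<psi> x) \<in> \<U> \<and> fun_support M \<phi> \<subseteq> U \<and> F (\<lambda>x. \<phi> x + \<psi> x) \<noteq> F \<psi>)}"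

text \<open>
  \<open>gateaux F [h\<^sub>1, \<dots>, h\<^sub>k] \<phi>\<close> is the iterated derivative \<open>\<partial>/\<partial>\<lambda>\<^sub>1 \<dots> \<partial>/\<partial>\<lambda>\<^sub>k\<close> at \<open>\<lambda> = 0\<close> of
  \<open>F (\<phi> + \<lambda>\<^sub>1 h\<^sub>1 + \<dots> + \<lambda>\<^sub>k h\<^sub>k)\<close>: by the time \<open>\<partial>/\<partial>\<lambda>\<^sub>1\<close> is taken, \<open>\<lambda>\<^sub>2 = \<dots> = \<lambda>\<^sub>k = 0\<close>.
\<close>

primrec gateaux :: "'a functional \<Rightarrow> ('a \<Rightarrow> real) list \<Rightarrow> ('a \<Rightarrow> real) \<Rightarrow> complex" where
  "gateaux F [] \<phi> = F \<phi>"
| "gateaux F (h # hs) \<phi> =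
     vector_derivative (\<lambda>s. gateaux F hs (\<lambda>x. \<phi> x + s * h x)) (at 0)"

definition smooth_functional ::
    "('a, 'z) manifold_scheme \<Rightarrow> ('a \<Rightarrow> real) set \<Rightarrow> 'a functional \<Rightarrow> bool" where
  "smooth_functional M \<U> F \<longleftrightarrow>
     continuous_map (subtopology (smooth_topology M) \<U>) euclidean F \<and>
     (\<forall>\<phi>\<in>\<U>. \<forall>h\<in>smooth_functions M. \<forall>hs. set hs \<subseteq> smooth_functions M \<longrightarrow>
        (\<lambda>s. gateaux F hs (\<lambda>x. \<phi> x + s * h x)) differentiable (at 0)) \<and>
     (\<forall>k\<ge>1. continuous_map
        (prod_topology (subtopology (smooth_topology M) \<U>)
           (product_topology (\<lambda>_. smooth_topology M) {..<k}))
        euclidean (\<lambda>(\<phi>, H). gateaux F (map H [0..<k]) \<phi>))"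

definition tensor_function ::
    "('a, 'z) manifold_scheme \<Rightarrow> nat \<Rightarrow> (nat \<Rightarrow> 'a \<Rightarrow> real) \<Rightarrow> (nat \<Rightarrow> 'a) \<Rightarrow> complex" where
  "tensor_function M k H = (\<lambda>x. if x \<in> topspace (mtop (power_manifold M k))
     then of_real (\<Prod>j<k. H j (x j)) else 0)"

text \<open>
  \<open>u\<close> is the distribution on \<open>M\<^sup>k\<close> defined by the \<open>k\<close>-linear map \<open>D\<close>; it is unique because tensor
  products are total in the smooth functions on \<open>M\<^sup>k\<close>.
\<close>

definition is_kernel ::
    "('a, 'z) manifold_scheme \<Rightarrow> nat \<Rightarrow> (('a \<Rightarrow> real) list \<Rightarrow> complex) \<Rightarrow>
     (((nat \<Rightarrow> 'a) \<Rightarrow> complex) \<Rightarrow> complex) \<Rightarrow> bool" where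
  "is_kernel M k D u \<longleftrightarrow> compact_distribution (power_manifold M k) u \<and>
     (\<forall>H. (\<forall>j<k. H j \<in> smooth_functions M) \<longrightarrow> u (tensor_function M k H) = D (map H [0..<k]))"

definition microcausal_functionals ::
    "'a spacetime \<Rightarrow> ('a \<Rightarrow> real) set \<Rightarrow> 'a functional set" where
  "microcausal_functionals M \<U> =
     {F. smooth_functional M \<U> F \<and> compactin (mtop M) (functional_support M \<U> F) \<and>
         (\<forall>\<phi>\<in>\<U>. \<forall>k\<ge>1. \<exists>u. is_kernel M k (\<lambda>hs. gateaux F hs \<phi>) u \<and>
            wavefront_set (power_manifold M k) u \<subseteq> Upsilon M k)}"

text \<open>The identification of \<open>\<complex>\<^sup>n\<close> with \<open>\<real>\<^sup>2\<^sup>n\<close>: real and imaginary parts alternate.\<close>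

definition real_coords :: "nat \<Rightarrow> (nat \<Rightarrow> complex) \<Rightarrow> nat \<Rightarrow> real" where
  "real_coords n z = (\<lambda>m. if m < 2 * n
     then (if even m then Re (z (m div 2)) else Im (z (m div 2))) else 0)"

end

theory Submission
  imports Defs
begin

text \<open>
  By the chain rule a derivative of \<open>\<psi> \<circ> (F\<^sub>1, \<dots>, F\<^sub>n)\<close> is a sum of terms, each a scalar
  \<open>(\<partial>\<^sup>\<alpha> \<psi>)(F)\<close> times a tensor product of derivatives of \<open>Re F\<^sub>j\<close> and \<open>Im F\<^sub>j\<close> over the blocks of
  a partition of the directions. The kernels of \<open>Re F\<^sub>j\<close> and \<open>Im F\<^sub>j\<close> are combinations of the kernel
  of \<open>F\<^sub>j\<close> and its conjugate, and conjugation negates the wave front set, under which \<open>\<Upsilon>\<^sub>k\<close> is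
  symmetric. A covector outside \<open>\<Upsilon>\<^sub>k\<close> has all components in the forward cones, or all in the
  backward cones, so its restriction to each block is again outside the corresponding \<open>\<Upsilon>\<close>.
  At least one of these restrictions is nonzero; in that block the Fourier transform decays rapidly,
  while in the other it grows polynomially. Hence the tensor product is regular in this direction.
  The wave front set does not depend on the cutoff because multiplication by a smooth function
  preserves rapid decay in a cone, which is shown by expanding the function in a Fourier series.
\<close>

section \<open>Calculus in coordinates\<close>

text \<open>The wave front set is a union over all charts: regularity must be shown in every chart,
  and a covector outside it comes with a cutoff in each. So no invariance of wave front sets under
  coordinate changes enters, and as all charts of M^k are product charts, the Fourier transform of a
  tensor product factorises. Cutoffs are the obstacle: two kernels may be regular with different
  cutoffs, and the product of the cutoffs has to serve both. Distributions are bare continuous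
  linear forms here, so instead of a convolution of Fourier transforms the multiplier is expanded in
  a Fourier series in one coordinate at a time, with one-dimensional integrals and limits of finite
  sums; each coordinate halves the aperture of the cone. Kernels are built along the terms of the
  iterated chain rule. A derivative of the outer function carries no direction and becomes a
  multiple of evaluation on the one-point manifold M^0. The tensor product applies one distribution
  to the slices and the other to the result; this needs no density argument, but it needs
  derivatives of a distribution with respect to a parameter.\<close>

definition euc :: "nat \<Rightarrow> (nat \<Rightarrow> real) set" where
  "euc n = {x. \<forall>i\<ge>n. x i = 0}"

lemma Euclidean_space_eq: "Euclidean_space n = top_of_set (euc n)"
  by (simp add: Euclidean_space_def euc_def euclidean_product_topology)

lemma continuous_map_Euclidean_iff:
  "V \<subseteq> euc n \<Longrightarrow> continuous_map (subtopology (Euclidean_space n) V) euclidean f \<longleftrightarrow> continuous_on V f"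
  by (simp add: Euclidean_space_eq subtopology_subtopology inf.absorb2)

lemma euc_upd: "y \<in> euc n \<Longrightarrow> i < n \<Longrightarrow> y(i := t) \<in> euc n"
  by (auto simp: euc_def)

lemma open_euc_subset: "openin (Euclidean_space n) V \<Longrightarrow> V \<subseteq> euc n"
  by (auto simp: Euclidean_space_eq dest: openin_imp_subset)

lemma continuous_on_fun_upd [continuous_intros]:
  fixes f :: "'a::topological_space \<Rightarrow> nat \<Rightarrow> real"
  assumes "continuous_on S f" "continuous_on S g"
  shows "continuous_on S (\<lambda>x. (f x)(i := g x))"
proof (rule continuous_on_coordinatewise_then_product)
  fix j show "continuous_on S (\<lambda>x. ((f x)(i := g x)) j)"
    using assms continuous_on_product_then_coordinatewise[OF assms(1), of j] by (cases "j = i") auto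
qed

lemma openin_euc_upd_eventually:
  assumes "openin (Euclidean_space n) V" "y \<in> V" "i < n"
  shows "\<forall>\<^sub>F t in nhds (y i). y(i := t) \<in> V"
proof -
  obtain T where T: "open T" "V = euc n \<inter> T"
    using assms(1) by (auto simp: Euclidean_space_eq openin_open)
  have "open ((\<lambda>t. y(i := t)) -` T)"
    by (rule open_vimage[OF T(1)]) (intro continuous_intros)
  moreover have "y i \<in> (\<lambda>t. y(i := t)) -` T"
    using assms T by auto
  ultimately have "\<forall>\<^sub>F t in nhds (y i). t \<in> (\<lambda>t. y(i := t)) -` T"
    by (rule eventually_nhds_in_open)
  then show ?thesis
    by eventually_elim (use assms T in \<open>auto intro: euc_upd\<close>)
qed

text \<open>A basic neighbourhood in the product topology allows a positive radius in every
  coordinate. The first n radii have a minimum, and from n on both points are 0. Boxes of this kind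
  serve as the local metric on sequences.\<close>

lemma openin_euc_box:
  assumes "openin (Euclidean_space n) V" "y \<in> V"
  obtains \<delta> where "\<delta> > 0" "\<And>z. z \<in> euc n \<Longrightarrow> (\<And>i. i < n \<Longrightarrow> \<bar>z i - y i\<bar> < \<delta>) \<Longrightarrow> z \<in> V"
proof -
  obtain T where T: "open T" "V = euc n \<inter> T"
    using assms(1) by (auto simp: Euclidean_space_eq openin_open)
  have "openin (product_topology (\<lambda>i. euclidean) UNIV) T"
    using T by (simp add: euclidean_product_topology)
  with assms T obtain X where X: "y \<in> Pi\<^sub>E UNIV X" "\<And>i. open (X i)" "Pi\<^sub>E UNIV X \<subseteq> T"
    by (auto dest!: product_topology_open_contains_basis[where x=y])
  have "\<exists>d>0. \<forall>t. \<bar>t - y i\<bar> < d \<longrightarrow> t \<in> X i" for i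
    using X(1,2) open_real[THEN iffD1, rule_format, of "X i" "y i"] open_dist
    by (metis PiE_E UNIV_I dist_real_def)
  then obtain d where d: "\<And>i. d i > 0" "\<And>i t. \<bar>t - y i\<bar> < d i \<Longrightarrow> t \<in> X i"
    by metis
  \<comment> \<open>The element 1 keeps the set nonempty when n = 0.\<close>
  define \<delta> where "\<delta> = Min (insert 1 (d ` {..<n}))"
  have \<delta>: "\<delta> > 0" "\<And>i. i < n \<Longrightarrow> \<delta> \<le> d i"
    using d by (auto simp: \<delta>_def)
  have "z \<in> V" if "z \<in> euc n" "\<And>i. i < n \<Longrightarrow> \<bar>z i - y i\<bar> < \<delta>" for z
  proof -
    have "z i \<in> X i" for i
    proof (cases "i < n")
      case True
      then show ?thesis using d(2) that(2)[of i] \<delta>(2)[of i] by force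
    next
      case False
      then have "z i = y i" using that(1) assms T by (auto simp: euc_def)
      then show ?thesis using X(1) by auto
    qed
    then show ?thesis using X(3) T that by auto
  qed
  with \<delta>(1) that show ?thesis by blast
qed

lemma openin_Euclidean_boxI:
  assumes "V \<subseteq> euc n"
    "\<And>y. y \<in> V \<Longrightarrow> \<exists>\<delta>>0. \<forall>z\<in>euc n. (\<forall>i<n. \<bar>z i - y i\<bar> < \<delta>) \<longrightarrow> z \<in> V"
  shows "openin (Euclidean_space n) V"
proof (subst openin_subopen, intro ballI)
  fix y assume y: "y \<in> V"
  then obtain d where d: "d > 0" "\<forall>z\<in>euc n. (\<forall>i<n. \<bar>z i - y i\<bar> < d) \<longrightarrow> z \<in> V"
    using assms(2) by blast
  define B where "B = (\<Inter>i<n. {z::nat\<Rightarrow>real. \<bar>z i - y i\<bar> < d})"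
  have "open B" unfolding B_def
    by (intro open_INT finite_lessThan ballI open_Collect_less continuous_intros) simp_all
  then have "openin (Euclidean_space n) (euc n \<inter> B)"
    by (auto simp: Euclidean_space_eq openin_open)
  moreover have "y \<in> euc n \<inter> B" "euc n \<inter> B \<subseteq> V"
    using y assms(1) d by (auto simp: B_def)
  ultimately show "\<exists>T. openin (Euclidean_space n) T \<and> y \<in> T \<and> T \<subseteq> V" by blast
qed

lemma openin_euc: "openin (Euclidean_space n) (euc n)"
  by (simp add: Euclidean_space_eq)

text \<open>Carries existence and value of a partial derivative together.
  \<open>partial_deriv\<close> by itself returns an arbitrary value where no derivative exists, so
  the rules of calculus are stated for this relation.\<close>

definition has_pd :: "nat \<Rightarrow> (nat \<Rightarrow> real) set \<Rightarrow> ((nat \<Rightarrow> real) \<Rightarrow> 'b::real_normed_vector) \<Rightarrow> ((nat \<Rightarrow> real) \<Rightarrow> 'b) \<Rightarrow> bool" where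
  "has_pd i V f f' \<longleftrightarrow> (\<forall>y\<in>V. ((\<lambda>t. f (y(i := t))) has_vector_derivative f' y) (at (y i)))"

lemma has_pdD: "has_pd i V f f' \<Longrightarrow> y \<in> V \<Longrightarrow> ((\<lambda>t. f (y(i := t))) has_vector_derivative f' y) (at (y i))"
  by (simp add: has_pd_def)

lemma has_pd_partial_deriv: "has_pd i V f f' \<Longrightarrow> y \<in> V \<Longrightarrow> partial_deriv i f y = f' y"
  by (simp add: has_pd_def partial_deriv_def vector_derivative_at)

lemma has_pd_cong:
  assumes "openin (Euclidean_space n) V" "i < n" "\<And>y. y \<in> V \<Longrightarrow> f y = g y" "\<And>y. y \<in> V \<Longrightarrow> f' y = g' y" "has_pd i V f f'"
  shows "has_pd i V g g'"
  unfolding has_pd_def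
proof
  fix y assume y: "y \<in> V"
  have "((\<lambda>t. f (y(i := t))) has_vector_derivative g' y) (at (y i))"
    using assms y by (auto simp: has_pd_def)
  moreover have "\<forall>\<^sub>F t in nhds (y i). t \<in> UNIV \<longrightarrow> f (y(i := t)) = g (y(i := t))"
    using openin_euc_upd_eventually[OF assms(1) y assms(2)] by eventually_elim (use assms in auto)
  ultimately show "((\<lambda>t. g (y(i := t))) has_vector_derivative g' y) (at (y i))"
    using has_vector_derivative_cong_ev[where x="y i" and S=UNIV and f="\<lambda>t. f (y(i := t))" and g="\<lambda>t. g (y(i := t))"] assms(3)[OF y]
    by simp
qed

lemma partial_deriv_cong:
  assumes "openin (Euclidean_space n) V" "i < n" "\<And>y. y \<in> V \<Longrightarrow> f y = g y" "y \<in> V"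
  shows "partial_deriv i f y = partial_deriv i g y"
  unfolding partial_deriv_def
proof (rule vector_derivative_cong_eq)
  show "\<forall>\<^sub>F t in nhds (y i). t \<in> UNIV \<longrightarrow> f (y(i := t)) = g (y(i := t))"
    using openin_euc_upd_eventually[OF assms(1,4,2)] by eventually_elim (use assms in auto)
qed auto

lemma iter_partial_cong:
  assumes "openin (Euclidean_space n) V" "set js \<subseteq> {..<n}" "\<And>y. y \<in> V \<Longrightarrow> f y = g y" "y \<in> V"
  shows "iter_partial js f y = iter_partial js g y"
  using assms(2,4)
proof (induction js arbitrary: y)
  case (Cons i js)
  then show ?case using partial_deriv_cong[OF assms(1), of i "iter_partial js f" "iter_partial js g" y] by auto
qed (use assms in auto)

lemma iter_partial_snoc: "iter_partial (js @ [i]) f = iter_partial js (partial_deriv i f)"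
  by (induction js) auto

lemma iter_partial_append: "iter_partial (js @ ks) f = iter_partial js (iter_partial ks f)"
  by (induction js) auto

lemma smooth_alt:
  assumes "openin (Euclidean_space n) V"
  shows "smooth_on_Rn n V f \<longleftrightarrow> (\<forall>js. set js \<subseteq> {..<n} \<longrightarrow> continuous_on V (iter_partial js f) \<and>
    (\<forall>i<n. has_pd i V (iter_partial js f) (iter_partial (i # js) f)))"
  using open_euc_subset[OF assms]
  by (auto simp: smooth_on_Rn_def continuous_map_Euclidean_iff has_pd_def partial_deriv_def
      vector_derivative_works[symmetric] differentiableI_vector)

lemma smooth_continuous: "openin (Euclidean_space n) V \<Longrightarrow> smooth_on_Rn n V f \<Longrightarrow> continuous_on V f"
  using smooth_alt[of n V f] by (metis empty_set empty_subsetI iter_partial.simps(1))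

lemma smooth_has_pd: "openin (Euclidean_space n) V \<Longrightarrow> smooth_on_Rn n V f \<Longrightarrow> i < n \<Longrightarrow> has_pd i V f (partial_deriv i f)"
  using smooth_alt[of n V f] by (metis empty_set empty_subsetI iter_partial.simps)

lemma smooth_iter: "smooth_on_Rn n V f \<Longrightarrow> set js \<subseteq> {..<n} \<Longrightarrow> smooth_on_Rn n V (iter_partial js f)"
  unfolding smooth_on_Rn_def by (metis iter_partial_append set_append le_sup_iff)

lemma smooth_partial: "smooth_on_Rn n V f \<Longrightarrow> i < n \<Longrightarrow> smooth_on_Rn n V (partial_deriv i f)"
  using smooth_iter[of n V f "[i]"] by auto

text \<open>Smoothness by coinduction: if the members of S are continuous and have their partial
  derivatives in S, then by induction on the list of indices every iterated derivative agrees on V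
  with a member of S. Agreement is claimed on V only; openness of V lets it pass to the next
  derivative. Closure properties of smooth functions are obtained by exhibiting such an S.\<close>

lemma smooth_coinduct:
  assumes V: "openin (Euclidean_space n) V" and "f \<in> S"
    and cont: "\<And>f. f \<in> S \<Longrightarrow> continuous_on V f"
    and pd: "\<And>f i. f \<in> S \<Longrightarrow> i < n \<Longrightarrow> \<exists>f'\<in>S. has_pd i V f f'"
  shows "smooth_on_Rn n V f"
proof -
  have *: "\<exists>g\<in>S. \<forall>y\<in>V. iter_partial js f y = g y" if "set js \<subseteq> {..<n}" for js
    using that
  proof (induction js)
    case (Cons i js)
    then obtain g where g: "g \<in> S" "\<forall>y\<in>V. iter_partial js f y = g y" by auto
    obtain g' where g': "g' \<in> S" "has_pd i V g g'" using pd[OF g(1)] Cons by force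
    have "iter_partial (i # js) f y = g' y" if "y \<in> V" for y
      using partial_deriv_cong[OF V _ _ that, of i "iter_partial js f" g] g g' Cons
        has_pd_partial_deriv[OF g'(2) that] that by auto
    then show ?case using g' by blast
  qed (use assms in auto)
  show ?thesis unfolding smooth_alt[OF V]
  proof (intro allI impI conjI)
    fix js assume js: "set js \<subseteq> {..<n}"
    then obtain g where g: "g \<in> S" "\<forall>y\<in>V. iter_partial js f y = g y" using * by blast
    then show "continuous_on V (iter_partial js f)"
      using cont[of g] by (simp cong: continuous_on_cong)
    fix i assume i: "i < n"
    obtain g' where g': "g' \<in> S" "has_pd i V g g'" using pd[OF g(1) i] by blast
    have "iter_partial (i # js) f y = g' y" if "y \<in> V" for y
      using partial_deriv_cong[OF V i _ that, of "iter_partial js f" g] g g' has_pd_partial_deriv[OF g'(2) that] by auto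
    then show "has_pd i V (iter_partial js f) (iter_partial (i # js) f)"
      using has_pd_cong[OF V i _ _ g'(2)] g by metis
  qed
qed

lemma smooth_cong:
  assumes V: "openin (Euclidean_space n) V" and "\<And>y. y \<in> V \<Longrightarrow> f y = g y" and "smooth_on_Rn n V f"
  shows "smooth_on_Rn n V g"
proof -
  have eq: "iter_partial js f y = iter_partial js g y" if "set js \<subseteq> {..<n}" "y \<in> V" for js y
    using iter_partial_cong[OF V that(1) assms(2) that(2)] .
  show ?thesis unfolding smooth_alt[OF V]
  proof (intro allI impI conjI)
    fix js assume js: "set js \<subseteq> {..<n}"
    have 1: "continuous_on V (iter_partial js f)" "\<And>i. i < n \<Longrightarrow> has_pd i V (iter_partial js f) (iter_partial (i # js) f)"
      using assms(3) js by (auto simp: smooth_alt[OF V])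
    show "continuous_on V (iter_partial js g)"
      using continuous_on_cong[THEN iffD1, OF refl eq 1(1)] js by auto
    fix i assume i: "i < n"
    show "has_pd i V (iter_partial js g) (iter_partial (i # js) g)"
      by (rule has_pd_cong[OF V i eq eq 1(2)[OF i]]) (use js i in auto)
  qed
qed

lemma smooth_subset:
  assumes "openin (Euclidean_space n) V" "openin (Euclidean_space n) W" "W \<subseteq> V" "smooth_on_Rn n V f"
  shows "smooth_on_Rn n W f"
  using assms unfolding smooth_alt[OF assms(1)] smooth_alt[OF assms(2)]
  by (auto simp: has_pd_def intro: continuous_on_subset)

lemma smooth_local:
  assumes V: "openin (Euclidean_space n) V"
    and loc: "\<And>y. y \<in> V \<Longrightarrow> \<exists>W. openin (Euclidean_space n) W \<and> y \<in> W \<and> smooth_on_Rn n W f"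
  shows "smooth_on_Rn n V f"
  unfolding smooth_alt[OF V]
proof (intro allI impI conjI)
  fix js assume js: "set js \<subseteq> {..<n}"
  show "continuous_on V (iter_partial js f)"
    unfolding continuous_on_eq_continuous_within
  proof
    fix y assume y: "y \<in> V"
    obtain W where W: "openin (Euclidean_space n) W" "y \<in> W" "smooth_on_Rn n W f" using loc[OF y] by blast
    then have "continuous (at y within W) (iter_partial js f)"
      using js by (auto simp: smooth_alt[OF W(1)] continuous_on_eq_continuous_within)
    moreover obtain T where T: "open T" "W = euc n \<inter> T"
      using W(1) by (auto simp: Euclidean_space_eq openin_open)
    moreover have "at y within (V \<inter> T) = at y within V"
      by (rule at_within_nhd[of _ T]) (use T W in auto)
    moreover have "V \<inter> T \<subseteq> W" using T open_euc_subset[OF V] by auto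
    ultimately show "continuous (at y within V) (iter_partial js f)"
      by (metis continuous_within_subset)
  qed
  fix i assume i: "i < n"
  show "has_pd i V (iter_partial js f) (iter_partial (i # js) f)"
    unfolding has_pd_def
  proof
    fix y assume y: "y \<in> V"
    obtain W where W: "openin (Euclidean_space n) W" "y \<in> W" "smooth_on_Rn n W f" using loc[OF y] by blast
    then show "((\<lambda>t. iter_partial js f (y(i := t))) has_vector_derivative iter_partial (i # js) f y) (at (y i))"
      using js i by (auto simp: smooth_alt[OF W(1)] has_pd_def)
  qed
qed

section \<open>Algebraic operations on smooth functions\<close>

lemma has_pd_const: "has_pd i V (\<lambda>y. c) (\<lambda>y. 0)"
  by (simp add: has_pd_def)

lemma has_pd_coord: "has_pd i V (\<lambda>y. y j) (\<lambda>y. if j = i then 1 else 0)"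
  by (auto simp: has_pd_def)

lemma has_pd_add: "has_pd i V f f' \<Longrightarrow> has_pd i V g g' \<Longrightarrow> has_pd i V (\<lambda>y. f y + g y) (\<lambda>y. f' y + g' y)"
  by (auto simp: has_pd_def intro!: has_vector_derivative_add)

lemma has_pd_mult:
  fixes f g :: "(nat \<Rightarrow> real) \<Rightarrow> 'b::real_normed_algebra"
  assumes "has_pd i V f f'" "has_pd i V g g'"
  shows "has_pd i V (\<lambda>y. f y * g y) (\<lambda>y. f y * g' y + f' y * g y)"
  unfolding has_pd_def
proof
  fix y assume "y \<in> V"
  then show "((\<lambda>t. f (y(i := t)) * g (y(i := t))) has_vector_derivative f y * g' y + f' y * g y) (at (y i))"
    using has_vector_derivative_mult[OF has_pdD[OF assms(1), of y] has_pdD[OF assms(2), of y]] by simp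
qed

lemma has_pd_bounded_linear: "bounded_linear L \<Longrightarrow> has_pd i V f f' \<Longrightarrow> has_pd i V (\<lambda>y. L (f y)) (\<lambda>y. L (f' y))"
  unfolding has_pd_def using bounded_linear.has_vector_derivative[of L] by blast

text \<open>The derivative of a product is a sum of products, so a set of building blocks is rarely
  closed under differentiation, while its hull is. By the Leibniz rule only the generators have to
  be differentiated, with result in the hull; this brings products and compositions within reach of
  \<open>smooth_coinduct\<close>.\<close>

inductive_set alg_hull :: "('x \<Rightarrow> 'b::real_normed_algebra) set \<Rightarrow> ('x \<Rightarrow> 'b) set" for B where
  base: "f \<in> B \<Longrightarrow> f \<in> alg_hull B"
| add: "f \<in> alg_hull B \<Longrightarrow> g \<in> alg_hull B \<Longrightarrow> (\<lambda>y. f y + g y) \<in> alg_hull B"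
| mult: "f \<in> alg_hull B \<Longrightarrow> g \<in> alg_hull B \<Longrightarrow> (\<lambda>y. f y * g y) \<in> alg_hull B"

lemma alg_hull_sum:
  assumes "(\<lambda>y. 0) \<in> B" "finite I" "\<And>i. i \<in> I \<Longrightarrow> f i \<in> alg_hull B"
  shows "(\<lambda>y. \<Sum>i\<in>I. f i y) \<in> alg_hull B"
  using assms(2,3) by (induction I rule: finite_induct) (auto intro: assms alg_hull.intros)

lemma smooth_alg_hull:
  fixes f :: "(nat \<Rightarrow> real) \<Rightarrow> 'b::real_normed_algebra"
  assumes V: "openin (Euclidean_space n) V" and "f \<in> alg_hull B"
    and cont: "\<And>f. f \<in> B \<Longrightarrow> continuous_on V f"
    and pd: "\<And>f i. f \<in> B \<Longrightarrow> i < n \<Longrightarrow> \<exists>f'\<in>alg_hull B. has_pd i V f f'"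
  shows "smooth_on_Rn n V f"
proof (rule smooth_coinduct[OF V assms(2)])
  fix f assume "f \<in> alg_hull B"
  then show "continuous_on V f"
    by induction (auto intro: cont continuous_intros)
next
  fix f i assume "f \<in> alg_hull B" and i: "i < n"
  then show "\<exists>f'\<in>alg_hull B. has_pd i V f f'"
  proof induction
    case (add f g)
    then show ?case using has_pd_add alg_hull.add by blast
  next
    case (mult f g)
    then obtain f' g' where fg: "f' \<in> alg_hull B" "has_pd i V f f'" "g' \<in> alg_hull B" "has_pd i V g g'" by blast
    with mult have "(\<lambda>y. f y * g' y + f' y * g y) \<in> alg_hull B"
      by (intro alg_hull.add alg_hull.mult)
    with has_pd_mult[OF fg(2,4)] show ?case by blast
  qed (use pd i in auto)
qed

lemma smooth_add_mult:
  fixes f g :: "(nat \<Rightarrow> real) \<Rightarrow> 'b::real_normed_algebra"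
  assumes V: "openin (Euclidean_space n) V" and f: "smooth_on_Rn n V f" and g: "smooth_on_Rn n V g"
  shows smooth_add: "smooth_on_Rn n V (\<lambda>y. f y + g y)" and smooth_mult: "smooth_on_Rn n V (\<lambda>y. f y * g y)"
proof -
  let ?B = "Collect (smooth_on_Rn n V :: ((nat \<Rightarrow> real) \<Rightarrow> 'b) \<Rightarrow> bool)"
  have *: "smooth_on_Rn n V h" if "h \<in> alg_hull ?B" for h :: "(nat \<Rightarrow> real) \<Rightarrow> 'b"
  proof (rule smooth_alg_hull[OF V that])
    fix f :: "(nat \<Rightarrow> real) \<Rightarrow> 'b" and i assume "f \<in> ?B" "i < n"
    then show "\<exists>f'\<in>alg_hull ?B. has_pd i V f f'"
      using smooth_has_pd[OF V, of f i] alg_hull.base[of "partial_deriv i f" ?B] smooth_partial[of n V f i] by blast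
  qed (auto intro: smooth_continuous[OF V])
  show "smooth_on_Rn n V (\<lambda>y. f y + g y)" "smooth_on_Rn n V (\<lambda>y. f y * g y)"
    using f g by (auto intro!: * intro: alg_hull.add alg_hull.mult alg_hull.base)
qed

lemma smooth_const: "openin (Euclidean_space n) V \<Longrightarrow> smooth_on_Rn n V (\<lambda>y. c)"
  by (rule smooth_coinduct[where S="range (\<lambda>c y. c)"]) (auto intro: has_pd_const)

lemma smooth_coord: "openin (Euclidean_space n) V \<Longrightarrow> smooth_on_Rn n V (\<lambda>y. y j)"
  by (rule smooth_coinduct[where S="insert (\<lambda>y. y j) (range (\<lambda>c y. c))"])
    (auto intro: has_pd_const has_pd_coord continuous_on_product_coordinates continuous_on_subset)

lemma smooth_sum:
  fixes f :: "'i \<Rightarrow> (nat \<Rightarrow> real) \<Rightarrow> 'b::real_normed_algebra"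
  assumes "openin (Euclidean_space n) V" "\<And>i. i \<in> I \<Longrightarrow> smooth_on_Rn n V (f i)"
  shows "smooth_on_Rn n V (\<lambda>y. \<Sum>i\<in>I. f i y)"
  using assms(2) by (induction I rule: infinite_finite_induct) (auto intro: assms smooth_const smooth_add)

lemma smooth_bounded_linear:
  assumes V: "openin (Euclidean_space n) V" and L: "bounded_linear L" and f: "smooth_on_Rn n V f"
  shows "smooth_on_Rn n V (\<lambda>y. L (f y))"
proof (rule smooth_coinduct[OF V, where S="{\<lambda>y. L (g y) | g. smooth_on_Rn n V g}"])
  fix g i assume "g \<in> {\<lambda>y. L (g y) | g. smooth_on_Rn n V g}" "i < n"
  then show "\<exists>f'\<in>{\<lambda>y. L (g y) | g. smooth_on_Rn n V g}. has_pd i V g f'"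
    using has_pd_bounded_linear[OF L smooth_has_pd[OF V]] smooth_partial by fast
next
  show "(\<lambda>y. L (f y)) \<in> {\<lambda>y. L (g y) | g. smooth_on_Rn n V g}" using f by blast
next
  fix g assume "g \<in> {\<lambda>y. L (g y) | g. smooth_on_Rn n V g}"
  then show "continuous_on V g"
    using bounded_linear.continuous_on[OF L smooth_continuous[OF V]] by blast
qed

lemma iter_partial_bounded_linear:
  assumes V: "openin (Euclidean_space n) V" and L: "bounded_linear L" and f: "smooth_on_Rn n V f"
    and "set js \<subseteq> {..<n}" "y \<in> V"
  shows "iter_partial js (\<lambda>y. L (f y)) y = L (iter_partial js f y)"
  using assms(4,5)
proof (induction js arbitrary: y)
  case (Cons i js)
  have "has_pd i V (\<lambda>y. L (iter_partial js f y)) (\<lambda>y. L (iter_partial (i # js) f y))"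
    using Cons by (intro has_pd_bounded_linear[OF L]) (use f in \<open>auto simp: smooth_alt[OF V]\<close>)
  with Cons show ?case
    using partial_deriv_cong[OF V, of i "iter_partial js (\<lambda>y. L (f y))" "\<lambda>y. L (iter_partial js f y)" y]
    by (auto simp: has_pd_partial_deriv)
qed auto

lemma iter_partial_add:
  assumes V: "openin (Euclidean_space n) V" and f: "smooth_on_Rn n V f" and g: "smooth_on_Rn n V g"
    and "set js \<subseteq> {..<n}" "y \<in> V"
  shows "iter_partial js (\<lambda>y. f y + g y) y = iter_partial js f y + iter_partial js g y"
  using assms(4,5)
proof (induction js arbitrary: y)
  case (Cons i js)
  have "has_pd i V (\<lambda>y. iter_partial js f y + iter_partial js g y) (\<lambda>y. iter_partial (i # js) f y + iter_partial (i # js) g y)"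
    using Cons by (intro has_pd_add) (use f g in \<open>auto simp: smooth_alt[OF V]\<close>)
  with Cons show ?case
    using partial_deriv_cong[OF V, of i "iter_partial js (\<lambda>y. f y + g y)" "\<lambda>y. iter_partial js f y + iter_partial js g y" y]
    by (auto simp: has_pd_partial_deriv)
qed auto

lemma iter_partial_sum:
  fixes f :: "'i \<Rightarrow> (nat \<Rightarrow> real) \<Rightarrow> 'b::real_normed_algebra"
  assumes V: "openin (Euclidean_space n) V" and f: "\<And>i. i \<in> I \<Longrightarrow> smooth_on_Rn n V (f i)"
    and js: "set js \<subseteq> {..<n}" "y \<in> V"
  shows "iter_partial js (\<lambda>y. \<Sum>i\<in>I. f i y) y = (\<Sum>i\<in>I. iter_partial js (f i) y)"
  using f
proof (induction I rule: infinite_finite_induct)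
  case (insert i I)
  then show ?case using iter_partial_add[OF V _ _ js, of "f i" "\<lambda>y. \<Sum>i\<in>I. f i y"] by (auto intro: smooth_sum[OF V])
next
  case empty
  show ?case using iter_partial_bounded_linear[OF V bounded_linear_zero smooth_const[OF V, of 0] js] by simp
next
  case (infinite A)
  show ?case using infinite iter_partial_bounded_linear[OF V bounded_linear_zero smooth_const[OF V, of 0] js] by simp
qed

section \<open>The chain rule in several variables\<close>

lemma has_vector_derivative_iff_quotient:
  "(f has_vector_derivative D) (at x) \<longleftrightarrow> ((\<lambda>t. (f t - f x) /\<^sub>R (t - x)) \<longlongrightarrow> D) (at x)"
proof -
  have "(f has_vector_derivative D) (at x) \<longleftrightarrow> ((\<lambda>y. norm (f y - f x - (y - x) *\<^sub>R D) / norm (y - x)) \<longlongrightarrow> 0) (at x)"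
    by (simp add: has_vector_derivative_def has_derivative_iff_norm bounded_linear_scaleR_left)
  also have "\<dots> \<longleftrightarrow> ((\<lambda>t. norm ((f t - f x) /\<^sub>R (t - x) - D)) \<longlongrightarrow> 0) (at x)"
  proof (rule filterlim_cong[OF refl refl])
    show "\<forall>\<^sub>F t in at x. norm (f t - f x - (t - x) *\<^sub>R D) / norm (t - x) = norm ((f t - f x) /\<^sub>R (t - x) - D)"
      unfolding eventually_at_filter
    proof (intro always_eventually allI impI)
      fix t assume "t \<noteq> x"
      then have "(f t - f x) /\<^sub>R (t - x) - D = (f t - f x - (t - x) *\<^sub>R D) /\<^sub>R (t - x)"
        by (simp add: scaleR_diff_right)
      then show "norm (f t - f x - (t - x) *\<^sub>R D) / norm (t - x) = norm ((f t - f x) /\<^sub>R (t - x) - D)"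
        by (simp add: divide_inverse mult.commute)
    qed
  qed
  also have "\<dots> \<longleftrightarrow> ((\<lambda>t. (f t - f x) /\<^sub>R (t - x)) \<longlongrightarrow> D) (at x)"
    by (simp add: tendsto_norm_zero_iff LIM_zero_iff)
  finally show ?thesis .
qed

lemma continuous_euc_box:
  assumes V: "openin (Euclidean_space n) V" and h: "continuous_on V h" and "y \<in> V" "\<epsilon> > 0"
  obtains \<delta> where "\<delta> > 0" "\<And>z. z \<in> euc n \<Longrightarrow> (\<And>i. i < n \<Longrightarrow> \<bar>z i - y i\<bar> < \<delta>) \<Longrightarrow> z \<in> V \<and> dist (h z) (h y) < \<epsilon>"
proof -
  have "openin (top_of_set V) (V \<inter> h -` ball (h y) \<epsilon>)"
    by (rule continuous_openin_preimage_gen[OF h]) simp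
  then have "openin (Euclidean_space n) (V \<inter> h -` ball (h y) \<epsilon>)"
    using V by (metis Euclidean_space_eq openin_trans)
  from openin_euc_box[OF this, of y] that show ?thesis
    using assms by (auto simp: dist_commute)
qed

text \<open>The idea is to move from \<open>c t\<^sub>0\<close> to \<open>c t\<close> one coordinate at a time.\<close>

lemma has_vector_derivative_along:
  fixes f :: "(nat \<Rightarrow> real) \<Rightarrow> 'b::real_normed_vector" and c :: "real \<Rightarrow> nat \<Rightarrow> real"
  assumes W: "openin (Euclidean_space m) W"
    and D: "\<And>q. q < m \<Longrightarrow> has_pd q W f (D q)" "\<And>q. q < m \<Longrightarrow> continuous_on W (D q)"
    and c: "\<And>q. q < m \<Longrightarrow> ((\<lambda>t. c t q) has_vector_derivative c' q) (at t0)"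
    and cW: "\<forall>\<^sub>F t in nhds t0. c t \<in> W"
  shows "((\<lambda>t. f (c t)) has_vector_derivative (\<Sum>q<m. c' q *\<^sub>R D q (c t0))) (at t0)"
proof -
  define y0 where "y0 = c t0"
  have y0: "y0 \<in> W" using eventually_nhds_x_imp_x[OF cW] by (simp add: y0_def)
  then have y0e: "y0 \<in> euc m" using open_euc_subset[OF W] by auto
  define hyb where "hyb q z = (\<lambda>i. if i < q then z i else y0 i)" for q and z :: "nat \<Rightarrow> real"
  \<comment> \<open>The difference quotient in coordinate q, filled in with the partial derivative
    where the denominator vanishes, so that the telescoping identity holds without
    exception.\<close>
  define A where "A q z = (if z q = y0 q then D q y0 else (f (hyb (Suc q) z) - f (hyb q z)) /\<^sub>R (z q - y0 q))" for q z
  have hyb_upd: "(hyb q z)(q := z q) = hyb (Suc q) z" "(hyb q z)(q := y0 q) = hyb q z" "hyb q z q = y0 q" for q z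
    by (auto simp: hyb_def)
  have tele: "f z - f y0 = (\<Sum>q<m. (z q - y0 q) *\<^sub>R A q z)" if "z \<in> euc m" for z
  proof -
    have "(z q - y0 q) *\<^sub>R A q z = f (hyb (Suc q) z) - f (hyb q z)" for q
      using hyb_upd[of q z] by (auto simp: A_def)
    then have "(\<Sum>q<m. (z q - y0 q) *\<^sub>R A q z) = f (hyb m z) - f (hyb 0 z)"
      using sum_lessThan_telescope[of "\<lambda>q. f (hyb q z)" m] by simp
    moreover have "hyb m z = z" "hyb 0 z = y0"
      using that y0e by (auto simp: hyb_def euc_def)
    ultimately show ?thesis by simp
  qed
  \<comment> \<open>In the small box \<open>D q\<close> differs by less than \<epsilon> from its
    value at y0, hence by less than 2\<epsilon> between two points of the segment. The mean value
    inequality gives 2\<epsilon>, and replacing the base point of the segment by y0 costs the third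
    \<epsilon>.\<close>
  have bound: "\<exists>\<delta>>0. \<forall>z\<in>euc m. (\<forall>i<m. \<bar>z i - y0 i\<bar> < \<delta>) \<longrightarrow> norm (A q z - D q y0) \<le> 3 * \<epsilon>"
    if q: "q < m" and \<epsilon>: "\<epsilon> > 0" for q \<epsilon>
  proof -
    obtain \<delta> where \<delta>: "\<delta> > 0" "\<And>z. z \<in> euc m \<Longrightarrow> (\<And>i. i < m \<Longrightarrow> \<bar>z i - y0 i\<bar> < \<delta>) \<Longrightarrow> z \<in> W \<and> dist (D q z) (D q y0) < \<epsilon>"
      using continuous_euc_box[OF W D(2)[OF q] y0 \<epsilon>] by blast
    have "norm (A q z - D q y0) \<le> 3 * \<epsilon>" if z: "z \<in> euc m" "\<forall>i<m. \<bar>z i - y0 i\<bar> < \<delta>" for z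
    proof (cases "z q = y0 q")
      case False
      define w where "w t = (hyb q z)(q := t)" for t
      have w: "w t \<in> W \<and> dist (D q (w t)) (D q y0) < \<epsilon>" if "t \<in> closed_segment (y0 q) (z q)" for t
      proof (rule \<delta>(2))
        show "w t \<in> euc m" using z y0e q by (auto simp: w_def hyb_def euc_def)
        have "\<bar>t - y0 q\<bar> \<le> \<bar>z q - y0 q\<bar>" using that by (auto simp: closed_segment_eq_real_ivl split: if_splits)
        then show "\<bar>w t i - y0 i\<bar> < \<delta>" if "i < m" for i
          using z(2) that \<delta>(1) q by (force simp: w_def hyb_def)
      qed
      have "norm (f (w (z q)) - f (w (y0 q)) - (z q - y0 q) *\<^sub>R D q (w (y0 q))) \<le> norm (z q - y0 q) * (2 * \<epsilon>)"
      proof (rule vector_differentiable_bound_linearization[where S="closed_segment (y0 q) (z q)"])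
        fix t assume t: "t \<in> closed_segment (y0 q) (z q)"
        have "((\<lambda>s. f ((w t)(q := s))) has_vector_derivative D q (w t)) (at (w t q))"
          using has_pdD[OF D(1)[OF q]] w[OF t] by blast
        then show "((\<lambda>t. f (w t)) has_vector_derivative D q (w t)) (at t within closed_segment (y0 q) (z q))"
          by (simp add: w_def has_vector_derivative_at_within)
        have "dist (D q (w t)) (D q (w (y0 q))) < 2 * \<epsilon>"
          using w[OF t] w[of "y0 q"] by (metis ends_in_segment(1) dist_triangle_half_r field_sum_of_halves mult_2 dist_commute add_strict_mono dist_triangle2 le_less_trans)
        then show "norm (D q (w t) - D q (w (y0 q))) \<le> 2 * \<epsilon>" by (simp add: dist_norm)
      qed auto
      moreover have "f (w (z q)) - f (w (y0 q)) - (z q - y0 q) *\<^sub>R D q (w (y0 q)) = (z q - y0 q) *\<^sub>R (A q z - D q (w (y0 q)))"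
        using False by (simp add: A_def w_def hyb_upd scaleR_diff_right)
      ultimately have "norm (A q z - D q (w (y0 q))) \<le> 2 * \<epsilon>"
        using False by simp
      moreover have "norm (D q (w (y0 q)) - D q y0) < \<epsilon>" using w[of "y0 q"] by (simp add: dist_norm)
      ultimately show ?thesis
        using norm_triangle_ineq[of "A q z - D q (w (y0 q))" "D q (w (y0 q)) - D q y0"] by simp
    qed (use \<epsilon> in \<open>simp add: A_def\<close>)
    then show ?thesis using \<delta>(1) by blast
  qed
  have lim: "((\<lambda>t. A q (c t)) \<longlongrightarrow> D q y0) (at t0)" if q: "q < m" for q
    unfolding tendsto_iff
  proof (intro allI impI)
    fix e :: real assume e: "e > 0"
    obtain \<delta> where \<delta>: "\<delta> > 0" "\<forall>z\<in>euc m. (\<forall>i<m. \<bar>z i - y0 i\<bar> < \<delta>) \<longrightarrow> norm (A q z - D q y0) \<le> 3 * (e/4)"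
      using bound[OF q, of "e/4"] e by auto
    have "\<forall>\<^sub>F t in at t0. \<forall>i\<in>{..<m}. dist (c t i) (y0 i) < \<delta>"
    proof (intro eventually_ball_finite ballI)
      fix i assume "i \<in> {..<m}"
      then have "((\<lambda>t. c t i) \<longlongrightarrow> y0 i) (at t0)"
        using has_vector_derivative_continuous[OF c] by (auto simp: continuous_within y0_def)
      then show "\<forall>\<^sub>F t in at t0. dist (c t i) (y0 i) < \<delta>" using \<delta>(1) by (rule tendstoD)
    qed simp
    moreover have "\<forall>\<^sub>F t in at t0. c t \<in> W" using cW by (simp add: eventually_at_filter eventually_mono)
    ultimately show "\<forall>\<^sub>F t in at t0. dist (A q (c t)) (D q y0) < e"
    proof eventually_elim
      case (elim t)
      then have "norm (A q (c t) - D q y0) \<le> 3 * (e/4)"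
        using \<delta>(2) open_euc_subset[OF W] by (auto simp: dist_real_def)
      then show ?case using e by (simp add: dist_norm)
    qed
  qed
  have "((\<lambda>t. \<Sum>q<m. ((c t q - c t0 q) /\<^sub>R (t - t0)) *\<^sub>R A q (c t)) \<longlongrightarrow> (\<Sum>q<m. c' q *\<^sub>R D q y0)) (at t0)"
    by (intro tendsto_sum tendsto_scaleR lim) (use c in \<open>auto simp: has_vector_derivative_iff_quotient\<close>)
  moreover have "\<forall>\<^sub>F t in at t0. (\<Sum>q<m. ((c t q - c t0 q) /\<^sub>R (t - t0)) *\<^sub>R A q (c t)) = (f (c t) - f (c t0)) /\<^sub>R (t - t0)"
  proof -
    have "\<forall>\<^sub>F t in at t0. c t \<in> W" using cW by (simp add: eventually_at_filter eventually_mono)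
    then show ?thesis
    proof eventually_elim
      case (elim t)
      then have "c t \<in> euc m" using open_euc_subset[OF W] by auto
      from tele[OF this] show ?case by (simp add: y0_def scaleR_sum_right mult.commute)
    qed
  qed
  ultimately show ?thesis
    unfolding has_vector_derivative_iff_quotient y0_def by (rule Lim_transform_eventually)
qed

lemma has_pd_compose:
  fixes f :: "(nat \<Rightarrow> real) \<Rightarrow> 'b::real_normed_vector"
  assumes V: "openin (Euclidean_space n) V" and W: "openin (Euclidean_space m) W" and i: "i < n"
    and f: "smooth_on_Rn m W f" and g: "\<And>y. y \<in> V \<Longrightarrow> g y \<in> W" "\<And>q. q < m \<Longrightarrow> has_pd i V (\<lambda>y. g y q) (g' q)"
  shows "has_pd i V (\<lambda>y. f (g y)) (\<lambda>y. \<Sum>q<m. g' q y *\<^sub>R partial_deriv q f (g y))"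
  unfolding has_pd_def
proof
  fix y assume y: "y \<in> V"
  have "((\<lambda>t. f (g (y(i := t)))) has_vector_derivative (\<Sum>q<m. g' q y *\<^sub>R partial_deriv q f (g (y(i := y i))))) (at (y i))"
  proof (rule has_vector_derivative_along[OF W])
    show "\<forall>\<^sub>F t in nhds (y i). g (y(i := t)) \<in> W"
      using openin_euc_upd_eventually[OF V y i] by eventually_elim (rule g(1))
    show "((\<lambda>t. g (y(i := t)) q) has_vector_derivative g' q y) (at (y i))" if "q < m" for q
      by (rule has_pdD[OF g(2)[OF that] y])
  qed (use f in \<open>auto intro: smooth_has_pd[OF W] smooth_continuous[OF W] smooth_partial\<close>)
  then show "((\<lambda>t. f (g (y(i := t)))) has_vector_derivative (\<Sum>q<m. g' q y *\<^sub>R partial_deriv q f (g y))) (at (y i))"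
    by simp
qed

text \<open>The generators are the compositions of smooth outer functions with g, together with the
  smooth functions on V. The chain rule expresses a derivative of a composition through products of
  the two kinds, so it lies in the hull.\<close>

lemma smooth_compose:
  fixes f :: "(nat \<Rightarrow> real) \<Rightarrow> 'b::real_normed_algebra_1"
  assumes V: "openin (Euclidean_space n) V" and W: "openin (Euclidean_space m) W"
    and f: "smooth_on_Rn m W f" and g: "\<And>y. y \<in> V \<Longrightarrow> g y \<in> W" "\<And>q. q < m \<Longrightarrow> smooth_on_Rn n V (\<lambda>y. g y q)"
  shows "smooth_on_Rn n V (\<lambda>y. f (g y))"
proof -
  let ?B = "{\<lambda>y. f (g y) | f::(nat \<Rightarrow> real) \<Rightarrow> 'b. smooth_on_Rn m W f} \<union> {h. smooth_on_Rn n V h}"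
  have 0: "(\<lambda>y. 0) \<in> ?B" using smooth_const[OF V] by auto
  \<comment> \<open>Coordinates from m on vanish, because g maps into W and W lies in
    \<open>euc m\<close>; smoothness is given for the first m only.\<close>
  have gcont: "continuous_on V g"
  proof (rule continuous_on_coordinatewise_then_product)
    fix q show "continuous_on V (\<lambda>y. g y q)"
    proof (cases "q < m")
      case True then show ?thesis using g(2) smooth_continuous[OF V] by blast
    next
      case False
      then have "g y q = 0" if "y \<in> V" for y using g(1)[OF that] open_euc_subset[OF W] by (auto simp: euc_def)
      then show ?thesis by (simp cong: continuous_on_cong)
    qed
  qed
  have "smooth_on_Rn n V h" if "h \<in> alg_hull ?B" for h
  proof (rule smooth_alg_hull[OF V that])
    fix h assume "h \<in> ?B"
    then show "continuous_on V h"
    proof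
      assume "h \<in> {\<lambda>y. f (g y) | f::(nat \<Rightarrow> real) \<Rightarrow> 'b. smooth_on_Rn m W f}"
      then show ?thesis
        using continuous_on_compose2[OF smooth_continuous[OF W] gcont] g(1) by blast
    qed (use smooth_continuous[OF V] in auto)
  next
    fix h i assume h: "h \<in> ?B" and i: "i < n"
    from h show "\<exists>h'\<in>alg_hull ?B. has_pd i V h h'"
    proof
      assume "h \<in> {\<lambda>y. f (g y) | f::(nat \<Rightarrow> real) \<Rightarrow> 'b. smooth_on_Rn m W f}"
      then obtain f where f: "h = (\<lambda>y. f (g y))" "smooth_on_Rn m W f" by auto
      have "has_pd i V (\<lambda>y. f (g y)) (\<lambda>y. \<Sum>q<m. partial_deriv i (\<lambda>y. g y q) y *\<^sub>R partial_deriv q f (g y))"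
        by (rule has_pd_compose[OF V W i f(2) g(1) smooth_has_pd[OF V g(2) i]])
      moreover have "(\<lambda>y. \<Sum>q<m. of_real (partial_deriv i (\<lambda>y. g y q) y) * partial_deriv q f (g y)) \<in> alg_hull ?B"
      proof (intro alg_hull_sum 0 alg_hull.mult)
        fix q assume q: "q \<in> {..<m}"
        show "(\<lambda>y. of_real (partial_deriv i (\<lambda>y. g y q) y)) \<in> alg_hull ?B"
          by (intro alg_hull.base) (use q g(2) i in \<open>auto intro!: smooth_bounded_linear[OF V bounded_linear_of_real] smooth_partial\<close>)
        show "(\<lambda>y. partial_deriv q f (g y)) \<in> alg_hull ?B"
          by (intro alg_hull.base) (use q smooth_partial[OF f(2)] in blast)
      qed auto
      ultimately show ?thesis by (auto simp: f(1) scaleR_conv_of_real)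
    next
      assume "h \<in> {h. smooth_on_Rn n V h}"
      then show ?thesis using i smooth_has_pd[OF V] smooth_partial alg_hull.base[of "partial_deriv i h" ?B] by blast
    qed
  qed
  then show ?thesis using f by (auto intro: alg_hull.base)
qed

text \<open>A family of functions of one real variable closed under differentiation consists of
  smooth functions on \<open>euc 1\<close>, to which composition applies. The families used are the
  multiples of \<open>cis\<close> and the functions \<open>flat\<close>.\<close>

lemma smooth_compose_family:
  fixes h :: "real \<Rightarrow> 'b::real_normed_algebra_1"
  assumes V: "openin (Euclidean_space n) V" and "h \<in> H"
    and H: "\<And>h. h \<in> H \<Longrightarrow> \<exists>h'\<in>H. \<forall>t. (h has_vector_derivative h' t) (at t)"
    and g: "smooth_on_Rn n V g"
  shows "smooth_on_Rn n V (\<lambda>y. h (g y))"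
proof -
  have "smooth_on_Rn 1 (euc 1) (\<lambda>z. h (z 0))"
  proof (rule smooth_coinduct[where S="{\<lambda>z. h (z 0) | h. h \<in> H}"])
    fix f assume "f \<in> {\<lambda>z::nat\<Rightarrow>real. h (z 0) | h. h \<in> H}"
    then obtain h h' where h: "f = (\<lambda>z. h (z 0))" "h \<in> H" "h' \<in> H" "\<forall>t. (h has_vector_derivative h' t) (at t)"
      using H by blast
    have "continuous_on UNIV h" using h(4) by (intro continuous_at_imp_continuous_on) (auto intro: has_vector_derivative_continuous)
    then show "continuous_on (euc 1) f" unfolding h(1)
      by (rule continuous_on_compose2) (auto intro: continuous_on_subset[OF continuous_on_product_coordinates])
    show "\<exists>f'\<in>{\<lambda>z. h (z 0) | h. h \<in> H}. has_pd i (euc 1) f f'" if "i < 1" for i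
      using h that by (auto simp: has_pd_def intro!: exI[of _ "\<lambda>z. h' (z 0)"])
  qed (use assms openin_euc in auto)
  then show ?thesis
    using smooth_compose[OF V openin_euc, of 1 "\<lambda>z. h (z 0)" "\<lambda>y i. if i = 0 then g y else 0"] g
    by (auto simp: euc_def)
qed

lemma smooth_cis: 
  assumes "openin (Euclidean_space n) V" "smooth_on_Rn n V g"
  shows "smooth_on_Rn n V (\<lambda>y. cis (g y))"
proof (rule smooth_compose_family[OF assms(1) _ _ assms(2), where H="range (\<lambda>c t. c * cis t)" and h=cis])
  show "cis \<in> range (\<lambda>c t. c * cis t)" by (auto intro!: image_eqI[of _ _ 1])
  fix h assume "h \<in> range (\<lambda>c t. c * cis t)"
  then obtain c where "h = (\<lambda>t. c * cis t)" by auto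
  then show "\<exists>h'\<in>range (\<lambda>c t. c * cis t). \<forall>t. (h has_vector_derivative h' t) (at t)"
    by (intro bexI[of _ "\<lambda>t. (c * \<i>) * cis t"])
       (auto intro!: derivative_eq_intros has_vector_derivative_mult_right simp: cis_conv_exp has_vector_derivative_complex_iff Re_exp Im_exp)
qed

section \<open>Extension by zero, Leibniz bounds, symmetry of second derivatives\<close>

lemma smooth_extend_zero:
  assumes V: "openin (Euclidean_space n) V" and W: "openin (Euclidean_space n) W"
    and f: "smooth_on_Rn n V f" and 0: "\<And>y. y \<in> W \<Longrightarrow> f y = 0"
  shows "smooth_on_Rn n (V \<union> W) f"
proof (rule smooth_local)
  fix y assume "y \<in> V \<union> W"
  then show "\<exists>X. openin (Euclidean_space n) X \<and> y \<in> X \<and> smooth_on_Rn n X f"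
    using V W f smooth_cong[OF W _ smooth_const[OF W, of 0], of f] 0 by (metis Un_iff)
qed (use V W in auto)

lemma iter_partial_zero:
  assumes V: "openin (Euclidean_space n) V" and "\<And>y. y \<in> V \<Longrightarrow> f y = 0" "set js \<subseteq> {..<n}" "y \<in> V"
  shows "iter_partial js f y = 0"
proof -
  have "iter_partial js f y = iter_partial js (\<lambda>y. 0) y"
    by (rule iter_partial_cong[OF V]) (use assms in auto)
  also have "\<dots> = 0" using iter_partial_bounded_linear[OF V bounded_linear_zero smooth_const[OF V, of 0] assms(3,4)] by simp
  finally show ?thesis .
qed

text \<open>Every application of the Leibniz rule doubles the number of terms, whence the power of
  2. The induction removes the innermost derivative, so that the hypothesis applies to the pairs f,
  derivative of g and derivative of f, g, whose bounds A and B are inherited.\<close>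

lemma iter_partial_mult_bound:
  fixes f g :: "(nat \<Rightarrow> real) \<Rightarrow> 'b::real_normed_algebra"
  assumes V: "openin (Euclidean_space n) V" and "smooth_on_Rn n V f" "smooth_on_Rn n V g" "y \<in> V" "set js \<subseteq> {..<n}"
    and "\<And>ks. set ks \<subseteq> {..<n} \<Longrightarrow> length ks \<le> length js \<Longrightarrow> norm (iter_partial ks f y) \<le> A"
    and "\<And>ks. set ks \<subseteq> {..<n} \<Longrightarrow> length ks \<le> length js \<Longrightarrow> norm (iter_partial ks g y) \<le> B"
  shows "norm (iter_partial js (\<lambda>y. f y * g y) y) \<le> 2 ^ length js * A * B"
  using assms(2-)
proof (induction js arbitrary: f g rule: rev_induct)
  case Nil
  from Nil.prems(5)[of "[]"] Nil.prems(6)[of "[]"] have "norm (f y) \<le> A" "norm (g y) \<le> B" by auto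
  then have "norm (f y) * norm (g y) \<le> A * B" by (meson mult_mono' norm_ge_zero)
  then show ?case using norm_mult_ineq[of "f y" "g y"] by simp
next
  case (snoc i js)
  have i: "i < n" and js: "set js \<subseteq> {..<n}" using snoc.prems by auto
  let ?fi = "partial_deriv i f" and ?gi = "partial_deriv i g"
  have fi: "smooth_on_Rn n V ?fi" and gi: "smooth_on_Rn n V ?gi" using smooth_partial snoc.prems i by auto
  have f: "norm (iter_partial ks f y) \<le> A" "norm (iter_partial ks ?fi y) \<le> A" if "set ks \<subseteq> {..<n}" "length ks \<le> length js" for ks
    using snoc.prems(5)[of ks] snoc.prems(5)[of "ks @ [i]"] that i by (auto simp: iter_partial_snoc)
  have g: "norm (iter_partial ks g y) \<le> B" "norm (iter_partial ks ?gi y) \<le> B" if "set ks \<subseteq> {..<n}" "length ks \<le> length js" for ks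
    using snoc.prems(6)[of ks] snoc.prems(6)[of "ks @ [i]"] that i by (auto simp: iter_partial_snoc)
  have "iter_partial (js @ [i]) (\<lambda>y. f y * g y) y = iter_partial js (\<lambda>y. f y * ?gi y + ?fi y * g y) y"
    unfolding iter_partial_snoc
    by (rule iter_partial_cong[OF V js _ snoc.prems(3)])
      (use has_pd_partial_deriv[OF has_pd_mult[OF smooth_has_pd[OF V snoc.prems(1) i] smooth_has_pd[OF V snoc.prems(2) i]]] in auto)
  also have "\<dots> = iter_partial js (\<lambda>y. f y * ?gi y) y + iter_partial js (\<lambda>y. ?fi y * g y) y"
    by (rule iter_partial_add[OF V _ _ js snoc.prems(3)]) (use snoc.prems fi gi in \<open>auto intro: smooth_mult[OF V]\<close>)
  also have "norm \<dots> \<le> 2 ^ length js * A * B + 2 ^ length js * A * B"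
    by (intro norm_triangle_mono snoc.IH; (rule fi gi snoc.prems(1-3) js f g; assumption?)) 
  finally show ?case by (simp add: mult_ac)
qed


text \<open>Let i and q differ. The increment of f along coordinate q is the integral of its
  q-derivative; differentiating under the integral sign in coordinate i expresses the increment of
  the i-derivative as the integral of the mixed derivative. Differentiation in the upper limit
  finishes the argument.\<close>

lemma partial_deriv_commute:
  fixes f :: "(nat \<Rightarrow> real) \<Rightarrow> 'b::banach"
  assumes V: "openin (Euclidean_space n) V" and f: "smooth_on_Rn n V f" and i: "i < n" and q: "q < n" and y: "y \<in> V"
  shows "partial_deriv i (partial_deriv q f) y = partial_deriv q (partial_deriv i f) y"
proof (cases "i = q")
  case False
  obtain \<delta> where \<delta>: "\<delta> > 0" "\<And>z. z \<in> euc n \<Longrightarrow> (\<And>i. i < n \<Longrightarrow> \<bar>z i - y i\<bar> < \<delta>) \<Longrightarrow> z \<in> V"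
    using openin_euc_box[OF V y] by blast
  define P where "P s t = y(i := s, q := t)" for s t
  \<comment> \<open>Half of the box radius, so that the closed interval still stays in V and has
    \<open>y q\<close> in its interior.\<close>
  define a b where "a = y q - \<delta>/2" and "b = y q + \<delta>/2"
  define U where "U = ball (y i) \<delta>"
  let ?fi = "partial_deriv i f" and ?fq = "partial_deriv q f"
  let ?J = "\<lambda>t. integral {a..t} (\<lambda>\<tau>. partial_deriv i (partial_deriv q f) (P (y i) \<tau>))"
    and ?D = "\<lambda>t. partial_deriv i f (P (y i) t) - partial_deriv i f (P (y i) a)" and ?y = "P (y i) (y q)"
  have fi: "smooth_on_Rn n V ?fi" and fq: "smooth_on_Rn n V ?fq" using f i q smooth_partial by auto
  have yU: "y i \<in> U" and ab: "a < y q" "y q < b" using \<delta>(1) by (auto simp: U_def a_def b_def)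
  have openU: "open U" by (simp add: U_def)
  have P: "P s t \<in> V" if "s \<in> U" "t \<in> {a..b}" for s t
  proof (rule \<delta>(2))
    show "P s t \<in> euc n" using y open_euc_subset[OF V] i q by (auto simp: P_def euc_def)
    show "\<bar>P s t j - y j\<bar> < \<delta>" for j
      using that \<delta>(1) by (auto simp: P_def U_def a_def b_def dist_real_def abs_less_iff)
  qed
  have dq: "((\<lambda>t. h (P s t)) has_vector_derivative partial_deriv q h (P s t)) (at t)"
    if "smooth_on_Rn n V h" "s \<in> U" "t \<in> {a..b}" for h :: "(nat \<Rightarrow> real) \<Rightarrow> 'b" and s t
    using has_pdD[OF smooth_has_pd[OF V that(1) q] P[OF that(2,3)]] by (simp add: P_def)
  have di: "((\<lambda>s. h (P s t)) has_vector_derivative partial_deriv i h (P s t)) (at s)"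
    if "smooth_on_Rn n V h" "s \<in> U" "t \<in> {a..b}" for h :: "(nat \<Rightarrow> real) \<Rightarrow> 'b" and s t
    using has_pdD[OF smooth_has_pd[OF V that(1) i] P[OF that(2,3)]] False by (simp add: P_def fun_upd_twist)
  have cont: "continuous_on (U \<times> {a..b}) (\<lambda>(s, t). h (P s t))"
    if "smooth_on_Rn n V h" for h :: "(nat \<Rightarrow> real) \<Rightarrow> 'b"
    unfolding split_beta
  proof (rule continuous_on_compose2[OF smooth_continuous[OF V that]])
    show "continuous_on (U \<times> {a..b}) (\<lambda>p. P (fst p) (snd p))"
      unfolding P_def by (intro continuous_on_fun_upd continuous_on_const continuous_on_fst continuous_on_snd continuous_on_id)
  qed (use P in auto)
  have cont2: "continuous_on {a..b} (\<lambda>t. h (P s t))" if "smooth_on_Rn n V h" "s \<in> U" for h :: "(nat \<Rightarrow> real) \<Rightarrow> 'b" and s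
    using has_vector_derivative_continuous[OF dq[OF that]] by (intro continuous_at_imp_continuous_on) auto
  \<comment> \<open>The i-derivative of the increment of f is computed twice, directly and under the
    integral; uniqueness of the derivative identifies the results.\<close>
  have key: "?D t = ?J t" if t: "t \<in> {a..b}" for t
  proof -
    let ?JC = "integral (cbox a t) (\<lambda>\<tau>. partial_deriv i ?fq (P (y i) \<tau>))" and ?I = "\<lambda>s. integral (cbox a t) (\<lambda>\<tau>. ?fq (P s \<tau>))"
    have FTC: "integral {a..t} (\<lambda>\<tau>. ?fq (P s \<tau>)) = f (P s t) - f (P s a)" if "s \<in> U" for s
      using dq[OF f that] t
      by (intro integral_unique fundamental_theorem_of_calculus) (auto intro: has_vector_derivative_at_within)
    have "(?I has_vector_derivative ?JC) (at (y i) within U)"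
    proof (rule leibniz_rule_vector_derivative)
      show "((\<lambda>s. ?fq (P s \<tau>)) has_vector_derivative partial_deriv i ?fq (P s \<tau>)) (at s within U)"
        if "s \<in> U" "\<tau> \<in> cbox a t" for s \<tau>
        using di[OF fq that(1)] that t by (auto intro: has_vector_derivative_at_within)
      show "(\<lambda>\<tau>. ?fq (P s \<tau>)) integrable_on cbox a t" if "s \<in> U" for s
        using continuous_on_subset[OF cont2[OF fq that], of "cbox a t"] t by (intro integrable_continuous) auto
      show "continuous_on (U \<times> cbox a t) (\<lambda>(s, \<tau>). partial_deriv i ?fq (P s \<tau>))"
        by (rule continuous_on_subset[OF cont[OF smooth_partial[OF fq i]]]) (use t in auto)
      show "y i \<in> U" "convex U" using yU by (simp_all add: U_def)
    qed
    then have "(?I has_vector_derivative ?JC) (at (y i))"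
      by (simp only: has_vector_derivative_within_open[OF yU openU])
    moreover have "\<forall>\<^sub>F s in nhds (y i). s \<in> U"
      using yU by (intro eventually_nhds_in_open) (auto simp: U_def)
    then have "\<forall>\<^sub>F s in nhds (y i). s \<in> UNIV \<longrightarrow> integral (cbox a t) (\<lambda>\<tau>. ?fq (P s \<tau>)) = f (P s t) - f (P s a)"
      by eventually_elim (use FTC in auto)
    ultimately have "((\<lambda>s. f (P s t) - f (P s a)) has_vector_derivative ?JC) (at (y i))"
      using has_vector_derivative_cong_ev[where x="y i" and S=UNIV and f="?I"
          and g="\<lambda>s. f (P s t) - f (P s a)"] FTC[OF yU] by simp
    moreover have "((\<lambda>s. f (P s t) - f (P s a)) has_vector_derivative ?fi (P (y i) t) - ?fi (P (y i) a)) (at (y i))"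
      using t by (intro has_vector_derivative_diff di[OF f yU]) auto
    ultimately show ?thesis
      by (metis box_real(2) vector_derivative_unique_at)
  qed
  have within: "at (y q) within {a..b} = at (y q)"
    by (rule at_within_interior) (use ab in \<open>simp add: interior_atLeastAtMost_real\<close>)
  have I: "(?J has_vector_derivative partial_deriv i ?fq ?y) (at (y q) within {a..b})"
    by (rule integral_has_vector_derivative[OF cont2[OF smooth_partial[OF fq i] yU]]) (use ab in auto)
  have "(?D has_vector_derivative partial_deriv i ?fq ?y) (at (y q) within {a..b})"
    by (rule has_vector_derivative_transform[OF _ _ I]) (use key ab in auto)
  then have "(?D has_vector_derivative partial_deriv i ?fq ?y) (at (y q))"
    by (simp only: within)
  moreover have "(?D has_vector_derivative partial_deriv q ?fi ?y - 0) (at (y q))"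
    by (intro has_vector_derivative_diff dq[OF fi yU] has_vector_derivative_const) (use ab in auto)
  ultimately have "partial_deriv i ?fq ?y = partial_deriv q ?fi ?y - 0"
    by (rule vector_derivative_unique_at)
  then show ?thesis by (simp add: P_def)
qed simp

lemma iter_partial_commute:
  fixes f :: "(nat \<Rightarrow> real) \<Rightarrow> 'b::banach"
  assumes V: "openin (Euclidean_space n) V" and "smooth_on_Rn n V f" "set js \<subseteq> {..<n}" and i: "i < n" and "y \<in> V"
  shows "iter_partial js (partial_deriv i f) y = partial_deriv i (iter_partial js f) y"
  using assms(2,3,5)
proof (induction js arbitrary: y)
  case (Cons j js)
  have "iter_partial (j # js) (partial_deriv i f) y = partial_deriv j (partial_deriv i (iter_partial js f)) y"
    using Cons partial_deriv_cong[OF V, of j "iter_partial js (partial_deriv i f)" "partial_deriv i (iter_partial js f)" y] by simp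
  also have "\<dots> = partial_deriv i (partial_deriv j (iter_partial js f)) y"
    by (rule partial_deriv_commute[OF V _ _ i]) (use Cons smooth_iter in auto)
  finally show ?case by simp
qed simp

section \<open>Smooth functions and distributions on charted spaces\<close>

declare split_paired_All [simp del] split_paired_Ex [simp del]

text \<open>The Hausdorff property and the chart axioms of \<open>smooth_manifold\<close>, the form
  in which M and its powers are treated alike: the product charts of M^k are verified against this
  list.\<close>

definition charted :: "('a, 'z) manifold_scheme \<Rightarrow> bool" where
  "charted N \<longleftrightarrow> Hausdorff_space (mtop N) \<and> (\<Union>c\<in>atlas N. fst c) = topspace (mtop N) \<and>
     (\<forall>c\<in>atlas N.
        openin (mtop N) (fst c) \<and>
        openin (Euclidean_space (mdim N)) (chart_image c) \<and>
        homeomorphic_map (subtopology (mtop N) (fst c))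
          (subtopology (Euclidean_space (mdim N)) (chart_image c)) (snd c)) \<and>
     (\<forall>c\<in>atlas N. \<forall>c'\<in>atlas N. \<forall>i<mdim N.
        smooth_on_Rn (mdim N) (snd c ` (fst c \<inter> fst c')) (\<lambda>y. snd c' (chart_inv c y) i))"

lemma smooth_manifold_charted: "smooth_manifold N \<Longrightarrow> charted N"
  by (simp add: smooth_manifold_def charted_def)

lemma charted_cover: "charted N \<Longrightarrow> x \<in> topspace (mtop N) \<Longrightarrow> \<exists>c\<in>atlas N. x \<in> fst c"
  unfolding charted_def by blast

context
  fixes N :: "('a, 'z) manifold_scheme" and c :: "'a chart"
  assumes N: "charted N" and c: "c \<in> atlas N"
begin

lemma chart_open: "openin (mtop N) (fst c)"
  and chart_image_open: "openin (Euclidean_space (mdim N)) (chart_image c)"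
  and chart_homeo: "homeomorphic_map (subtopology (mtop N) (fst c)) (top_of_set (chart_image c)) (snd c)"
proof -
  show "openin (mtop N) (fst c)" and *: "openin (Euclidean_space (mdim N)) (chart_image c)"
    using N c by (auto simp: charted_def)
  show "homeomorphic_map (subtopology (mtop N) (fst c)) (top_of_set (chart_image c)) (snd c)"
    using N c open_euc_subset[OF *]
    by (auto simp: charted_def Euclidean_space_eq subtopology_subtopology inf.absorb2)
qed

lemma chart_subset: "fst c \<subseteq> topspace (mtop N)"
  using chart_open by (rule openin_subset)

lemma chart_image_subset: "chart_image c \<subseteq> euc (mdim N)"
  using chart_image_open by (rule open_euc_subset)

lemma chart_inj: "inj_on (snd c) (fst c)"
  using homeomorphic_imp_injective_map[OF chart_homeo] chart_subset by (simp add: inf.absorb2)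

lemma chart_inv_snd [simp]: "x \<in> fst c \<Longrightarrow> chart_inv c (snd c x) = x"
  by (simp add: chart_inv_def inv_into_f_f[OF chart_inj])

lemma snd_chart_image: "x \<in> fst c \<Longrightarrow> snd c x \<in> chart_image c"
  by (simp add: chart_image_def)

lemma snd_chart_inv [simp]: "y \<in> chart_image c \<Longrightarrow> snd c (chart_inv c y) = y"
  and chart_inv_in: "y \<in> chart_image c \<Longrightarrow> chart_inv c y \<in> fst c"
  by (auto simp: chart_image_def)

lemma chart_continuous: "continuous_map (subtopology (mtop N) (fst c)) euclidean (snd c)"
  using homeomorphic_imp_continuous_map[OF chart_homeo] continuous_map_into_fulltopology by blast

lemma chart_inv_continuous: "continuous_map (top_of_set (chart_image c)) (mtop N) (chart_inv c)"
proof -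
  obtain g where g: "homeomorphic_maps (subtopology (mtop N) (fst c)) (top_of_set (chart_image c)) (snd c) g"
    using chart_homeo by (auto simp: homeomorphic_map_maps)
  then have "continuous_map (top_of_set (chart_image c)) (subtopology (mtop N) (fst c)) g"
    by (simp add: homeomorphic_maps_def)
  moreover have "g y = chart_inv c y" if "y \<in> chart_image c" for y
    using that g chart_subset by (auto simp: homeomorphic_maps_def chart_image_def)
  ultimately have "continuous_map (top_of_set (chart_image c)) (subtopology (mtop N) (fst c)) (chart_inv c)"
    by (auto elim: continuous_map_eq)
  then show ?thesis using continuous_map_into_fulltopology by blast
qed

lemma chart_open_image:
  assumes "openin (mtop N) U"
  shows "openin (Euclidean_space (mdim N)) (snd c ` (fst c \<inter> U))"
proof -
  have "openin (top_of_set (chart_image c)) (snd c ` (fst c \<inter> U))"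
    using homeomorphic_imp_open_map[OF chart_homeo] assms
    by (auto simp: open_map_def openin_subtopology_Int2)
  then show ?thesis using chart_image_open unfolding Euclidean_space_eq by (rule openin_trans)
qed

lemma chart_compact_image: "compactin (mtop N) K \<Longrightarrow> K \<subseteq> fst c \<Longrightarrow> compact (snd c ` K)"
  using image_compactin[OF _ chart_continuous, of K] by (simp add: compactin_subtopology)

lemma chart_transition:
  assumes "c' \<in> atlas N" "i < mdim N"
  shows "smooth_on_Rn (mdim N) (snd c ` (fst c \<inter> fst c')) (\<lambda>y. snd c' (chart_inv c y) i)"
  using N c assms unfolding charted_def by blast

end

lemma smooth_functions_zero: "f \<in> smooth_functions N \<Longrightarrow> x \<notin> topspace (mtop N) \<Longrightarrow> f x = 0"
  by (simp add: smooth_functions_def)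

lemma smooth_functions_chart: "f \<in> smooth_functions N \<Longrightarrow> c \<in> atlas N \<Longrightarrow> smooth_on_Rn (mdim N) (chart_image c) (\<lambda>y. f (chart_inv c y))"
  by (simp add: smooth_functions_def)

text \<open>Around each point one chart is enough, since transition maps are smooth and smoothness
  is local. This serves for functions given by a formula in one chart and by 0 elsewhere.\<close>

lemma smooth_functions_localI:
  fixes f :: "'a \<Rightarrow> 'b::real_normed_algebra_1"
  assumes N: "charted N" and 0: "\<And>x. x \<notin> topspace (mtop N) \<Longrightarrow> f x = 0"
    and loc: "\<And>x. x \<in> topspace (mtop N) \<Longrightarrow> \<exists>U c. openin (mtop N) U \<and> x \<in> U \<and> c \<in> atlas N \<and> x \<in> fst c \<and>
      smooth_on_Rn (mdim N) (snd c ` (fst c \<inter> U)) (\<lambda>y. f (chart_inv c y))"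
  shows "f \<in> smooth_functions N"
  unfolding smooth_functions_def
proof (intro CollectI conjI allI impI ballI 0)
  fix c' assume c': "c' \<in> atlas N"
  let ?n = "mdim N"
  show "smooth_on_Rn ?n (chart_image c') (\<lambda>y. f (chart_inv c' y))"
  proof (rule smooth_local[OF chart_image_open[OF N c']])
    fix y assume y: "y \<in> chart_image c'"
    define x where "x = chart_inv c' y"
    have x: "x \<in> fst c'" "snd c' x = y" using y by (auto simp: x_def chart_inv_in[OF N c'] snd_chart_inv[OF N c'])
    then obtain U c where U: "openin (mtop N) U" "x \<in> U" "c \<in> atlas N" "x \<in> fst c"
      "smooth_on_Rn ?n (snd c ` (fst c \<inter> U)) (\<lambda>y. f (chart_inv c y))"
      using loc[of x] chart_subset[OF N c'] by blast
    let ?W = "snd c' ` (fst c' \<inter> (fst c \<inter> U))"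
    have W: "openin (Euclidean_space ?n) ?W"
      by (intro chart_open_image[OF N c'] openin_Int chart_open[OF N] U)
    have "smooth_on_Rn ?n ?W (\<lambda>y. f (chart_inv c (snd c (chart_inv c' y))))"
    proof (rule smooth_compose[OF W chart_open_image[OF N U(3) U(1)] U(5)])
      show "smooth_on_Rn ?n ?W (\<lambda>y. snd c (chart_inv c' y) q)" if "q < ?n" for q
        by (rule smooth_subset[OF _ W _ chart_transition[OF N c' U(3) that]])
          (auto intro: chart_open_image[OF N c'] chart_open[OF N U(3)])
    qed (auto simp: chart_inv_snd[OF N c'])
    then have "smooth_on_Rn ?n ?W (\<lambda>y. f (chart_inv c' y))"
      by (rule smooth_cong[OF W, rotated]) (auto simp: chart_inv_snd[OF N c'] chart_inv_snd[OF N U(3)])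
    then show "\<exists>W. openin (Euclidean_space ?n) W \<and> y \<in> W \<and> smooth_on_Rn ?n W (\<lambda>y. f (chart_inv c' y))"
      using W x U by blast
  qed
qed

context
  fixes N :: "('a, 'z) manifold_scheme"
  assumes N: "charted N"
begin

lemma smooth_functions_add_mult:
  fixes f g :: "'a \<Rightarrow> 'b::real_normed_algebra"
  assumes "f \<in> smooth_functions N" "g \<in> smooth_functions N"
  shows smooth_functions_add: "(\<lambda>x. f x + g x) \<in> smooth_functions N"
    and smooth_functions_mult: "(\<lambda>x. f x * g x) \<in> smooth_functions N"
  using assms chart_image_open[OF N] by (auto simp: smooth_functions_def intro!: smooth_add smooth_mult)

lemma smooth_functions_bounded_linear:
  assumes "bounded_linear L" "f \<in> smooth_functions N"
  shows "(\<lambda>x. L (f x)) \<in> smooth_functions N"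
  unfolding smooth_functions_def
proof (intro CollectI conjI allI impI ballI)
  show "L (f x) = 0" if "x \<notin> topspace (mtop N)" for x
    using smooth_functions_zero[OF assms(2) that] linear_simps(3)[OF assms(1)] by simp
  show "smooth_on_Rn (mdim N) (chart_image c) (\<lambda>y. L (f (chart_inv c y)))" if "c \<in> atlas N" for c
    by (rule smooth_bounded_linear[OF chart_image_open[OF N that] assms(1) smooth_functions_chart[OF assms(2) that]])
qed

lemma smooth_functions_cmult:
  fixes f :: "'a \<Rightarrow> 'b::real_normed_algebra"
  shows "f \<in> smooth_functions N \<Longrightarrow> (\<lambda>x. a * f x) \<in> smooth_functions N"
  by (rule smooth_functions_bounded_linear) (rule bounded_linear_mult_right)

lemma smooth_functions_0: "(\<lambda>x. 0) \<in> smooth_functions N"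
  using chart_image_open[OF N] by (auto simp: smooth_functions_def intro!: smooth_const)

lemma smooth_functions_diff:
  fixes f g :: "'a \<Rightarrow> 'b::real_normed_algebra_1"
  assumes "f \<in> smooth_functions N" "g \<in> smooth_functions N"
  shows "(\<lambda>x. f x - g x) \<in> smooth_functions N"
  using smooth_functions_add[OF assms(1) smooth_functions_cmult[OF assms(2), of "-1"]] by simp

end

section \<open>Seminorms of the Frechet topology and continuity of distributions\<close>

definition tests :: "('a, 'z) manifold_scheme \<Rightarrow> ('a chart \<times> 'a set \<times> nat list) set" where
  "tests N = {(c, K, js). c \<in> atlas N \<and> compactin (mtop N) K \<and> K \<subseteq> fst c \<and> set js \<subseteq> {..<mdim N}}"

text \<open>Bounds one seminorm, the supremum over K of a derivative in a chart, without forming the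
  supremum. \<open>tests\<close> is the index set of these seminorms; finite subsets of it describe
  neighbourhoods and orders of distributions.\<close>

definition test_le :: "('a chart \<times> 'a set \<times> nat list) \<Rightarrow> ('a \<Rightarrow> 'b::real_normed_vector) \<Rightarrow> real \<Rightarrow> bool" where
  "test_le \<tau> f B \<longleftrightarrow> (case \<tau> of (c, K, js) \<Rightarrow> \<forall>x\<in>K. norm (iter_partial js (\<lambda>y. f (chart_inv c y)) (snd c x)) \<le> B)"

lemma topspace_smooth_topology: "topspace (smooth_topology N) = smooth_functions N"
  unfolding smooth_topology_def topology_generated_by_topspace by blast

lemma test_continuous:
  assumes "charted N" "(c, K, js) \<in> tests N" "f \<in> smooth_functions N"
  shows "continuous_on (snd c ` K) (iter_partial js (\<lambda>y. f (chart_inv c y)))" "compact (snd c ` K)"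
proof -
  have c: "c \<in> atlas N" "K \<subseteq> fst c" "set js \<subseteq> {..<mdim N}" "compactin (mtop N) K" using assms by (auto simp: tests_def)
  show "continuous_on (snd c ` K) (iter_partial js (\<lambda>y. f (chart_inv c y)))"
    by (rule continuous_on_subset[OF smooth_continuous[OF chart_image_open[OF assms(1) c(1)] smooth_iter[OF smooth_functions_chart[OF assms(3) c(1)] c(3)]]])
      (use c in \<open>auto simp: chart_image_def\<close>)
  show "compact (snd c ` K)" by (rule chart_compact_image[OF assms(1) c(1,4,2)])
qed

lemma test_bounded:
  assumes "charted N" "\<tau> \<in> tests N" "f \<in> smooth_functions N"
  obtains B where "B \<ge> 0" "test_le \<tau> f B"
proof -
  obtain c K js where \<tau>: "\<tau> = (c, K, js)" by (cases \<tau>)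
  have "bounded (iter_partial js (\<lambda>y. f (chart_inv c y)) ` snd c ` K)"
    using compact_continuous_image[OF test_continuous(1,2)[OF assms(1) assms(2)[unfolded \<tau>] assms(3)]] compact_imp_bounded by blast
  then obtain B where "\<forall>x\<in>iter_partial js (\<lambda>y. f (chart_inv c y)) ` snd c ` K. norm x \<le> B" by (auto simp: bounded_iff)
  then have "test_le \<tau> f (max B 0)" by (auto simp: test_le_def \<tau>)
  then show ?thesis using that[of "max B 0"] by simp
qed

lemma test_le_add:
  fixes f g :: "'a \<Rightarrow> 'b::real_normed_algebra"
  assumes "charted N" "\<tau> \<in> tests N" "f \<in> smooth_functions N" "g \<in> smooth_functions N" "test_le \<tau> f A" "test_le \<tau> g B"
  shows "test_le \<tau> (\<lambda>x. f x + g x) (A + B)"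
proof -
  obtain c K js where \<tau>: "\<tau> = (c, K, js)" by (cases \<tau>)
  show ?thesis unfolding \<tau> test_le_def prod.case
  proof
    fix x assume x: "x \<in> K"
    have "iter_partial js (\<lambda>y. f (chart_inv c y) + g (chart_inv c y)) (snd c x) =
        iter_partial js (\<lambda>y. f (chart_inv c y)) (snd c x) + iter_partial js (\<lambda>y. g (chart_inv c y)) (snd c x)"
      using assms(2) x unfolding \<tau> tests_def
      by (intro iter_partial_add[OF chart_image_open[OF assms(1)] smooth_functions_chart[OF assms(3)] smooth_functions_chart[OF assms(4)]])
        (auto intro: snd_chart_image[OF assms(1)])
    then show "norm (iter_partial js (\<lambda>y. f (chart_inv c y) + g (chart_inv c y)) (snd c x)) \<le> A + B"
      using assms(5,6) x by (auto simp: test_le_def \<tau> intro: norm_triangle_mono)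
  qed
qed

lemma test_le_bounded_linear:
  assumes "charted N" "\<tau> \<in> tests N" "f \<in> smooth_functions N" "bounded_linear L" "\<And>z. norm (L z) \<le> C * norm z" "C \<ge> 0" "test_le \<tau> f A"
  shows "test_le \<tau> (\<lambda>x. L (f x)) (C * A)"
proof -
  obtain c K js where \<tau>: "\<tau> = (c, K, js)" by (cases \<tau>)
  show ?thesis unfolding \<tau> test_le_def prod.case
  proof
    fix x assume x: "x \<in> K"
    have "iter_partial js (\<lambda>y. L (f (chart_inv c y))) (snd c x) = L (iter_partial js (\<lambda>y. f (chart_inv c y)) (snd c x))"
      using assms(2) x unfolding \<tau> tests_def
      by (intro iter_partial_bounded_linear[OF chart_image_open[OF assms(1)] assms(4) smooth_functions_chart[OF assms(3)]])
        (auto intro: snd_chart_image[OF assms(1)])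
    moreover have "norm (iter_partial js (\<lambda>y. f (chart_inv c y)) (snd c x)) \<le> A" using assms(7) x by (auto simp: test_le_def \<tau>)
    ultimately show "norm (iter_partial js (\<lambda>y. L (f (chart_inv c y))) (snd c x)) \<le> C * A"
      using assms(5)[of "iter_partial js (\<lambda>y. f (chart_inv c y)) (snd c x)"] assms(6) by (simp add: mult_left_mono order_trans)
  qed
qed

lemma test_le_cmult:
  fixes f :: "'a \<Rightarrow> 'b::real_normed_algebra"
  assumes "charted N" "\<tau> \<in> tests N" "f \<in> smooth_functions N" "test_le \<tau> f A"
  shows "test_le \<tau> (\<lambda>x. a * f x) (norm a * A)"
  by (rule test_le_bounded_linear[OF assms(1-3) bounded_linear_mult_right _ _ assms(4)]) (auto simp: norm_mult_ineq)

lemma test_le_mono: "test_le \<tau> f A \<Longrightarrow> A \<le> B \<Longrightarrow> test_le \<tau> f B"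
  by (auto simp: test_le_def split: prod.splits intro: order_trans)

text \<open>The generating sets are balls around arbitrary functions, whereas estimates need balls
  around the given point f. The induction follows the generation of the topology; the substance is
  in the generators, where f has to be given some room inside a ball centred elsewhere.\<close>

lemma smooth_topology_nbhd:
  fixes f :: "'a \<Rightarrow> 'b::real_normed_algebra_1"
  assumes N: "charted N" and "openin (smooth_topology N) U" "f \<in> U"
  obtains S e where "finite S" "S \<subseteq> tests N" "e > 0"
    "\<And>h. h \<in> smooth_functions N \<Longrightarrow> (\<And>\<tau>. \<tau> \<in> S \<Longrightarrow> test_le \<tau> (\<lambda>x. h x - f x) e) \<Longrightarrow> h \<in> U"
proof -
  have f: "f \<in> smooth_functions N" using assms openin_subset topspace_smooth_topology by blast
  define P where "P U \<longleftrightarrow> (f \<in> U \<longrightarrow> (\<exists>S e. finite S \<and> S \<subseteq> tests N \<and> e > 0 \<and>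
    (\<forall>h\<in>smooth_functions N. (\<forall>\<tau>\<in>S. test_le \<tau> (\<lambda>x. h x - f x) e) \<longrightarrow> h \<in> U)))" for U
  have "P U"
    using assms(2) unfolding smooth_topology_def openin_topology_generated_by_iff
  proof induction
    case Empty
    then show ?case by (simp add: P_def)
  next
    case (Int a b)
    show ?case unfolding P_def
    proof
      assume "f \<in> a \<inter> b"
      with Int.IH obtain S e S' e' where *: "finite S" "S \<subseteq> tests N" "e > 0" "\<forall>h\<in>smooth_functions N. (\<forall>\<tau>\<in>S. test_le \<tau> (\<lambda>x. h x - f x) e) \<longrightarrow> h \<in> a"
        "finite S'" "S' \<subseteq> tests N" "e' > 0" "\<forall>h\<in>smooth_functions N. (\<forall>\<tau>\<in>S'. test_le \<tau> (\<lambda>x. h x - f x) e') \<longrightarrow> h \<in> b"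
        unfolding P_def by blast
      have "h \<in> a \<inter> b" if h: "h \<in> smooth_functions N" "\<forall>\<tau>\<in>S \<union> S'. test_le \<tau> (\<lambda>x. h x - f x) (min e e')" for h
      proof -
        have "test_le \<tau> (\<lambda>x. h x - f x) e" if "\<tau> \<in> S" for \<tau>
          by (rule test_le_mono[of _ _ "min e e'"]) (use h that in auto)
        moreover have "test_le \<tau> (\<lambda>x. h x - f x) e'" if "\<tau> \<in> S'" for \<tau>
          by (rule test_le_mono[of _ _ "min e e'"]) (use h that in auto)
        ultimately show ?thesis using * h(1) by blast
      qed
      then show "\<exists>S e. finite S \<and> S \<subseteq> tests N \<and> e > 0 \<and> (\<forall>h\<in>smooth_functions N. (\<forall>\<tau>\<in>S. test_le \<tau> (\<lambda>x. h x - f x) e) \<longrightarrow> h \<in> a \<inter> b)"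
        using * by (intro exI[of _ "S \<union> S'"] exI[of _ "min e e'"]) simp
    qed
  next
    case (UN K)
    show ?case unfolding P_def
    proof
      assume "f \<in> \<Union>K"
      then obtain k where k: "k \<in> K" "f \<in> k" by blast
      then show "\<exists>S e. finite S \<and> S \<subseteq> tests N \<and> e > 0 \<and> (\<forall>h\<in>smooth_functions N. (\<forall>\<tau>\<in>S. test_le \<tau> (\<lambda>x. h x - f x) e) \<longrightarrow> h \<in> \<Union>K)"
        using UN.IH[OF k(1)] unfolding P_def by (meson UnionI)
    qed
  next
    case (Basis s)
    show ?case unfolding P_def
    proof
      assume fs: "f \<in> s"
      from Basis consider "s = smooth_functions N" | (2) f0 c K js e where "f0 \<in> smooth_functions N" "c \<in> atlas N"
            "compactin (mtop N) K" "K \<subseteq> fst c" "set js \<subseteq> {..<mdim N}" "0 < e"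
            "s = {h \<in> smooth_functions N. \<forall>x\<in>K. norm (iter_partial js (\<lambda>y. h (chart_inv c y) - f0 (chart_inv c y)) (snd c x)) < e}"
        by auto
      then show "\<exists>S e. finite S \<and> S \<subseteq> tests N \<and> e > 0 \<and> (\<forall>h\<in>smooth_functions N. (\<forall>\<tau>\<in>S. test_le \<tau> (\<lambda>x. h x - f x) e) \<longrightarrow> h \<in> s)"
      proof cases
        case 1
        then show ?thesis by (intro exI[of _ "{}"] exI[of _ 1]) auto
      next
        case 2
        have \<tau>: "(c, K, js) \<in> tests N" using 2 by (auto simp: tests_def)
        define d where "d = (\<lambda>x. f x - f0 x)"
        have d: "d \<in> smooth_functions N" unfolding d_def by (rule smooth_functions_diff[OF N f 2(1)])
        let ?g = "\<lambda>y. norm (iter_partial js (\<lambda>y. d (chart_inv c y)) y)"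
        have lt: "?g (snd c x) < e" if "x \<in> K" for x using fs 2(7) that by (auto simp: d_def)
        \<comment> \<open>Compactness of K turns the pointwise strict inequality into a bound m
          strictly below e; the gap e - m is the room in which h may differ from f.\<close>
        have "\<exists>m<e. \<forall>x\<in>K. ?g (snd c x) \<le> m"
        proof (cases "K = {}")
          case False
          then obtain z where "z \<in> snd c ` K" "\<forall>y\<in>snd c ` K. ?g y \<le> ?g z"
            using continuous_attains_sup[OF test_continuous(2)[OF N \<tau> d], of ?g] test_continuous(1)[OF N \<tau> d]
            by (auto intro: continuous_on_norm)
          then show ?thesis using lt by (intro exI[of _ "?g z"]) auto
        qed (use lt_ex in auto)
        then obtain m where m: "m < e" "test_le (c, K, js) d m" by (auto simp: test_le_def)
        have hs: "h \<in> s" if h: "h \<in> smooth_functions N" "test_le (c, K, js) (\<lambda>x. h x - f x) ((e - m)/2)" for h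
        proof -
          have "test_le (c, K, js) (\<lambda>x. (h x - f x) + d x) ((e - m)/2 + m)"
            by (rule test_le_add[OF N \<tau> smooth_functions_diff[OF N h(1) f] d h(2) m(2)])
          moreover have "(e - m)/2 + m < e" using m(1) by (simp add: field_simps)
          ultimately show ?thesis using h(1) by (auto simp: test_le_def d_def 2(7))
        qed
        then have "\<forall>h\<in>smooth_functions N. (\<forall>\<tau>\<in>{(c, K, js)}. test_le \<tau> (\<lambda>x. h x - f x) ((e - m)/2)) \<longrightarrow> h \<in> s"
          by blast
        moreover have "finite {(c, K, js)}" "{(c, K, js)} \<subseteq> tests N" "(e - m)/2 > 0" using \<tau> m(1) by auto
        ultimately show ?thesis by (intro exI conjI)
      qed
    qed
  qed
  then obtain S e where "finite S" "S \<subseteq> tests N" "e > 0"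
    "\<forall>h\<in>smooth_functions N. (\<forall>\<tau>\<in>S. test_le \<tau> (\<lambda>x. h x - f x) e) \<longrightarrow> h \<in> U"
    using assms(3) unfolding P_def by blast
  then show ?thesis by (intro that) auto
qed

lemma compact_distribution_add:
  "compact_distribution N u \<Longrightarrow> f \<in> smooth_functions N \<Longrightarrow> g \<in> smooth_functions N \<Longrightarrow> u (\<lambda>x. f x + g x) = u f + u g"
  and compact_distribution_cmult:
  "compact_distribution N u \<Longrightarrow> f \<in> smooth_functions N \<Longrightarrow> u (\<lambda>x. a * f x) = a * u f"
  by (simp_all add: compact_distribution_def)

lemma compact_distribution_diff:
  assumes "charted N" "compact_distribution N u" "f \<in> smooth_functions N" "g \<in> smooth_functions N"
  shows "u (\<lambda>x. f x - g x) = u f - u g"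
  using compact_distribution_add[OF assms(2,3) smooth_functions_cmult[OF assms(1,4), of "-1"]]
    compact_distribution_cmult[OF assms(2,4), of "-1"] by simp

text \<open>Continuity at 0 provides a ball of finitely many seminorms on which |u| < 1, and
  homogeneity extends the estimate to all functions. From here on a distribution is used through
  this bound and its linearity.\<close>

lemma compact_distribution_bound:
  assumes N: "charted N" and u: "compact_distribution N u"
  obtains S C where "finite S" "S \<subseteq> tests N" "C \<ge> 0"
    "\<And>f B. f \<in> smooth_functions N \<Longrightarrow> (\<And>\<tau>. \<tau> \<in> S \<Longrightarrow> test_le \<tau> f B) \<Longrightarrow> B \<ge> 0 \<Longrightarrow> norm (u f) \<le> C * B"
proof -
  have lin: "u (\<lambda>x. a * f x) = a * u f" if "f \<in> smooth_functions N" for f a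
    using u that by (auto simp: compact_distribution_def)
  have cont: "continuous_map (smooth_topology N) euclidean u" using u by (simp add: compact_distribution_def)
  have op: "openin (smooth_topology N) {f \<in> topspace (smooth_topology N). u f \<in> ball 0 1}"
    by (rule openin_continuous_map_preimage[OF cont]) simp
  have "(\<lambda>x. 0) \<in> {f \<in> topspace (smooth_topology N). u f \<in> ball 0 1}"
    using lin[OF smooth_functions_0[OF N], of 0] smooth_functions_0[OF N] by (simp add: topspace_smooth_topology)
  from smooth_topology_nbhd[OF N op this] obtain S e where S: "finite S" "S \<subseteq> tests N" "e > 0"
    "\<And>h. h \<in> smooth_functions N \<Longrightarrow> (\<And>\<tau>. \<tau> \<in> S \<Longrightarrow> test_le \<tau> h e) \<Longrightarrow> norm (u h) < 1"
    by (simp add: topspace_smooth_topology) metis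
  have "norm (u f) \<le> (1/e) * B" if f: "f \<in> smooth_functions N" "\<And>\<tau>. \<tau> \<in> S \<Longrightarrow> test_le \<tau> f B" "B \<ge> 0" for f B
  proof -
    have "e * norm (u f) \<le> B"
    \<comment> \<open>The scaling factor is e / B', and B may be 0; therefore the estimate is proved
      for every B' > B.\<close>
    proof (rule dense_ge)
      fix B' assume B': "B < B'"
      let ?a = "of_real (e / B') :: complex"
      have "norm (u (\<lambda>x. ?a * f x)) < 1"
      proof (rule S(4))
        fix \<tau> assume "\<tau> \<in> S"
        then have "test_le \<tau> (\<lambda>x. ?a * f x) (norm ?a * B')"
          using S(2) B' by (intro test_le_cmult[OF N _ f(1)] test_le_mono[OF f(2)]) auto
        moreover have "norm ?a * B' = e" using B' f(3) S(3) by (simp add: norm_divide)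
        ultimately show "test_le \<tau> (\<lambda>x. ?a * f x) e" by simp
      qed (rule smooth_functions_cmult[OF N f(1)])
      then have "norm ?a * norm (u f) < 1" unfolding lin[OF f(1)] norm_mult .
      then have "(e / B') * norm (u f) < 1" using B' f(3) S(3) by (simp add: norm_divide)
      then show "e * norm (u f) \<le> B'" using B' f(3) by (simp add: field_simps)
    qed
    then show ?thesis using S(3) by (simp add: field_simps)
  qed
  then show ?thesis using that[of S "1/e"] S by simp
qed

text \<open>The converse of the seminorm bound: a linear form dominated by finitely many seminorms
  is continuous. Conjugates, point evaluations and tensor products are recognised as distributions
  in this way.\<close>

lemma compact_distributionI:
  assumes N: "charted N"
    and add: "\<And>f h. f \<in> smooth_functions N \<Longrightarrow> h \<in> smooth_functions N \<Longrightarrow> u (\<lambda>x. f x + h x) = u f + u h"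
    and cmult: "\<And>f a. f \<in> smooth_functions N \<Longrightarrow> u (\<lambda>x. a * f x) = a * u f"
    and S: "finite S" "S \<subseteq> tests N" "C \<ge> 0"
      "\<And>f B. f \<in> smooth_functions N \<Longrightarrow> (\<And>\<tau>. \<tau> \<in> S \<Longrightarrow> test_le \<tau> f B) \<Longrightarrow> B \<ge> 0 \<Longrightarrow> norm (u f) \<le> C * B"
  shows "compact_distribution N u"
proof -
  have "openin (smooth_topology N) {f \<in> topspace (smooth_topology N). u f \<in> W}" if "open W" for W
  proof (subst openin_subopen, intro ballI)
    fix f assume "f \<in> {f \<in> topspace (smooth_topology N). u f \<in> W}"
    then have f: "f \<in> smooth_functions N" "u f \<in> W" by (auto simp: topspace_smooth_topology)
    then obtain r where r: "r > 0" "ball (u f) r \<subseteq> W" using \<open>open W\<close> by (auto simp: open_contains_ball)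
    \<comment> \<open>The summand 1 avoids a division by 0 and keeps C d below r.\<close>
    define d where "d = r / (C + 1)"
    have d: "d > 0" "C * d < r" using r S(3) by (auto simp: d_def field_simps)
    define B where "B \<tau> = (case \<tau> of (c, K, js) \<Rightarrow> {h \<in> smooth_functions N. \<forall>x\<in>K.
           norm (iter_partial js (\<lambda>y. h (chart_inv c y) - f (chart_inv c y)) (snd c x)) < d})" for \<tau>
    have "openin (smooth_topology N) (B \<tau>)" if "\<tau> \<in> S" for \<tau>
    proof -
      obtain c K js where \<tau>: "\<tau> = (c, K, js)" by (cases \<tau>)
      show ?thesis unfolding smooth_topology_def
        unfolding \<tau> B_def prod.case
        by (rule topology_generated_by_Basis, rule insertI2, rule CollectI,
            rule exI[of _ f], rule exI[of _ c], rule exI[of _ K], rule exI[of _ js], rule exI[of _ d])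
          (use that S(2) f(1) d in \<open>auto simp: \<tau> tests_def\<close>)
    qed
    then have "openin (smooth_topology N) (\<Inter>(insert (smooth_functions N) (B ` S)))"
      using S(1) openin_topspace[of "smooth_topology N"] by (intro openin_Inter) (auto simp: topspace_smooth_topology)
    moreover have "f \<in> \<Inter>(insert (smooth_functions N) (B ` S))"
    proof -
      have "f \<in> B \<tau>" if \<tau>S: "\<tau> \<in> S" for \<tau>
      proof -
        obtain c K js where \<tau>: "\<tau> = (c, K, js)" by (cases \<tau>)
        \<comment> \<open>The difference of f with itself is treated as 0 times f, whose seminorm is
          0 by homogeneity because some bound for f exists.\<close>
        have "test_le \<tau> (\<lambda>x. 0 * f x) (norm (0::complex) * (SOME B. test_le \<tau> f B))"
          using test_bounded[OF N, of \<tau> f] \<tau>S S(2) f(1) by (intro test_le_cmult[OF N]) (auto intro: someI)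
        then show ?thesis using f(1) d by (auto simp: B_def \<tau> test_le_def)
      qed
      then show ?thesis using f(1) by auto
    qed
    moreover have "\<Inter>(insert (smooth_functions N) (B ` S)) \<subseteq> {f \<in> topspace (smooth_topology N). u f \<in> W}"
    proof
      fix h assume h: "h \<in> \<Inter>(insert (smooth_functions N) (B ` S))"
      then have hs: "h \<in> smooth_functions N" by auto
      have "norm (u (\<lambda>x. h x - f x)) \<le> C * d"
      proof (rule S(4)[OF smooth_functions_diff[OF N hs f(1)]])
        fix \<tau> assume "\<tau> \<in> S"
        then have "h \<in> B \<tau>" using h by auto
        then show "test_le \<tau> (\<lambda>x. h x - f x) d" by (auto simp: B_def test_le_def split: prod.splits)
      qed (use d in auto)
      moreover have "u (\<lambda>x. h x - f x) = u h - u f"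
        using add[OF hs smooth_functions_cmult[OF N f(1), of "-1"]] cmult[OF f(1), of "-1"] by simp
      ultimately have "u h \<in> ball (u f) r" using d by (simp add: dist_norm norm_minus_commute)
      then show "h \<in> {f \<in> topspace (smooth_topology N). u f \<in> W}" using r hs by (auto simp: topspace_smooth_topology)
    qed
    ultimately show "\<exists>T. openin (smooth_topology N) T \<and> f \<in> T \<and> T \<subseteq> {f \<in> topspace (smooth_topology N). u f \<in> W}" by blast
  qed
  then have "continuous_map (smooth_topology N) euclidean u" by (auto simp: continuous_map_def)
  then show ?thesis using add cmult by (auto simp: compact_distribution_def)
qed

text \<open>A seminorm of s h is |s| times that of h, and finitely many seminorms decide membership
  near \<phi>. Directional derivatives at a point of an open domain thus depend on values in the
  domain alone.\<close>

lemma line_eventually: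
  fixes \<phi> h :: "'a \<Rightarrow> 'b::real_normed_algebra_1"
  assumes N: "charted N" and U: "openin (smooth_topology N) U" "\<phi> \<in> U" and h: "h \<in> smooth_functions N"
  shows "\<forall>\<^sub>F s in nhds 0. (\<lambda>x. \<phi> x + of_real s * h x) \<in> U"
proof -
  obtain S e where S: "finite S" "S \<subseteq> tests N" "e > 0"
    "\<And>h. h \<in> smooth_functions N \<Longrightarrow> (\<And>\<tau>. \<tau> \<in> S \<Longrightarrow> test_le \<tau> (\<lambda>x. h x - \<phi> x) e) \<Longrightarrow> h \<in> U"
    by (rule smooth_topology_nbhd[OF N U]) blast
  have \<phi>: "\<phi> \<in> smooth_functions N" using U openin_subset topspace_smooth_topology by blast
  have "\<forall>\<^sub>F s in nhds 0. \<forall>\<tau>\<in>S. test_le \<tau> (\<lambda>x. of_real s * h x) e"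
  proof (intro eventually_ball_finite S ballI)
    fix \<tau> assume "\<tau> \<in> S"
    then have \<tau>: "\<tau> \<in> tests N" using S by auto
    obtain B where B: "B \<ge> 0" "test_le \<tau> h B" using test_bounded[OF N \<tau> h] by metis
    have "((\<lambda>s. \<bar>s\<bar> * B) \<longlongrightarrow> \<bar>0\<bar> * B) (nhds 0)" by (intro tendsto_intros) (simp add: filterlim_ident)
    then have "\<forall>\<^sub>F s in nhds 0. \<bar>s\<bar> * B < e" by (rule order_tendstoD) (use S in simp)
    then show "\<forall>\<^sub>F s in nhds 0. test_le \<tau> (\<lambda>x. of_real s * h x) e"
    proof eventually_elim
      case (elim s)
      show ?case using test_le_cmult[OF N \<tau> h B(2), of "of_real s"] elim by (auto elim: test_le_mono)
    qed
  qed
  then show ?thesis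
    by eventually_elim
      (rule S(4), auto intro!: smooth_functions_add[OF N \<phi>] smooth_functions_cmult[OF N h])
qed


section \<open>Localisation of a distribution to a chart by a cutoff\<close>

definition cutoff :: "('a, 'z) manifold_scheme \<Rightarrow> 'a chart \<Rightarrow> ('a \<Rightarrow> complex) \<Rightarrow> bool" where
  "cutoff N c \<rho> \<longleftrightarrow> \<rho> \<in> smooth_functions N \<and> compactin (mtop N) (fun_support N \<rho>) \<and> fun_support N \<rho> \<subseteq> fst c"

lemma fun_support_closed: "closedin (mtop N) (fun_support N \<rho>)"
  by (simp add: fun_support_def)

lemma fun_support_outside: "x \<in> topspace (mtop N) \<Longrightarrow> x \<notin> fun_support N \<rho> \<Longrightarrow> \<rho> x = 0"
  unfolding fun_support_def using closure_of_subset[of "{x \<in> topspace (mtop N). \<rho> x \<noteq> 0}" "mtop N"] by auto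

lemma fun_support_mono: "(\<And>x. x \<in> topspace (mtop N) \<Longrightarrow> f x = 0 \<Longrightarrow> g x = 0) \<Longrightarrow> fun_support N g \<subseteq> fun_support N f"
  unfolding fun_support_def by (intro closure_of_mono) auto

lemma cutoff_mult:
  assumes "charted N" "cutoff N c \<rho>" "\<rho>' \<in> smooth_functions N"
  shows "cutoff N c (\<lambda>x. \<rho> x * \<rho>' x)"
proof -
  have sub: "fun_support N (\<lambda>x. \<rho> x * \<rho>' x) \<subseteq> fun_support N \<rho>" by (rule fun_support_mono) simp
  then show ?thesis
    using assms closed_compactin[OF _ sub fun_support_closed] smooth_functions_mult[OF assms(1) _ assms(3)]
    by (auto simp: cutoff_def)
qed

context
  fixes N :: "('a, 'z) manifold_scheme" and c :: "'a chart" and \<rho> :: "'a \<Rightarrow> complex"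
  assumes N: "charted N" and c: "c \<in> atlas N" and \<rho>: "cutoff N c \<rho>"
begin

text \<open>The coordinate map means nothing outside its chart. A point outside the chart has the
  open complement of the support of \<rho> as a neighbourhood, where the product is 0; inside, the
  chart c itself shows smoothness.\<close>

lemma cutoff_times_smooth:
  assumes V: "openin (Euclidean_space (mdim N)) V" "chart_image c \<subseteq> V" and f: "smooth_on_Rn (mdim N) V f"
  shows "(\<lambda>x. \<rho> x * f (snd c x)) \<in> smooth_functions N"
proof (rule smooth_functions_localI[OF N])
  show "\<rho> x * f (snd c x) = 0" if "x \<notin> topspace (mtop N)" for x
    using \<rho> smooth_functions_zero[of \<rho> N x] that by (simp add: cutoff_def)
  fix x assume x: "x \<in> topspace (mtop N)"
  show "\<exists>U c'. openin (mtop N) U \<and> x \<in> U \<and> c' \<in> atlas N \<and> x \<in> fst c' \<and>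
      smooth_on_Rn (mdim N) (snd c' ` (fst c' \<inter> U)) (\<lambda>y. \<rho> (chart_inv c' y) * f (snd c (chart_inv c' y)))"
  proof (cases "x \<in> fst c")
    case True
    have eq: "snd c ` (fst c \<inter> fst c) = chart_image c" by (simp add: chart_image_def)
    have "smooth_on_Rn (mdim N) (chart_image c) (\<lambda>y. \<rho> (chart_inv c y) * f y)"
      by (intro smooth_mult[OF chart_image_open[OF N c]] smooth_functions_chart c smooth_subset[OF V(1) chart_image_open[OF N c] V(2) f])
        (use \<rho> in \<open>simp add: cutoff_def\<close>)
    then have "smooth_on_Rn (mdim N) (chart_image c) (\<lambda>y. \<rho> (chart_inv c y) * f (snd c (chart_inv c y)))"
      by (rule smooth_cong[OF chart_image_open[OF N c], rotated]) (simp add: snd_chart_inv[OF N c])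
    then show ?thesis using True c chart_open[OF N c] eq by (intro exI[of _ "fst c"] exI[of _ c]) simp
  next
    case False
    obtain c' where c': "c' \<in> atlas N" "x \<in> fst c'" using charted_cover[OF N x] by blast
    define U where "U = topspace (mtop N) - fun_support N \<rho>"
    have U: "openin (mtop N) U" unfolding U_def by (intro openin_diff openin_topspace fun_support_closed)
    have "smooth_on_Rn (mdim N) (snd c' ` (fst c' \<inter> U)) (\<lambda>y. \<rho> (chart_inv c' y) * f (snd c (chart_inv c' y)))"
      by (rule smooth_cong[OF chart_open_image[OF N c'(1) U] _ smooth_const[OF chart_open_image[OF N c'(1) U], of 0]])
        (auto simp: chart_inv_snd[OF N c'(1)] U_def fun_support_outside)
    moreover have "x \<in> U" using x False \<rho> by (auto simp: U_def cutoff_def)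
    ultimately show ?thesis using U c' by blast
  qed
qed

text \<open>Read in another chart c', the product becomes a(y) f(T y) with the transition map T. A
  derivative of it consists of the derivative of a times f(T y), and of a times a derivative of T
  times a partial derivative of f at T y. Both have the same shape, so an induction over the list of
  derivatives works for all admissible coefficients a at once.\<close>

lemma cutoff_test_bound:
  assumes \<tau>: "(c', K, js) \<in> tests N"
  obtains p C where "C \<ge> 0" "\<And>f B. smooth_on_Rn (mdim N) (euc (mdim N)) f \<Longrightarrow> B \<ge> 0 \<Longrightarrow>
    (\<And>l y. set l \<subseteq> {..<mdim N} \<Longrightarrow> length l \<le> p \<Longrightarrow> y \<in> snd c ` fun_support N \<rho> \<Longrightarrow> norm (iter_partial l f y) \<le> B) \<Longrightarrow>
    test_le (c', K, js) (\<lambda>x. \<rho> x * f (snd c x)) (C * B)"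
proof -
  let ?n = "mdim N"
  have c': "c' \<in> atlas N" "compactin (mtop N) K" "K \<subseteq> fst c'" "set js \<subseteq> {..<?n}" using \<tau> by (auto simp: tests_def)
  define W where "W = chart_image c'"
  define \<Omega> where "\<Omega> = snd c' ` (fst c' \<inter> fst c)"
  define Z where "Z = snd c' ` (fst c' \<inter> (topspace (mtop N) - fun_support N \<rho>))"
  define T where "T y = snd c (chart_inv c' y)" for y
  have W: "openin (Euclidean_space ?n) W" unfolding W_def by (rule chart_image_open[OF N c'(1)])
  have \<Omega>: "openin (Euclidean_space ?n) \<Omega>" unfolding \<Omega>_def by (rule chart_open_image[OF N c'(1) chart_open[OF N c]])
  have Z: "openin (Euclidean_space ?n) Z" unfolding Z_def
    by (intro chart_open_image[OF N c'(1)] openin_diff openin_topspace fun_support_closed)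
  have WU: "\<Omega> \<union> Z = W"
    using \<rho> chart_subset[OF N c'(1)] by (auto simp: \<Omega>_def Z_def W_def chart_image_def cutoff_def)
  have T: "smooth_on_Rn ?n \<Omega> (\<lambda>y. T y q)" if "q < ?n" for q
    unfolding T_def \<Omega>_def by (rule chart_transition[OF N c'(1) c that])
  have Te: "T y \<in> euc ?n" if "y \<in> \<Omega>" for y
    using that chart_image_subset[OF N c] by (auto simp: T_def \<Omega>_def chart_inv_snd[OF N c'(1)] chart_image_def)
  let ?S = "snd c ` fun_support N \<rho>"
  \<comment> \<open>Admissible coefficients vanish off the image of the support. This makes products
    with derivatives of T smooth on the whole chart image, although T is meaningful on the overlap
    of the charts only.\<close>
  define R where "R = {a :: (nat \<Rightarrow> real) \<Rightarrow> complex. smooth_on_Rn ?n W a \<and> (\<forall>y\<in>Z. a y = 0)}"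
  have fT: "smooth_on_Rn ?n \<Omega> (\<lambda>y. f (T y))" if "smooth_on_Rn ?n (euc ?n) f" for f :: "(nat \<Rightarrow> real) \<Rightarrow> complex"
    by (rule smooth_compose[OF \<Omega> openin_euc that Te T])
  have ext: "smooth_on_Rn ?n W a" if "smooth_on_Rn ?n \<Omega> a" "\<And>y. y \<in> Z \<Longrightarrow> a y = 0" for a :: "(nat \<Rightarrow> real) \<Rightarrow> complex"
    using smooth_extend_zero[OF \<Omega> Z that] by (simp add: WU)
  have aS: "smooth_on_Rn ?n \<Omega> a" if "a \<in> R" for a
    by (rule smooth_subset[OF W \<Omega>]) (use that WU in \<open>auto simp: R_def\<close>)
  have afT: "smooth_on_Rn ?n W (\<lambda>y. a y * f (T y))" if "a \<in> R" "smooth_on_Rn ?n (euc ?n) f" for a f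
    by (rule ext, rule smooth_mult[OF \<Omega> aS[OF that(1)] fT[OF that(2)]]) (use that in \<open>simp add: R_def\<close>)
  define dT where "dT i q y = partial_deriv i (\<lambda>y. T y q) y" for i q y
  have R1: "partial_deriv i a \<in> R" if "a \<in> R" "i < ?n" for a i
    using that smooth_partial iter_partial_zero[OF Z, of a "[i]"] by (auto simp: R_def)
  have R2: "(\<lambda>y. a y * of_real (dT i q y)) \<in> R" if "a \<in> R" "i < ?n" "q < ?n" for a i q
    unfolding R_def dT_def
    by (intro CollectI conjI ext smooth_mult[OF \<Omega> aS[OF that(1)]] smooth_bounded_linear[OF \<Omega> bounded_linear_of_real] smooth_partial T that)
      (use that in \<open>auto simp: R_def\<close>)
  have deriv: "partial_deriv i (\<lambda>y. a y * f (T y)) y =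
      partial_deriv i a y * f (T y) + (\<Sum>q<?n. (a y * of_real (dT i q y)) * partial_deriv q f (T y))"
    if a: "a \<in> R" and f: "smooth_on_Rn ?n (euc ?n) f" and i: "i < ?n" and y: "y \<in> W" for a f i y
  proof (cases "y \<in> \<Omega>")
    case True
    have "has_pd i \<Omega> (\<lambda>y. a y * f (T y)) (\<lambda>y. a y * (\<Sum>q<?n. dT i q y *\<^sub>R partial_deriv q f (T y)) + partial_deriv i a y * f (T y))"
      unfolding dT_def
      by (intro has_pd_mult smooth_has_pd[OF \<Omega> aS[OF a] i] has_pd_compose[OF \<Omega> openin_euc i f Te] smooth_has_pd[OF \<Omega> T i])
    from has_pd_partial_deriv[OF this True] show ?thesis
      by (simp add: sum_distrib_left scaleR_conv_of_real mult.assoc)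
  next
    case False
    then have yZ: "y \<in> Z" using y WU by auto
    have "partial_deriv i (\<lambda>y. a y * f (T y)) y = 0" "partial_deriv i a y = 0" "a y = 0"
      using iter_partial_zero[OF Z, of "\<lambda>y. a y * f (T y)" "[i]"] iter_partial_zero[OF Z, of a "[i]"] yZ a i by (auto simp: R_def)
    then show ?thesis by simp
  qed
  have KW: "snd c' ` K \<subseteq> W" using c'(3) by (auto simp: W_def chart_image_def)
  \<comment> \<open>The order p and the constant C must be independent of f, since the induction
    hypothesis is applied to the partial derivatives of f.\<close>
  define good where "good js a p C \<longleftrightarrow> C \<ge> 0 \<and> (\<forall>f B. smooth_on_Rn ?n (euc ?n) f \<longrightarrow> B \<ge> 0 \<longrightarrow>
      (\<forall>l y. set l \<subseteq> {..<?n} \<longrightarrow> length l \<le> p \<longrightarrow> y \<in> ?S \<longrightarrow> norm (iter_partial l f y) \<le> B) \<longrightarrow>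
      (\<forall>y\<in>snd c' ` K. norm (iter_partial js (\<lambda>y. a y * f (T y)) y) \<le> C * B))" for js and a :: "(nat \<Rightarrow> real) \<Rightarrow> complex" and p C
  have main: "\<exists>p C. good js a p C" if "a \<in> R" "set js \<subseteq> {..<?n}" for a js
    using that
  proof (induction js arbitrary: a rule: rev_induct)
    case Nil
    have "continuous_on (snd c' ` K) a"
      by (rule continuous_on_subset[OF smooth_continuous[OF W] KW]) (use Nil in \<open>simp add: R_def\<close>)
    then have "bounded (a ` snd c' ` K)"
      using compact_continuous_image chart_compact_image[OF N c'(1,2,3)] compact_imp_bounded by blast
    then obtain A where A: "A > 0" "\<And>y. y \<in> snd c' ` K \<Longrightarrow> norm (a y) \<le> A"
      unfolding bounded_pos by auto
    have "norm (a y * f (T y)) \<le> A * B"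
      if yK: "y \<in> snd c' ` K" and "B \<ge> 0" "\<And>l y. set l \<subseteq> {..<?n} \<Longrightarrow> length l \<le> 0 \<Longrightarrow> y \<in> ?S \<Longrightarrow> norm (iter_partial l f y) \<le> B" for y f B
    proof (cases "y \<in> Z")
      case True
      then show ?thesis using Nil A that by (simp add: R_def)
    next
      case False
      obtain x where x: "x \<in> K" "y = snd c' x" using yK by blast
      then have "x \<in> fun_support N \<rho>" using False c'(3) chart_subset[OF N c'(1)] by (auto simp: Z_def)
      then have "T y \<in> ?S" using x c'(3) by (auto simp: T_def chart_inv_snd[OF N c'(1)])
      then have "norm (f (T y)) \<le> B" using that(3)[of "[]"] by simp
      then show ?thesis unfolding norm_mult using A(1,2) that by (intro mult_mono) auto
    qed
    then show ?case using A(1) by (intro exI[of _ 0] exI[of _ A]) (auto simp: good_def)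
  next
    case (snoc i js)
    have i: "i < ?n" and js: "set js \<subseteq> {..<?n}" using snoc.prems by auto
    obtain p0 C0 where 0: "good js (partial_deriv i a) p0 C0" using snoc.IH[OF R1[OF snoc.prems(1) i] js] by blast
    have "\<forall>q. \<exists>p C. q < ?n \<longrightarrow> good js (\<lambda>y. a y * of_real (dT i q y)) p C"
      using snoc.IH[OF R2[OF snoc.prems(1) i] js] by blast
    then obtain p C where pC: "\<And>q. q < ?n \<Longrightarrow> good js (\<lambda>y. a y * of_real (dT i q y)) (p q) (C q)" by metis
    \<comment> \<open>The sum dominates every single order, and the summand 1 pays for the
      additional partial derivative of f.\<close>
    define P where "P = p0 + (\<Sum>q<?n. p q) + 1"
    have "norm (iter_partial (js @ [i]) (\<lambda>y. a y * f (T y)) y) \<le> (C0 + (\<Sum>q<?n. C q)) * B"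
      if f: "smooth_on_Rn ?n (euc ?n) f" and B: "B \<ge> 0" and y: "y \<in> snd c' ` K"
        and bd: "\<And>l y. set l \<subseteq> {..<?n} \<Longrightarrow> length l \<le> P \<Longrightarrow> y \<in> ?S \<Longrightarrow> norm (iter_partial l f y) \<le> B" for f B y
    proof -
      have yW: "y \<in> W" using y KW by auto
      let ?t = "\<lambda>q y. (a y * of_real (dT i q y)) * partial_deriv q f (T y)"
      have sm: "smooth_on_Rn ?n W (?t q)" if "q < ?n" for q
        by (rule afT[OF R2[OF snoc.prems(1) i that] smooth_partial[OF f that]])
      have "iter_partial (js @ [i]) (\<lambda>y. a y * f (T y)) y = iter_partial js (\<lambda>y. partial_deriv i a y * f (T y) + (\<Sum>q<?n. ?t q y)) y"
        unfolding iter_partial_snoc by (rule iter_partial_cong[OF W js _ yW]) (rule deriv[OF snoc.prems(1) f i])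
      also have "\<dots> = iter_partial js (\<lambda>y. partial_deriv i a y * f (T y)) y + iter_partial js (\<lambda>y. \<Sum>q<?n. ?t q y) y"
        by (intro iter_partial_add[OF W] afT R1 snoc.prems i f smooth_sum[OF W] sm js yW) auto
      also have "iter_partial js (\<lambda>y. \<Sum>q<?n. ?t q y) y = (\<Sum>q<?n. iter_partial js (?t q) y)"
        by (intro iter_partial_sum[OF W _ js yW] sm) simp
      also have "norm (iter_partial js (\<lambda>y. partial_deriv i a y * f (T y)) y + \<dots>) \<le> C0 * B + (\<Sum>q<?n. C q * B)"
      proof (intro norm_triangle_mono sum_norm_le)
        show "norm (iter_partial js (\<lambda>y. partial_deriv i a y * f (T y)) y) \<le> C0 * B"
          using 0 f B y bd unfolding good_def P_def by force
        fix q assume q: "q \<in> {..<?n}"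
        have "norm (iter_partial l (partial_deriv q f) y) \<le> B" if "set l \<subseteq> {..<?n}" "length l \<le> p q" "y \<in> ?S" for l y
        proof -
          have "p q \<le> (\<Sum>q<?n. p q)" by (rule member_le_sum[OF q]) auto
          then show ?thesis using bd[of "l @ [q]" y] that q by (simp add: iter_partial_snoc P_def)
        qed
        then show "norm (iter_partial js (?t q) y) \<le> C q * B"
          using pC[of q, unfolded good_def, THEN conjunct2, rule_format, of "partial_deriv q f" B y]
            q smooth_partial[OF f, of q] B y by simp
      qed
      finally show ?thesis by (simp add: distrib_right sum_distrib_right)
    qed
    moreover have "C0 + (\<Sum>q<?n. C q) \<ge> 0" using 0 pC by (auto simp: good_def intro!: add_nonneg_nonneg sum_nonneg)
    ultimately show ?case by (intro exI[of _ P] exI[of _ "C0 + (\<Sum>q<?n. C q)"]) (auto simp: good_def)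
  qed
  define a where "a = (\<lambda>y. \<rho> (chart_inv c' y))"
  have "a \<in> R"
    using \<rho> smooth_functions_chart[of \<rho> N c'] c'(1)
    by (auto simp: R_def a_def W_def cutoff_def Z_def chart_inv_snd[OF N c'(1)] fun_support_outside)
  from main[OF this c'(4)] obtain p C where pC: "good js a p C" by blast
  show ?thesis
  proof (rule that[of C p])
    show "C \<ge> 0" using pC by (simp add: good_def)
    fix f :: "(nat \<Rightarrow> real) \<Rightarrow> complex" and B
    assume "smooth_on_Rn ?n (euc ?n) f" "B \<ge> 0"
      "\<And>l y. set l \<subseteq> {..<?n} \<Longrightarrow> length l \<le> p \<Longrightarrow> y \<in> ?S \<Longrightarrow> norm (iter_partial l f y) \<le> B"
    then have "\<forall>y\<in>snd c' ` K. norm (iter_partial js (\<lambda>y. a y * f (T y)) y) \<le> C * B"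
      using pC unfolding good_def by blast
    then show "test_le (c', K, js) (\<lambda>x. \<rho> x * f (snd c x)) (C * B)"
      by (simp add: test_le_def a_def T_def)
  qed
qed

text \<open>Finitely many seminorms bound u, and each is controlled by derivatives of f on the image
  of the support of \<rho>; the sums of the orders and of the constants serve all of them. In the
  chart, u becomes a form of finite order on functions of n variables.\<close>

lemma cutoff_distribution_bound:
  assumes u: "compact_distribution N u"
  obtains p C where "C \<ge> 0" "\<And>f B. smooth_on_Rn (mdim N) (euc (mdim N)) f \<Longrightarrow> B \<ge> 0 \<Longrightarrow>
    (\<And>l y. set l \<subseteq> {..<mdim N} \<Longrightarrow> length l \<le> p \<Longrightarrow> y \<in> snd c ` fun_support N \<rho> \<Longrightarrow> norm (iter_partial l f y) \<le> B) \<Longrightarrow>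
    norm (u (\<lambda>x. \<rho> x * f (snd c x))) \<le> C * B"
proof -
  obtain S C where S: "finite S" "S \<subseteq> tests N" "C \<ge> 0"
    "\<And>f B. f \<in> smooth_functions N \<Longrightarrow> (\<And>\<tau>. \<tau> \<in> S \<Longrightarrow> test_le \<tau> f B) \<Longrightarrow> B \<ge> 0 \<Longrightarrow> norm (u f) \<le> C * B"
    by (rule compact_distribution_bound[OF N u]) blast
  let ?hyp = "\<lambda>p f B. \<forall>l y. set l \<subseteq> {..<mdim N} \<longrightarrow> length l \<le> p \<longrightarrow> y \<in> snd c ` fun_support N \<rho> \<longrightarrow> norm (iter_partial l f y) \<le> B"
  define Q where "Q \<tau> p D \<longleftrightarrow> D \<ge> 0 \<and> (\<forall>f B. smooth_on_Rn (mdim N) (euc (mdim N)) f \<longrightarrow> B \<ge> 0 \<longrightarrow> ?hyp p f B \<longrightarrow>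
      test_le \<tau> (\<lambda>x. \<rho> x * f (snd c x)) (D * B))" for \<tau> p D
  have "\<exists>p D. Q \<tau> p D" if "\<tau> \<in> S" for \<tau>
  proof -
    obtain c' K js where \<tau>: "\<tau> = (c', K, js)" by (cases \<tau>)
    then have "(c', K, js) \<in> tests N" using that S by auto
    then show ?thesis unfolding \<tau>
    proof (rule cutoff_test_bound)
      fix p C
      assume *: "0 \<le> C" "\<And>f B. smooth_on_Rn (mdim N) (euc (mdim N)) f \<Longrightarrow> B \<ge> 0 \<Longrightarrow>
        (\<And>l y. set l \<subseteq> {..<mdim N} \<Longrightarrow> length l \<le> p \<Longrightarrow> y \<in> snd c ` fun_support N \<rho> \<Longrightarrow> norm (iter_partial l f y) \<le> B) \<Longrightarrow>
        test_le (c', K, js) (\<lambda>x. \<rho> x * f (snd c x)) (C * B)"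
      show "\<exists>p D. Q (c', K, js) p D" unfolding Q_def
        by (rule exI[of _ p], rule exI[of _ C], intro conjI allI impI *) simp_all
    qed
  qed
  then obtain p D where Q: "\<And>\<tau>. \<tau> \<in> S \<Longrightarrow> Q \<tau> (p \<tau>) (D \<tau>)" by metis
  have pD: "\<And>\<tau>. \<tau> \<in> S \<Longrightarrow> D \<tau> \<ge> 0"
    "\<And>\<tau> f B. \<tau> \<in> S \<Longrightarrow> smooth_on_Rn (mdim N) (euc (mdim N)) f \<Longrightarrow> B \<ge> 0 \<Longrightarrow> ?hyp (p \<tau>) f B \<Longrightarrow> test_le \<tau> (\<lambda>x. \<rho> x * f (snd c x)) (D \<tau> * B)"
    using Q unfolding Q_def by auto
  show ?thesis
  proof (rule that[of "C * sum D S" "sum p S"])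
    show "C * sum D S \<ge> 0" using S(3) pD(1) by (auto intro!: mult_nonneg_nonneg sum_nonneg)
    fix f :: "(nat \<Rightarrow> real) \<Rightarrow> complex" and B
    assume f: "smooth_on_Rn (mdim N) (euc (mdim N)) f" "B \<ge> 0"
      and bd: "\<And>l y. set l \<subseteq> {..<mdim N} \<Longrightarrow> length l \<le> sum p S \<Longrightarrow> y \<in> snd c ` fun_support N \<rho> \<Longrightarrow> norm (iter_partial l f y) \<le> B"
    have "norm (u (\<lambda>x. \<rho> x * f (snd c x))) \<le> C * (sum D S * B)"
    proof (rule S(4))
      show "(\<lambda>x. \<rho> x * f (snd c x)) \<in> smooth_functions N"
        by (rule cutoff_times_smooth[OF openin_euc chart_image_subset[OF N c] f(1)])
      show "0 \<le> sum D S * B" using f(2) pD(1) by (auto intro!: mult_nonneg_nonneg sum_nonneg)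
      fix \<tau> assume \<tau>: "\<tau> \<in> S"
      have "p \<tau> \<le> sum p S" by (rule member_le_sum[OF \<tau>]) (use S in auto)
      moreover have "D \<tau> \<le> sum D S" by (rule member_le_sum[OF \<tau>]) (use S pD(1) in auto)
      ultimately show "test_le \<tau> (\<lambda>x. \<rho> x * f (snd c x)) (sum D S * B)"
        by (intro test_le_mono[OF pD(2)[OF \<tau> f]] mult_right_mono f(2) allI impI bd) auto
    qed
    then show "norm (u (\<lambda>x. \<rho> x * f (snd c x))) \<le> C * sum D S * B" by (simp add: mult.assoc)
  qed
qed

end

section \<open>Fourier series\<close>

lemma cis_has_vector_derivative:
  "((\<lambda>t. cis (\<omega> * t)) has_vector_derivative \<i> * of_real \<omega> * cis (\<omega> * t)) (at t)"
  unfolding has_vector_derivative_def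
  by (rule derivative_eq_intros refl)+ (auto simp: scaleR_conv_of_real algebra_simps)

lemma integral_cis_by_parts:
  fixes h :: "real \<Rightarrow> complex"
  assumes "a \<le> b" and h: "\<And>t. t \<in> {a..b} \<Longrightarrow> (h has_vector_derivative h' t) (at t)" and h': "continuous_on {a..b} h'"
  shows "integral {a..b} (\<lambda>t. h' t * cis (\<omega> * t)) =
    h b * cis (\<omega> * b) - h a * cis (\<omega> * a) - \<i> * of_real \<omega> * integral {a..b} (\<lambda>t. h t * cis (\<omega> * t))"
proof -
  have hc: "continuous_on {a..b} h"
    using has_vector_derivative_continuous[OF h] by (intro continuous_at_imp_continuous_on) auto
  have "((\<lambda>t. h t * (\<i> * of_real \<omega> * cis (\<omega> * t)) + h' t * cis (\<omega> * t)) has_integral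
      h b * cis (\<omega> * b) - h a * cis (\<omega> * a)) {a..b}"
    by (rule fundamental_theorem_of_calculus[OF assms(1)],
        rule has_vector_derivative_at_within, rule has_vector_derivative_mult[OF h cis_has_vector_derivative])
  then have "integral {a..b} (\<lambda>t. h t * (\<i> * of_real \<omega> * cis (\<omega> * t)) + h' t * cis (\<omega> * t)) =
      h b * cis (\<omega> * b) - h a * cis (\<omega> * a)" by (rule integral_unique)
  moreover have "integral {a..b} (\<lambda>t. h t * (\<i> * of_real \<omega> * cis (\<omega> * t)) + h' t * cis (\<omega> * t)) =
      integral {a..b} (\<lambda>t. (\<i> * of_real \<omega>) * (h t * cis (\<omega> * t))) + integral {a..b} (\<lambda>t. h' t * cis (\<omega> * t))"
    by (subst integral_add[symmetric])
      (auto intro!: integrable_continuous_real continuous_intros hc h' simp: mult_ac)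
  moreover have "integral {a..b} (\<lambda>t. (\<i> * of_real \<omega>) * (h t * cis (\<omega> * t))) = \<i> * of_real \<omega> * integral {a..b} (\<lambda>t. h t * cis (\<omega> * t))"
    by (rule integral_mult_right)
  ultimately show ?thesis by (simp add: algebra_simps)
qed

lemma norm_integral_cis_le:
  fixes g :: "real \<Rightarrow> complex"
  assumes "a \<le> b" "continuous_on {a..b} g" "\<And>t. t \<in> {a..b} \<Longrightarrow> norm (g t) \<le> B"
  shows "norm (integral {a..b} (\<lambda>t. g t * cis (\<omega> * t))) \<le> B * (b - a)"
  by (rule integral_bound[OF assms(1)]) (use assms in \<open>auto intro!: continuous_intros simp: norm_mult\<close>)

text \<open>By polynomial approximation and one integration by parts.\<close>

lemma Riemann_Lebesgue:
  fixes g :: "real \<Rightarrow> complex"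
  assumes "a < b" and g: "continuous_on {a..b} g" and \<epsilon>: "\<epsilon> > 0"
  obtains \<Omega> where "\<Omega> > 0" "\<And>\<omega>. \<bar>\<omega>\<bar> \<ge> \<Omega> \<Longrightarrow> norm (integral {a..b} (\<lambda>t. g t * cis (\<omega> * t))) \<le> \<epsilon>"
proof -
  define w where "w = b - a"
  have w: "w > 0" using assms by (simp add: w_def)
  \<comment> \<open>A uniform error e over an interval of length w contributes \<epsilon> / 2. The
    polynomial contributes at most L / |\<omega>| after integration by parts, which is the other
    half once |\<omega>| \<ge> 2 L / \<epsilon>.\<close>
  define e where "e = \<epsilon> / (2 * w)"
  have e: "e > 0" using \<epsilon> w by (simp add: e_def)
  obtain p where p: "polynomial_function p" "\<And>t. t \<in> {a..b} \<Longrightarrow> norm (g t - p t) < e"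
    using Stone_Weierstrass_polynomial_function[OF compact_Icc g e] by auto
  obtain p' where p': "polynomial_function p'" "\<And>x. (p has_vector_derivative p' x) (at x)"
    using has_vector_derivative_polynomial_function[OF p(1)] by auto
  have cont: "continuous_on {a..b} p" "continuous_on {a..b} p'"
    using p(1) p'(1) continuous_on_polymonial_function by auto
  have "bounded (p ` {a..b})" "bounded (p' ` {a..b})"
    using cont compact_continuous_image compact_imp_bounded compact_Icc by blast+
  then obtain M M' where M: "M > 0" "\<And>t. t \<in> {a..b} \<Longrightarrow> norm (p t) \<le> M" "M' > 0" "\<And>t. t \<in> {a..b} \<Longrightarrow> norm (p' t) \<le> M'"
    unfolding bounded_pos by auto
  define L where "L = 2 * M + M' * (b - a)"
  have L: "L > 0" using M assms by (auto simp: L_def intro!: add_pos_pos)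
  have P: "\<bar>\<omega>\<bar> * norm (integral {a..b} (\<lambda>t. p t * cis (\<omega> * t))) \<le> L" for \<omega>
  proof -
    have "\<i> * of_real \<omega> * integral {a..b} (\<lambda>t. p t * cis (\<omega> * t)) =
        p b * cis (\<omega> * b) - p a * cis (\<omega> * a) - integral {a..b} (\<lambda>t. p' t * cis (\<omega> * t))"
      using integral_cis_by_parts[of a b p p' \<omega>] p' cont assms by simp
    also have "norm \<dots> \<le> M + M + M' * (b - a)"
      using norm_integral_cis_le[of a b p' M' \<omega>] M cont assms
      by (intro norm_triangle_le_diff add_mono) (auto simp: norm_mult)
    finally show ?thesis by (simp add: norm_mult L_def)
  qed
  show ?thesis
  proof (rule that[of "2 * L / \<epsilon>"])
    show "2 * L / \<epsilon> > 0" using L \<epsilon> by simp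
    fix \<omega> :: real assume \<omega>: "\<bar>\<omega>\<bar> \<ge> 2 * L / \<epsilon>"
    have "2 * L / \<epsilon> > 0" using L \<epsilon> by simp
    with \<omega> have \<omega>0: "\<bar>\<omega>\<bar> > 0" by linarith
    have "norm (integral {a..b} (\<lambda>t. p t * cis (\<omega> * t))) \<le> L / \<bar>\<omega>\<bar>"
      using P[of \<omega>] \<omega>0 by (simp add: field_simps)
    also have "\<dots> \<le> \<epsilon> / 2" using \<omega> \<omega>0 \<epsilon> by (simp add: field_simps)
    finally have 1: "norm (integral {a..b} (\<lambda>t. p t * cis (\<omega> * t))) \<le> \<epsilon> / 2" .
    have 2: "norm (integral {a..b} (\<lambda>t. (g t - p t) * cis (\<omega> * t))) \<le> \<epsilon> / 2"
    proof -
      have "norm (integral {a..b} (\<lambda>t. (g t - p t) * cis (\<omega> * t))) \<le> e * (b - a)"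
        by (rule norm_integral_cis_le) (use assms cont p(2) in \<open>auto intro!: continuous_on_diff less_imp_le\<close>)
      also have "e * (b - a) = \<epsilon> / 2" using w by (simp add: e_def flip: w_def)
      finally show ?thesis .
    qed
    have "integral {a..b} (\<lambda>t. g t * cis (\<omega> * t)) =
        integral {a..b} (\<lambda>t. p t * cis (\<omega> * t)) + integral {a..b} (\<lambda>t. (g t - p t) * cis (\<omega> * t))"
      by (subst integral_add[symmetric])
        (auto intro!: integrable_continuous_real continuous_intros cont g simp: algebra_simps)
    then show "norm (integral {a..b} (\<lambda>t. g t * cis (\<omega> * t))) \<le> \<epsilon>"
      using norm_triangle_mono[OF 1 2] by simp
  qed
qed

definition fourier_coeff :: "real \<Rightarrow> int \<Rightarrow> (real \<Rightarrow> complex) \<Rightarrow> complex" where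
  "fourier_coeff A m f = integral {- A..A} (\<lambda>t. f t * cis (- (pi / A) * m * t)) / of_real (2 * A)"

lemma cis_eq_1_small: "cis \<theta> = 1 \<Longrightarrow> \<bar>\<theta>\<bar> < 2 * pi \<Longrightarrow> \<theta> = 0"
proof -
  assume "cis \<theta> = 1" and lt: "\<bar>\<theta>\<bar> < 2 * pi"
  then have "cos \<theta> = 1" by (metis cis.sel(1) one_complex.sel(1))
  then obtain n :: int where n: "\<theta> = n * 2 * pi" by (auto simp: cos_one_2pi_int)
  with lt have "\<bar>real_of_int n\<bar> * (2 * pi) < 1 * (2 * pi)" by (simp add: abs_mult)
  then have "\<bar>real_of_int n\<bar> < 1" by (rule mult_right_less_imp_less) simp
  then show "\<theta> = 0" using n by simp
qed

lemma fourier_coeff_const: 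
  assumes "A > 0"
  shows "fourier_coeff A m (\<lambda>t. c) = (if m = 0 then c else 0)"
proof (cases "m = 0")
  case True
  then show ?thesis using assms by (simp add: fourier_coeff_def scaleR_conv_of_real)
next
  case False
  define \<omega> where "\<omega> = - (pi / A) * m"
  have \<omega>: "\<omega> \<noteq> 0" using assms False by (simp add: \<omega>_def)
  have "0 = c * cis (\<omega> * A) - c * cis (\<omega> * -A) - \<i> * of_real \<omega> * integral {-A..A} (\<lambda>t. c * cis (\<omega> * t))"
    using integral_cis_by_parts[of "-A" A "\<lambda>t. c" "\<lambda>t. 0" \<omega>] assms by simp
  moreover have "cis (\<omega> * A) = cis (\<omega> * -A)"
    using assms by (simp add: \<omega>_def complex_eq_iff)
  ultimately have "integral {-A..A} (\<lambda>t. c * cis (\<omega> * t)) = 0" using \<omega> by simp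
  then show ?thesis using False by (simp add: fourier_coeff_def \<omega>_def)
qed

lemma sum_symmetric_int_Suc:
  fixes T :: "int \<Rightarrow> 'b::comm_monoid_add"
  shows "(\<Sum>m\<in>{-int (Suc M)..int (Suc M)}. T m) = T (int (Suc M)) + T (- int (Suc M)) + (\<Sum>m\<in>{-int M..int M}. T m)"
proof -
  have "{-int (Suc M)..int (Suc M)} = insert (int (Suc M)) (insert (- int (Suc M)) {-int M..int M})" by auto
  then show ?thesis by (simp add: add_ac)
qed

text \<open>Chernoff's argument: division by \<open>cis (\<pi>/A (t - x)) - 1\<close> makes the partial sums telescope.\<close>

lemma fourier_series_pointwise:
  fixes f :: "real \<Rightarrow> complex"
  assumes A: "A > 0" and f: "continuous_on {-A..A} f" and x: "-A < x" "x < A" and D: "(f has_vector_derivative D) (at x)"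
  shows "(\<lambda>M::nat. \<Sum>m\<in>{-int M..int M}. fourier_coeff A m f * cis ((pi / A) * m * x)) \<longlonglongrightarrow> f x"
proof -
  define \<kappa> where "\<kappa> = pi / A"
  have \<kappa>: "\<kappa> > 0" using A by (simp add: \<kappa>_def)
  \<comment> \<open>The value at x is the limit of the quotient, as numerator and denominator are
    both differentiable there. So g is continuous and its Fourier coefficients tend to 0. The
    denominator has no further zero, because x is interior and thus |t - x| < 2 A.\<close>
  define g where "g t = (if t = x then D / (\<i> * of_real \<kappa>) else (f t - f x) / (cis (\<kappa> * (t - x)) - 1))" for t
  have ne: "cis (\<kappa> * (t - x)) - 1 \<noteq> 0" if "t \<in> {-A..A}" "t \<noteq> x" for t
  proof
    assume "cis (\<kappa> * (t - x)) - 1 = 0"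
    moreover have "\<bar>t - x\<bar> < 2 * A" using that x by (auto simp: abs_less_iff)
    then have "\<bar>\<kappa> * (t - x)\<bar> < \<kappa> * (2 * A)" using \<kappa> by (simp add: abs_mult)
    then have "\<bar>\<kappa> * (t - x)\<bar> < 2 * pi" using A by (simp add: \<kappa>_def)
    ultimately have "\<kappa> * (t - x) = 0" by (intro cis_eq_1_small) auto
    then show False using \<kappa> that by simp
  qed
  have lim: "(g \<longlongrightarrow> g x) (at x)"
  proof -
    have "((\<lambda>t. cis (\<kappa> * t)) has_vector_derivative \<i> * of_real \<kappa> * cis (\<kappa> * x)) (at x)"
      by (rule cis_has_vector_derivative)
    then have "((\<lambda>t. cis (\<kappa> * t) * cis (- \<kappa> * x)) has_vector_derivative \<i> * of_real \<kappa> * cis (\<kappa> * x) * cis (- \<kappa> * x)) (at x)"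
      by (rule has_vector_derivative_mult_left)
    then have "((\<lambda>t. (cis (\<kappa> * t) * cis (- \<kappa> * x) - cis (\<kappa> * x) * cis (- \<kappa> * x)) /\<^sub>R (t - x)) \<longlongrightarrow> \<i> * of_real \<kappa> * cis (\<kappa> * x) * cis (- \<kappa> * x)) (at x)"
      by (simp add: has_vector_derivative_iff_quotient)
    then have 1: "((\<lambda>t. (cis (\<kappa> * (t - x)) - 1) /\<^sub>R (t - x)) \<longlongrightarrow> \<i> * of_real \<kappa>) (at x)"
      by (simp add: cis_mult algebra_simps)
    have 2: "((\<lambda>t. (f t - f x) /\<^sub>R (t - x)) \<longlongrightarrow> D) (at x)" using D by (simp add: has_vector_derivative_iff_quotient)
    have "((\<lambda>t. ((f t - f x) /\<^sub>R (t - x)) / ((cis (\<kappa> * (t - x)) - 1) /\<^sub>R (t - x))) \<longlongrightarrow> D / (\<i> * of_real \<kappa>)) (at x)"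
      by (rule tendsto_divide[OF 2 1]) (use \<kappa> in simp)
    moreover have "\<forall>\<^sub>F t in at x. ((f t - f x) /\<^sub>R (t - x)) / ((cis (\<kappa> * (t - x)) - 1) /\<^sub>R (t - x)) = g t"
      by (auto simp: eventually_at_filter g_def scaleR_conv_of_real)
    ultimately show ?thesis by (simp add: g_def Lim_transform_eventually)
  qed
  have gc: "continuous_on {-A..A} g"
    unfolding continuous_on_eq_continuous_within
  proof
    fix t assume t: "t \<in> {-A..A}"
    show "continuous (at t within {-A..A}) g"
    proof (cases "t = x")
      case True
      then show ?thesis using tendsto_within_subset[OF lim, of "{-A..A}"] by (simp add: continuous_within)
    next
      case False
      have "continuous_on ({-A..A} - {x}) (\<lambda>t. (f t - f x) / (cis (\<kappa> * (t - x)) - 1))"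
        by (intro continuous_intros continuous_on_subset[OF f]) (use ne in auto)
      then have "continuous_on ({-A..A} - {x}) g" by (rule continuous_on_eq) (simp add: g_def)
      then have "continuous (at t within ({-A..A} - {x})) g"
        using t False by (simp add: continuous_on_eq_continuous_within)
      moreover have "at t within ({-A..A} - {x}) = at t within {-A..A}"
        by (rule at_within_nhd[of _ "- {x}"]) (use False in auto)
      ultimately show ?thesis by simp
    qed
  qed
  define G where "G m = fourier_coeff A m g * cis (\<kappa> * m * x)" for m :: int
  \<comment> \<open>f is f x plus g times (cis (\<kappa> (t - x)) - 1). Multiplication by this
    exponential lowers the index of a coefficient by one, so each term of the series for f is a
    difference of consecutive values of G; the constant f x contributes at m = 0 only.\<close>
  have step: "fourier_coeff A m f * cis (\<kappa> * m * x) = (if m = 0 then f x else 0) + (G (m - 1) - G m)" for m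
  proof -
    have cc: "continuous_on {-A..A} (\<lambda>t. h t * cis (\<omega> * t))" if "continuous_on {-A..A} h" for h and \<omega>
      by (intro continuous_intros that)
    have eq: "f t = f x + (g t * cis (\<kappa> * (t - x)) - g t)" if "t \<in> {-A..A}" for t
    proof (cases "t = x")
      case False
      then have "g t * (cis (\<kappa> * (t - x)) - 1) = f t - f x" using ne[OF that False] by (simp add: g_def)
      then show ?thesis by (simp add: algebra_simps)
    qed simp
    have "integral {-A..A} (\<lambda>t. f t * cis (- \<kappa> * m * t)) =
        integral {-A..A} (\<lambda>t. f x * cis (- \<kappa> * m * t) + (g t * cis (- \<kappa> * (m - 1) * t) * cis (- \<kappa> * x) - g t * cis (- \<kappa> * m * t)))"
    proof (rule integral_cong)
      fix t assume t: "t \<in> {-A..A}"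
      have "f t * cis (- \<kappa> * m * t) = f x * cis (- \<kappa> * m * t) + (g t * (cis (\<kappa> * (t - x)) * cis (- \<kappa> * m * t)) - g t * cis (- \<kappa> * m * t))"
        by (subst eq[OF t]) (simp add: algebra_simps)
      also have "cis (\<kappa> * (t - x)) * cis (- \<kappa> * m * t) = cis (- \<kappa> * (m - 1) * t) * cis (- \<kappa> * x)"
        by (simp add: cis_mult algebra_simps)
      finally show "f t * cis (- \<kappa> * m * t) = f x * cis (- \<kappa> * m * t) + (g t * cis (- \<kappa> * (m - 1) * t) * cis (- \<kappa> * x) - g t * cis (- \<kappa> * m * t))"
        by (simp add: mult.assoc)
    qed
    also have "\<dots> = integral {-A..A} (\<lambda>t. f x * cis (- \<kappa> * m * t)) +
        (integral {-A..A} (\<lambda>t. g t * cis (- \<kappa> * (m - 1) * t)) * cis (- \<kappa> * x) - integral {-A..A} (\<lambda>t. g t * cis (- \<kappa> * m * t)))"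
    proof -
      have "((\<lambda>t. h t * cis (\<omega> * t)) has_integral integral {-A..A} (\<lambda>t. h t * cis (\<omega> * t))) {-A..A}"
        if "continuous_on {-A..A} h" for h and \<omega>
        using integrable_continuous_real[OF cc[OF that]] by (rule integrable_integral)
      note hi = this[OF continuous_on_const] this[OF gc]
      show ?thesis
        by (rule integral_unique[OF has_integral_add[OF hi(1) has_integral_diff[OF has_integral_mult_left[OF hi(2)] hi(2)]]])
    qed
    finally have "fourier_coeff A m f = fourier_coeff A m (\<lambda>t. f x) + (fourier_coeff A (m - 1) g * cis (- \<kappa> * x) - fourier_coeff A m g)"
      unfolding fourier_coeff_def \<kappa>_def[symmetric] by (simp add: add_divide_distrib diff_divide_distrib)
    then have "fourier_coeff A m f * cis (\<kappa> * m * x) = fourier_coeff A m (\<lambda>t. f x) * cis (\<kappa> * m * x) +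
        (fourier_coeff A (m - 1) g * (cis (- \<kappa> * x) * cis (\<kappa> * m * x)) - fourier_coeff A m g * cis (\<kappa> * m * x))"
      by (simp only: distrib_right left_diff_distrib mult.assoc)
    moreover have "cis (- \<kappa> * x) * cis (\<kappa> * m * x) = cis (\<kappa> * (m - 1) * x)"
      by (simp only: cis_mult) (simp add: algebra_simps)
    moreover have "fourier_coeff A m (\<lambda>t. f x) * cis (\<kappa> * m * x) = (if m = 0 then f x else 0)"
      using fourier_coeff_const[OF A, of m "f x"] by simp
    ultimately show ?thesis by (simp add: G_def)
  qed
  \<comment> \<open>The lower end is -M - 1, one beyond the range of summation, because every
    difference reaches back to m - 1.\<close>
  have sum: "(\<Sum>m\<in>{-int M..int M}. fourier_coeff A m f * cis (\<kappa> * m * x)) = f x + (G (- int M - 1) - G (int M))" for M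
  proof (induction M)
    case (Suc M)
    show ?case
      unfolding sum_symmetric_int_Suc Suc.IH
      unfolding step[of "int (Suc M)"] step[of "- int (Suc M)"]
      by (simp add: algebra_simps) (rule arg_cong[where f=G], simp)
  next
    case 0
    show ?case using step[of 0] by simp
  qed
  have G0: "\<exists>M0. \<forall>m::int. \<bar>m\<bar> \<ge> M0 \<longrightarrow> norm (G m) < \<epsilon>" if \<epsilon>: "\<epsilon> > 0" for \<epsilon>
  proof -
    obtain \<Omega> where \<Omega>: "\<Omega> > 0" "\<And>\<omega>. \<bar>\<omega>\<bar> \<ge> \<Omega> \<Longrightarrow> norm (integral {-A..A} (\<lambda>t. g t * cis (\<omega> * t))) \<le> \<epsilon> * A"
      using Riemann_Lebesgue[OF _ gc, of "\<epsilon> * A"] A \<epsilon> by auto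
    have "norm (G m) < \<epsilon>" if m: "\<bar>m\<bar> \<ge> \<lceil>\<Omega> / \<kappa>\<rceil>" for m
    proof -
      have "\<bar>real_of_int m\<bar> \<ge> \<Omega> / \<kappa>" using m by linarith
      then have "\<bar>- \<kappa> * real_of_int m\<bar> \<ge> \<Omega>" using \<kappa> by (simp add: abs_mult field_simps)
      from \<Omega>(2)[OF this] have "norm (integral {-A..A} (\<lambda>t. g t * cis (- \<kappa> * m * t))) / (2 * A) \<le> \<epsilon> * A / (2 * A)"
        using A by (intro divide_right_mono) auto
      then have "norm (G m) \<le> \<epsilon> * A / (2 * A)"
        using A unfolding G_def fourier_coeff_def \<kappa>_def[symmetric] norm_mult norm_divide by simp
      also have "\<dots> < \<epsilon>" using A \<epsilon> by simp
      finally show ?thesis .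
    qed
    then show ?thesis by blast
  qed
  have "(\<lambda>M. f x + (G (- int M - 1) - G (int M))) \<longlonglongrightarrow> f x + (0 - 0)"
  proof (intro tendsto_intros)
    have "(\<lambda>M. G (k M)) \<longlonglongrightarrow> 0" if k: "\<And>M. \<bar>k M\<bar> \<ge> int M" for k :: "nat \<Rightarrow> int"
      unfolding LIMSEQ_iff
    proof (intro allI impI)
      fix r :: real assume "r > 0"
      then obtain M0 where M0: "\<And>m::int. \<bar>m\<bar> \<ge> M0 \<Longrightarrow> norm (G m) < r" using G0 by blast
      have "norm (G (k M) - 0) < r" if "M \<ge> nat M0" for M
        using M0[of "k M"] k[of M] that by (simp add: nat_le_iff)
      then show "\<exists>no. \<forall>n\<ge>no. norm (G (k n) - 0) < r" by blast
    qed
    from this[of "\<lambda>M. - int M - 1"] this[of int]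
    show "(\<lambda>M. G (- int M - 1)) \<longlonglongrightarrow> 0" "(\<lambda>M. G (int M)) \<longlonglongrightarrow> 0"
      by simp_all
  qed
  then show ?thesis unfolding sum[unfolded \<kappa>_def, symmetric] by simp
qed

section \<open>Fourier coefficients with respect to one of n coordinates\<close>

definition fcoef :: "nat \<Rightarrow> real \<Rightarrow> int \<Rightarrow> ((nat \<Rightarrow> real) \<Rightarrow> complex) \<Rightarrow> (nat \<Rightarrow> real) \<Rightarrow> complex" where
  "fcoef r A m f y = fourier_coeff A m (\<lambda>t. f (y(r := t)))"

definition vanishing :: "nat \<Rightarrow> nat \<Rightarrow> real \<Rightarrow> ((nat \<Rightarrow> real) \<Rightarrow> complex) \<Rightarrow> bool" where
  "vanishing n r R f \<longleftrightarrow> (\<forall>y\<in>euc n. R < \<bar>y r\<bar> \<longrightarrow> f y = 0)"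

definition deriv_bounded :: "nat \<Rightarrow> nat \<Rightarrow> ((nat \<Rightarrow> real) \<Rightarrow> complex) \<Rightarrow> real \<Rightarrow> bool" where
  "deriv_bounded n p f B \<longleftrightarrow> (\<forall>l y. set l \<subseteq> {..<n} \<longrightarrow> length l \<le> p \<longrightarrow> y \<in> euc n \<longrightarrow> norm (iter_partial l f y) \<le> B)"

lemma deriv_boundedD: "deriv_bounded n p f B \<Longrightarrow> set l \<subseteq> {..<n} \<Longrightarrow> length l \<le> p \<Longrightarrow> y \<in> euc n \<Longrightarrow> norm (iter_partial l f y) \<le> B"
  by (simp add: deriv_bounded_def)

lemma deriv_bounded_mono: "deriv_bounded n p f B \<Longrightarrow> q \<le> p \<Longrightarrow> deriv_bounded n q f B"
  by (auto simp: deriv_bounded_def)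

lemma vanishing_iter:
  assumes "vanishing n r R f" "r < n" "set l \<subseteq> {..<n}"
  shows "vanishing n r R (iter_partial l f)"
  unfolding vanishing_def
proof (intro ballI impI)
  fix y assume y: "y \<in> euc n" "R < \<bar>y r\<bar>"
  have "open {y::nat\<Rightarrow>real. R < \<bar>y r\<bar>}" by (intro open_Collect_less continuous_intros continuous_on_product_coordinates)
  then have "openin (Euclidean_space n) (euc n \<inter> {y. R < \<bar>y r\<bar>})"
    by (auto simp: Euclidean_space_eq openin_open)
  then show "iter_partial l f y = 0"
    by (rule iter_partial_zero) (use assms y in \<open>auto simp: vanishing_def\<close>)
qed

lemma has_pd_cis: "has_pd i V (\<lambda>y. cis (\<omega> * y r)) (\<lambda>y. if i = r then \<i> * of_real \<omega> * cis (\<omega> * y r) else 0)"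
  using cis_has_vector_derivative[of \<omega>] by (auto simp: has_pd_def)

context
  fixes n r :: nat and A :: real and m :: int
  assumes r: "r < n" and A: "A > 0"
begin

lemma fcoef_section_continuous:
  assumes "continuous_on (euc n) f" "y \<in> euc n"
  shows "continuous_on S (\<lambda>t. f (y(r := t)))"
proof (rule continuous_on_compose2[OF assms(1)])
  show "continuous_on S (\<lambda>t. y(r := t))" by (intro continuous_on_fun_upd continuous_on_const continuous_on_id)
qed (use euc_upd[OF assms(2) r] in auto)

lemma fcoef_norm_le:
  assumes "continuous_on (euc n) f" "y \<in> euc n" "\<And>t. norm (f (y(r := t))) \<le> B"
  shows "norm (fcoef r A m f y) \<le> B"
proof -
  have "norm (integral {-A..A} (\<lambda>t. f (y(r := t)) * cis (- (pi / A) * m * t))) \<le> B * (A - (-A))"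
    by (rule norm_integral_cis_le) (use A assms in \<open>auto intro: fcoef_section_continuous\<close>)
  then show ?thesis using A by (simp add: fcoef_def fourier_coeff_def norm_divide field_simps)
qed

lemma fcoef_upd [simp]: "fcoef r A m f (y(r := s)) = fcoef r A m f y"
  by (simp add: fcoef_def)

lemma fcoef_continuous:
  assumes "continuous_on (euc n) f"
  shows "continuous_on (euc n) (fcoef r A m f)"
proof -
  have "continuous_on (euc n) (\<lambda>y. integral (cbox (-A) A) (\<lambda>t. f (y(r := t)) * cis (- (pi / A) * m * t)))"
  proof (rule integral_continuous_on_param, unfold split_beta, rule continuous_on_mult, rule continuous_on_compose2[OF assms])
    show "continuous_on (euc n \<times> cbox (-A) A) (\<lambda>p. (fst p)(r := snd p))"
      by (intro continuous_on_fun_upd continuous_on_fst continuous_on_snd continuous_on_id)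
  qed (use A in \<open>auto intro!: continuous_intros euc_upd r\<close>)
  then show ?thesis using A
    unfolding fcoef_def fourier_coeff_def by (intro continuous_on_divide continuous_on_const) auto
qed

lemma fcoef_has_pd:
  assumes f: "smooth_on_Rn n (euc n) f" and i: "i < n" "i \<noteq> r"
  shows "has_pd i (euc n) (fcoef r A m f) (fcoef r A m (partial_deriv i f))"
  unfolding has_pd_def
proof
  fix y assume y: "y \<in> euc n"
  let ?e = "\<lambda>t. cis (- (pi / A) * m * t)"
  have ye: "y(i := s, r := t) \<in> euc n" for s t using y i r by (auto simp: euc_def)
  have cont: "continuous_on (UNIV \<times> cbox (-A) A) (\<lambda>(s, t). g (y(i := s, r := t)) * ?e t)" if "smooth_on_Rn n (euc n) g" for g
    unfolding split_beta
  proof (rule continuous_on_mult, rule continuous_on_compose2[OF smooth_continuous[OF openin_euc that]])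
    show "continuous_on (UNIV \<times> cbox (-A) A) (\<lambda>p. y(i := fst p, r := snd p))"
      by (intro continuous_on_fun_upd continuous_on_const continuous_on_fst continuous_on_snd continuous_on_id)
  qed (use A in \<open>auto intro!: continuous_intros ye\<close>)
  have "((\<lambda>s. integral (cbox (-A) A) (\<lambda>t. f (y(i := s, r := t)) * ?e t)) has_vector_derivative
      integral (cbox (-A) A) (\<lambda>t. partial_deriv i f (y(i := y i, r := t)) * ?e t)) (at (y i) within UNIV)"
  proof (rule leibniz_rule_vector_derivative)
    fix s t
    have "((\<lambda>s. f (y(i := s, r := t))) has_vector_derivative partial_deriv i f (y(i := s, r := t))) (at s)"
      using has_pdD[OF smooth_has_pd[OF openin_euc f i(1)] ye[of s t]] i(2) by (simp add: fun_upd_twist)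
    then show "((\<lambda>s. f (y(i := s, r := t)) * ?e t) has_vector_derivative partial_deriv i f (y(i := s, r := t)) * ?e t) (at s within UNIV)"
      by (rule has_vector_derivative_mult_left)
  next
    show "(\<lambda>t. f (y(i := s, r := t)) * ?e t) integrable_on cbox (-A) A" for s
      by (intro integrable_continuous continuous_on_mult fcoef_section_continuous[OF _ euc_upd[OF y i(1)]] smooth_continuous[OF openin_euc f])
        (use A in \<open>auto intro!: continuous_intros\<close>)
    show "continuous_on (UNIV \<times> cbox (-A) A) (\<lambda>(s, t). partial_deriv i f (y(i := s, r := t)) * ?e t)"
      by (rule cont[OF smooth_partial[OF f i(1)]])
  qed auto
  from bounded_linear.has_vector_derivative[OF bounded_linear_divide this, of "of_real (2 * A)"]
  show "((\<lambda>s. fcoef r A m f (y(i := s))) has_vector_derivative fcoef r A m (partial_deriv i f) y) (at (y i))"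
    by (simp add: fcoef_def fourier_coeff_def)
qed

lemma fcoef_has_pd_self: "has_pd r (euc n) (fcoef r A m f) (\<lambda>y. 0)"
  by (simp add: has_pd_def)

lemma fcoef_smooth:
  assumes "smooth_on_Rn n (euc n) f"
  shows "smooth_on_Rn n (euc n) (fcoef r A m f)"
proof (rule smooth_coinduct[OF openin_euc, where S="insert (\<lambda>y. 0) {fcoef r A m f | f. smooth_on_Rn n (euc n) f}"])
  fix g i assume "g \<in> insert (\<lambda>y. 0) {fcoef r A m f | f. smooth_on_Rn n (euc n) f}" and i: "i < n"
  then show "\<exists>f'\<in>insert (\<lambda>y. 0) {fcoef r A m f | f. smooth_on_Rn n (euc n) f}. has_pd i (euc n) g f'"
    using fcoef_has_pd[of _ i] fcoef_has_pd_self smooth_partial[of n "euc n" _ i] has_pd_const[of i "euc n" 0] by (cases "i = r") blast+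
qed (use assms in \<open>auto intro: fcoef_continuous smooth_continuous[OF openin_euc]\<close>)

lemma iter_partial_fcoef:
  assumes f: "smooth_on_Rn n (euc n) f" and "set js \<subseteq> {..<n}" "y \<in> euc n"
  shows "iter_partial js (fcoef r A m f) y = (if r \<in> set js then 0 else fcoef r A m (iter_partial js f) y)"
  using assms(2,3)
proof (induction js arbitrary: y)
  case (Cons i js)
  then have i: "i < n" and js: "set js \<subseteq> {..<n}" by auto
  have "iter_partial (i # js) (fcoef r A m f) y =
      partial_deriv i (\<lambda>y. if r \<in> set js then 0 else fcoef r A m (iter_partial js f) y) y"
    using partial_deriv_cong[OF openin_euc i Cons.IH[OF js] Cons.prems(2)] by simp
  also have "\<dots> = (if r \<in> set (i # js) then 0 else fcoef r A m (iter_partial (i # js) f) y)"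
    using has_pd_partial_deriv[OF has_pd_const Cons.prems(2), of i "0::complex"]
      has_pd_partial_deriv[OF fcoef_has_pd_self Cons.prems(2)]
      has_pd_partial_deriv[OF fcoef_has_pd[OF smooth_iter[OF f js] i] Cons.prems(2)]
    by (cases "r \<in> set js"; cases "i = r"; simp)
  finally show ?case .
qed simp

text \<open>Integration by parts in coordinate r. The boundary terms vanish because f is 0 where |y
  r| > R and R < A, so a derivative multiplies the coefficient by its frequency.\<close>

lemma fcoef_partial_self:
  assumes f: "smooth_on_Rn n (euc n) f" and "vanishing n r R f" "R < A" and y: "y \<in> euc n"
  shows "fcoef r A m (partial_deriv r f) y = \<i> * of_real ((pi / A) * m) * fcoef r A m f y"
proof -
  have ye: "y(r := t) \<in> euc n" for t using y r by (rule euc_upd)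
  have "((\<lambda>t. f (y(r := t))) has_vector_derivative partial_deriv r f (y(r := t))) (at t)" for t
    using has_pdD[OF smooth_has_pd[OF openin_euc f r] ye[of t]] by simp
  from integral_cis_by_parts[of "-A" A, OF _ this, of "- (pi / A) * m"]
  have "integral {-A..A} (\<lambda>t. partial_deriv r f (y(r := t)) * cis (- (pi / A) * m * t)) =
      - \<i> * of_real (- (pi / A) * m) * integral {-A..A} (\<lambda>t. f (y(r := t)) * cis (- (pi / A) * m * t))"
    using A assms(2,3) ye smooth_continuous[OF openin_euc smooth_partial[OF f r]] fcoef_section_continuous[OF _ y]
    by (auto simp: vanishing_def)
  then show ?thesis by (simp add: fcoef_def fourier_coeff_def)
qed

lemma fcoef_partial_iter_self:
  assumes f: "smooth_on_Rn n (euc n) f" and "vanishing n r R f" "R < A" and y: "y \<in> euc n"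
  shows "fcoef r A m (iter_partial (replicate q r) f) y = (\<i> * of_real ((pi / A) * m)) ^ q * fcoef r A m f y"
proof (induction q)
  case (Suc q)
  have l: "set (replicate q r) \<subseteq> {..<n}" using r by auto
  show ?case
    using fcoef_partial_self[OF smooth_iter[OF f l] vanishing_iter[OF assms(2) r l] assms(3) y] Suc by simp
qed simp

text \<open>In coordinate r the factor produced by the exponential is the one produced by
  integration by parts; in the other coordinates the derivative passes under the integral. Hence the
  derivatives of the partial sums of f are the partial sums of the derivatives of f.\<close>

lemma iter_partial_fcoef_cis:
  assumes f: "smooth_on_Rn n (euc n) f" and "vanishing n r R f" "R < A" and "set js \<subseteq> {..<n}" "y \<in> euc n"
  shows "iter_partial js (\<lambda>y. fcoef r A m f y * cis ((pi / A) * m * y r)) y = fcoef r A m (iter_partial js f) y * cis ((pi / A) * m * y r)"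
  using assms(4,5)
proof (induction js arbitrary: y)
  case (Cons i js)
  then have i: "i < n" and js: "set js \<subseteq> {..<n}" by auto
  note g = smooth_iter[OF f js] vanishing_iter[OF assms(2) r js]
  have "iter_partial (i # js) (\<lambda>y. fcoef r A m f y * cis ((pi / A) * m * y r)) y =
      partial_deriv i (\<lambda>y. fcoef r A m (iter_partial js f) y * cis ((pi / A) * m * y r)) y"
    using partial_deriv_cong[OF openin_euc i Cons.IH[OF js] Cons.prems(2)] by simp
  also have "\<dots> = fcoef r A m (iter_partial (i # js) f) y * cis ((pi / A) * m * y r)"
  proof (cases "i = r")
    case True
    show ?thesis
      using has_pd_partial_deriv[OF has_pd_mult[OF fcoef_has_pd_self has_pd_cis[of r _ "(pi / A) * m" r]] Cons.prems(2)]
        fcoef_partial_self[OF g assms(3) Cons.prems(2)] True by simp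
  next
    case False
    show ?thesis
      using has_pd_partial_deriv[OF has_pd_mult[OF fcoef_has_pd[OF g(1) i False] has_pd_cis[of i _ "(pi / A) * m" r]] Cons.prems(2)] False by simp
  qed
  finally show ?case .
qed simp

text \<open>Integrating by parts q times multiplies the coefficient by the q-th power of the
  frequency, and the result is still bounded by B. The extreme cases q = 0 and q = Q together bound
  the power of 1 plus the frequency.\<close>

lemma fcoef_decay:
  assumes f: "smooth_on_Rn n (euc n) f" and v: "vanishing n r R f" "R < A" and b: "deriv_bounded n (p + Q) f B"
    and l: "set l \<subseteq> {..<n}" "length l \<le> p" and y: "y \<in> euc n"
  shows "norm (fcoef r A m (iter_partial l f) y) * (1 + (pi / A) * \<bar>m\<bar>) ^ Q \<le> 2 ^ Q * B"
proof -
  define a where "a = (pi / A) * \<bar>m\<bar>"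
  have a: "a \<ge> 0" using A by (simp add: a_def)
  have ye: "y(r := t) \<in> euc n" for t using y r by (rule euc_upd)
  have *: "norm (fcoef r A m (iter_partial l f) y) * a ^ q \<le> B" if "q \<le> Q" for q
  proof -
    have rl: "set (replicate q r) \<subseteq> {..<n}" using r by auto
    have "norm (fcoef r A m (iter_partial (replicate q r) (iter_partial l f)) y) \<le> B"
    proof (rule fcoef_norm_le[OF _ y])
      show "continuous_on (euc n) (iter_partial (replicate q r) (iter_partial l f))"
        by (intro smooth_continuous[OF openin_euc] smooth_iter f rl l)
      show "norm (iter_partial (replicate q r) (iter_partial l f) (y(r := t))) \<le> B" for t
        unfolding iter_partial_append[symmetric]
        by (rule deriv_boundedD[OF b _ _ ye]) (use rl l that in auto)
    qed
    also have "fcoef r A m (iter_partial (replicate q r) (iter_partial l f)) y = (\<i> * of_real ((pi / A) * m)) ^ q * fcoef r A m (iter_partial l f) y"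
      by (rule fcoef_partial_iter_self[OF smooth_iter[OF f l(1)] vanishing_iter[OF v(1) r l(1)] v(2) y])
    finally have "norm (\<i> * of_real ((pi / A) * m) :: complex) ^ q * norm (fcoef r A m (iter_partial l f) y) \<le> B"
      by (simp only: norm_mult norm_power)
    also have "norm (\<i> * of_real ((pi / A) * m) :: complex) = a" using A by (simp add: norm_mult norm_divide a_def)
    finally show ?thesis by (simp add: mult.commute)
  qed
  \<comment> \<open>1 + a is at most twice the maximum of 1 and a; this is where 2^Q comes
    from.\<close>
  have "(1 + a) ^ Q \<le> (2 * max 1 a) ^ Q" using a by (intro power_mono) auto
  also have "\<dots> = 2 ^ Q * max 1 (a ^ Q)" using a
    by (cases "a \<le> 1") (auto simp: power_mult_distrib max_def power_le_one one_le_power not_le intro: antisym)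
  finally have "norm (fcoef r A m (iter_partial l f) y) * (1 + a) ^ Q \<le> norm (fcoef r A m (iter_partial l f) y) * (2 ^ Q * max 1 (a ^ Q))"
    by (rule mult_left_mono) simp
  also have "\<dots> = 2 ^ Q * (norm (fcoef r A m (iter_partial l f) y) * max 1 (a ^ Q))" by simp
  also have "\<dots> \<le> 2 ^ Q * B" using *[of 0] *[of Q] by (intro mult_left_mono) (auto simp: max_def)
  finally show ?thesis by (simp add: a_def)
qed

end

section \<open>Uniform error of the partial Fourier sums\<close>

definition weight_sum :: "real \<Rightarrow> nat \<Rightarrow> real" where
  "weight_sum \<kappa> M = (\<Sum>m\<in>{-int M..int M}. 1 / (1 + \<kappa> * real_of_int \<bar>m\<bar>)\<^sup>2)"

lemma weight_sum_mono: "M \<le> M' \<Longrightarrow> weight_sum \<kappa> M \<le> weight_sum \<kappa> M'"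
  unfolding weight_sum_def by (intro sum_mono2) auto

text \<open>Comparison with the sum of 1 / k^2. The symmetric partial sums increase, so they stay
  below their limit W, and W minus a partial sum is the tail that bounds the error of a Fourier
  series whose coefficients decay to order 2.\<close>

lemma weight_sum_convergent: 
  assumes "\<kappa> > 0"
  obtains W where "weight_sum \<kappa> \<longlonglongrightarrow> W" "\<And>M. weight_sum \<kappa> M \<le> W"
proof -
  let ?a = "\<lambda>k::nat. 1 / (1 + \<kappa> * k)\<^sup>2"
  have "summable ?a"
  proof (rule summable_comparison_test_ev)
    have "norm (?a k) \<le> (1 / \<kappa>\<^sup>2) * (1 / real k ^ 2)" if "k > 0" for k
    proof -
      have "(\<kappa> * k)\<^sup>2 \<le> (1 + \<kappa> * k)\<^sup>2" using assms by (intro power_mono) auto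
      moreover have "(\<kappa> * k)\<^sup>2 > 0" using assms that by simp
      ultimately have "1 / (1 + \<kappa> * k)\<^sup>2 \<le> 1 / (\<kappa> * k)\<^sup>2" by (rule frac_le[OF zero_le_one order_refl, rotated])
      then show ?thesis by (simp add: power_mult_distrib)
    qed
    then show "\<forall>\<^sub>F k in sequentially. norm (?a k) \<le> (1 / \<kappa>\<^sup>2) * (1 / real k ^ 2)"
      by (rule eventually_mono[OF eventually_gt_at_top[of 0]])
    show "summable (\<lambda>k. (1 / \<kappa>\<^sup>2) * (1 / real k ^ 2))"
      using inverse_power_summable[of 2, where 'a=real] by (intro summable_mult) (simp add: divide_inverse)
  qed
  have le: "weight_sum \<kappa> M \<le> 2 * suminf ?a" for M
  proof -
    have "weight_sum \<kappa> M \<le> 2 * (\<Sum>k<Suc M. ?a k)"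
    proof (induction M)
      case (Suc M)
      have "weight_sum \<kappa> (Suc M) = ?a (Suc M) + ?a (Suc M) + weight_sum \<kappa> M"
        unfolding weight_sum_def sum_symmetric_int_Suc by (simp only: abs_minus_cancel abs_of_nat of_int_of_nat_eq)
      moreover have "w' \<le> 2 * (s + a)" if "w' = a + a + w" "w \<le> 2 * s" for w :: real and w' :: real and a :: real and s :: real
        using that by simp
      ultimately show ?case using Suc unfolding sum.lessThan_Suc[of ?a "Suc M"] by blast
    qed (simp add: weight_sum_def)
    also have "\<dots> \<le> 2 * suminf ?a" using sum_le_suminf[OF \<open>summable ?a\<close>, of "{..<Suc M}"] by simp
    finally show ?thesis .
  qed
  have inc: "incseq (weight_sum \<kappa>)" by (simp add: incseq_def weight_sum_mono)
  have "bdd_above (range (weight_sum \<kappa>))" by (rule bdd_aboveI2) (rule le)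
  then show ?thesis using LIMSEQ_incseq_SUP[OF _ inc] that by (auto intro: cSUP_upper)
qed

definition fpartial :: "nat \<Rightarrow> real \<Rightarrow> nat \<Rightarrow> ((nat \<Rightarrow> real) \<Rightarrow> complex) \<Rightarrow> (nat \<Rightarrow> real) \<Rightarrow> complex" where
  "fpartial r A M f y = (\<Sum>m\<in>{-int M..int M}. fcoef r A m f y * cis ((pi / A) * m * y r))"

text \<open>The pointwise limit of the partial sums is known, so the error is at most the tail of
  the series. Decay of order 2 costs two derivatives beyond p and yields the factor 4 = 2^2. The
  bound is uniform in y and in the derivatives up to order p, as a distribution of order p
  requires.\<close>

lemma fpartial_error:
  assumes r: "r < n" and A: "A > 0" and f: "smooth_on_Rn n (euc n) f" and v: "vanishing n r R f" "R < A"
    and b: "deriv_bounded n (p + 2) f B" and W: "weight_sum (pi / A) \<longlonglongrightarrow> W" "\<And>M. weight_sum (pi / A) M \<le> W"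
    and l: "set l \<subseteq> {..<n}" "length l \<le> p" and y: "y \<in> euc n" "\<bar>y r\<bar> < A"
  shows "norm (iter_partial l f y - fpartial r A M (iter_partial l f) y) \<le> 4 * B * (W - weight_sum (pi / A) M)"
proof -
  let ?g = "iter_partial l f"
  have g: "smooth_on_Rn n (euc n) ?g" by (rule smooth_iter[OF f l(1)])
  have "norm (f y) \<le> B" using deriv_boundedD[OF b, of "[]" y] y by simp
  then have B: "B \<ge> 0" using norm_ge_zero order_trans by blast
  have "(\<lambda>M. \<Sum>m\<in>{-int M..int M}. fourier_coeff A m (\<lambda>t. ?g (y(r := t))) * cis ((pi / A) * m * y r)) \<longlonglongrightarrow> ?g (y(r := y r))"
  proof (rule fourier_series_pointwise[OF A])
    show "continuous_on {-A..A} (\<lambda>t. ?g (y(r := t)))"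
      by (rule fcoef_section_continuous[OF r A smooth_continuous[OF openin_euc g] y(1)])
    show "((\<lambda>t. ?g (y(r := t))) has_vector_derivative partial_deriv r ?g y) (at (y r))"
      using has_pdD[OF smooth_has_pd[OF openin_euc g r] y(1)] .
  qed (use y in auto)
  then have lim: "(\<lambda>M. fpartial r A M ?g y) \<longlonglongrightarrow> ?g y" by (simp add: fpartial_def fcoef_def)
  have diff: "norm (fpartial r A M' ?g y - fpartial r A M ?g y) \<le> 4 * B * (W - weight_sum (pi / A) M)" if "M \<le> M'" for M'
  proof -
    let ?I = "\<lambda>M. {-int M..int M}"
    have sub: "?I M \<subseteq> ?I M'" using that by auto
    have "fpartial r A M' ?g y - fpartial r A M ?g y = (\<Sum>m\<in>?I M' - ?I M. fcoef r A m ?g y * cis ((pi / A) * m * y r))"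
      unfolding fpartial_def by (simp add: sum_diff[OF _ sub])
    also have "norm \<dots> \<le> (\<Sum>m\<in>?I M' - ?I M. 4 * B * (1 / (1 + (pi / A) * \<bar>m\<bar>)\<^sup>2))"
    proof (rule sum_norm_le)
      fix m
      have "norm (fcoef r A m ?g y) * (1 + (pi / A) * \<bar>m\<bar>) ^ 2 \<le> 2 ^ 2 * B"
        by (rule fcoef_decay[OF r A f v b l y(1)])
      moreover have "(1 + (pi / A) * \<bar>m\<bar>) ^ 2 > 0" using A by (intro zero_less_power add_pos_nonneg) auto
      ultimately show "norm (fcoef r A m ?g y * cis ((pi / A) * m * y r)) \<le> 4 * B * (1 / (1 + (pi / A) * \<bar>m\<bar>)\<^sup>2)"
        by (simp add: norm_mult pos_le_divide_eq)
    qed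
    also have "\<dots> = 4 * B * (weight_sum (pi / A) M' - weight_sum (pi / A) M)"
      unfolding weight_sum_def by (simp add: sum_diff[OF _ sub] sum_distrib_left right_diff_distrib)
    also have "\<dots> \<le> 4 * B * (W - weight_sum (pi / A) M)" using B W(2) by (intro mult_left_mono) auto
    finally show ?thesis .
  qed
  have "(\<lambda>M'. norm (fpartial r A M' ?g y - fpartial r A M ?g y)) \<longlonglongrightarrow> norm (?g y - fpartial r A M ?g y)"
    by (intro tendsto_intros lim)
  then show ?thesis
    by (rule LIMSEQ_le_const2) (use diff in blast)
qed


section \<open>Exponentials and conic neighbourhoods\<close>

definition expo :: "nat \<Rightarrow> (nat \<Rightarrow> real) \<Rightarrow> (nat \<Rightarrow> real) \<Rightarrow> complex" where
  "expo n \<eta> y = cis (- (\<Sum>i<n. y i * \<eta> i))"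

abbreviation enorm :: "nat \<Rightarrow> (nat \<Rightarrow> real) \<Rightarrow> real" where
  "enorm n \<eta> \<equiv> L2_set \<eta> {..<n}"

lemma norm_expo [simp]: "norm (expo n \<eta> y) = 1"
  by (simp add: expo_def)

lemma smooth_expo: "openin (Euclidean_space n) V \<Longrightarrow> smooth_on_Rn n V (expo n \<eta>)"
proof -
  assume V: "openin (Euclidean_space n) V"
  have "smooth_on_Rn n V (\<lambda>y. cis (\<Sum>i<n. y i * (- \<eta> i)))"
    by (intro smooth_cis smooth_sum smooth_mult smooth_coord smooth_const V)
  then show ?thesis by (simp add: expo_def[abs_def] sum_negf)
qed

lemma expo_has_pd:
  assumes "i < n"
  shows "has_pd i V (expo n \<eta>) (\<lambda>y. (- \<i> * of_real (\<eta> i)) * expo n \<eta> y)"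
  unfolding has_pd_def
proof
  fix y :: "nat \<Rightarrow> real"
  let ?c = "cis (- (\<Sum>j\<in>{..<n} - {i}. y j * \<eta> j))"
  have eq: "expo n \<eta> (y(i := t)) = cis (- \<eta> i * t) * ?c" for t
  proof -
    have "(\<Sum>j<n. (y(i := t)) j * \<eta> j) = t * \<eta> i + (\<Sum>j\<in>{..<n} - {i}. (y(i := t)) j * \<eta> j)"
      by (subst sum.remove[of _ i]) (use assms in auto)
    also have "(\<Sum>j\<in>{..<n} - {i}. (y(i := t)) j * \<eta> j) = (\<Sum>j\<in>{..<n} - {i}. y j * \<eta> j)"
      by (intro sum.cong) auto
    finally show ?thesis by (simp add: expo_def cis_mult mult.commute)
  qed
  have "((\<lambda>t. cis (- \<eta> i * t) * ?c) has_vector_derivative \<i> * of_real (- \<eta> i) * cis (- \<eta> i * y i) * ?c) (at (y i))"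
    by (intro has_vector_derivative_mult_left cis_has_vector_derivative)
  moreover have "\<i> * of_real (- \<eta> i) * cis (- \<eta> i * y i) * ?c = (- \<i> * of_real (\<eta> i)) * expo n \<eta> y"
    using eq[of "y i"] by simp
  ultimately show "((\<lambda>t. expo n \<eta> (y(i := t))) has_vector_derivative (- \<i> * of_real (\<eta> i)) * expo n \<eta> y) (at (y i))"
    unfolding eq by (simp only:)
qed

lemma iter_partial_expo:
  assumes "set js \<subseteq> {..<n}"
  shows "iter_partial js (expo n \<eta>) = (\<lambda>y. (\<Prod>i\<leftarrow>js. - \<i> * of_real (\<eta> i)) * expo n \<eta> y)"
  using assms
proof (induction js)
  case (Cons i js)
  have "has_pd i UNIV (\<lambda>y. (\<Prod>i\<leftarrow>js. - \<i> * of_real (\<eta> i)) * expo n \<eta> y)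
      (\<lambda>y. (\<Prod>i\<leftarrow>js. - \<i> * of_real (\<eta> i)) * ((- \<i> * of_real (\<eta> i)) * expo n \<eta> y))"
    by (intro has_pd_bounded_linear[OF bounded_linear_mult_right] expo_has_pd) (use Cons in auto)
  with Cons show ?case by (auto simp: has_pd_partial_deriv mult_ac)
qed auto

lemma norm_iter_partial_expo:
  assumes "set js \<subseteq> {..<n}" "length js \<le> p"
  shows "norm (iter_partial js (expo n \<eta>) y) \<le> (1 + enorm n \<eta>) ^ p"
proof -
  have nn: "enorm n \<eta> \<ge> 0" by (rule L2_set_nonneg)
  have "norm (\<Prod>i\<leftarrow>js. - \<i> * complex_of_real (\<eta> i)) \<le> (1 + enorm n \<eta>) ^ length js"
    using assms(1)
  proof (induction js)
    case (Cons i js)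
    have "\<bar>\<eta> i\<bar> \<le> L2_set (\<lambda>i. \<bar>\<eta> i\<bar>) {..<n}" using Cons by (intro member_le_L2_set) auto
    then have "\<bar>\<eta> i\<bar> \<le> 1 + enorm n \<eta>" by (simp add: L2_set_def)
    then show ?case using Cons by (auto simp: norm_mult intro!: mult_mono)
  qed simp
  also have "\<dots> \<le> (1 + enorm n \<eta>) ^ p" using assms nn by (intro power_increasing) auto
  finally show ?thesis using assms(1) by (simp add: iter_partial_expo norm_mult)
qed

lemma expo_shift:
  assumes "r < n"
  shows "cis (\<omega> * y r) * expo n \<eta> y = expo n (\<eta>(r := \<eta> r - \<omega>)) y"
proof -
  have "(\<Sum>i<n. y i * (\<eta>(r := \<eta> r - \<omega>)) i) = (\<Sum>i<n. y i * \<eta> i - (if i = r then y r * \<omega> else 0))"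
    by (intro sum.cong) (auto simp: algebra_simps)
  also have "\<dots> = (\<Sum>i<n. y i * \<eta> i) - y r * \<omega>" using assms by (simp add: sum_subtractf)
  finally show ?thesis by (simp only: expo_def cis_mult) (simp add: algebra_simps)
qed

lemma enorm_triangle: "enorm n (\<lambda>i. x i + y i) \<le> enorm n x + enorm n y"
  by (rule L2_set_triangle_ineq)

lemma enorm_single: "r < n \<Longrightarrow> enorm n (\<lambda>i. if i = r then a else 0) = \<bar>a\<bar>"
  by (simp add: L2_set_def if_distrib[of "\<lambda>x. x\<^sup>2"] cong: if_cong)

lemma enorm_scale: "enorm n (\<lambda>i. c * x i) = \<bar>c\<bar> * enorm n x"
  using L2_set_right_distrib[of "\<bar>c\<bar>" x "{..<n}"] by (simp add: L2_set_def power_mult_distrib)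

lemma enorm_upd_le: "r < n \<Longrightarrow> enorm n (\<lambda>i. (\<eta>(r := \<eta> r - \<omega>)) i - z i) \<le> enorm n (\<lambda>i. \<eta> i - z i) + \<bar>\<omega>\<bar>"
proof -
  assume r: "r < n"
  have "enorm n (\<lambda>i. (\<eta>(r := \<eta> r - \<omega>)) i - z i) = enorm n (\<lambda>i. (\<eta> i - z i) + (if i = r then - \<omega> else 0))"
    by (rule arg_cong[where f="enorm n"]) auto
  also have "\<dots> \<le> enorm n (\<lambda>i. \<eta> i - z i) + \<bar>- \<omega>\<bar>"
    using enorm_triangle[of "\<lambda>i. \<eta> i - z i" "\<lambda>i. if i = r then - \<omega> else 0" n] enorm_single[OF r, of "- \<omega>"] by simp
  finally show ?thesis by simp
qed

text \<open>The union over s > 0 of the balls of radius \<epsilon> s around s times \<eta>0: a conic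
  neighbourhood with a measurable aperture. The scale s makes the effect of a frequency shift
  explicit, as a shift by at most \<epsilon> s / 2 leads from the cone of half the width into the
  full one.\<close>

definition cone :: "nat \<Rightarrow> (nat \<Rightarrow> real) \<Rightarrow> real \<Rightarrow> (nat \<Rightarrow> real) set" where
  "cone n \<eta>0 \<epsilon> = {\<eta> \<in> euc n. \<exists>s>0. enorm n (\<lambda>i. \<eta> i - s * \<eta>0 i) < \<epsilon> * s}"

lemma cone_open: "openin (Euclidean_space n) (cone n \<eta>0 \<epsilon>)"
proof (rule openin_Euclidean_boxI)
  fix \<eta> assume "\<eta> \<in> cone n \<eta>0 \<epsilon>"
  then obtain s where s: "s > 0" "enorm n (\<lambda>i. \<eta> i - s * \<eta>0 i) < \<epsilon> * s" by (auto simp: cone_def)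
  define d where "d = (\<epsilon> * s - enorm n (\<lambda>i. \<eta> i - s * \<eta>0 i)) / (n + 1)"
  have d: "d > 0" using s by (simp add: d_def)
  have "z \<in> cone n \<eta>0 \<epsilon>" if z: "z \<in> euc n" "\<forall>i<n. \<bar>z i - \<eta> i\<bar> < d" for z
  proof -
    have "enorm n (\<lambda>i. z i - \<eta> i) \<le> (\<Sum>i<n. \<bar>z i - \<eta> i\<bar>)" by (rule L2_set_le_sum_abs)
    also have "\<dots> \<le> (\<Sum>i<n. d)" by (intro sum_mono) (use z in \<open>auto intro: less_imp_le\<close>)
    also have "\<dots> < d * (n + 1)" using d by (simp add: algebra_simps)
    also have "\<dots> = \<epsilon> * s - enorm n (\<lambda>i. \<eta> i - s * \<eta>0 i)" by (simp add: d_def)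
    finally have "enorm n (\<lambda>i. z i - s * \<eta>0 i) < \<epsilon> * s"
      using enorm_triangle[of "\<lambda>i. z i - \<eta> i" "\<lambda>i. \<eta> i - s * \<eta>0 i" n] by simp
    then show ?thesis using z(1) s(1) by (auto simp: cone_def)
  qed
  then show "\<exists>\<delta>>0. \<forall>z\<in>euc n. (\<forall>i<n. \<bar>z i - \<eta> i\<bar> < \<delta>) \<longrightarrow> z \<in> cone n \<eta>0 \<epsilon>" using d by blast
qed (auto simp: cone_def)

lemma cone_scale:
  assumes "\<eta> \<in> cone n \<eta>0 \<epsilon>" "t > 0"
  shows "(\<lambda>i. t * \<eta> i) \<in> cone n \<eta>0 \<epsilon>"
proof -
  obtain s where s: "s > 0" "enorm n (\<lambda>i. \<eta> i - s * \<eta>0 i) < \<epsilon> * s" using assms(1) by (auto simp: cone_def)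
  have "enorm n (\<lambda>i. t * \<eta> i - (t * s) * \<eta>0 i) = t * enorm n (\<lambda>i. \<eta> i - s * \<eta>0 i)"
    using enorm_scale[of t "\<lambda>i. \<eta> i - s * \<eta>0 i" n] assms(2) by (simp add: algebra_simps)
  also have "\<dots> < \<epsilon> * (t * s)" using s(2) assms(2) by (simp add: algebra_simps)
  finally show ?thesis using assms s(1) by (auto simp: cone_def euc_def intro!: exI[of _ "t * s"])
qed

lemma cone_self: "\<eta>0 \<in> euc n \<Longrightarrow> \<epsilon> > 0 \<Longrightarrow> \<eta>0 \<in> cone n \<eta>0 \<epsilon>"
  by (auto simp: cone_def L2_set_def intro!: exI[of _ 1])

text \<open>Division by the scale s brings a point of the cone into a box around \<eta>0 inside
  \<Gamma>, and homogeneity of \<Gamma> scales it back.\<close>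

lemma cone_subset:
  assumes "openin (Euclidean_space n) \<Gamma>" "\<eta>0 \<in> \<Gamma>" and \<Gamma>: "\<And>\<eta> t. \<eta> \<in> \<Gamma> \<Longrightarrow> t > 0 \<Longrightarrow> (\<lambda>i. t * \<eta> i) \<in> \<Gamma>"
  obtains \<epsilon> where "\<epsilon> > 0" "cone n \<eta>0 \<epsilon> \<subseteq> \<Gamma>"
proof -
  obtain \<delta> where \<delta>: "\<delta> > 0" "\<And>z. z \<in> euc n \<Longrightarrow> (\<And>i. i < n \<Longrightarrow> \<bar>z i - \<eta>0 i\<bar> < \<delta>) \<Longrightarrow> z \<in> \<Gamma>"
    using openin_euc_box[OF assms(1,2)] by blast
  have "\<eta> \<in> \<Gamma>" if \<eta>: "\<eta> \<in> cone n \<eta>0 \<delta>" for \<eta>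
  proof -
    obtain s where s: "s > 0" "enorm n (\<lambda>i. \<eta> i - s * \<eta>0 i) < \<delta> * s" using \<eta> by (auto simp: cone_def)
    have "(\<lambda>i. \<eta> i / s) \<in> \<Gamma>"
    proof (rule \<delta>(2))
      show "(\<lambda>i. \<eta> i / s) \<in> euc n" using \<eta> by (auto simp: cone_def euc_def)
      fix i assume "i < n"
      then have "\<bar>\<eta> i - s * \<eta>0 i\<bar> \<le> L2_set (\<lambda>i. \<bar>\<eta> i - s * \<eta>0 i\<bar>) {..<n}" by (intro member_le_L2_set) auto
      also have "\<dots> < \<delta> * s" using s(2) by (simp add: L2_set_def)
      finally have "\<bar>\<eta> i - s * \<eta>0 i\<bar> / s < \<delta>" using s(1) by (simp add: field_simps)
      moreover have "\<eta> i / s - \<eta>0 i = (\<eta> i - s * \<eta>0 i) / s" using s(1) by (simp add: field_simps)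
      then have "\<bar>\<eta> i - s * \<eta>0 i\<bar> / s = \<bar>\<eta> i / s - \<eta>0 i\<bar>"
        using s(1) by (simp add: abs_divide)
      ultimately show "\<bar>\<eta> i / s - \<eta>0 i\<bar> < \<delta>" by simp
    qed
    from \<Gamma>[OF this s(1)] show ?thesis using s(1) by simp
  qed
  with \<delta>(1) that show ?thesis by blast
qed

section \<open>Multipliers and rapid decay\<close>

definition depends_below :: "nat \<Rightarrow> nat \<Rightarrow> ((nat \<Rightarrow> real) \<Rightarrow> complex) \<Rightarrow> bool" where
  "depends_below n r f \<longleftrightarrow> (\<forall>y\<in>euc n. \<forall>i. r \<le> i \<longrightarrow> i < n \<longrightarrow> (\<forall>t. f (y(i := t)) = f y))"

lemma depends_below_0:
  assumes "depends_below n 0 f" "y \<in> euc n"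
  shows "f y = f (\<lambda>i. 0)"
proof -
  have "f (\<lambda>i. if i < k then 0 else y i) = f y" if "k \<le> n" for k
    using that
  proof (induction k)
    case (Suc k)
    have "(\<lambda>i. if i < Suc k then 0 else y i) = (\<lambda>i. if i < k then 0 else y i)(k := 0)" by auto
    moreover have "(\<lambda>i. if i < k then 0 else y i) \<in> euc n" using assms(2) by (auto simp: euc_def)
    ultimately show ?case using Suc assms(1) by (simp add: depends_below_def)
  qed simp
  from this[of n] have "f (\<lambda>i. if i < n then 0 else y i) = f y" by simp
  moreover have "(\<lambda>i. if i < n then 0 else y i) = (\<lambda>i. 0)" using assms(2) by (auto simp: euc_def)
  ultimately show ?thesis by simp
qed

text \<open>The model is \<open>v f = u (\<rho> f)\<close> in a chart, for a distribution \<open>u\<close> and a cutoff \<open>\<rho>\<close>.\<close>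

locale box_distribution =
  fixes n :: nat and R :: real and v :: "((nat \<Rightarrow> real) \<Rightarrow> complex) \<Rightarrow> complex" and p0 :: nat and C0 :: real
  assumes add: "smooth_on_Rn n (euc n) f \<Longrightarrow> smooth_on_Rn n (euc n) g \<Longrightarrow> v (\<lambda>y. f y + g y) = v f + v g"
    and cmult: "smooth_on_Rn n (euc n) f \<Longrightarrow> v (\<lambda>y. a * f y) = a * v f"
    and eq_on: "(\<And>y. y \<in> euc n \<Longrightarrow> f y = g y) \<Longrightarrow> v f = v g"
    and C0: "C0 \<ge> 0"
    and bound: "smooth_on_Rn n (euc n) f \<Longrightarrow> B \<ge> 0 \<Longrightarrow>
      (\<And>l y. set l \<subseteq> {..<n} \<Longrightarrow> length l \<le> p0 \<Longrightarrow> y \<in> euc n \<Longrightarrow> (\<And>i. i < n \<Longrightarrow> \<bar>y i\<bar> \<le> R) \<Longrightarrow> norm (iter_partial l f y) \<le> B) \<Longrightarrow>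
      norm (v f) \<le> C0 * B"
begin

lemma sum: "(\<And>i. i \<in> I \<Longrightarrow> smooth_on_Rn n (euc n) (f i)) \<Longrightarrow> finite I \<Longrightarrow> v (\<lambda>y. \<Sum>i\<in>I. f i y) = (\<Sum>i\<in>I. v (f i))"
proof (induction I rule: infinite_finite_induct)
  case (insert i I)
  then show ?case using add[of "f i" "\<lambda>y. \<Sum>i\<in>I. f i y"] by (auto intro: smooth_sum[OF openin_euc])
next
  case empty
  show ?case using cmult[OF smooth_const[OF openin_euc, of n 0], of 0] by simp
qed auto

text \<open>Each derivative of the exponential costs at most a factor 1 + |\<eta>| and each use of
  the Leibniz rule a factor 2. The resulting polynomial bound holds in all directions and handles
  the frequencies for which no decay is known.\<close>

lemma times_expo_bound:
  assumes f: "smooth_on_Rn n (euc n) f" and B: "B \<ge> 0"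
    "\<And>l y. set l \<subseteq> {..<n} \<Longrightarrow> length l \<le> p0 \<Longrightarrow> y \<in> euc n \<Longrightarrow> (\<And>i. i < n \<Longrightarrow> \<bar>y i\<bar> \<le> R) \<Longrightarrow> norm (iter_partial l f y) \<le> B"
  shows "norm (v (\<lambda>y. f y * expo n \<eta> y)) \<le> C0 * 2 ^ p0 * B * (1 + enorm n \<eta>) ^ p0"
proof -
  have nn: "enorm n \<eta> \<ge> 0" by (rule L2_set_nonneg)
  have "norm (v (\<lambda>y. f y * expo n \<eta> y)) \<le> C0 * (2 ^ p0 * B * (1 + enorm n \<eta>) ^ p0)"
  proof (rule bound)
    show "smooth_on_Rn n (euc n) (\<lambda>y. f y * expo n \<eta> y)"
      by (intro smooth_mult[OF openin_euc] f smooth_expo openin_euc)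
    show "0 \<le> 2 ^ p0 * B * (1 + enorm n \<eta>) ^ p0" using B nn by simp
    fix l y assume l: "set l \<subseteq> {..<n}" "length l \<le> p0" and y: "y \<in> euc n" "\<And>i. i < n \<Longrightarrow> \<bar>y i\<bar> \<le> R"
    have "norm (iter_partial l (\<lambda>y. f y * expo n \<eta> y) y) \<le> 2 ^ length l * B * (1 + enorm n \<eta>) ^ p0"
      by (rule iter_partial_mult_bound[OF openin_euc f smooth_expo[OF openin_euc] y(1) l(1)])
        (use l y in \<open>auto intro: B norm_iter_partial_expo\<close>)
    also have "\<dots> \<le> 2 ^ p0 * B * (1 + enorm n \<eta>) ^ p0"
      using l B nn by (intro mult_right_mono power_increasing) auto
    finally show "norm (iter_partial l (\<lambda>y. f y * expo n \<eta> y) y) \<le> 2 ^ p0 * B * (1 + enorm n \<eta>) ^ p0" .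
  qed
  then show ?thesis by (simp add: mult.assoc)
qed

lemma times_expo_bound':
  assumes "smooth_on_Rn n (euc n) f" "B \<ge> 0" "deriv_bounded n p0 f B"
  shows "norm (v (\<lambda>y. f y * expo n \<eta> y)) \<le> C0 * 2 ^ p0 * B * (1 + enorm n \<eta>) ^ p0"
  by (rule times_expo_bound[OF assms(1,2)]) (use assms(3) in \<open>auto dest: deriv_boundedD\<close>)

text \<open>On the box that v sees, the coordinate r stays below A, and there the partial sums
  converge to f together with the derivatives up to the order p0 of v; the error is the tail of
  \<open>weight_sum\<close>. So v may be applied term by term, and a term times the exponential is
  the coefficient times an exponential of shifted frequency.\<close>

lemma fourier_expansion:
  assumes r: "r < n" and A: "A > 0" "R < A" and f: "smooth_on_Rn n (euc n) f" and vf: "vanishing n r R f"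
    and B: "B \<ge> 0" "deriv_bounded n (p0 + 2) f B"
  shows "(\<lambda>M. \<Sum>m\<in>{-int M..int M}. v (\<lambda>y. fcoef r A m f y * expo n (\<eta>(r := \<eta> r - (pi / A) * m)) y)) \<longlonglongrightarrow> v (\<lambda>y. f y * expo n \<eta> y)"
proof -
  obtain W where W: "weight_sum (pi / A) \<longlonglongrightarrow> W" "\<And>M. weight_sum (pi / A) M \<le> W"
    using weight_sum_convergent[of "pi / A"] A by auto
  let ?t = "\<lambda>m y. fcoef r A m f y * cis ((pi / A) * m * y r)"
  have t: "smooth_on_Rn n (euc n) (?t m)" for m
    by (intro smooth_mult[OF openin_euc] fcoef_smooth[OF r A(1) f] smooth_cis smooth_const smooth_coord openin_euc)
  let ?S = "fpartial r A"
  have S: "smooth_on_Rn n (euc n) (?S M f)" for M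
    unfolding fpartial_def[abs_def] by (intro smooth_sum[OF openin_euc] t)
  have d: "smooth_on_Rn n (euc n) (\<lambda>y. f y + (-1) * ?S M f y)" for M
    by (intro smooth_add[OF openin_euc] smooth_mult[OF openin_euc] smooth_const openin_euc f S)
  define K where "K = C0 * 2 ^ p0 * (1 + enorm n \<eta>) ^ p0"
  have err: "norm (v (\<lambda>y. (f y + (-1) * ?S M f y) * expo n \<eta> y)) \<le> K * (4 * B * (W - weight_sum (pi / A) M))" for M
  proof -
    have "norm (v (\<lambda>y. (f y + (-1) * ?S M f y) * expo n \<eta> y)) \<le> C0 * 2 ^ p0 * (4 * B * (W - weight_sum (pi / A) M)) * (1 + enorm n \<eta>) ^ p0"
    proof (rule times_expo_bound[OF d])
      show "0 \<le> 4 * B * (W - weight_sum (pi / A) M)" using B W(2)[of M] by simp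
      fix l y assume l: "set l \<subseteq> {..<n}" "length l \<le> p0" and y: "y \<in> euc n" and yR: "\<And>i. i < n \<Longrightarrow> \<bar>y i\<bar> \<le> R"
      have "iter_partial l (\<lambda>y. f y + (-1) * ?S M f y) y = iter_partial l f y + iter_partial l (\<lambda>y. (-1) * ?S M f y) y"
        by (rule iter_partial_add[OF openin_euc f _ l(1) y]) (intro smooth_mult[OF openin_euc] smooth_const openin_euc S)
      also have "iter_partial l (\<lambda>y. (-1) * ?S M f y) y = (-1) * iter_partial l (?S M f) y"
        by (rule iter_partial_bounded_linear[OF openin_euc bounded_linear_mult_right S l(1) y])
      also have "iter_partial l (?S M f) y = (\<Sum>m\<in>{-int M..int M}. iter_partial l (?t m) y)"
        unfolding fpartial_def[abs_def] by (rule iter_partial_sum[OF openin_euc t l(1) y])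
      also have "\<dots> = ?S M (iter_partial l f) y"
        unfolding fpartial_def by (intro sum.cong refl iter_partial_fcoef_cis[OF r A(1) f vf A(2) l(1) y])
      finally have "norm (iter_partial l (\<lambda>y. f y + (-1) * ?S M f y) y) = norm (iter_partial l f y - ?S M (iter_partial l f) y)" by simp
      also have "\<dots> \<le> 4 * B * (W - weight_sum (pi / A) M)"
        by (rule fpartial_error[OF r A(1) f vf A(2) B(2) W l y]) (use yR[OF r] A in simp)
      finally show "norm (iter_partial l (\<lambda>y. f y + (-1) * ?S M f y) y) \<le> 4 * B * (W - weight_sum (pi / A) M)" .
    qed
    then show ?thesis by (simp add: K_def mult_ac)
  qed
  have eq: "v (\<lambda>y. (f y + (-1) * ?S M f y) * expo n \<eta> y) = v (\<lambda>y. f y * expo n \<eta> y) -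
      (\<Sum>m\<in>{-int M..int M}. v (\<lambda>y. fcoef r A m f y * expo n (\<eta>(r := \<eta> r - (pi / A) * m)) y))" for M
  proof -
    have sm: "smooth_on_Rn n (euc n) (\<lambda>y. fcoef r A m f y * expo n (\<eta>(r := \<eta> r - (pi / A) * m)) y)" for m
      by (intro smooth_mult[OF openin_euc] fcoef_smooth[OF r A(1) f] smooth_expo openin_euc)
    have "(\<lambda>y. (f y + (-1) * ?S M f y) * expo n \<eta> y) =
        (\<lambda>y. f y * expo n \<eta> y + (-1) * (\<Sum>m\<in>{-int M..int M}. fcoef r A m f y * expo n (\<eta>(r := \<eta> r - (pi / A) * m)) y))"
      by (rule ext) (simp add: fpartial_def algebra_simps sum_distrib_left expo_shift[OF r, symmetric])
    then have "v (\<lambda>y. (f y + (-1) * ?S M f y) * expo n \<eta> y) = v (\<lambda>y. f y * expo n \<eta> y) +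
        v (\<lambda>y. (-1) * (\<Sum>m\<in>{-int M..int M}. fcoef r A m f y * expo n (\<eta>(r := \<eta> r - (pi / A) * m)) y))"
      by (simp only:) (intro add smooth_mult[OF openin_euc] f smooth_expo openin_euc smooth_const smooth_sum[OF openin_euc] sm fcoef_smooth[OF r A(1) f])
    also have "v (\<lambda>y. (-1) * (\<Sum>m\<in>{-int M..int M}. fcoef r A m f y * expo n (\<eta>(r := \<eta> r - (pi / A) * m)) y)) =
        (-1) * v (\<lambda>y. \<Sum>m\<in>{-int M..int M}. fcoef r A m f y * expo n (\<eta>(r := \<eta> r - (pi / A) * m)) y)"
      by (rule cmult) (intro smooth_sum[OF openin_euc] sm)
    also have "v (\<lambda>y. \<Sum>m\<in>{-int M..int M}. fcoef r A m f y * expo n (\<eta>(r := \<eta> r - (pi / A) * m)) y) =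
        (\<Sum>m\<in>{-int M..int M}. v (\<lambda>y. fcoef r A m f y * expo n (\<eta>(r := \<eta> r - (pi / A) * m)) y))"
      by (rule sum) (use sm in auto)
    finally show ?thesis by simp
  qed
  have "(\<lambda>M. K * (4 * B * (W - weight_sum (pi / A) M))) \<longlonglongrightarrow> K * (4 * B * (W - W))"
    by (intro tendsto_intros W(1))
  then have "(\<lambda>M. v (\<lambda>y. f y * expo n \<eta> y) -
      (\<Sum>m\<in>{-int M..int M}. v (\<lambda>y. fcoef r A m f y * expo n (\<eta>(r := \<eta> r - (pi / A) * m)) y))) \<longlonglongrightarrow> 0"
    by (intro Lim_null_comparison[OF always_eventually[OF allI[OF err[unfolded eq]]]]) simp
  from tendsto_diff[OF tendsto_const[of "v (\<lambda>y. f y * expo n \<eta> y)"] this] show ?thesis by simp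
qed

text \<open>Decay of order N in a cone, for all multipliers f that depend on the first r
  coordinates, and linear in a bound B for finitely many derivatives of f. The uniformity in f is
  essential: expanding in coordinate r replaces f by its Fourier coefficients, which are infinitely
  many new multipliers with ever smaller bounds.\<close>

abbreviation conic_decay :: "nat \<Rightarrow> (nat \<Rightarrow> real) \<Rightarrow> real \<Rightarrow> nat \<Rightarrow> bool" where
  "conic_decay r \<eta>0 \<epsilon> N \<equiv> \<exists>p C. C \<ge> 0 \<and> (\<forall>f B \<eta>. smooth_on_Rn n (euc n) f \<longrightarrow> (\<forall>i<r. vanishing n i R f) \<longrightarrow> depends_below n r f \<longrightarrow>
      B \<ge> 0 \<longrightarrow> deriv_bounded n p f B \<longrightarrow> \<eta> \<in> cone n \<eta>0 \<epsilon> \<longrightarrow> norm (v (\<lambda>y. f y * expo n \<eta> y)) * (1 + enorm n \<eta>) ^ N \<le> C * B)"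

text \<open>Fourier expansion in one coordinate after the other. A frequency shift \<open>m\<close> that is small relative
  to \<open>\<eta>\<close> stays in the larger cone; for a large one the decay of the \<open>m\<close>-th coefficient wins.\<close>

lemma multiplier_step:
  assumes r: "r < n" and R: "R > 0" and \<epsilon>: "\<epsilon> > 0" and \<eta>0: "\<eta>0 \<in> euc n"
    and IH: "\<And>N. conic_decay r \<eta>0 \<epsilon> N"
  shows "conic_decay (Suc r) \<eta>0 (\<epsilon> / 2) N"
proof -
  obtain p1 C1 where C1: "C1 \<ge> 0" and 1: "\<And>f B \<eta>. smooth_on_Rn n (euc n) f \<Longrightarrow> (\<And>i. i < r \<Longrightarrow> vanishing n i R f) \<Longrightarrow> depends_below n r f \<Longrightarrow>
      B \<ge> 0 \<Longrightarrow> deriv_bounded n p1 f B \<Longrightarrow> \<eta> \<in> cone n \<eta>0 \<epsilon> \<Longrightarrow> norm (v (\<lambda>y. f y * expo n \<eta> y)) * (1 + enorm n \<eta>) ^ N \<le> C1 * B"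
    using IH[of N] by blast
  define A where "A = R + 1"
  have A: "A > 0" "R < A" using R by (auto simp: A_def)
  define \<kappa> where "\<kappa> = pi / A"
  have \<kappa>: "\<kappa> > 0" using A by (simp add: \<kappa>_def)
  \<comment> \<open>For \<eta> in the narrower cone at scale s one has |\<eta>| \<le> s (|\<eta>0| +
    \<epsilon>). A shift of length at most \<delta> |\<eta>| is then at most \<epsilon> s / 2 and
    stays in the wider cone.\<close>
  define \<delta> where "\<delta> = (\<epsilon> / 2) / (enorm n \<eta>0 + \<epsilon>)"
  have nn: "enorm n x \<ge> 0" for x by (rule L2_set_nonneg)
  have \<delta>: "\<delta> > 0" "\<delta> * (enorm n \<eta>0 + \<epsilon>) = \<epsilon> / 2"
  proof -
    define D where "D = enorm n \<eta>0 + \<epsilon>"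
    have "D > 0" unfolding D_def by (rule add_nonneg_pos[OF nn \<epsilon>])
    then show "\<delta> > 0" "\<delta> * (enorm n \<eta>0 + \<epsilon>) = \<epsilon> / 2" using \<epsilon> by (auto simp: \<delta>_def simp flip: D_def)
  qed
  define C2 where "C2 = C0 * 2 ^ p0"
  have C2: "C2 \<ge> 0" using C0 by (simp add: C2_def)
  \<comment> \<open>The decay asked of the coefficients: p0 for the growth at the shifted frequency,
    p0 + N for trading powers of 1 + |\<eta>| against the size of a large shift, and 2 for
    summability over m.\<close>
  define Q where "Q = N + 2 * p0 + 2"
  define E where "E = (1 + 1 / \<delta>) ^ (p0 + N)"
  have E: "E \<ge> 0" using \<delta>(1) by (simp add: E_def)
  \<comment> \<open>The derivatives asked of f: p1 + p0 so that the coefficients meet the induction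
    hypothesis and the polynomial bound, Q for their decay, and room for the p0 + 2 of
    \<open>fourier_expansion\<close>.\<close>
  define p where "p = p1 + p0 + Q + 2"
  define C3 where "C3 = 2 ^ Q * (C1 + C2 * E)"
  have C3: "C3 \<ge> 0" using C1 C2 E by (simp add: C3_def)
  obtain W where W: "weight_sum \<kappa> \<longlonglongrightarrow> W" "\<And>M. weight_sum \<kappa> M \<le> W"
    using weight_sum_convergent[OF \<kappa>] by auto
  have main: "norm (v (\<lambda>y. f y * expo n \<eta> y)) * (1 + enorm n \<eta>) ^ N \<le> C3 * W * B"
    if f: "smooth_on_Rn n (euc n) f" and vf: "\<And>i. i < Suc r \<Longrightarrow> vanishing n i R f" and dep: "depends_below n (Suc r) f"
      and B: "B \<ge> 0" "deriv_bounded n p f B" and \<eta>: "\<eta> \<in> cone n \<eta>0 (\<epsilon> / 2)" for f B \<eta>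
  proof -
    let ?\<eta> = "\<lambda>m. \<eta>(r := \<eta> r - \<kappa> * real_of_int m)"
    let ?c = "\<lambda>m. fcoef r A m f"
    obtain s where s: "s > 0" "enorm n (\<lambda>i. \<eta> i - s * \<eta>0 i) < (\<epsilon> / 2) * s" using \<eta> by (auto simp: cone_def)
    have \<eta>e: "\<eta> \<in> euc n" using \<eta> by (simp add: cone_def)
    have bound_term: "norm (v (\<lambda>y. ?c m y * expo n (?\<eta> m) y)) * (1 + enorm n \<eta>) ^ N \<le> C3 * B * (1 / (1 + \<kappa> * real_of_int \<bar>m\<bar>)\<^sup>2)" for m :: int
    proof -
      define a where "a = 1 + \<kappa> * real_of_int \<bar>m\<bar>"
      have a: "a \<ge> 1" using \<kappa> by (simp add: a_def)
      define b where "b = 2 ^ Q * B / a ^ Q"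
      have b: "b \<ge> 0" using B a by (simp add: b_def)
      have c: "smooth_on_Rn n (euc n) (?c m)" by (rule fcoef_smooth[OF r A(1) f])
      have cb: "deriv_bounded n (p1 + p0) (?c m) b"
        unfolding deriv_bounded_def
      proof (intro allI impI)
        fix l y assume l: "set l \<subseteq> {..<n}" "length l \<le> p1 + p0" and y: "y \<in> euc n"
        have "norm (fcoef r A m (iter_partial l f) y) * a ^ Q \<le> 2 ^ Q * B"
          unfolding a_def \<kappa>_def
          by (rule fcoef_decay[OF r A(1) f vf A(2) deriv_bounded_mono[OF B(2)] l y]) (auto simp: p_def)
        then have "norm (fcoef r A m (iter_partial l f) y) \<le> b" using a by (simp add: b_def pos_le_divide_eq)
        then show "norm (iter_partial l (?c m) y) \<le> b" using b by (simp add: iter_partial_fcoef[OF r A(1) f l(1) y])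
      qed
      \<comment> \<open>Peetre's inequality for a shift of length a - 1: either of the two weights
        is at most a times the other.\<close>
      have sh: "1 + enorm n \<eta> \<le> (1 + enorm n (?\<eta> m)) * a" "1 + enorm n (?\<eta> m) \<le> (1 + enorm n \<eta>) * a"
      proof -
        have am: "\<bar>\<kappa> * real_of_int m\<bar> = a - 1" using \<kappa> by (simp add: a_def abs_mult)
        have "enorm n (?\<eta> m) \<le> enorm n \<eta> + (a - 1)"
          using enorm_upd_le[OF r, of \<eta> "\<kappa> * m" "\<lambda>i. 0"] am by (simp del: fun_upd_apply)
        moreover have "enorm n \<eta> \<le> enorm n (?\<eta> m) + (a - 1)"
        proof -
          have "(?\<eta> m)(r := ?\<eta> m r - (- \<kappa> * m)) = \<eta>" by auto
          then show ?thesis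
            using enorm_upd_le[OF r, of "?\<eta> m" "- \<kappa> * m" "\<lambda>i. 0"] am by (simp del: fun_upd_apply)
        qed
        moreover have "1 + x \<le> (1 + z) * a" if "x \<le> z + (a - 1)" "z \<ge> 0" for x z :: real
        proof -
          have "z * (a - 1) \<ge> 0" using that a by simp
          then show ?thesis using that(1) by (simp add: algebra_simps)
        qed
        ultimately show "1 + enorm n \<eta> \<le> (1 + enorm n (?\<eta> m)) * a" "1 + enorm n (?\<eta> m) \<le> (1 + enorm n \<eta>) * a"
          using nn by blast+
      qed
      have "norm (v (\<lambda>y. ?c m y * expo n (?\<eta> m) y)) * (1 + enorm n \<eta>) ^ N \<le> (C1 + C2 * E) * b * a ^ (Q - 2)"
      proof (cases "\<kappa> * real_of_int \<bar>m\<bar> \<le> \<delta> * enorm n \<eta>")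
        case True
        have "enorm n \<eta> \<le> enorm n (\<lambda>i. \<eta> i - s * \<eta>0 i) + enorm n (\<lambda>i. s * \<eta>0 i)"
          using enorm_triangle[of "\<lambda>i. \<eta> i - s * \<eta>0 i" "\<lambda>i. s * \<eta>0 i" n] by simp
        also have "\<dots> \<le> s * (enorm n \<eta>0 + \<epsilon>)" proof -
          have "0 < \<epsilon> * s" using \<epsilon> s(1) by simp
          then have "enorm n (\<lambda>i. \<eta> i - s * \<eta>0 i) \<le> \<epsilon> * s" using s(2) by linarith
          then show ?thesis using s(1) by (simp add: enorm_scale algebra_simps)
        qed
        finally have "\<delta> * enorm n \<eta> \<le> \<delta> * (s * (enorm n \<eta>0 + \<epsilon>))" using \<delta>(1) by simp
        also have "\<dots> = s * (\<epsilon> / 2)" by (simp only: \<delta>(2) mult.left_commute[of \<delta> s])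
        finally have "\<bar>\<kappa> * real_of_int m\<bar> \<le> (\<epsilon> / 2) * s" using True \<kappa> by (simp add: abs_mult mult.commute)
        then have "enorm n (\<lambda>i. ?\<eta> m i - s * \<eta>0 i) < \<epsilon> * s"
          using enorm_upd_le[OF r, of \<eta> "\<kappa> * m" "\<lambda>i. s * \<eta>0 i"] s(2) by (simp add: field_simps)
        then have \<eta>m: "?\<eta> m \<in> cone n \<eta>0 \<epsilon>" using s(1) euc_upd[OF \<eta>e r] by (auto simp: cone_def)
        have "norm (v (\<lambda>y. ?c m y * expo n (?\<eta> m) y)) * (1 + enorm n (?\<eta> m)) ^ N \<le> C1 * b"
        proof (rule 1[OF c _ _ b deriv_bounded_mono[OF cb] \<eta>m])
          fix i assume i: "i < r"
          have "vanishing n i R f" by (rule vf) (use i in simp)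
          then have "f (y(r := t)) = 0" if "y \<in> euc n" "R < \<bar>y i\<bar>" for y t
            using euc_upd[OF that(1) r, of t] that i by (simp add: vanishing_def)
          then show "vanishing n i R (?c m)" by (simp add: vanishing_def fcoef_def fourier_coeff_def)
        next
          show "depends_below n r (?c m)"
            unfolding depends_below_def
          proof (intro ballI allI impI)
            fix y i t assume y: "y \<in> euc n" and i: "r \<le> i" "i < n"
            show "?c m (y(i := t)) = ?c m y"
            proof (cases "i = r")
              case False
              then have "f ((y(i := t))(r := s)) = f (y(r := s))" for s
                using dep i euc_upd[OF y r, of s] fun_upd_twist[of i r y t s] by (simp add: depends_below_def)
              then show ?thesis by (simp add: fcoef_def)
            qed (simp add: fcoef_def)
          qed
        qed simp
        moreover have "(1 + enorm n \<eta>) ^ N \<le> (1 + enorm n (?\<eta> m)) ^ N * a ^ N"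
          unfolding power_mult_distrib[symmetric] using sh(1) nn by (intro power_mono) auto
        ultimately have "norm (v (\<lambda>y. ?c m y * expo n (?\<eta> m) y)) * (1 + enorm n \<eta>) ^ N \<le> (C1 * b) * a ^ N"
          using a by (smt (verit, best) mult.assoc mult_left_mono mult_right_mono norm_ge_zero zero_le_power)
        also have "\<dots> \<le> ((C1 + C2 * E) * b) * a ^ (Q - 2)"
          using C1 C2 E b a by (intro mult_mono power_increasing) (auto simp: Q_def)
        finally show ?thesis .
      next
        case False
        have "1 + enorm n \<eta> \<le> (1 + 1 / \<delta>) * a"
        proof -
          have "enorm n \<eta> \<le> (a - 1) / \<delta>" using False \<delta>(1) by (simp add: a_def field_simps)
          also have "\<dots> \<le> a / \<delta>" using \<delta>(1) by (simp add: divide_right_mono)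
          finally show ?thesis using a by (simp add: distrib_right)
        qed
        then have g: "(1 + enorm n \<eta>) ^ (p0 + N) \<le> E * a ^ (p0 + N)"
          unfolding E_def power_mult_distrib[symmetric] using nn[of \<eta>] by (intro power_mono) auto
        have "norm (v (\<lambda>y. ?c m y * expo n (?\<eta> m) y)) \<le> C2 * b * (1 + enorm n (?\<eta> m)) ^ p0"
          unfolding C2_def by (rule times_expo_bound'[OF c b deriv_bounded_mono[OF cb]]) simp
        also have "\<dots> \<le> C2 * b * ((1 + enorm n \<eta>) ^ p0 * a ^ p0)"
          unfolding power_mult_distrib[symmetric] using sh(2) nn C2 b by (intro mult_left_mono power_mono) auto
        finally have "norm (v (\<lambda>y. ?c m y * expo n (?\<eta> m) y)) * (1 + enorm n \<eta>) ^ N \<le> C2 * b * ((1 + enorm n \<eta>) ^ p0 * a ^ p0) * (1 + enorm n \<eta>) ^ N"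
          using nn[of \<eta>] by (intro mult_right_mono) auto
        also have "\<dots> = C2 * b * a ^ p0 * (1 + enorm n \<eta>) ^ (p0 + N)" by (simp add: power_add mult_ac)
        also have "\<dots> \<le> C2 * b * a ^ p0 * (E * a ^ (p0 + N))" using g C2 b a by (intro mult_left_mono) auto
        also have "\<dots> = (C2 * E * b) * a ^ (Q - 2)"
        proof -
          have "Q - 2 = p0 + (p0 + N)" by (simp add: Q_def)
          then show ?thesis by (simp only: power_add mult_ac)
        qed
        also have "\<dots> \<le> ((C1 + C2 * E) * b) * a ^ (Q - 2)" using C1 b a by (intro mult_right_mono) auto
        finally show ?thesis .
      qed
      also have "\<dots> = C3 * B * (1 / a\<^sup>2)"
      proof -
        have "a ^ Q = a ^ (Q - 2) * a\<^sup>2" by (simp add: Q_def flip: power_add)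
        then show ?thesis using a by (simp add: b_def C3_def field_simps)
      qed
      finally show ?thesis by (simp add: a_def)
    qed
    have "norm (\<Sum>m\<in>{-int M..int M}. v (\<lambda>y. ?c m y * expo n (?\<eta> m) y)) * (1 + enorm n \<eta>) ^ N \<le> C3 * W * B" for M
    proof -
      have "norm (\<Sum>m\<in>{-int M..int M}. v (\<lambda>y. ?c m y * expo n (?\<eta> m) y)) * (1 + enorm n \<eta>) ^ N \<le>
          (\<Sum>m\<in>{-int M..int M}. norm (v (\<lambda>y. ?c m y * expo n (?\<eta> m) y))) * (1 + enorm n \<eta>) ^ N"
        using nn[of \<eta>] by (intro mult_right_mono norm_sum) auto
      also have "\<dots> \<le> (\<Sum>m\<in>{-int M..int M}. C3 * B * (1 / (1 + \<kappa> * real_of_int \<bar>m\<bar>)\<^sup>2))"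
        unfolding sum_distrib_right by (intro sum_mono bound_term)
      also have "\<dots> = C3 * B * weight_sum \<kappa> M" by (simp add: weight_sum_def sum_distrib_left)
      also have "\<dots> \<le> C3 * B * W" using C3 B W(2) by (intro mult_left_mono) auto
      finally show ?thesis by (simp add: mult_ac)
    qed
    moreover have "(\<lambda>M. norm (\<Sum>m\<in>{-int M..int M}. v (\<lambda>y. ?c m y * expo n (?\<eta> m) y)) * (1 + enorm n \<eta>) ^ N) \<longlonglongrightarrow>
        norm (v (\<lambda>y. f y * expo n \<eta> y)) * (1 + enorm n \<eta>) ^ N"
      unfolding \<kappa>_def
      by (intro tendsto_intros fourier_expansion[OF r A f vf B(1) deriv_bounded_mono[OF B(2)]]) (auto simp: p_def)
    ultimately show ?thesis by (intro LIMSEQ_le_const2) auto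
  qed
  have "W \<ge> 0" using W(2)[of 0] order_trans[of 0 "weight_sum \<kappa> 0" W] by (simp add: weight_sum_def)
  then show ?thesis using main C3 by (intro exI[of _ p] exI[of _ "C3 * W"]) auto
qed

lemma multiplier:
  assumes R: "R > 0" and \<epsilon>: "\<epsilon> > 0" and \<eta>0: "\<eta>0 \<in> euc n"
    and decay: "\<And>N. \<exists>C. \<forall>\<eta>\<in>cone n \<eta>0 \<epsilon>. norm (v (expo n \<eta>)) * (1 + enorm n \<eta>) ^ N \<le> C"
    and "r \<le> n"
  shows "conic_decay r \<eta>0 (\<epsilon> / 2 ^ r) N"
  using assms(5)
proof (induction r arbitrary: N)
  case 0
  obtain C where C: "\<And>\<eta>. \<eta> \<in> cone n \<eta>0 \<epsilon> \<Longrightarrow> norm (v (expo n \<eta>)) * (1 + enorm n \<eta>) ^ N \<le> C" using decay by blast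
  have "norm (v (\<lambda>y. f y * expo n \<eta> y)) * (1 + enorm n \<eta>) ^ N \<le> max C 0 * B"
    if f: "depends_below n 0 f" "B \<ge> 0" "deriv_bounded n 0 f B" "\<eta> \<in> cone n \<eta>0 \<epsilon>" for f B \<eta>
  proof -
    have z: "(\<lambda>i. 0) \<in> euc n" by (simp add: euc_def)
    have "v (\<lambda>y. f y * expo n \<eta> y) = v (\<lambda>y. f (\<lambda>i. 0) * expo n \<eta> y)"
      by (rule eq_on) (simp add: depends_below_0[OF f(1)])
    also have "\<dots> = f (\<lambda>i. 0) * v (expo n \<eta>)" by (rule cmult[OF smooth_expo[OF openin_euc]])
    finally have "norm (v (\<lambda>y. f y * expo n \<eta> y)) * (1 + enorm n \<eta>) ^ N = norm (f (\<lambda>i. 0)) * (norm (v (expo n \<eta>)) * (1 + enorm n \<eta>) ^ N)"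
      by (simp add: norm_mult)
    also have "\<dots> \<le> B * max C 0"
      using C[OF f(4)] deriv_boundedD[OF f(3), of "[]" "\<lambda>i. 0"] z f(2) L2_set_nonneg[of \<eta> "{..<n}"] by (intro mult_mono) auto
    finally show ?thesis by (simp add: mult.commute)
  qed
  then show ?case by (intro exI[of _ 0] exI[of _ "max C 0"]) auto
next
  case (Suc r)
  have "r < n" "\<epsilon> / 2 ^ r > 0" using Suc.prems \<epsilon> by auto
  from multiplier_step[OF this(1) R this(2) \<eta>0, of N] Suc.IH Suc.prems show ?case by (simp add: mult.commute)
qed

end

section \<open>Wave front sets\<close>

lemma local_fourier_expo: "local_fourier N c u \<rho> \<eta> = u (\<lambda>x. \<rho> x * expo (mdim N) \<eta> (snd c x))"
  by (simp add: local_fourier_def expo_def)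

lemma regular_directionI:
  assumes "openin (Euclidean_space n) \<Gamma>" "\<eta>0 \<in> \<Gamma>" "\<And>\<eta> t. \<eta> \<in> \<Gamma> \<Longrightarrow> t > 0 \<Longrightarrow> (\<lambda>i. t * \<eta> i) \<in> \<Gamma>"
    "\<And>m::nat. \<exists>C. \<forall>\<eta>\<in>\<Gamma>. norm (w \<eta>) * (1 + enorm n \<eta>) ^ m \<le> C"
  shows "regular_direction n w \<eta>0"
  using assms unfolding regular_direction_def by blast

lemma compact_coord_bounded:
  fixes K :: "(nat \<Rightarrow> real) set"
  assumes "compact K"
  obtains R where "R > 0" "\<And>y i. y \<in> K \<Longrightarrow> i < n \<Longrightarrow> \<bar>y i\<bar> \<le> R"
proof -
  have "\<exists>b. \<forall>y\<in>K. \<bar>y i\<bar> \<le> b" for i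
  proof -
    have "compact ((\<lambda>y. y i) ` K)"
      by (rule compact_continuous_image[OF _ assms]) (rule continuous_on_subset[OF continuous_on_product_coordinates], simp)
    then have "bounded ((\<lambda>y. y i) ` K)" by (rule compact_imp_bounded)
    then show ?thesis by (auto simp: bounded_iff)
  qed
  then obtain b where b: "\<And>i y. y \<in> K \<Longrightarrow> \<bar>y i\<bar> \<le> b i" by metis
  show ?thesis
  proof (rule that[of "Max (insert 1 (b ` {..<n}))"])
    show "Max (insert 1 (b ` {..<n})) > 0" by (rule less_le_trans[OF zero_less_one Max_ge]) auto
    fix y i assume "y \<in> K" "i < n"
    then have "b i \<le> Max (insert 1 (b ` {..<n}))" by (intro Max_ge) auto
    then show "\<bar>y i\<bar> \<le> Max (insert 1 (b ` {..<n}))" using b[OF \<open>y \<in> K\<close>, of i] by linarith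
  qed
qed

context
  fixes N :: "('a, 'z) manifold_scheme"
  assumes N: "charted N"
begin

text \<open>Since \<rho> vanishes off its support, the form depends only on values of f on the image
  of the support, which lies in \<open>euc\<close> and in the box; this gives \<open>eq_on\<close>
  and the bound from derivatives on the box.\<close>

lemma cutoff_box_distribution:
  assumes c: "c \<in> atlas N" and \<rho>: "cutoff N c \<rho>" and u: "compact_distribution N u"
    and R: "\<And>y i. y \<in> snd c ` fun_support N \<rho> \<Longrightarrow> i < mdim N \<Longrightarrow> \<bar>y i\<bar> \<le> R"
  obtains p C where "box_distribution (mdim N) R (\<lambda>f. u (\<lambda>x. \<rho> x * f (snd c x))) p C"
proof -
  let ?n = "mdim N"
  obtain p C where C: "C \<ge> 0" and bd: "\<And>f B. smooth_on_Rn ?n (euc ?n) f \<Longrightarrow> B \<ge> 0 \<Longrightarrow>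
    (\<And>l y. set l \<subseteq> {..<?n} \<Longrightarrow> length l \<le> p \<Longrightarrow> y \<in> snd c ` fun_support N \<rho> \<Longrightarrow> norm (iter_partial l f y) \<le> B) \<Longrightarrow>
    norm (u (\<lambda>x. \<rho> x * f (snd c x))) \<le> C * B"
    by (rule cutoff_distribution_bound[OF N c \<rho> u]) blast
  have sm: "(\<lambda>x. \<rho> x * f (snd c x)) \<in> smooth_functions N" if "smooth_on_Rn ?n (euc ?n) f" for f
    by (rule cutoff_times_smooth[OF N c \<rho> openin_euc chart_image_subset[OF N c] that])
  have sub: "snd c ` fun_support N \<rho> \<subseteq> euc ?n"
    using \<rho> chart_image_subset[OF N c] by (auto simp: cutoff_def chart_image_def)
  have "box_distribution ?n R (\<lambda>f. u (\<lambda>x. \<rho> x * f (snd c x))) p C"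
  proof
    fix f g :: "(nat \<Rightarrow> real) \<Rightarrow> complex"
    assume f: "smooth_on_Rn ?n (euc ?n) f"
    show "u (\<lambda>x. \<rho> x * (a * f (snd c x))) = a * u (\<lambda>x. \<rho> x * f (snd c x))" for a
      using compact_distribution_cmult[OF u sm[OF f], of a] by (simp add: mult.left_commute)
    assume g: "smooth_on_Rn ?n (euc ?n) g"
    show "u (\<lambda>x. \<rho> x * (f (snd c x) + g (snd c x))) = u (\<lambda>x. \<rho> x * f (snd c x)) + u (\<lambda>x. \<rho> x * g (snd c x))"
      using compact_distribution_add[OF u sm[OF f] sm[OF g]] by (simp add: distrib_left)
  next
    fix f g :: "(nat \<Rightarrow> real) \<Rightarrow> complex"
    assume eq: "\<And>y. y \<in> euc ?n \<Longrightarrow> f y = g y"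
    have "\<rho> x * f (snd c x) = \<rho> x * g (snd c x)" for x
    proof (cases "\<rho> x = 0")
      case False
      then have "x \<in> fun_support N \<rho>"
        using \<rho> smooth_functions_zero[of \<rho> N x] fun_support_outside[of x N \<rho>] by (auto simp: cutoff_def)
      then show ?thesis using eq sub by auto
    qed simp
    then show "u (\<lambda>x. \<rho> x * f (snd c x)) = u (\<lambda>x. \<rho> x * g (snd c x))" by (simp only:)
  next
    fix f :: "(nat \<Rightarrow> real) \<Rightarrow> complex" and B
    assume "smooth_on_Rn ?n (euc ?n) f" "0 \<le> B"
      and b: "\<And>l y. set l \<subseteq> {..<?n} \<Longrightarrow> length l \<le> p \<Longrightarrow> y \<in> euc ?n \<Longrightarrow> (\<And>i. i < ?n \<Longrightarrow> \<bar>y i\<bar> \<le> R) \<Longrightarrow> norm (iter_partial l f y) \<le> B"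
    then show "norm (u (\<lambda>x. \<rho> x * f (snd c x))) \<le> C * B"
      by (intro bd b) (use sub R in auto)
  qed (rule C)
  then show ?thesis by (rule that)
qed

text \<open>The image of the support is compact, hence closed, so its complement in
  \<open>euc\<close> is open and covers \<open>euc\<close> together with the chart image; on it the
  function is 0. Compactness bounds each derivative, and there are finitely many lists of length at
  most p.\<close>

lemma cutoff_extension:
  assumes c: "c \<in> atlas N" and \<rho>: "cutoff N c \<rho>"
  defines "f \<equiv> \<lambda>y. if y \<in> chart_image c then \<rho> (chart_inv c y) else 0"
  shows "smooth_on_Rn (mdim N) (euc (mdim N)) f"
    and "\<And>p. \<exists>B\<ge>0. deriv_bounded (mdim N) p f B"
    and "\<And>y. y \<in> euc (mdim N) \<Longrightarrow> y \<notin> snd c ` fun_support N \<rho> \<Longrightarrow> f y = 0"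
proof -
  let ?n = "mdim N" and ?K = "snd c ` fun_support N \<rho>"
  have K: "compact ?K" "?K \<subseteq> chart_image c"
    using \<rho> chart_compact_image[OF N c] by (auto simp: cutoff_def chart_image_def)
  define Z where "Z = euc ?n - ?K"
  have "closed ?K" using K(1) by (rule compact_imp_closed)
  then have Z: "openin (Euclidean_space ?n) Z"
    unfolding Z_def Euclidean_space_eq openin_open by (intro exI[of _ "- ?K"]) auto
  have 0: "f y = 0" if "y \<in> Z" for y
  proof (cases "y \<in> chart_image c")
    case True
    then obtain x where x: "x \<in> fst c" "y = snd c x" by (auto simp: chart_image_def)
    then have "x \<notin> fun_support N \<rho>" using that by (auto simp: Z_def)
    then show ?thesis using x chart_subset[OF N c] by (auto simp: f_def chart_inv_snd[OF N c] fun_support_outside)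
  qed (simp add: f_def)
  then show "f y = 0" if "y \<in> euc ?n" "y \<notin> ?K" for y using that by (simp add: Z_def)
  have "smooth_on_Rn ?n (chart_image c) f"
    by (rule smooth_cong[OF chart_image_open[OF N c] _ smooth_functions_chart[OF _ c, of \<rho>]]) (use \<rho> in \<open>auto simp: f_def cutoff_def\<close>)
  from smooth_extend_zero[OF chart_image_open[OF N c] Z this 0]
  have "smooth_on_Rn ?n (chart_image c \<union> Z) f" by simp
  moreover have "chart_image c \<union> Z = euc ?n" using K(2) chart_image_subset[OF N c] by (auto simp: Z_def)
  ultimately show f: "smooth_on_Rn ?n (euc ?n) f" by simp
  fix p
  have "\<exists>B. \<forall>y\<in>euc ?n. norm (iter_partial l f y) \<le> B" if l: "set l \<subseteq> {..<?n}" for l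
  proof -
    have "continuous_on ?K (iter_partial l f)"
      by (rule continuous_on_subset[OF smooth_continuous[OF openin_euc smooth_iter[OF f l]]])
        (use K(2) chart_image_subset[OF N c] in auto)
    then have "bounded (iter_partial l f ` ?K)"
      using K(1) compact_continuous_image compact_imp_bounded by blast
    then obtain B where B: "\<And>y. y \<in> ?K \<Longrightarrow> norm (iter_partial l f y) \<le> B" by (auto simp: bounded_iff)
    have "norm (iter_partial l f y) \<le> max B 0" if "y \<in> euc ?n" for y
    proof (cases "y \<in> ?K")
      case False
      then show ?thesis using iter_partial_zero[OF Z _ l, of f y] 0 that by (simp add: Z_def)
    qed (use B in \<open>auto simp: le_max_iff_disj\<close>)
    then show ?thesis by blast
  qed
  then obtain B where B: "\<And>l y. set l \<subseteq> {..<?n} \<Longrightarrow> y \<in> euc ?n \<Longrightarrow> norm (iter_partial l f y) \<le> B l" by metis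
  define L where "L = {l. set l \<subseteq> {..<?n} \<and> length l \<le> p}"
  have fin: "finite L" unfolding L_def by (rule finite_lists_length_le) simp
  have "deriv_bounded ?n p f (\<Sum>l\<in>L. \<bar>B l\<bar>)"
    unfolding deriv_bounded_def
  proof (intro allI impI)
    fix l y assume *: "set l \<subseteq> {..<?n}" "length l \<le> p" "y \<in> euc ?n"
    then have "\<bar>B l\<bar> \<le> (\<Sum>l\<in>L. \<bar>B l\<bar>)" by (intro member_le_sum fin) (auto simp: L_def)
    then show "norm (iter_partial l f y) \<le> (\<Sum>l\<in>L. \<bar>B l\<bar>)" using B[OF *(1,3)] by linarith
  qed
  then show "\<exists>B\<ge>0. deriv_bounded ?n p f B" by (intro exI[of _ "\<Sum>l\<in>L. \<bar>B l\<bar>"]) (simp add: sum_nonneg)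
qed

text \<open>In the chart the second cutoff is a multiplier for the form v f = u (\<rho> f), and one
  box contains both supports. Refining a cutoff therefore loses no regular direction, so two
  distributions that are regular with different cutoffs are both regular with the product.\<close>

theorem regular_direction_cutoff_mult:
  assumes c: "c \<in> atlas N" and \<rho>: "cutoff N c \<rho>" and \<rho>': "cutoff N c \<rho>'" and u: "compact_distribution N u"
    and reg: "regular_direction (mdim N) (local_fourier N c u \<rho>) \<eta>0"
  shows "regular_direction (mdim N) (local_fourier N c u (\<lambda>x. \<rho> x * \<rho>' x)) \<eta>0"
proof -
  let ?n = "mdim N"
  let ?K = "\<lambda>\<rho>. snd c ` fun_support N \<rho>"
  have "compact (?K \<rho> \<union> ?K \<rho>')"
    using \<rho> \<rho>' chart_compact_image[OF N c] by (auto simp: cutoff_def)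
  then obtain R where R: "R > 0" "\<And>y i. y \<in> ?K \<rho> \<union> ?K \<rho>' \<Longrightarrow> i < ?n \<Longrightarrow> \<bar>y i\<bar> \<le> R"
    by (rule compact_coord_bounded) blast
  define v where "v f = u (\<lambda>x. \<rho> x * f (snd c x))" for f
  obtain p0 C0 where "box_distribution ?n R (\<lambda>f. u (\<lambda>x. \<rho> x * f (snd c x))) p0 C0"
    by (rule cutoff_box_distribution[OF c \<rho> u, of R]) (use R in auto)
  then interpret box_distribution ?n R v p0 C0 by (simp add: v_def[abs_def])
  define f where "f y = (if y \<in> chart_image c then \<rho>' (chart_inv c y) else 0)" for y
  note f = cutoff_extension[OF c \<rho>', folded f_def]
  obtain \<Gamma> where \<Gamma>: "openin (Euclidean_space ?n) \<Gamma>" "\<eta>0 \<in> \<Gamma>" "\<And>\<eta> t. \<eta> \<in> \<Gamma> \<Longrightarrow> t > 0 \<Longrightarrow> (\<lambda>i. t * \<eta> i) \<in> \<Gamma>"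
    and dec: "\<And>m::nat. \<exists>C. \<forall>\<eta>\<in>\<Gamma>. norm (local_fourier N c u \<rho> \<eta>) * (1 + enorm ?n \<eta>) ^ m \<le> C"
    using reg unfolding regular_direction_def by blast
  have \<eta>0: "\<eta>0 \<in> euc ?n" using open_euc_subset[OF \<Gamma>(1)] \<Gamma>(2) by auto
  obtain \<epsilon> where \<epsilon>: "\<epsilon> > 0" "cone ?n \<eta>0 \<epsilon> \<subseteq> \<Gamma>" using cone_subset[OF \<Gamma>] by blast
  have decay: "\<exists>C. \<forall>\<eta>\<in>cone ?n \<eta>0 \<epsilon>. norm (v (expo ?n \<eta>)) * (1 + enorm ?n \<eta>) ^ m \<le> C" for m
    using dec[of m] \<epsilon>(2) by (auto simp: local_fourier_expo v_def)
  have eq: "local_fourier N c u (\<lambda>x. \<rho> x * \<rho>' x) \<eta> = v (\<lambda>y. f y * expo ?n \<eta> y)" for \<eta>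
  proof -
    have "\<rho> x * \<rho>' x = \<rho> x * f (snd c x)" for x
    proof (cases "\<rho> x = 0")
      case False
      then have "x \<in> fst c"
        using \<rho> smooth_functions_zero[of \<rho> N x] fun_support_outside[of x N \<rho>] by (auto simp: cutoff_def)
      then show ?thesis by (simp add: f_def snd_chart_image[OF N c] chart_inv_snd[OF N c])
    qed simp
    then have "local_fourier N c u (\<lambda>x. \<rho> x * \<rho>' x) \<eta> = u (\<lambda>x. \<rho> x * f (snd c x) * expo ?n \<eta> (snd c x))"
      by (simp only: local_fourier_expo)
    then show ?thesis by (simp only: v_def mult.assoc)
  qed
  have vf: "vanishing ?n i R f" if "i < ?n" for i
    unfolding vanishing_def using f(3) R(2) that by (metis Un_iff not_le)
  have dep: "depends_below ?n ?n f" by (simp add: depends_below_def)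
  show ?thesis
  proof (rule regular_directionI[OF cone_open cone_self[OF \<eta>0] cone_scale])
    show "0 < \<epsilon> / 2 ^ ?n" using \<epsilon> by simp
    fix m :: nat
    obtain p C where "C \<ge> 0" and C: "\<And>f B \<eta>. smooth_on_Rn ?n (euc ?n) f \<Longrightarrow> (\<forall>i<?n. vanishing ?n i R f) \<Longrightarrow> depends_below ?n ?n f \<Longrightarrow>
      B \<ge> 0 \<Longrightarrow> deriv_bounded ?n p f B \<Longrightarrow> \<eta> \<in> cone ?n \<eta>0 (\<epsilon> / 2 ^ ?n) \<Longrightarrow> norm (v (\<lambda>y. f y * expo ?n \<eta> y)) * (1 + enorm ?n \<eta>) ^ m \<le> C * B"
      using multiplier[OF R(1) \<epsilon>(1) \<eta>0 decay order_refl, of m] by blast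
    obtain B where "B \<ge> 0" "deriv_bounded ?n p f B" using f(2) by blast
    then show "\<exists>C. \<forall>\<eta>\<in>cone ?n \<eta>0 (\<epsilon> / 2 ^ ?n). norm (local_fourier N c u (\<lambda>x. \<rho> x * \<rho>' x) \<eta>) * (1 + enorm ?n \<eta>) ^ m \<le> C"
      using C[OF f(1) _ dep] vf unfolding eq by blast
  qed
qed

text \<open>Since the wave front set collects the bad directions of all charts, regularity is to be
  shown in an arbitrary chart around the point. In return, \<open>not_wavefrontD\<close> supplies a
  cutoff in whichever chart is at hand.\<close>

lemma wavefront_subsetI:
  assumes "\<And>x \<xi> c. x \<in> topspace (mtop N) \<Longrightarrow> \<xi> \<in> cotangent_space N x \<Longrightarrow> \<xi> \<noteq> (\<lambda>_. 0) \<Longrightarrow> (x, \<xi>) \<notin> S \<Longrightarrow>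
    c \<in> atlas N \<Longrightarrow> x \<in> fst c \<Longrightarrow>
    \<exists>\<rho>. cutoff N c \<rho> \<and> \<rho> x \<noteq> 0 \<and> regular_direction (mdim N) (local_fourier N c u \<rho>) (cotangent_coords N c x \<xi>)"
  shows "wavefront_set N u \<subseteq> S"
proof
  fix p assume p: "p \<in> wavefront_set N u"
  obtain x \<xi> where x\<xi>: "p = (x, \<xi>)" by (cases p)
  obtain c where c: "x \<in> topspace (mtop N)" "\<xi> \<in> cotangent_space N x" "\<xi> \<noteq> (\<lambda>_. 0)" "c \<in> atlas N" "x \<in> fst c"
    and nr: "\<And>\<rho>. cutoff N c \<rho> \<Longrightarrow> \<rho> x \<noteq> 0 \<Longrightarrow> \<not> regular_direction (mdim N) (local_fourier N c u \<rho>) (cotangent_coords N c x \<xi>)"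
    using p unfolding x\<xi> wavefront_set_def charts_at_def cutoff_def by blast
  show "p \<in> S"
  proof (rule ccontr)
    assume "p \<notin> S"
    with assms[OF c(1-3) _ c(4,5)] nr show False unfolding x\<xi> by blast
  qed
qed

lemma not_wavefrontD:
  assumes "(x, \<xi>) \<notin> wavefront_set N u" "x \<in> topspace (mtop N)" "\<xi> \<in> cotangent_space N x" "\<xi> \<noteq> (\<lambda>_. 0)"
    "c \<in> atlas N" "x \<in> fst c"
  obtains \<rho> where "cutoff N c \<rho>" "\<rho> x \<noteq> 0" "regular_direction (mdim N) (local_fourier N c u \<rho>) (cotangent_coords N c x \<xi>)"
  using assms unfolding wavefront_set_def charts_at_def cutoff_def by blast

section \<open>Wave front sets of sums, multiples and conjugates\<close>

lemma compact_distribution_sum2: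
  assumes "compact_distribution N u" "compact_distribution N v"
  shows "compact_distribution N (\<lambda>f. u f + v f)"
  using assms unfolding compact_distribution_def
  by (auto intro: continuous_map_add simp: algebra_simps)

lemma compact_distribution_scale:
  assumes "compact_distribution N u"
  shows "compact_distribution N (\<lambda>f. a * u f)"
  using assms unfolding compact_distribution_def
  by (auto simp: algebra_simps continuous_map_atin intro!: tendsto_mult tendsto_const)

lemma cnj_smooth: "f \<in> smooth_functions N \<Longrightarrow> (\<lambda>x. cnj (f x)) \<in> smooth_functions N"
  by (rule smooth_functions_bounded_linear[OF N bounded_linear_cnj])

lemma compact_distribution_cnj:
  assumes u: "compact_distribution N u"
  shows "compact_distribution N (\<lambda>f. cnj (u (\<lambda>x. cnj (f x))))"
proof -
  obtain S C where S: "finite S" "S \<subseteq> tests N" "C \<ge> 0"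
    "\<And>f B. f \<in> smooth_functions N \<Longrightarrow> (\<And>\<tau>. \<tau> \<in> S \<Longrightarrow> test_le \<tau> f B) \<Longrightarrow> B \<ge> 0 \<Longrightarrow> norm (u f) \<le> C * B"
    by (rule compact_distribution_bound[OF N u]) blast
  show ?thesis
  proof (rule compact_distributionI[OF N _ _ S(1-3)])
    fix f h :: "'a \<Rightarrow> complex" assume f: "f \<in> smooth_functions N"
    show "cnj (u (\<lambda>x. cnj (a * f x))) = a * cnj (u (\<lambda>x. cnj (f x)))" for a
      using compact_distribution_cmult[OF u cnj_smooth[OF f], of "cnj a"] by simp
    show "norm (cnj (u (\<lambda>x. cnj (f x)))) \<le> C * B" if "\<And>\<tau>. \<tau> \<in> S \<Longrightarrow> test_le \<tau> f B" "B \<ge> 0" for B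
    proof -
      have "norm (u (\<lambda>x. cnj (f x))) \<le> C * B"
      proof (rule S(4)[OF cnj_smooth[OF f] _ that(2)])
        fix \<tau> assume \<tau>: "\<tau> \<in> S"
        have "test_le \<tau> (\<lambda>x. cnj (f x)) (1 * B)"
          by (rule test_le_bounded_linear[OF N _ f bounded_linear_cnj _ _ that(1)[OF \<tau>]]) (use \<tau> S(2) in auto)
        then show "test_le \<tau> (\<lambda>x. cnj (f x)) B" by simp
      qed
      then show ?thesis by simp
    qed
    assume h: "h \<in> smooth_functions N"
    show "cnj (u (\<lambda>x. cnj (f x + h x))) = cnj (u (\<lambda>x. cnj (f x))) + cnj (u (\<lambda>x. cnj (h x)))"
      using compact_distribution_add[OF u cnj_smooth[OF f] cnj_smooth[OF h]] by simp
  qed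
qed

lemma regular_direction_add:
  assumes "regular_direction n w \<eta>0" "regular_direction n w' \<eta>0"
  shows "regular_direction n (\<lambda>\<eta>. w \<eta> + w' \<eta>) \<eta>0"
proof -
  obtain \<Gamma> where \<Gamma>: "openin (Euclidean_space n) \<Gamma>" "\<eta>0 \<in> \<Gamma>" "\<And>\<eta> t. \<eta> \<in> \<Gamma> \<Longrightarrow> t > 0 \<Longrightarrow> (\<lambda>i. t * \<eta> i) \<in> \<Gamma>"
    and d: "\<And>m::nat. \<exists>C. \<forall>\<eta>\<in>\<Gamma>. norm (w \<eta>) * (1 + enorm n \<eta>) ^ m \<le> C"
    using assms(1) unfolding regular_direction_def by blast
  obtain \<Gamma>' where \<Gamma>': "openin (Euclidean_space n) \<Gamma>'" "\<eta>0 \<in> \<Gamma>'" "\<And>\<eta> t. \<eta> \<in> \<Gamma>' \<Longrightarrow> t > 0 \<Longrightarrow> (\<lambda>i. t * \<eta> i) \<in> \<Gamma>'"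
    and d': "\<And>m::nat. \<exists>C. \<forall>\<eta>\<in>\<Gamma>'. norm (w' \<eta>) * (1 + enorm n \<eta>) ^ m \<le> C"
    using assms(2) unfolding regular_direction_def by blast
  show ?thesis
  proof (rule regular_directionI[of n "\<Gamma> \<inter> \<Gamma>'"])
    fix m :: nat
    obtain C C' where C: "\<And>\<eta>. \<eta> \<in> \<Gamma> \<Longrightarrow> norm (w \<eta>) * (1 + enorm n \<eta>) ^ m \<le> C" "\<And>\<eta>. \<eta> \<in> \<Gamma>' \<Longrightarrow> norm (w' \<eta>) * (1 + enorm n \<eta>) ^ m \<le> C'"
      using d[of m] d'[of m] by blast
    have "norm (w \<eta> + w' \<eta>) * (1 + enorm n \<eta>) ^ m \<le> C + C'" if "\<eta> \<in> \<Gamma> \<inter> \<Gamma>'" for \<eta>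
    proof -
      have "norm (w \<eta> + w' \<eta>) * (1 + enorm n \<eta>) ^ m \<le> (norm (w \<eta>) + norm (w' \<eta>)) * (1 + enorm n \<eta>) ^ m"
        using L2_set_nonneg[of \<eta> "{..<n}"] by (intro mult_right_mono norm_triangle_ineq) auto
      then show ?thesis using C(1)[of \<eta>] C(2)[of \<eta>] that by (simp add: distrib_right)
    qed
    then show "\<exists>C. \<forall>\<eta>\<in>\<Gamma> \<inter> \<Gamma>'. norm (w \<eta> + w' \<eta>) * (1 + enorm n \<eta>) ^ m \<le> C" by blast
  qed (use \<Gamma> \<Gamma>' in auto)
qed

lemma regular_direction_scale:
  assumes "regular_direction n w \<eta>0"
  shows "regular_direction n (\<lambda>\<eta>. a * w \<eta>) \<eta>0"
proof -
  obtain \<Gamma> where \<Gamma>: "openin (Euclidean_space n) \<Gamma>" "\<eta>0 \<in> \<Gamma>" "\<And>\<eta> t. \<eta> \<in> \<Gamma> \<Longrightarrow> t > 0 \<Longrightarrow> (\<lambda>i. t * \<eta> i) \<in> \<Gamma>"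
    and d: "\<And>m::nat. \<exists>C. \<forall>\<eta>\<in>\<Gamma>. norm (w \<eta>) * (1 + enorm n \<eta>) ^ m \<le> C"
    using assms(1) unfolding regular_direction_def by blast
  show ?thesis
  proof (rule regular_directionI[OF \<Gamma>])
    fix m :: nat
    obtain C where C: "\<And>\<eta>. \<eta> \<in> \<Gamma> \<Longrightarrow> norm (w \<eta>) * (1 + enorm n \<eta>) ^ m \<le> C" using d by blast
    have "norm (a * w \<eta>) * (1 + enorm n \<eta>) ^ m \<le> norm a * C" if "\<eta> \<in> \<Gamma>" for \<eta>
      using mult_left_mono[OF C[OF that], of "norm a"] by (simp add: norm_mult mult.assoc)
    then show "\<exists>C. \<forall>\<eta>\<in>\<Gamma>. norm (a * w \<eta>) * (1 + enorm n \<eta>) ^ m \<le> C" by blast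
  qed
qed

lemma regular_direction_cnj_reflect:
  assumes "regular_direction n w (\<lambda>i. - \<eta>0 i)"
  shows "regular_direction n (\<lambda>\<eta>. cnj (w (\<lambda>i. - \<eta> i))) \<eta>0"
proof -
  obtain \<Gamma> where \<Gamma>: "openin (Euclidean_space n) \<Gamma>" "(\<lambda>i. - \<eta>0 i) \<in> \<Gamma>" "\<And>\<eta> t. \<eta> \<in> \<Gamma> \<Longrightarrow> t > 0 \<Longrightarrow> (\<lambda>i. t * \<eta> i) \<in> \<Gamma>"
    and d: "\<And>m::nat. \<exists>C. \<forall>\<eta>\<in>\<Gamma>. norm (w \<eta>) * (1 + enorm n \<eta>) ^ m \<le> C"
    using assms(1) unfolding regular_direction_def by blast
  let ?\<Gamma> = "{\<eta>. (\<lambda>i. - \<eta> i) \<in> \<Gamma>}"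
  show ?thesis
  proof (rule regular_directionI[of n ?\<Gamma>])
    show "openin (Euclidean_space n) ?\<Gamma>"
    proof (rule openin_Euclidean_boxI)
      show "?\<Gamma> \<subseteq> euc n" using open_euc_subset[OF \<Gamma>(1)] by (force simp: euc_def)
      fix y assume "y \<in> ?\<Gamma>"
      then obtain \<delta> where \<delta>: "\<delta> > 0" "\<And>z. z \<in> euc n \<Longrightarrow> (\<And>i. i < n \<Longrightarrow> \<bar>z i - - y i\<bar> < \<delta>) \<Longrightarrow> z \<in> \<Gamma>"
        using openin_euc_box[OF \<Gamma>(1)] by blast
      have "z \<in> ?\<Gamma>" if "z \<in> euc n" "\<forall>i<n. \<bar>z i - y i\<bar> < \<delta>" for z
        using that \<delta>(2)[of "\<lambda>i. - z i"] by (auto simp: euc_def abs_minus_commute)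
      then show "\<exists>\<delta>>0. \<forall>z\<in>euc n. (\<forall>i<n. \<bar>z i - y i\<bar> < \<delta>) \<longrightarrow> z \<in> ?\<Gamma>" using \<delta>(1) by blast
    qed
    show "(\<lambda>i. t * \<eta> i) \<in> ?\<Gamma>" if "\<eta> \<in> ?\<Gamma>" "t > 0" for \<eta> t using \<Gamma>(3) that by fastforce
    fix m :: nat
    obtain C where C: "\<And>\<eta>. \<eta> \<in> \<Gamma> \<Longrightarrow> norm (w \<eta>) * (1 + enorm n \<eta>) ^ m \<le> C" using d by blast
    have "norm (cnj (w (\<lambda>i. - \<eta> i))) * (1 + enorm n \<eta>) ^ m \<le> C" if "\<eta> \<in> ?\<Gamma>" for \<eta>
      using C[of "\<lambda>i. - \<eta> i"] that by (simp add: L2_set_def)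
    then show "\<exists>C. \<forall>\<eta>\<in>?\<Gamma>. norm (cnj (w (\<lambda>i. - \<eta> i))) * (1 + enorm n \<eta>) ^ m \<le> C" by blast
  qed (use \<Gamma>(2) in simp)
qed

lemma wavefront_add:
  assumes u: "compact_distribution N u" "wavefront_set N u \<subseteq> S" and v: "compact_distribution N v" "wavefront_set N v \<subseteq> S"
  shows "wavefront_set N (\<lambda>f. u f + v f) \<subseteq> S"
proof (rule wavefront_subsetI)
  fix x \<xi> c
  assume *: "x \<in> topspace (mtop N)" "\<xi> \<in> cotangent_space N x" "\<xi> \<noteq> (\<lambda>_. 0)" and nS: "(x, \<xi>) \<notin> S" and c: "c \<in> atlas N" "x \<in> fst c"
  let ?\<eta> = "cotangent_coords N c x \<xi>"
  obtain \<rho> where \<rho>: "cutoff N c \<rho>" "\<rho> x \<noteq> 0" "regular_direction (mdim N) (local_fourier N c u \<rho>) ?\<eta>"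
    using not_wavefrontD[OF _ * c, of u] nS u(2) by blast
  obtain \<rho>' where \<rho>': "cutoff N c \<rho>'" "\<rho>' x \<noteq> 0" "regular_direction (mdim N) (local_fourier N c v \<rho>') ?\<eta>"
    using not_wavefrontD[OF _ * c, of v] nS v(2) by blast
  have "regular_direction (mdim N) (local_fourier N c u (\<lambda>x. \<rho> x * \<rho>' x)) ?\<eta>"
    by (rule regular_direction_cutoff_mult[OF c(1) \<rho>(1) \<rho>'(1) u(1) \<rho>(3)])
  moreover have "regular_direction (mdim N) (local_fourier N c v (\<lambda>x. \<rho> x * \<rho>' x)) ?\<eta>"
    using regular_direction_cutoff_mult[OF c(1) \<rho>'(1) \<rho>(1) v(1) \<rho>'(3)] by (simp add: mult.commute)
  ultimately have "regular_direction (mdim N) (\<lambda>\<eta>. local_fourier N c u (\<lambda>x. \<rho> x * \<rho>' x) \<eta> + local_fourier N c v (\<lambda>x. \<rho> x * \<rho>' x) \<eta>) ?\<eta>"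
    by (rule regular_direction_add)
  moreover have "cutoff N c (\<lambda>x. \<rho> x * \<rho>' x)" by (rule cutoff_mult[OF N \<rho>(1)]) (use \<rho>'(1) in \<open>simp add: cutoff_def\<close>)
  ultimately show "\<exists>\<rho>. cutoff N c \<rho> \<and> \<rho> x \<noteq> 0 \<and> regular_direction (mdim N) (local_fourier N c (\<lambda>f. u f + v f) \<rho>) ?\<eta>"
    using \<rho>(2) \<rho>'(2) by (intro exI[of _ "\<lambda>x. \<rho> x * \<rho>' x"]) (simp add: local_fourier_def[abs_def])
qed

lemma wavefront_scale:
  assumes "wavefront_set N u \<subseteq> S"
  shows "wavefront_set N (\<lambda>f. a * u f) \<subseteq> S"
proof (rule wavefront_subsetI)
  fix x \<xi> c
  assume *: "x \<in> topspace (mtop N)" "\<xi> \<in> cotangent_space N x" "\<xi> \<noteq> (\<lambda>_. 0)" and nS: "(x, \<xi>) \<notin> S" and c: "c \<in> atlas N" "x \<in> fst c"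
  obtain \<rho> where \<rho>: "cutoff N c \<rho>" "\<rho> x \<noteq> 0" "regular_direction (mdim N) (local_fourier N c u \<rho>) (cotangent_coords N c x \<xi>)"
    using not_wavefrontD[OF _ * c, of u] nS assms by blast
  then show "\<exists>\<rho>. cutoff N c \<rho> \<and> \<rho> x \<noteq> 0 \<and> regular_direction (mdim N) (local_fourier N c (\<lambda>f. a * u f) \<rho>) (cotangent_coords N c x \<xi>)"
    using regular_direction_scale[OF \<rho>(3), of a] by (intro exI[of _ \<rho>]) (simp add: local_fourier_def[abs_def])
qed

text \<open>With the conjugated cutoff, the transform of the conjugate distribution at \<eta> is the
  conjugate of the transform of u at the negative of \<eta>. Regularity of u at the negative
  covector is what is needed, and the symmetry of S provides it.\<close>

lemma wavefront_cnj:
  assumes "wavefront_set N u \<subseteq> S" and sym: "\<And>x \<xi>. \<xi> \<in> cotangent_space N x \<Longrightarrow> (x, \<lambda>v. - \<xi> v) \<in> S \<Longrightarrow> (x, \<xi>) \<in> S"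
  shows "wavefront_set N (\<lambda>f. cnj (u (\<lambda>x. cnj (f x)))) \<subseteq> S"
proof (rule wavefront_subsetI)
  fix x \<xi> c
  assume *: "x \<in> topspace (mtop N)" "\<xi> \<in> cotangent_space N x" "\<xi> \<noteq> (\<lambda>_. 0)" and nS: "(x, \<xi>) \<notin> S" and c: "c \<in> atlas N" "x \<in> fst c"
  have "(x, \<lambda>v. - \<xi> v) \<notin> wavefront_set N u" using sym[OF *(2)] nS assms(1) by blast
  moreover have "(\<lambda>v. - \<xi> v) \<in> cotangent_space N x" using *(2) by (auto simp: cotangent_space_def linear_form_on_def)
  moreover have "(\<lambda>v. - \<xi> v) \<noteq> (\<lambda>_. 0)" using *(3) by (auto simp: fun_eq_iff)
  ultimately obtain \<rho> where \<rho>: "cutoff N c \<rho>" "\<rho> x \<noteq> 0" "regular_direction (mdim N) (local_fourier N c u \<rho>) (cotangent_coords N c x (\<lambda>v. - \<xi> v))"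
    using not_wavefrontD[OF _ *(1) _ _ c, of "\<lambda>v. - \<xi> v" u] by blast
  have "cotangent_coords N c x (\<lambda>v. - \<xi> v) = (\<lambda>i. - cotangent_coords N c x \<xi> i)"
    by (auto simp: cotangent_coords_def)
  with \<rho>(3) have "regular_direction (mdim N) (\<lambda>\<eta>. cnj (local_fourier N c u \<rho> (\<lambda>i. - \<eta> i))) (cotangent_coords N c x \<xi>)"
    by (intro regular_direction_cnj_reflect) simp
  moreover have "(\<lambda>\<eta>. cnj (local_fourier N c u \<rho> (\<lambda>i. - \<eta> i))) = local_fourier N c (\<lambda>f. cnj (u (\<lambda>x. cnj (f x)))) (\<lambda>x. cnj (\<rho> x))"
    by (auto simp: local_fourier_def cis_cnj sum_negf)
  moreover have "cutoff N c (\<lambda>x. cnj (\<rho> x))"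
    using \<rho>(1) cnj_smooth by (auto simp: cutoff_def fun_support_def)
  ultimately show "\<exists>\<rho>. cutoff N c \<rho> \<and> \<rho> x \<noteq> 0 \<and> regular_direction (mdim N) (local_fourier N c (\<lambda>f. cnj (u (\<lambda>x. cnj (f x)))) \<rho>) (cotangent_coords N c x \<xi>)"
    using \<rho>(2) by (intro exI[of _ "\<lambda>x. cnj (\<rho> x)"]) simp
qed

end

section \<open>Tensor products of distributions\<close>

definition index_pull :: "nat \<Rightarrow> (nat \<Rightarrow> nat) \<Rightarrow> (nat \<Rightarrow> real) \<Rightarrow> nat \<Rightarrow> real" where
  "index_pull k s y = (\<lambda>q. if q < k then y (s q) else 0)"

lemma index_pull_euc [simp]: "index_pull k s y \<in> euc k"
  by (simp add: index_pull_def euc_def)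

lemma index_pull_continuous: "continuous_on S (index_pull k s)"
proof (rule continuous_on_coordinatewise_then_product)
  fix q show "continuous_on S (\<lambda>y. index_pull k s y q)"
    by (cases "q < k") (auto simp: index_pull_def intro: continuous_on_subset[OF continuous_on_product_coordinates])
qed

lemma enorm_continuous: "continuous_on S f \<Longrightarrow> continuous_on S (\<lambda>x. enorm k (f x))"
  unfolding L2_set_def
  by (intro continuous_on_real_sqrt continuous_on_sum continuous_on_power) (rule continuous_on_product_then_coordinatewise)

text \<open>Two injections with complementary ranges rather than an initial and a final segment,
  because the blocks of directions in the chain rule interleave.\<close>

definition index_split :: "nat \<Rightarrow> nat \<Rightarrow> nat \<Rightarrow> (nat \<Rightarrow> nat) \<Rightarrow> (nat \<Rightarrow> nat) \<Rightarrow> bool" where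
  "index_split n n1 n2 s t \<longleftrightarrow> inj_on s {..<n1} \<and> inj_on t {..<n2} \<and>
    s ` {..<n1} \<inter> t ` {..<n2} = {} \<and> s ` {..<n1} \<union> t ` {..<n2} = {..<n}"

lemma index_split_swap: "index_split n n1 n2 s t \<Longrightarrow> index_split n n2 n1 t s"
  by (auto simp: index_split_def)

lemma index_split_sum:
  assumes "index_split n n1 n2 s t"
  shows "(\<Sum>i<n. f i) = (\<Sum>q<n1. f (s q)) + (\<Sum>q<n2. f (t q))"
proof -
  have "(\<Sum>i<n. f i) = sum f (s ` {..<n1}) + sum f (t ` {..<n2})"
    using assms by (subst sum.union_disjoint[symmetric]) (auto simp: index_split_def)
  then show ?thesis using assms by (simp add: index_split_def sum.reindex)
qed

lemma index_split_enorm_le: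
  assumes "index_split n n1 n2 s t"
  shows "enorm n \<eta> \<le> enorm n1 (index_pull n1 s \<eta>) + enorm n2 (index_pull n2 t \<eta>)"
  unfolding L2_set_def index_pull_def using assms
  by (simp add: index_split_sum sqrt_add_le_add_sqrt sum_nonneg)

text \<open>The first part of \<eta>0 is nonzero, so \<eta>0 has a conic neighbourhood in which the
  second part is smaller than a times the first. There |\<eta>| and the growth of w2 are bounded by
  powers of the first part alone, and the rapid decay of w1 outweighs them.\<close>

lemma regular_direction_product:
  assumes st: "index_split n n1 n2 s t" and \<eta>0: "\<eta>0 \<in> euc n" and q: "q < n1" "\<eta>0 (s q) \<noteq> 0"
    and w1: "regular_direction n1 w1 (index_pull n1 s \<eta>0)"
    and w2: "C2 \<ge> 0" "\<And>\<eta>. norm (w2 \<eta>) \<le> C2 * (1 + enorm n2 \<eta>) ^ p"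
  shows "regular_direction n (\<lambda>\<eta>. w1 (index_pull n1 s \<eta>) * w2 (index_pull n2 t \<eta>)) \<eta>0"
proof -
  let ?s = "index_pull n1 s" and ?t = "index_pull n2 t"
  obtain \<Gamma> where \<Gamma>: "openin (Euclidean_space n1) \<Gamma>" "?s \<eta>0 \<in> \<Gamma>" "\<And>\<eta> t. \<eta> \<in> \<Gamma> \<Longrightarrow> t > 0 \<Longrightarrow> (\<lambda>i. t * \<eta> i) \<in> \<Gamma>"
    and d: "\<And>m::nat. \<exists>C. \<forall>\<eta>\<in>\<Gamma>. norm (w1 \<eta>) * (1 + enorm n1 \<eta>) ^ m \<le> C"
    using w1 unfolding regular_direction_def by blast
  have nn: "enorm k x \<ge> 0" for k x by (rule L2_set_nonneg)
  have pos: "enorm n1 (?s \<eta>0) > 0"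
  proof -
    have "\<bar>?s \<eta>0 q\<bar> \<le> L2_set (\<lambda>i. \<bar>?s \<eta>0 i\<bar>) {..<n1}" using q by (intro member_le_L2_set) auto
    moreover have "L2_set (\<lambda>i. \<bar>?s \<eta>0 i\<bar>) {..<n1} = enorm n1 (?s \<eta>0)" by (simp add: L2_set_def)
    moreover have "0 < \<bar>?s \<eta>0 q\<bar>" using q by (simp add: index_pull_def)
    ultimately show ?thesis by linarith
  qed
  \<comment> \<open>The summand 1 makes the inequality that defines \<Delta> strict at
    \<eta>0.\<close>
  define a where "a = enorm n2 (?t \<eta>0) / enorm n1 (?s \<eta>0) + 1"
  have a: "a \<ge> 1" using nn pos by (simp add: a_def)
  define \<Delta> where "\<Delta> = {\<eta> \<in> euc n. ?s \<eta> \<in> \<Gamma> \<and> enorm n2 (?t \<eta>) < a * enorm n1 (?s \<eta>)}"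
  have sc: "?s (\<lambda>i. r * \<eta> i) = (\<lambda>i. r * ?s \<eta> i)" "?t (\<lambda>i. r * \<eta> i) = (\<lambda>i. r * ?t \<eta> i)" for r \<eta>
    by (auto simp: index_pull_def)
  show ?thesis
  proof (rule regular_directionI[of n \<Delta>])
    obtain T where T: "open T" "\<Gamma> = euc n1 \<inter> T" using \<Gamma>(1) by (auto simp: Euclidean_space_eq openin_open)
    have "open (?s -` T)" by (rule open_vimage[OF T(1) index_pull_continuous])
    moreover have "open {\<eta>. enorm n2 (?t \<eta>) < a * enorm n1 (?s \<eta>)}"
      by (intro open_Collect_less enorm_continuous index_pull_continuous continuous_intros)
    ultimately have "openin (Euclidean_space n) (euc n \<inter> (?s -` T \<inter> {\<eta>. enorm n2 (?t \<eta>) < a * enorm n1 (?s \<eta>)}))"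
      unfolding Euclidean_space_eq by (intro openin_open_Int open_Int)
    also have "euc n \<inter> (?s -` T \<inter> {\<eta>. enorm n2 (?t \<eta>) < a * enorm n1 (?s \<eta>)}) = \<Delta>"
      by (auto simp: \<Delta>_def T(2))
    finally show "openin (Euclidean_space n) \<Delta>" .
    show "\<eta>0 \<in> \<Delta>" using \<eta>0 \<Gamma>(2) pos by (simp add: \<Delta>_def a_def distrib_right)
    show "(\<lambda>i. r * \<eta> i) \<in> \<Delta>" if "\<eta> \<in> \<Delta>" "r > 0" for \<eta> r
      using that \<Gamma>(3) by (auto simp: \<Delta>_def sc enorm_scale euc_def mult.left_commute)
    fix m :: nat
    obtain C where C: "\<And>\<eta>. \<eta> \<in> \<Gamma> \<Longrightarrow> norm (w1 \<eta>) * (1 + enorm n1 \<eta>) ^ (p + m) \<le> C" using d[of "p + m"] by blast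
    have "norm (w1 (?s \<eta>) * w2 (?t \<eta>)) * (1 + enorm n \<eta>) ^ m \<le> C2 * (1 + a) ^ p * (2 + a) ^ m * C" if \<eta>: "\<eta> \<in> \<Delta>" for \<eta>
    proof -
      let ?x = "enorm n1 (?s \<eta>)" and ?y = "enorm n2 (?t \<eta>)"
      have y: "?y \<le> a * ?x" using \<eta> by (simp add: \<Delta>_def)
      have ax: "a * ?x \<ge> 0" using a nn by simp
      have e: "(1 + a) * (1 + ?x) = 1 + a + ?x + a * ?x" "(2 + a) * (1 + ?x) = 2 + a + 2 * ?x + a * ?x"
        by (simp_all add: algebra_simps)
      have "1 + ?y \<le> (1 + a) * (1 + ?x)" unfolding e using y a nn[of "?s \<eta>" n1] by linarith
      then have 1: "(1 + ?y) ^ p \<le> (1 + a) ^ p * (1 + ?x) ^ p"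
        unfolding power_mult_distrib[symmetric] using nn by (intro power_mono) auto
      have "1 + enorm n \<eta> \<le> (2 + a) * (1 + ?x)"
        unfolding e using index_split_enorm_le[OF st, of \<eta>] y a nn[of "?s \<eta>" n1] by linarith
      then have 2: "(1 + enorm n \<eta>) ^ m \<le> (2 + a) ^ m * (1 + ?x) ^ m"
        unfolding power_mult_distrib[symmetric] using nn by (intro power_mono) auto
      have "norm (w2 (?t \<eta>)) \<le> C2 * ((1 + a) ^ p * (1 + ?x) ^ p)"
        using w2(2)[of "?t \<eta>"] mult_left_mono[OF 1 w2(1)] by linarith
      then have "norm (w1 (?s \<eta>) * w2 (?t \<eta>)) * (1 + enorm n \<eta>) ^ m \<le>
          (norm (w1 (?s \<eta>)) * (C2 * ((1 + a) ^ p * (1 + ?x) ^ p))) * ((2 + a) ^ m * (1 + ?x) ^ m)"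
        unfolding norm_mult using 2 a nn w2(1) by (intro mult_mono mult_left_mono) auto
      also have "\<dots> = (C2 * (1 + a) ^ p * (2 + a) ^ m) * (norm (w1 (?s \<eta>)) * (1 + ?x) ^ (p + m))"
        by (simp add: power_add mult_ac)
      also have "\<dots> \<le> (C2 * (1 + a) ^ p * (2 + a) ^ m) * C"
        using C[of "?s \<eta>"] \<eta> a w2(1) by (intro mult_left_mono) (auto simp: \<Delta>_def)
      finally show ?thesis .
    qed
    then show "\<exists>C. \<forall>\<eta>\<in>\<Delta>. norm (w1 (?s \<eta>) * w2 (?t \<eta>)) * (1 + enorm n \<eta>) ^ m \<le> C" by blast
  qed
qed

text \<open>The polynomial bound for f = 1: the order of the distribution in the chart is the degree
  of growth of its Fourier transform.\<close>

lemma local_fourier_polynomial_bound: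
  assumes N: "charted N" and c: "c \<in> atlas N" and \<rho>: "cutoff N c \<rho>" and u: "compact_distribution N u"
  obtains p C where "C \<ge> 0" "\<And>\<eta>. norm (local_fourier N c u \<rho> \<eta>) \<le> C * (1 + enorm (mdim N) \<eta>) ^ p"
proof -
  have "compact (snd c ` fun_support N \<rho>)"
    using \<rho> chart_compact_image[OF N c] by (auto simp: cutoff_def)
  then obtain R where R: "R > 0" "\<And>y i. y \<in> snd c ` fun_support N \<rho> \<Longrightarrow> i < mdim N \<Longrightarrow> \<bar>y i\<bar> \<le> R"
    by (rule compact_coord_bounded) blast
  obtain p C where "box_distribution (mdim N) R (\<lambda>f. u (\<lambda>x. \<rho> x * f (snd c x))) p C"
    by (rule cutoff_box_distribution[OF N c \<rho> u, of R]) (use R in auto)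
  then interpret box_distribution "mdim N" R "\<lambda>f. u (\<lambda>x. \<rho> x * f (snd c x))" p C .
  have 1: "deriv_bounded (mdim N) p (\<lambda>y. 1) 1"
    unfolding deriv_bounded_def
  proof (intro allI impI)
    fix l y assume l: "set l \<subseteq> {..<mdim N}"
    show "norm (iter_partial l (\<lambda>y. 1::complex) y) \<le> 1"
    proof (cases l)
      case (Cons i l')
      have "iter_partial l' (\<lambda>y. 1::complex) = (\<lambda>y. if l' = [] then 1 else 0)"
        by (induction l') (auto simp: partial_deriv_def)
      then show ?thesis by (simp add: Cons partial_deriv_def)
    qed simp
  qed
  show ?thesis
  proof (rule that[of "C * 2 ^ p" p])
    show "norm (local_fourier N c u \<rho> \<eta>) \<le> C * 2 ^ p * (1 + enorm (mdim N) \<eta>) ^ p" for \<eta>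
      using times_expo_bound'[OF smooth_const[OF openin_euc] _ 1, of \<eta>] by (simp add: local_fourier_expo)
  qed (use C0 in simp)
qed

text \<open>The seminorm bound turned into a limit along an arbitrary filter. It yields continuity
  in a parameter as well as the limit of difference quotients.\<close>

lemma compact_distribution_tendsto:
  assumes N: "charted N" and v: "compact_distribution N v"
    and g: "g \<in> smooth_functions N" and f: "\<forall>\<^sub>F a in F. f a \<in> smooth_functions N"
    and lim: "\<And>\<tau> \<epsilon>. \<tau> \<in> tests N \<Longrightarrow> \<epsilon> > 0 \<Longrightarrow> \<forall>\<^sub>F a in F. test_le \<tau> (\<lambda>x. f a x - g x) \<epsilon>"
  shows "((\<lambda>a. v (f a)) \<longlongrightarrow> v g) F"
proof -
  obtain S C where S: "finite S" "S \<subseteq> tests N" "C \<ge> 0"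
    "\<And>f B. f \<in> smooth_functions N \<Longrightarrow> (\<And>\<tau>. \<tau> \<in> S \<Longrightarrow> test_le \<tau> f B) \<Longrightarrow> B \<ge> 0 \<Longrightarrow> norm (v f) \<le> C * B"
    by (rule compact_distribution_bound[OF N v]) blast
  show ?thesis unfolding tendsto_iff
  proof (intro allI impI)
    fix e :: real assume e: "e > 0"
    define \<epsilon> where "\<epsilon> = e / (C + 1)"
    have \<epsilon>: "\<epsilon> > 0" "C * \<epsilon> < e" using e S(3) by (auto simp: \<epsilon>_def field_simps)
    have "\<forall>\<^sub>F a in F. \<forall>\<tau>\<in>S. test_le \<tau> (\<lambda>x. f a x - g x) \<epsilon>"
      using S \<epsilon> by (intro eventually_ball_finite) (auto intro: lim)
    with f show "\<forall>\<^sub>F a in F. dist (v (f a)) (v g) < e"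
    proof eventually_elim
      case (elim a)
      have "norm (v (\<lambda>x. f a x - g x)) \<le> C * \<epsilon>"
        using elim \<epsilon> by (intro S(4) smooth_functions_diff[OF N _ g]) auto
      then show ?case using \<epsilon> compact_distribution_diff[OF N v elim(1) g] by (simp add: dist_norm)
    qed
  qed
qed

text \<open>N is the product of N1 and N2 up to a reordering of coordinates: J joins two points,
  \<open>pc\<close> two charts, and s and t place the coordinates. \<open>pc_surj\<close> makes
  every chart of N a product, as the wave front set ranges over all charts. The abstraction keeps
  the index arithmetic of powers of M out of the analysis.\<close>

locale manifold_product =
  fixes N1 :: "('a, 'x) manifold_scheme" and N2 :: "('b, 'y) manifold_scheme" and N :: "('c, 'z) manifold_scheme"
    and s t :: "nat \<Rightarrow> nat" and J :: "'a \<Rightarrow> 'b \<Rightarrow> 'c" and \<pi>1 :: "'c \<Rightarrow> 'a" and \<pi>2 :: "'c \<Rightarrow> 'b"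
    and pc :: "'a chart \<Rightarrow> 'b chart \<Rightarrow> 'c chart"
  assumes N1: "charted N1" and N2: "charted N2" and N: "charted N"
    and st: "index_split (mdim N) (mdim N1) (mdim N2) s t"
    and J: "x1 \<in> topspace (mtop N1) \<Longrightarrow> x2 \<in> topspace (mtop N2) \<Longrightarrow> J x1 x2 \<in> topspace (mtop N)"
    and \<pi>J: "x1 \<in> topspace (mtop N1) \<Longrightarrow> x2 \<in> topspace (mtop N2) \<Longrightarrow> \<pi>1 (J x1 x2) = x1"
      "x1 \<in> topspace (mtop N1) \<Longrightarrow> x2 \<in> topspace (mtop N2) \<Longrightarrow> \<pi>2 (J x1 x2) = x2"
    and \<pi>: "x \<in> topspace (mtop N) \<Longrightarrow> \<pi>1 x \<in> topspace (mtop N1)" "x \<in> topspace (mtop N) \<Longrightarrow> \<pi>2 x \<in> topspace (mtop N2)"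
      "x \<in> topspace (mtop N) \<Longrightarrow> J (\<pi>1 x) (\<pi>2 x) = x"
    and J_continuous: "continuous_map (prod_topology (mtop N1) (mtop N2)) (mtop N) (\<lambda>(x1, x2). J x1 x2)"
    and pc: "c1 \<in> atlas N1 \<Longrightarrow> c2 \<in> atlas N2 \<Longrightarrow> pc c1 c2 \<in> atlas N"
    and pc_fst: "c1 \<in> atlas N1 \<Longrightarrow> c2 \<in> atlas N2 \<Longrightarrow> fst (pc c1 c2) = (\<lambda>(x1, x2). J x1 x2) ` (fst c1 \<times> fst c2)"
    and pc_s: "c1 \<in> atlas N1 \<Longrightarrow> c2 \<in> atlas N2 \<Longrightarrow> x1 \<in> fst c1 \<Longrightarrow> x2 \<in> fst c2 \<Longrightarrow> q < mdim N1 \<Longrightarrow> snd (pc c1 c2) (J x1 x2) (s q) = snd c1 x1 q"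
    and pc_t: "c1 \<in> atlas N1 \<Longrightarrow> c2 \<in> atlas N2 \<Longrightarrow> x1 \<in> fst c1 \<Longrightarrow> x2 \<in> fst c2 \<Longrightarrow> q < mdim N2 \<Longrightarrow> snd (pc c1 c2) (J x1 x2) (t q) = snd c2 x2 q"
    and pc_surj: "c \<in> atlas N \<Longrightarrow> \<exists>c1\<in>atlas N1. \<exists>c2\<in>atlas N2. c = pc c1 c2"
begin

abbreviation "n1 \<equiv> mdim N1"
abbreviation "n2 \<equiv> mdim N2"
abbreviation "n \<equiv> mdim N"
abbreviation "X1 \<equiv> topspace (mtop N1)"
abbreviation "X2 \<equiv> topspace (mtop N2)"
abbreviation "rs \<equiv> index_pull n1 s"
abbreviation "rt \<equiv> index_pull n2 t"

text \<open>J read in charts, and the inverse of the pair \<open>rs\<close>, \<open>rt\<close> on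
  coordinate vectors. Indices outside both ranges give 0, so the result lies in
  \<open>euc n\<close>.\<close>

definition comb :: "(nat \<Rightarrow> real) \<Rightarrow> (nat \<Rightarrow> real) \<Rightarrow> nat \<Rightarrow> real" where
  "comb y1 y2 = (\<lambda>m. if m \<in> s ` {..<n1} then y1 (inv_into {..<n1} s m)
    else if m \<in> t ` {..<n2} then y2 (inv_into {..<n2} t m) else 0)"

lemma s_less: "q < n1 \<Longrightarrow> s q < n" and t_less: "q < n2 \<Longrightarrow> t q < n"
  using st by (auto simp: index_split_def)

lemma st_cases: "m < n \<Longrightarrow> (\<exists>q<n1. m = s q) \<or> (\<exists>q<n2. m = t q)"
proof -
  assume "m < n"
  then have "m \<in> s ` {..<n1} \<union> t ` {..<n2}" using st by (simp add: index_split_def)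
  then show ?thesis by auto
qed

lemma st_disjoint: "q < n1 \<Longrightarrow> q' < n2 \<Longrightarrow> s q \<noteq> t q'"
  using st by (auto simp: index_split_def)

lemma comb_s [simp]: "q < n1 \<Longrightarrow> comb y1 y2 (s q) = y1 q"
  using st by (simp add: comb_def index_split_def)

lemma comb_t [simp]: "q < n2 \<Longrightarrow> comb y1 y2 (t q) = y2 q"
  using st st_disjoint[of _ q] by (auto simp: comb_def index_split_def)

lemma comb_euc [simp]: "comb y1 y2 \<in> euc n"
proof -
  have "m \<notin> s ` {..<n1}" "m \<notin> t ` {..<n2}" if "n \<le> m" for m
    using s_less t_less that by force+
  then show ?thesis by (simp add: comb_def euc_def)
qed

lemma euc_st_eqI: "x \<in> euc n \<Longrightarrow> y \<in> euc n \<Longrightarrow> (\<And>q. q < n1 \<Longrightarrow> x (s q) = y (s q)) \<Longrightarrow> (\<And>q. q < n2 \<Longrightarrow> x (t q) = y (t q)) \<Longrightarrow> x = y"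
proof
  fix m assume *: "x \<in> euc n" "y \<in> euc n" "\<And>q. q < n1 \<Longrightarrow> x (s q) = y (s q)" "\<And>q. q < n2 \<Longrightarrow> x (t q) = y (t q)"
  show "x m = y m"
  proof (cases "m < n")
    case True
    then show ?thesis using st_cases[OF True] *(3,4) by auto
  qed (use *(1,2) in \<open>simp add: euc_def\<close>)
qed

lemma comb_pull [simp]: "y \<in> euc n \<Longrightarrow> comb (rs y) (rt y) = y"
  by (rule euc_st_eqI) (auto simp: index_pull_def)

lemma pull_comb [simp]: "y1 \<in> euc n1 \<Longrightarrow> rs (comb y1 y2) = y1" "y2 \<in> euc n2 \<Longrightarrow> rt (comb y1 y2) = y2"
  by (auto simp: index_pull_def euc_def fun_eq_iff)

lemma comb_upd_s: "q < n1 \<Longrightarrow> comb (y1(q := r)) y2 = (comb y1 y2)(s q := r)"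
  using st by (intro euc_st_eqI) (auto simp: s_less st_disjoint index_split_def inj_on_def dest!: sym[of "s _" "t _"] intro!: euc_upd)

lemma comb_upd_t: "q < n2 \<Longrightarrow> comb y1 (y2(q := r)) = (comb y1 y2)(t q := r)"
  using st by (intro euc_st_eqI) (auto simp: t_less st_disjoint index_split_def inj_on_def dest: st_disjoint intro!: euc_upd)

lemma pull_upd_s: "q < n1 \<Longrightarrow> rs (y(s q := r)) = (rs y)(q := r)" "q < n1 \<Longrightarrow> rt (y(s q := r)) = rt y"
  using st st_disjoint by (auto simp: index_pull_def fun_eq_iff index_split_def inj_on_def)

lemma comb_continuous: "continuous_on S (\<lambda>p. comb (fst p) (snd p))"
proof (rule continuous_on_coordinatewise_then_product)
  fix m
  have "continuous_on S (\<lambda>p::(nat\<Rightarrow>real)\<times>(nat\<Rightarrow>real). fst p i)" "continuous_on S (\<lambda>p::(nat\<Rightarrow>real)\<times>(nat\<Rightarrow>real). snd p i)" for i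
    by (rule continuous_on_product_then_coordinatewise, rule continuous_on_fst continuous_on_snd, rule continuous_on_id)+
  then show "continuous_on S (\<lambda>p. comb (fst p) (snd p) m)"
    by (cases "m \<in> s ` {..<n1}"; cases "m \<in> t ` {..<n2}"; simp add: comb_def)
qed

lemma iter_partial_comb:
  assumes "set js \<subseteq> {..<n2}"
  shows "iter_partial js (\<lambda>y2. H (comb y1 y2)) y2 = iter_partial (map t js) H (comb y1 y2)"
  using assms
proof (induction js arbitrary: y2)
  case (Cons i js)
  then have "iter_partial js (\<lambda>y2. H (comb y1 y2)) = (\<lambda>y2. iter_partial (map t js) H (comb y1 y2))" by auto
  then show ?case using Cons.prems by (simp add: partial_deriv_def comb_upd_t)
qed simp

context
  fixes c1 :: "'a chart" and c2 :: "'b chart"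
  assumes c1: "c1 \<in> atlas N1" and c2: "c2 \<in> atlas N2"
begin

lemma snd_pc: "x1 \<in> fst c1 \<Longrightarrow> x2 \<in> fst c2 \<Longrightarrow> snd (pc c1 c2) (J x1 x2) = comb (snd c1 x1) (snd c2 x2)"
proof (rule euc_st_eqI)
  assume x: "x1 \<in> fst c1" "x2 \<in> fst c2"
  then have "J x1 x2 \<in> fst (pc c1 c2)" by (auto simp: pc_fst[OF c1 c2])
  then show "snd (pc c1 c2) (J x1 x2) \<in> euc n"
    using chart_image_subset[OF N pc[OF c1 c2]] by (auto simp: chart_image_def)
qed (auto simp: pc_s[OF c1 c2] pc_t[OF c1 c2])

lemma J_in_pc: "x1 \<in> fst c1 \<Longrightarrow> x2 \<in> fst c2 \<Longrightarrow> J x1 x2 \<in> fst (pc c1 c2)"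
  by (auto simp: pc_fst[OF c1 c2])

lemma chart_image_pc: "y \<in> chart_image (pc c1 c2) \<longleftrightarrow> y \<in> euc n \<and> rs y \<in> chart_image c1 \<and> rt y \<in> chart_image c2"
proof
  assume "y \<in> chart_image (pc c1 c2)"
  then obtain x1 x2 where x: "x1 \<in> fst c1" "x2 \<in> fst c2" "y = comb (snd c1 x1) (snd c2 x2)"
    by (auto simp: chart_image_def pc_fst[OF c1 c2] snd_pc)
  moreover have "snd c1 x1 \<in> chart_image c1" "snd c2 x2 \<in> chart_image c2" using x by (auto simp: chart_image_def)
  ultimately show "y \<in> euc n \<and> rs y \<in> chart_image c1 \<and> rt y \<in> chart_image c2"
    using chart_image_subset[OF N1 c1] chart_image_subset[OF N2 c2] by auto
next
  assume y: "y \<in> euc n \<and> rs y \<in> chart_image c1 \<and> rt y \<in> chart_image c2"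
  then obtain x1 x2 where x: "x1 \<in> fst c1" "x2 \<in> fst c2" "rs y = snd c1 x1" "rt y = snd c2 x2"
    by (auto simp: chart_image_def)
  then have "snd (pc c1 c2) (J x1 x2) = y" using y comb_pull[of y] by (simp add: snd_pc)
  then show "y \<in> chart_image (pc c1 c2)" using J_in_pc[OF x(1,2)] by (auto simp: chart_image_def)
qed

lemma comb_in_pc: "y1 \<in> chart_image c1 \<Longrightarrow> y2 \<in> chart_image c2 \<Longrightarrow> comb y1 y2 \<in> chart_image (pc c1 c2)"
  using chart_image_subset[OF N1 c1] chart_image_subset[OF N2 c2] by (auto simp: chart_image_pc subset_iff)

lemma chart_inv_pc:
  assumes "y1 \<in> chart_image c1" "y2 \<in> chart_image c2"
  shows "chart_inv (pc c1 c2) (comb y1 y2) = J (chart_inv c1 y1) (chart_inv c2 y2)"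
proof -
  note i = chart_inv_in[OF N1 c1 assms(1)] chart_inv_in[OF N2 c2 assms(2)]
  have "comb y1 y2 = snd (pc c1 c2) (J (chart_inv c1 y1) (chart_inv c2 y2))"
    using assms by (simp add: snd_pc[OF i] snd_chart_inv[OF N1 c1] snd_chart_inv[OF N2 c2])
  then show ?thesis by (simp add: chart_inv_snd[OF N pc[OF c1 c2] J_in_pc[OF i]])
qed

end

end

lemma iter_partial_diff:
  fixes f g :: "(nat \<Rightarrow> real) \<Rightarrow> 'b::real_normed_algebra_1"
  assumes V: "openin (Euclidean_space n) V" and f: "smooth_on_Rn n V f" and g: "smooth_on_Rn n V g"
    and "set js \<subseteq> {..<n}" "y \<in> V"
  shows "iter_partial js (\<lambda>y. f y - g y) y = iter_partial js f y - iter_partial js g y"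
  using iter_partial_add[OF V f smooth_bounded_linear[OF V bounded_linear_mult_right g] assms(4,5), of "-1"]
    iter_partial_bounded_linear[OF V bounded_linear_mult_right g assms(4,5), of "-1"] by simp

context manifold_product
begin

section \<open>Distributions applied to families of functions with a parameter\<close>

definition coord_rep :: "'b chart \<Rightarrow> ((nat \<Rightarrow> real) \<Rightarrow> 'b \<Rightarrow> complex) \<Rightarrow> (nat \<Rightarrow> real) \<Rightarrow> complex" where
  "coord_rep c2 \<Phi> y = \<Phi> (rs y) (chart_inv c2 (rt y))"

text \<open>The parameter runs through the image of a chart of N1, and smoothness is required in
  parameter and variable together. The notion abstracts the slices of a smooth function on N and is
  closed under differentiation in the parameter.\<close>

definition jointly_smooth :: "'a chart \<Rightarrow> ((nat \<Rightarrow> real) \<Rightarrow> 'b \<Rightarrow> complex) \<Rightarrow> bool" where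
  "jointly_smooth c1 \<Phi> \<longleftrightarrow> (\<forall>y1\<in>chart_image c1. \<forall>x2. x2 \<notin> X2 \<longrightarrow> \<Phi> y1 x2 = 0) \<and>
    (\<forall>c2\<in>atlas N2. smooth_on_Rn n (chart_image (pc c1 c2)) (coord_rep c2 \<Phi>))"

definition param_deriv :: "nat list \<Rightarrow> ((nat \<Rightarrow> real) \<Rightarrow> 'b \<Rightarrow> complex) \<Rightarrow> (nat \<Rightarrow> real) \<Rightarrow> 'b \<Rightarrow> complex" where
  "param_deriv js \<Phi> y1 x2 = iter_partial js (\<lambda>z. \<Phi> z x2) y1"

lemma coord_rep_param_deriv:
  assumes "set js \<subseteq> {..<n1}"
  shows "coord_rep c2 (param_deriv js \<Phi>) = iter_partial (map s js) (coord_rep c2 \<Phi>)"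
  using assms
proof (induction js)
  case Nil
  show ?case by (simp add: coord_rep_def[abs_def] param_deriv_def)
next
  case (Cons q js)
  then have q: "q < n1" and IH: "coord_rep c2 (param_deriv js \<Phi>) = iter_partial (map s js) (coord_rep c2 \<Phi>)" by auto
  have "coord_rep c2 (param_deriv (q # js) \<Phi>) y = partial_deriv (s q) (coord_rep c2 (param_deriv js \<Phi>)) y" for y
    using q by (simp add: coord_rep_def param_deriv_def partial_deriv_def pull_upd_s) (simp add: index_pull_def)
  then show ?case by (simp add: IH fun_eq_iff)
qed

context
  fixes c1 :: "'a chart"
  assumes c1: "c1 \<in> atlas N1"
begin

lemma jointly_smooth_param_deriv:
  assumes \<Phi>: "jointly_smooth c1 \<Phi>" and js: "set js \<subseteq> {..<n1}"
  shows "jointly_smooth c1 (param_deriv js \<Phi>)"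
  unfolding jointly_smooth_def
proof (intro conjI ballI allI impI)
  fix y1 x2 assume "y1 \<in> chart_image c1" "x2 \<notin> X2"
  then show "param_deriv js \<Phi> y1 x2 = 0"
    using \<Phi> unfolding param_deriv_def jointly_smooth_def
    by (intro iter_partial_zero[OF chart_image_open[OF N1 c1] _ js]) auto
next
  fix c2 assume c2: "c2 \<in> atlas N2"
  show "smooth_on_Rn n (chart_image (pc c1 c2)) (coord_rep c2 (param_deriv js \<Phi>))"
    unfolding coord_rep_param_deriv[OF js]
    by (rule smooth_iter) (use \<Phi> c2 js s_less in \<open>auto simp: jointly_smooth_def\<close>)
qed

lemma section_smooth:
  assumes \<Phi>: "jointly_smooth c1 \<Phi>" and y1: "y1 \<in> chart_image c1"
  shows "\<Phi> y1 \<in> smooth_functions N2"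
  unfolding smooth_functions_def
proof (intro CollectI conjI ballI allI impI)
  show "\<Phi> y1 x = 0" if "x \<notin> X2" for x using \<Phi> y1 that by (simp add: jointly_smooth_def)
  fix c2 assume c2: "c2 \<in> atlas N2"
  have V: "openin (Euclidean_space n2) (chart_image c2)" by (rule chart_image_open[OF N2 c2])
  have "smooth_on_Rn n2 (chart_image c2) (\<lambda>y2. coord_rep c2 \<Phi> (comb y1 y2))"
  proof (rule smooth_compose[OF V chart_image_open[OF N pc[OF c1 c2]]])
    show "smooth_on_Rn n (chart_image (pc c1 c2)) (coord_rep c2 \<Phi>)" using \<Phi> c2 by (simp add: jointly_smooth_def)
    show "comb y1 y \<in> chart_image (pc c1 c2)" if "y \<in> chart_image c2" for y by (rule comb_in_pc[OF c1 c2 y1 that])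
    fix q assume q: "q < n"
    then show "smooth_on_Rn n2 (chart_image c2) (\<lambda>y. comb y1 y q)"
      using st_cases[OF q] by (auto intro: smooth_const[OF V] smooth_coord[OF V])
  qed
  then show "smooth_on_Rn n2 (chart_image c2) (\<lambda>y. \<Phi> y1 (chart_inv c2 y))"
    by (rule smooth_cong[OF V, rotated])
      (use y1 chart_image_subset[OF N1 c1] chart_image_subset[OF N2 c2] in \<open>auto simp: coord_rep_def subset_iff\<close>)
qed

lemma section_iter_partial:
  assumes y1: "y1 \<in> chart_image c1" and c2: "c2 \<in> atlas N2" and y2: "y2 \<in> chart_image c2" and js: "set js \<subseteq> {..<n2}"
  shows "iter_partial js (\<lambda>y. \<Phi> y1 (chart_inv c2 y)) y2 = iter_partial (map t js) (coord_rep c2 \<Phi>) (comb y1 y2)"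
proof -
  have "iter_partial js (\<lambda>y. \<Phi> y1 (chart_inv c2 y)) y2 = iter_partial js (\<lambda>y. coord_rep c2 \<Phi> (comb y1 y)) y2"
    by (rule iter_partial_cong[OF chart_image_open[OF N2 c2] js _ y2])
      (use y1 chart_image_subset[OF N1 c1] chart_image_subset[OF N2 c2] in \<open>auto simp: coord_rep_def subset_iff\<close>)
  then show ?thesis by (simp add: iter_partial_comb[OF js])
qed

end

context
  fixes c1 :: "'a chart" and v :: "('b \<Rightarrow> complex) \<Rightarrow> complex"
  assumes c1: "c1 \<in> atlas N1" and v: "compact_distribution N2 v"
begin

text \<open>For one seminorm, the derivatives of the family in the N2 directions form a function
  that is continuous on the product of the chart image with a compact set. Continuity in the
  parameter is then uniform over the compact set, which is convergence in the seminorm.\<close>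

lemma distribution_param_tendsto:
  assumes \<Phi>: "jointly_smooth c1 \<Phi>" and y0: "y0 \<in> chart_image c1"
  shows "((\<lambda>y1. v (\<Phi> y1)) \<longlongrightarrow> v (\<Phi> y0)) (at y0 within chart_image c1)"
proof (rule compact_distribution_tendsto[OF N2 v section_smooth[OF c1 \<Phi> y0]])
  show "\<forall>\<^sub>F y1 in at y0 within chart_image c1. \<Phi> y1 \<in> smooth_functions N2"
    unfolding eventually_at_filter by (intro always_eventually) (auto intro: section_smooth[OF c1 \<Phi>])
  fix \<tau> and \<epsilon> :: real assume \<tau>: "\<tau> \<in> tests N2" and \<epsilon>: "\<epsilon> > 0"
  obtain c2 K js where \<tau>_eq: "\<tau> = (c2, K, js)" by (cases \<tau>)
  have c2: "c2 \<in> atlas N2" "compactin (mtop N2) K" "K \<subseteq> fst c2" "set js \<subseteq> {..<n2}" using \<tau> by (auto simp: \<tau>_eq tests_def)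
  let ?L = "snd c2 ` K"
  have L: "compact ?L" "?L \<subseteq> chart_image c2" using chart_compact_image[OF N2 c2(1-3)] c2(3) by (auto simp: chart_image_def)
  define H where "H = iter_partial (map t js) (coord_rep c2 \<Phi>)"
  have H: "continuous_on (chart_image (pc c1 c2)) H"
    unfolding H_def
    by (rule smooth_continuous[OF chart_image_open[OF N pc[OF c1 c2(1)]] smooth_iter])
      (use \<Phi> c2 t_less in \<open>auto simp: jointly_smooth_def\<close>)
  have cont: "continuous_on (chart_image c1 \<times> ?L) (\<lambda>p. H (comb (fst p) (snd p)))"
    by (rule continuous_on_compose2[OF H comb_continuous]) (use L(2) comb_in_pc[OF c1 c2(1)] in auto)
  obtain X0 where X0: "y0 \<in> X0" "open X0" "\<forall>y\<in>X0 \<inter> chart_image c1. \<forall>y2\<in>?L. dist (H (comb y y2)) (H (comb y0 y2)) \<le> \<epsilon>"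
    by (rule continuous_on_prod_compactE[OF cont L(1) y0 \<epsilon>]) (simp only: fst_conv snd_conv)
  have "\<forall>\<^sub>F y in nhds y0. y \<in> X0" by (rule eventually_nhds_in_open[OF X0(2,1)])
  then show "\<forall>\<^sub>F y in at y0 within chart_image c1. test_le \<tau> (\<lambda>x. \<Phi> y x - \<Phi> y0 x) \<epsilon>"
    unfolding eventually_at_filter
  proof eventually_elim
    case (elim y)
    show ?case
    proof (intro impI)
      assume y: "y \<in> chart_image c1"
      show "test_le \<tau> (\<lambda>x. \<Phi> y x - \<Phi> y0 x) \<epsilon>"
        unfolding test_le_def \<tau>_eq prod.case
      proof
        fix x assume x: "x \<in> K"
        then have y2: "snd c2 x \<in> chart_image c2" using L(2) by auto
        have "iter_partial js (\<lambda>z. \<Phi> y (chart_inv c2 z) - \<Phi> y0 (chart_inv c2 z)) (snd c2 x) = H (comb y (snd c2 x)) - H (comb y0 (snd c2 x))"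
          using iter_partial_diff[OF chart_image_open[OF N2 c2(1)] smooth_functions_chart[OF section_smooth[OF c1 \<Phi> y] c2(1)]
              smooth_functions_chart[OF section_smooth[OF c1 \<Phi> y0] c2(1)] c2(4) y2]
          by (simp add: section_iter_partial[OF c1 y c2(1) y2 c2(4)] section_iter_partial[OF c1 y0 c2(1) y2 c2(4)] H_def)
        then show "norm (iter_partial js (\<lambda>z. \<Phi> y (chart_inv c2 z) - \<Phi> y0 (chart_inv c2 z)) (snd c2 x)) \<le> \<epsilon>"
          using X0(3) elim y x by (auto simp: dist_norm)
      qed
    qed
  qed
qed

text \<open>The difference quotients of the family converge to its parameter derivative in every
  seminorm: the mean value inequality bounds the error by the oscillation of the parameter
  derivative, which is small uniformly over a compact set of the other variables. Continuity of v
  carries the limit over.\<close>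

lemma distribution_param_has_pd:
  assumes \<Phi>: "jointly_smooth c1 \<Phi>" and q: "q < n1"
  shows "has_pd q (chart_image c1) (\<lambda>y1. v (\<Phi> y1)) (\<lambda>y1. v (param_deriv [q] \<Phi> y1))"
  unfolding has_pd_def
proof
  fix y0 assume y0: "y0 \<in> chart_image c1"
  let ?U = "\<lambda>r. y0(q := r)"
  have V1: "openin (Euclidean_space n1) (chart_image c1)" by (rule chart_image_open[OF N1 c1])
  have d\<Phi>: "jointly_smooth c1 (param_deriv [q] \<Phi>)" using q by (intro jointly_smooth_param_deriv[OF c1 \<Phi>]) auto
  have evU: "\<forall>\<^sub>F r in nhds (y0 q). ?U r \<in> chart_image c1" by (rule openin_euc_upd_eventually[OF V1 y0 q])
  have evU': "\<forall>\<^sub>F r in at (y0 q). ?U r \<in> chart_image c1" using evU by (simp add: eventually_at_filter eventually_mono)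
  define f where "f r = (\<lambda>x. of_real (inverse (r - y0 q)) * (\<Phi> (?U r) x - \<Phi> y0 x))" for r
  have fs: "f r \<in> smooth_functions N2" if "?U r \<in> chart_image c1" for r
    unfolding f_def by (intro smooth_functions_cmult[OF N2] smooth_functions_diff[OF N2] section_smooth[OF c1 \<Phi>] that y0)
  have "((\<lambda>r. v (f r)) \<longlongrightarrow> v (param_deriv [q] \<Phi> y0)) (at (y0 q))"
  proof (rule compact_distribution_tendsto[OF N2 v section_smooth[OF c1 d\<Phi> y0]])
    show "\<forall>\<^sub>F r in at (y0 q). f r \<in> smooth_functions N2" using evU' by eventually_elim (rule fs)
    fix \<tau> and \<epsilon> :: real assume \<tau>: "\<tau> \<in> tests N2" and \<epsilon>: "\<epsilon> > 0"
    obtain c2 K js where \<tau>_eq: "\<tau> = (c2, K, js)" by (cases \<tau>)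
    have c2: "c2 \<in> atlas N2" "compactin (mtop N2) K" "K \<subseteq> fst c2" "set js \<subseteq> {..<n2}" using \<tau> by (auto simp: \<tau>_eq tests_def)
    have W: "openin (Euclidean_space n) (chart_image (pc c1 c2))" by (rule chart_image_open[OF N pc[OF c1 c2(1)]])
    have tj: "set (map t js) \<subseteq> {..<n}" using c2(4) t_less by auto
    let ?L = "snd c2 ` K"
    have L: "compact ?L" "?L \<subseteq> chart_image c2" using chart_compact_image[OF N2 c2(1-3)] c2(3) by (auto simp: chart_image_def)
    define G where "G = coord_rep c2 \<Phi>"
    have G: "smooth_on_Rn n (chart_image (pc c1 c2)) G" using \<Phi> c2(1) by (simp add: jointly_smooth_def G_def)
    define H where "H = iter_partial (map t js) G"
    have H: "smooth_on_Rn n (chart_image (pc c1 c2)) H" unfolding H_def by (rule smooth_iter[OF G tj])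
    let ?dH = "partial_deriv (s q) H"
    have dH: "smooth_on_Rn n (chart_image (pc c1 c2)) ?dH" by (rule smooth_partial[OF H s_less[OF q]])
    define I where "I = {r. ?U r \<in> chart_image c1}"
    have upd: "continuous_on S (\<lambda>p. ?U (fst p))" for S :: "(real \<times> (nat \<Rightarrow> real)) set"
      by (intro continuous_on_fun_upd continuous_on_const continuous_on_fst continuous_on_id)
    have "continuous_on (I \<times> ?L) (\<lambda>p. ?dH (comb (fst (?U (fst p), snd p)) (snd (?U (fst p), snd p))))"
      by (rule continuous_on_compose2[OF continuous_on_compose2[OF smooth_continuous[OF W dH] comb_continuous, of "chart_image c1 \<times> ?L"], of _ "\<lambda>p. (?U (fst p), snd p)"])
        (use L(2) comb_in_pc[OF c1 c2(1)] in \<open>auto simp: I_def intro!: continuous_on_Pair upd continuous_on_snd continuous_on_id\<close>)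
    then have cont: "continuous_on (I \<times> ?L) (\<lambda>p. ?dH (comb (?U (fst p)) (snd p)))" by simp
    have y0I: "y0 q \<in> I" using y0 by (simp add: I_def)
    obtain X0 where X0: "y0 q \<in> X0" "open X0" "\<forall>r\<in>X0 \<inter> I. \<forall>y2\<in>?L. dist (?dH (comb (?U r) y2)) (?dH (comb (?U (y0 q)) y2)) \<le> \<epsilon>"
      using continuous_on_prod_compactE[OF cont L(1) y0I \<epsilon>] by (auto simp del: fun_upd_triv)
    have "\<forall>\<^sub>F r in nhds (y0 q). r \<in> X0 \<and> r \<in> I"
      using eventually_conj[OF eventually_nhds_in_open[OF X0(2,1)] evU] by (simp add: I_def)
    then obtain e where e: "e > 0" "\<And>r. dist r (y0 q) < e \<Longrightarrow> r \<in> X0 \<and> r \<in> I"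
      unfolding eventually_nhds_metric by blast
    have main: "test_le \<tau> (\<lambda>x. f r x - param_deriv [q] \<Phi> y0 x) \<epsilon>" if r: "dist r (y0 q) < e" "r \<noteq> y0 q" for r
      unfolding test_le_def \<tau>_eq prod.case
    proof
      fix x assume x: "x \<in> K"
      define y2 where "y2 = snd c2 x"
      have y2: "y2 \<in> chart_image c2" "y2 \<in> ?L" using x L(2) by (auto simp: y2_def)
      have rI: "?U r \<in> chart_image c1" using e(2)[OF r(1)] by (simp add: I_def)
      let ?h = "complex_of_real (inverse (r - y0 q))" and ?\<Delta> = "H (comb (y0(q := r)) y2) - H (comb y0 y2)"
        and ?g = "\<lambda>y. \<Phi> (y0(q := r)) (chart_inv c2 y) - \<Phi> y0 (chart_inv c2 y)" and ?p = "\<lambda>y. param_deriv [q] \<Phi> y0 (chart_inv c2 y)"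
        and ?f = "\<lambda>y. f r (chart_inv c2 y)"
      note V2 = chart_image_open[OF N2 c2(1)]
      have sf: "smooth_on_Rn n2 (chart_image c2) (\<lambda>y. \<Phi> z (chart_inv c2 y))" if "z \<in> chart_image c1" for z
        by (rule smooth_functions_chart[OF section_smooth[OF c1 \<Phi> that] c2(1)])
      have sd: "smooth_on_Rn n2 (chart_image c2) ?g"
        using smooth_functions_chart[OF smooth_functions_diff[OF N2 section_smooth[OF c1 \<Phi> rI] section_smooth[OF c1 \<Phi> y0]] c2(1)] .
      have "iter_partial js (\<lambda>y. ?f y - ?p y) y2 =
          iter_partial js ?f y2 - iter_partial js ?p y2"
        by (rule iter_partial_diff[OF V2 smooth_functions_chart[OF fs[OF rI] c2(1)] smooth_functions_chart[OF section_smooth[OF c1 d\<Phi> y0] c2(1)] c2(4) y2(1)])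
      also have "iter_partial js ?f y2 =
          ?h * iter_partial js ?g y2"
        unfolding f_def by (rule iter_partial_bounded_linear[OF V2 bounded_linear_mult_right sd c2(4) y2(1)])
      also have "iter_partial js ?g y2 = ?\<Delta>"
        using iter_partial_diff[OF V2 sf[OF rI] sf[OF y0] c2(4) y2(1)]
        by (simp add: section_iter_partial[OF c1 rI c2(1) y2(1) c2(4)] section_iter_partial[OF c1 y0 c2(1) y2(1) c2(4)] H_def G_def)
      also have "iter_partial js ?p y2 = iter_partial (map t js) (partial_deriv (s q) G) (comb y0 y2)"
        using section_iter_partial[OF c1 y0 c2(1) y2(1) c2(4), of "param_deriv [q] \<Phi>"] coord_rep_param_deriv[of "[q]" c2 \<Phi>] q by (simp add: G_def)
      \<comment> \<open>The derivative in the parameter slot is moved past the derivatives in the N2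
        slots by symmetry of second derivatives.\<close>
      also have "\<dots> = ?dH (comb y0 y2)"
        unfolding H_def by (rule iter_partial_commute[OF W G tj s_less[OF q] comb_in_pc[OF c1 c2(1) y0 y2(1)]])
      finally have eq: "iter_partial js (\<lambda>y. ?f y - ?p y) y2 =
          ?h * ?\<Delta> - ?dH (comb y0 y2)" .
      have "norm (H (comb (?U r) y2) - H (comb (?U (y0 q)) y2) - (r - y0 q) *\<^sub>R ?dH (comb (?U (y0 q)) y2)) \<le> norm (r - y0 q) * \<epsilon>"
      proof (rule vector_differentiable_bound_linearization[where S="ball (y0 q) e"])
        fix \<tau>' assume \<tau>': "\<tau>' \<in> ball (y0 q) e"
        then have \<tau>'I: "\<tau>' \<in> X0 \<inter> I" using e(2)[of \<tau>'] by (auto simp: dist_commute)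
        have "comb (?U \<tau>') y2 \<in> chart_image (pc c1 c2)" using comb_in_pc[OF c1 c2(1) _ y2(1)] \<tau>'I by (simp add: I_def)
        from has_pdD[OF smooth_has_pd[OF W H s_less[OF q]] this]
        have "((\<lambda>r. H ((comb (?U \<tau>') y2)(s q := r))) has_vector_derivative ?dH (comb (?U \<tau>') y2)) (at \<tau>')"
          using q by simp
        moreover have "(comb (?U \<tau>') y2)(s q := r) = comb (?U r) y2" for r
          using comb_upd_s[OF q, of "?U \<tau>'" r y2] by simp
        ultimately show "((\<lambda>r. H (comb (?U r) y2)) has_vector_derivative ?dH (comb (?U \<tau>') y2)) (at \<tau>' within ball (y0 q) e)"
          by (simp add: has_vector_derivative_at_within)
        show "norm (?dH (comb (?U \<tau>') y2) - ?dH (comb (?U (y0 q)) y2)) \<le> \<epsilon>"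
          using X0(3)[rule_format, OF \<tau>'I y2(2)] by (simp add: dist_norm)
      next
        show "closed_segment (y0 q) r \<subseteq> ball (y0 q) e"
          using r(1) e(1) by (intro closed_segment_subset) (auto simp: dist_commute)
      qed (use e in auto)
      then have le: "norm (?\<Delta> - (r - y0 q) *\<^sub>R ?dH (comb y0 y2)) \<le> \<bar>r - y0 q\<bar> * \<epsilon>" by simp
      have "?h * ?\<Delta> - ?dH (comb y0 y2) =
          ?h * (?\<Delta> - (r - y0 q) *\<^sub>R ?dH (comb y0 y2))"
      proof -
        have "?h * ((r - y0 q) *\<^sub>R z) = z" for z :: complex
          using r(2) by (simp add: scaleR_conv_of_real flip: of_real_mult mult.assoc)
        then show ?thesis by (simp add: right_diff_distrib)
      qed
      also have "norm \<dots> \<le> inverse \<bar>r - y0 q\<bar> * (\<bar>r - y0 q\<bar> * \<epsilon>)"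
        unfolding norm_mult norm_of_real abs_inverse using le by (intro mult_left_mono) auto
      also have "\<dots> = \<epsilon>" using r(2) by simp
      finally show "norm (iter_partial js (\<lambda>y. ?f y - ?p y) (snd c2 x)) \<le> \<epsilon>"
        using eq by (simp add: y2_def)
    qed
    show "\<forall>\<^sub>F r in at (y0 q). test_le \<tau> (\<lambda>x. f r x - param_deriv [q] \<Phi> y0 x) \<epsilon>"
      unfolding eventually_at using e(1) main by blast
  qed
  moreover have "\<forall>\<^sub>F r in at (y0 q). v (f r) = (v (\<Phi> (?U r)) - v (\<Phi> (?U (y0 q)))) /\<^sub>R (r - y0 q)"
    using evU'
  proof eventually_elim
    case (elim r)
    have "v (f r) = of_real (inverse (r - y0 q)) * v (\<lambda>x. \<Phi> (?U r) x - \<Phi> y0 x)"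
      unfolding f_def
      by (rule compact_distribution_cmult[OF v smooth_functions_diff[OF N2 section_smooth[OF c1 \<Phi> elim] section_smooth[OF c1 \<Phi> y0]]])
    also have "v (\<lambda>x. \<Phi> (?U r) x - \<Phi> y0 x) = v (\<Phi> (?U r)) - v (\<Phi> y0)"
      by (rule compact_distribution_diff[OF N2 v section_smooth[OF c1 \<Phi> elim] section_smooth[OF c1 \<Phi> y0]])
    finally show ?case by (simp add: scaleR_conv_of_real)
  qed
  ultimately show "((\<lambda>r. v (\<Phi> (?U r))) has_vector_derivative v (param_deriv [q] \<Phi> y0)) (at (y0 q))"
    unfolding has_vector_derivative_iff_quotient by (rule Lim_transform_eventually)
qed

text \<open>Applying v turns parameter derivatives of a family into partial derivatives of the
  value. The values of all jointly smooth families thus form a set closed under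
  differentiation.\<close>

lemma distribution_param_smooth:
  assumes \<Phi>: "jointly_smooth c1 \<Phi>"
  shows "smooth_on_Rn n1 (chart_image c1) (\<lambda>y1. v (\<Phi> y1))"
proof (rule smooth_coinduct[OF chart_image_open[OF N1 c1], where S="{\<lambda>y1. v (\<Phi> y1) | \<Phi>. jointly_smooth c1 \<Phi>}"])
  fix f assume "f \<in> {\<lambda>y1. v (\<Phi> y1) | \<Phi>. jointly_smooth c1 \<Phi>}"
  then obtain \<Phi> where f: "f = (\<lambda>y1. v (\<Phi> y1))" "jointly_smooth c1 \<Phi>" by auto
  then show "continuous_on (chart_image c1) f"
    using distribution_param_tendsto by (auto simp: continuous_on_def)
  show "\<exists>f'\<in>{\<lambda>y1. v (\<Phi> y1) | \<Phi>. jointly_smooth c1 \<Phi>}. has_pd i (chart_image c1) f f'" if i: "i < n1" for i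
  proof -
    have "jointly_smooth c1 (param_deriv [i] \<Phi>)" using i by (intro jointly_smooth_param_deriv[OF c1 f(2)]) auto
    then show ?thesis using distribution_param_has_pd[OF f(2) i] unfolding f(1) by blast
  qed
qed (use \<Phi> in auto)

lemma distribution_param_iter_partial:
  assumes \<Phi>: "jointly_smooth c1 \<Phi>" and "set js \<subseteq> {..<n1}" "y1 \<in> chart_image c1"
  shows "iter_partial js (\<lambda>y1. v (\<Phi> y1)) y1 = v (param_deriv js \<Phi> y1)"
  using assms(2,3)
proof (induction js arbitrary: y1)
  case (Cons q js)
  then have q: "q < n1" and js: "set js \<subseteq> {..<n1}" by auto
  have "iter_partial (q # js) (\<lambda>y1. v (\<Phi> y1)) y1 = partial_deriv q (\<lambda>y1. v (param_deriv js \<Phi> y1)) y1"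
    using partial_deriv_cong[OF chart_image_open[OF N1 c1] q Cons.IH[OF js] Cons.prems(2)] by simp
  also have "\<dots> = v (param_deriv [q] (param_deriv js \<Phi>) y1)"
    by (rule has_pd_partial_deriv[OF distribution_param_has_pd[OF jointly_smooth_param_deriv[OF c1 \<Phi> js] q] Cons.prems(2)])
  also have "param_deriv [q] (param_deriv js \<Phi>) = param_deriv (q # js) \<Phi>"
    by (simp add: param_deriv_def[abs_def])
  finally show ?case .
qed (simp add: param_deriv_def[abs_def])

end

section \<open>The tensor product by iterated application\<close>

definition slice :: "('c \<Rightarrow> complex) \<Rightarrow> 'a \<Rightarrow> 'b \<Rightarrow> complex" where
  "slice f x1 = (\<lambda>x2. if x2 \<in> X2 then f (J x1 x2) else 0)"

definition slice_integral :: "(('b \<Rightarrow> complex) \<Rightarrow> complex) \<Rightarrow> ('c \<Rightarrow> complex) \<Rightarrow> 'a \<Rightarrow> complex" where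
  "slice_integral v f = (\<lambda>x1. if x1 \<in> X1 then v (slice f x1) else 0)"

text \<open>Fubini's prescription. It is defined on all smooth functions on N at once and not merely
  on products; the price is the proof that \<open>slice_integral\<close> is smooth.\<close>

definition tensor :: "(('a \<Rightarrow> complex) \<Rightarrow> complex) \<Rightarrow> (('b \<Rightarrow> complex) \<Rightarrow> complex) \<Rightarrow> ('c \<Rightarrow> complex) \<Rightarrow> complex" where
  "tensor u v f = u (slice_integral v f)"

lemma slice_jointly_smooth:
  assumes f: "f \<in> smooth_functions N" and c1: "c1 \<in> atlas N1"
  shows "jointly_smooth c1 (\<lambda>y1. slice f (chart_inv c1 y1))"
  unfolding jointly_smooth_def
proof (intro conjI ballI allI impI)
  fix c2 assume c2: "c2 \<in> atlas N2"
  show "smooth_on_Rn n (chart_image (pc c1 c2)) (coord_rep c2 (\<lambda>y1. slice f (chart_inv c1 y1)))"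
  proof (rule smooth_cong[OF chart_image_open[OF N pc[OF c1 c2]] _ smooth_functions_chart[OF f pc[OF c1 c2]]])
    fix y assume "y \<in> chart_image (pc c1 c2)"
    then have y: "y \<in> euc n" "rs y \<in> chart_image c1" "rt y \<in> chart_image c2" by (simp_all add: chart_image_pc[OF c1 c2])
    then show "f (chart_inv (pc c1 c2) y) = coord_rep c2 (\<lambda>y1. slice f (chart_inv c1 y1)) y"
      using chart_inv_pc[OF c1 c2 y(2,3)] chart_inv_in[OF N2 c2 y(3)] chart_subset[OF N2 c2]
      by (auto simp: coord_rep_def slice_def)
  qed
qed (simp add: slice_def)

lemma slice_smooth:
  assumes f: "f \<in> smooth_functions N" and x1: "x1 \<in> X1"
  shows "slice f x1 \<in> smooth_functions N2"
proof -
  obtain c1 where c1: "c1 \<in> atlas N1" "x1 \<in> fst c1" using charted_cover[OF N1 x1] by blast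
  show ?thesis
    using section_smooth[OF c1(1) slice_jointly_smooth[OF f c1(1)] snd_chart_image[OF N1 c1]]
    by (simp add: chart_inv_snd[OF N1 c1])
qed

lemma slice_integral_smooth:
  assumes v: "compact_distribution N2 v" and f: "f \<in> smooth_functions N"
  shows "slice_integral v f \<in> smooth_functions N1"
  unfolding smooth_functions_def
proof (intro CollectI conjI ballI allI impI)
  fix c1 assume c1: "c1 \<in> atlas N1"
  show "smooth_on_Rn n1 (chart_image c1) (\<lambda>y. slice_integral v f (chart_inv c1 y))"
    by (rule smooth_cong[OF chart_image_open[OF N1 c1] _ distribution_param_smooth[OF c1 v slice_jointly_smooth[OF f c1]]])
      (use chart_inv_in[OF N1 c1] chart_subset[OF N1 c1] in \<open>auto simp: slice_integral_def\<close>)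
qed (simp add: slice_integral_def)

lemma compactin_J:
  assumes "compactin (mtop N1) K1" "compactin (mtop N2) K2"
  shows "compactin (mtop N) ((\<lambda>(x1, x2). J x1 x2) ` (K1 \<times> K2))"
  by (rule image_compactin[OF _ J_continuous]) (use assms in \<open>auto simp: compactin_Times\<close>)

text \<open>A derivative of the slice integral is v applied to a parameter derivative of the slices.
  Bounding u by finitely many seminorms and, for each of them, v by finitely many more leads to
  finitely many seminorms of f on N; the constants multiply.\<close>

lemma tensor_distribution:
  assumes u: "compact_distribution N1 u" and v: "compact_distribution N2 v"
  shows "compact_distribution N (tensor u v)"
proof -
  obtain S1 C1 where S1: "finite S1" "S1 \<subseteq> tests N1" "C1 \<ge> 0"
    "\<And>f B. f \<in> smooth_functions N1 \<Longrightarrow> (\<And>\<tau>. \<tau> \<in> S1 \<Longrightarrow> test_le \<tau> f B) \<Longrightarrow> B \<ge> 0 \<Longrightarrow> norm (u f) \<le> C1 * B"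
    by (rule compact_distribution_bound[OF N1 u]) blast
  obtain S2 C2 where S2: "finite S2" "S2 \<subseteq> tests N2" "C2 \<ge> 0"
    "\<And>f B. f \<in> smooth_functions N2 \<Longrightarrow> (\<And>\<tau>. \<tau> \<in> S2 \<Longrightarrow> test_le \<tau> f B) \<Longrightarrow> B \<ge> 0 \<Longrightarrow> norm (v f) \<le> C2 * B"
    by (rule compact_distribution_bound[OF N2 v]) blast
  \<comment> \<open>The seminorm on N that belongs to a pair of seminorms: product chart, product of
    the compact sets, and both lists of derivatives. Those in N1 are innermost, because they are the
    parameter derivatives of the family to which the bound for v is applied.\<close>
  define T where "T = (\<lambda>(\<tau>1, \<tau>2). case \<tau>1 of (c1, K1, js1) \<Rightarrow> case \<tau>2 of (c2, K2, js2) \<Rightarrow>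
    (pc c1 c2, (\<lambda>(x1, x2). J x1 x2) ` (K1 \<times> K2), map t js2 @ map s js1))"
  show ?thesis
  proof (rule compact_distributionI[OF N, of _ "T ` (S1 \<times> S2)" "C1 * C2"])
    fix f :: "'c \<Rightarrow> complex" assume f: "f \<in> smooth_functions N"
    show "tensor u v (\<lambda>x. a * f x) = a * tensor u v f" for a
    proof -
      have "slice_integral v (\<lambda>x. a * f x) = (\<lambda>x1. a * slice_integral v f x1)"
      proof
        fix x1
        have "slice (\<lambda>x. a * f x) x1 = (\<lambda>x2. a * slice f x1 x2)" by (auto simp: slice_def)
        then show "slice_integral v (\<lambda>x. a * f x) x1 = a * slice_integral v f x1"
          using compact_distribution_cmult[OF v slice_smooth[OF f], of x1 a] by (simp add: slice_integral_def)
      qed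
      then show ?thesis
        using compact_distribution_cmult[OF u slice_integral_smooth[OF v f], of a] by (simp add: tensor_def)
    qed
    show "tensor u v (\<lambda>x. f x + h x) = tensor u v f + tensor u v h" if h: "h \<in> smooth_functions N" for h
    proof -
      have "slice_integral v (\<lambda>x. f x + h x) = (\<lambda>x1. slice_integral v f x1 + slice_integral v h x1)"
      proof
        fix x1
        have "slice (\<lambda>x. f x + h x) x1 = (\<lambda>x2. slice f x1 x2 + slice h x1 x2)" by (auto simp: slice_def)
        then show "slice_integral v (\<lambda>x. f x + h x) x1 = slice_integral v f x1 + slice_integral v h x1"
          using compact_distribution_add[OF v slice_smooth[OF f] slice_smooth[OF h], of x1 x1] by (simp add: slice_integral_def)
      qed
      then show ?thesis
        using compact_distribution_add[OF u slice_integral_smooth[OF v f] slice_integral_smooth[OF v h]] by (simp add: tensor_def)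
    qed
    fix B :: real assume B: "B \<ge> 0" and le: "\<And>\<tau>. \<tau> \<in> T ` (S1 \<times> S2) \<Longrightarrow> test_le \<tau> f B"
    have "norm (tensor u v f) \<le> C1 * (C2 * B)"
      unfolding tensor_def
    proof (rule S1(4)[OF slice_integral_smooth[OF v f]])
      show "C2 * B \<ge> 0" using S2(3) B by simp
      fix \<tau>1 assume \<tau>1: "\<tau>1 \<in> S1"
      obtain c1 K1 js1 where \<tau>1_eq: "\<tau>1 = (c1, K1, js1)" by (cases \<tau>1)
      have c1: "c1 \<in> atlas N1" "K1 \<subseteq> fst c1" "set js1 \<subseteq> {..<n1}" using \<tau>1 S1(2) by (auto simp: \<tau>1_eq tests_def)
      let ?\<Phi> = "\<lambda>y1. slice f (chart_inv c1 y1)"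
      note \<Phi> = slice_jointly_smooth[OF f c1(1)]
      show "test_le \<tau>1 (slice_integral v f) (C2 * B)"
        unfolding test_le_def \<tau>1_eq prod.case
      proof
        fix x1 assume x1: "x1 \<in> K1"
        then have y1: "snd c1 x1 \<in> chart_image c1" using c1(2) by (auto simp: chart_image_def)
        have "iter_partial js1 (\<lambda>y. slice_integral v f (chart_inv c1 y)) (snd c1 x1) = iter_partial js1 (\<lambda>y1. v (?\<Phi> y1)) (snd c1 x1)"
          by (rule iter_partial_cong[OF chart_image_open[OF N1 c1(1)] c1(3) _ y1])
            (use chart_inv_in[OF N1 c1(1)] chart_subset[OF N1 c1(1)] in \<open>auto simp: slice_integral_def\<close>)
        also have "\<dots> = v (param_deriv js1 ?\<Phi> (snd c1 x1))"
          by (rule distribution_param_iter_partial[OF c1(1) v \<Phi> c1(3) y1])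
        also have "norm \<dots> \<le> C2 * B"
        proof (rule S2(4)[OF section_smooth[OF c1(1) jointly_smooth_param_deriv[OF c1(1) \<Phi> c1(3)] y1] _ B])
          fix \<tau>2 assume \<tau>2: "\<tau>2 \<in> S2"
          obtain c2 K2 js2 where \<tau>2_eq: "\<tau>2 = (c2, K2, js2)" by (cases \<tau>2)
          have c2: "c2 \<in> atlas N2" "K2 \<subseteq> fst c2" "set js2 \<subseteq> {..<n2}" using \<tau>2 S2(2) by (auto simp: \<tau>2_eq tests_def)
          have tle: "test_le (T (\<tau>1, \<tau>2)) f B" using le \<tau>1 \<tau>2 by blast
          show "test_le \<tau>2 (param_deriv js1 ?\<Phi> (snd c1 x1)) B"
            unfolding test_le_def \<tau>2_eq prod.case
          proof
            fix x2 assume x2: "x2 \<in> K2"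
            then have y2: "snd c2 x2 \<in> chart_image c2" using c2(2) by (auto simp: chart_image_def)
            have jj: "set (map t js2 @ map s js1) \<subseteq> {..<n}" using c1(3) c2(3) s_less t_less by auto
            have y: "comb (snd c1 x1) (snd c2 x2) \<in> chart_image (pc c1 c2)" by (rule comb_in_pc[OF c1(1) c2(1) y1 y2])
            have "iter_partial js2 (\<lambda>y. param_deriv js1 ?\<Phi> (snd c1 x1) (chart_inv c2 y)) (snd c2 x2) =
                iter_partial (map t js2 @ map s js1) (coord_rep c2 ?\<Phi>) (comb (snd c1 x1) (snd c2 x2))"
              by (simp add: section_iter_partial[OF c1(1) y1 c2(1) y2 c2(3)] coord_rep_param_deriv[OF c1(3)] iter_partial_append)
            also have "\<dots> = iter_partial (map t js2 @ map s js1) (\<lambda>y. f (chart_inv (pc c1 c2) y)) (comb (snd c1 x1) (snd c2 x2))"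
            proof (rule iter_partial_cong[OF chart_image_open[OF N pc[OF c1(1) c2(1)]] jj _ y])
              fix y assume "y \<in> chart_image (pc c1 c2)"
              then have y: "y \<in> euc n" "rs y \<in> chart_image c1" "rt y \<in> chart_image c2" by (simp_all add: chart_image_pc[OF c1(1) c2(1)])
              then show "coord_rep c2 ?\<Phi> y = f (chart_inv (pc c1 c2) y)"
                using chart_inv_pc[OF c1(1) c2(1) y(2,3)] chart_inv_in[OF N2 c2(1) y(3)] chart_subset[OF N2 c2(1)]
                by (auto simp: coord_rep_def slice_def)
            qed
            also have "comb (snd c1 x1) (snd c2 x2) = snd (pc c1 c2) (J x1 x2)"
              using snd_pc[OF c1(1) c2(1) subsetD[OF c1(2) x1] subsetD[OF c2(2) x2]] by (rule sym)
            finally show "norm (iter_partial js2 (\<lambda>y. param_deriv js1 ?\<Phi> (snd c1 x1) (chart_inv c2 y)) (snd c2 x2)) \<le> B"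
              using tle x1 x2 by (auto simp: test_le_def T_def \<tau>1_eq \<tau>2_eq)
          qed
        qed
        finally show "norm (iter_partial js1 (\<lambda>y. slice_integral v f (chart_inv c1 y)) (snd c1 x1)) \<le> C2 * B" .
      qed
    qed
    then show "norm (tensor u v f) \<le> C1 * C2 * B" by (simp add: mult.assoc)
  next
    show "T ` (S1 \<times> S2) \<subseteq> tests N"
    proof
      fix \<tau> assume "\<tau> \<in> T ` (S1 \<times> S2)"
      then obtain c1 K1 js1 c2 K2 js2 where *: "(c1, K1, js1) \<in> S1" "(c2, K2, js2) \<in> S2"
        "\<tau> = (pc c1 c2, (\<lambda>(x1, x2). J x1 x2) ` (K1 \<times> K2), map t js2 @ map s js1)"
        by (force simp: T_def)
      then have c: "(c1, K1, js1) \<in> tests N1" "(c2, K2, js2) \<in> tests N2" using S1(2) S2(2) by auto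
      then have "fst (pc c1 c2) = (\<lambda>(x1, x2). J x1 x2) ` (fst c1 \<times> fst c2)" by (intro pc_fst) (auto simp: tests_def)
      then show "\<tau> \<in> tests N"
        using c s_less t_less unfolding *(3) tests_def by (auto intro: pc compactin_J)
    qed
  qed (use S1 S2 in auto)
qed

lemma tensor_product:
  assumes u: "compact_distribution N1 u" and v: "compact_distribution N2 v"
    and f1: "f1 \<in> smooth_functions N1" and f2: "f2 \<in> smooth_functions N2"
    and f: "\<And>x1 x2. x1 \<in> X1 \<Longrightarrow> x2 \<in> X2 \<Longrightarrow> f (J x1 x2) = f1 x1 * f2 x2"
  shows "tensor u v f = u f1 * v f2"
proof -
  have "slice_integral v f = (\<lambda>x1. v f2 * f1 x1)"
  proof
    fix x1
    show "slice_integral v f x1 = v f2 * f1 x1"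
    proof (cases "x1 \<in> X1")
      case True
      have "slice f x1 = (\<lambda>x2. f1 x1 * f2 x2)"
        using f True smooth_functions_zero[OF f2] by (auto simp: slice_def)
      then show ?thesis using True compact_distribution_cmult[OF v f2, of "f1 x1"] by (simp add: slice_integral_def mult.commute)
    qed (use smooth_functions_zero[OF f1] in \<open>simp add: slice_integral_def\<close>)
  qed
  then show ?thesis using compact_distribution_cmult[OF u f1, of "v f2"] by (simp add: tensor_def mult.commute)
qed


lemma expo_pc: "y1 \<in> euc n1 \<Longrightarrow> y2 \<in> euc n2 \<Longrightarrow> expo n \<eta> (comb y1 y2) = expo n1 (rs \<eta>) y1 * expo n2 (rt \<eta>) y2"
  by (simp add: expo_def cis_mult index_split_sum[OF st] index_pull_def)

definition tensor_fun :: "('a \<Rightarrow> complex) \<Rightarrow> ('b \<Rightarrow> complex) \<Rightarrow> 'c \<Rightarrow> complex" where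
  "tensor_fun f1 f2 = (\<lambda>x. if x \<in> topspace (mtop N) then f1 (\<pi>1 x) * f2 (\<pi>2 x) else 0)"

lemma tensor_fun_J: "x1 \<in> X1 \<Longrightarrow> x2 \<in> X2 \<Longrightarrow> tensor_fun f1 f2 (J x1 x2) = f1 x1 * f2 x2"
  by (simp add: tensor_fun_def J \<pi>J)

lemma tensor_fun_smooth:
  assumes f1: "f1 \<in> smooth_functions N1" and f2: "f2 \<in> smooth_functions N2"
  shows "tensor_fun f1 f2 \<in> smooth_functions N"
  unfolding smooth_functions_def
proof (intro CollectI conjI ballI allI impI)
  fix c assume "c \<in> atlas N"
  then obtain c1 c2 where c: "c1 \<in> atlas N1" "c2 \<in> atlas N2" "c = pc c1 c2" using pc_surj by blast
  have V: "openin (Euclidean_space n) (chart_image c)" unfolding c(3) by (rule chart_image_open[OF N pc[OF c(1,2)]])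
  have "smooth_on_Rn n (chart_image c) (\<lambda>y. f1 (chart_inv c1 (rs y)) * f2 (chart_inv c2 (rt y)))"
  proof (rule smooth_mult[OF V])
    show "smooth_on_Rn n (chart_image c) (\<lambda>y. f1 (chart_inv c1 (rs y)))"
      by (rule smooth_compose[OF V chart_image_open[OF N1 c(1)] smooth_functions_chart[OF f1 c(1)]])
        (use smooth_coord[OF V] in \<open>auto simp: c(3) chart_image_pc[OF c(1,2)] index_pull_def\<close>)
    show "smooth_on_Rn n (chart_image c) (\<lambda>y. f2 (chart_inv c2 (rt y)))"
      by (rule smooth_compose[OF V chart_image_open[OF N2 c(2)] smooth_functions_chart[OF f2 c(2)]])
        (use smooth_coord[OF V] in \<open>auto simp: c(3) chart_image_pc[OF c(1,2)] index_pull_def\<close>)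
  qed
  then show "smooth_on_Rn n (chart_image c) (\<lambda>y. tensor_fun f1 f2 (chart_inv c y))"
  proof (rule smooth_cong[OF V, rotated])
    fix y assume "y \<in> chart_image c"
    then have y: "y \<in> euc n" "rs y \<in> chart_image c1" "rt y \<in> chart_image c2" by (simp_all add: c(3) chart_image_pc[OF c(1,2)])
    then show "f1 (chart_inv c1 (rs y)) * f2 (chart_inv c2 (rt y)) = tensor_fun f1 f2 (chart_inv c y)"
      using chart_inv_pc[OF c(1,2) y(2,3)] chart_inv_in[OF N1 c(1) y(2)] chart_inv_in[OF N2 c(2) y(3)]
        chart_subset[OF N1 c(1)] chart_subset[OF N2 c(2)] by (auto simp: c(3) tensor_fun_J subset_iff)
  qed
qed (simp add: tensor_fun_def)

text \<open>The support lies in the image under J of the product of the two supports, which is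
  compact and, N being Hausdorff, closed.\<close>

lemma tensor_fun_cutoff:
  assumes c: "c1 \<in> atlas N1" "c2 \<in> atlas N2" and \<rho>1: "cutoff N1 c1 \<rho>1" and \<rho>2: "cutoff N2 c2 \<rho>2"
  shows "cutoff N (pc c1 c2) (tensor_fun \<rho>1 \<rho>2)"
proof -
  let ?K = "(\<lambda>(x1, x2). J x1 x2) ` (fun_support N1 \<rho>1 \<times> fun_support N2 \<rho>2)"
  have K: "compactin (mtop N) ?K" by (rule compactin_J) (use \<rho>1 \<rho>2 in \<open>auto simp: cutoff_def\<close>)
  have cl: "closedin (mtop N) ?K" using compactin_imp_closedin[OF _ K] N by (simp add: charted_def)
  have "{x \<in> topspace (mtop N). tensor_fun \<rho>1 \<rho>2 x \<noteq> 0} \<subseteq> ?K"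
  proof
    fix x assume x: "x \<in> {x \<in> topspace (mtop N). tensor_fun \<rho>1 \<rho>2 x \<noteq> 0}"
    then have "\<rho>1 (\<pi>1 x) \<noteq> 0" "\<rho>2 (\<pi>2 x) \<noteq> 0" by (auto simp: tensor_fun_def)
    then have "\<pi>1 x \<in> fun_support N1 \<rho>1" "\<pi>2 x \<in> fun_support N2 \<rho>2"
      using fun_support_outside[of "\<pi>1 x" N1 \<rho>1] fun_support_outside[of "\<pi>2 x" N2 \<rho>2] \<pi>(1,2)[of x] x by auto
    then show "x \<in> ?K" using x \<pi>(3)[of x] by (force intro: image_eqI[of _ _ "(\<pi>1 x, \<pi>2 x)"])
  qed
  then have sub: "fun_support N (tensor_fun \<rho>1 \<rho>2) \<subseteq> ?K"
    unfolding fun_support_def[of N "tensor_fun \<rho>1 \<rho>2"] by (rule closure_of_minimal[OF _ cl])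
  moreover have "?K \<subseteq> fst (pc c1 c2)" using \<rho>1 \<rho>2 by (auto simp: pc_fst[OF c] cutoff_def)
  ultimately show ?thesis
    using closed_compactin[OF K sub fun_support_closed] \<rho>1 \<rho>2 by (auto simp: cutoff_def tensor_fun_smooth)
qed

text \<open>In a product chart the exponential is a product of exponentials, so with a product
  cutoff the integrand separates. Where a point leaves its chart the coordinates mean nothing, but
  there one of the cutoffs is 0.\<close>

lemma local_fourier_tensor:
  assumes c: "c1 \<in> atlas N1" "c2 \<in> atlas N2" and \<rho>1: "cutoff N1 c1 \<rho>1" and \<rho>2: "cutoff N2 c2 \<rho>2"
    and u: "compact_distribution N1 u" and v: "compact_distribution N2 v"
  shows "local_fourier N (pc c1 c2) (tensor u v) (tensor_fun \<rho>1 \<rho>2) \<eta> = local_fourier N1 c1 u \<rho>1 (rs \<eta>) * local_fourier N2 c2 v \<rho>2 (rt \<eta>)"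
  unfolding local_fourier_expo
proof (rule tensor_product[OF u v])
  show "(\<lambda>x. \<rho>1 x * expo n1 (rs \<eta>) (snd c1 x)) \<in> smooth_functions N1"
    by (rule cutoff_times_smooth[OF N1 c(1) \<rho>1 openin_euc chart_image_subset[OF N1 c(1)] smooth_expo[OF openin_euc]])
  show "(\<lambda>x. \<rho>2 x * expo n2 (rt \<eta>) (snd c2 x)) \<in> smooth_functions N2"
    by (rule cutoff_times_smooth[OF N2 c(2) \<rho>2 openin_euc chart_image_subset[OF N2 c(2)] smooth_expo[OF openin_euc]])
  fix x1 x2 assume x: "x1 \<in> X1" "x2 \<in> X2"
  show "tensor_fun \<rho>1 \<rho>2 (J x1 x2) * expo n \<eta> (snd (pc c1 c2) (J x1 x2)) =
      \<rho>1 x1 * expo n1 (rs \<eta>) (snd c1 x1) * (\<rho>2 x2 * expo n2 (rt \<eta>) (snd c2 x2))"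
  proof (cases "x1 \<in> fst c1 \<and> x2 \<in> fst c2")
    case True
    then have "snd c1 x1 \<in> euc n1" "snd c2 x2 \<in> euc n2"
      using chart_image_subset[OF N1 c(1)] chart_image_subset[OF N2 c(2)] by (auto simp: chart_image_def)
    then show ?thesis using True x by (simp add: snd_pc[OF c] expo_pc tensor_fun_J)
  next
    case False
    then have "\<rho>1 x1 = 0 \<or> \<rho>2 x2 = 0"
      using fun_support_outside[OF x(1), of \<rho>1] fun_support_outside[OF x(2), of \<rho>2] \<rho>1 \<rho>2 by (auto simp: cutoff_def)
    then show ?thesis using x by (auto simp: tensor_fun_J)
  qed
qed

lemma tensor_regular_direction:
  assumes c: "c1 \<in> atlas N1" "c2 \<in> atlas N2" and \<rho>1: "cutoff N1 c1 \<rho>1" and \<rho>2: "cutoff N2 c2 \<rho>2"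
    and u: "compact_distribution N1 u" and v: "compact_distribution N2 v" and \<eta>0: "\<eta>0 \<in> euc n"
    and reg: "(\<exists>q<n1. \<eta>0 (s q) \<noteq> 0) \<and> regular_direction n1 (local_fourier N1 c1 u \<rho>1) (rs \<eta>0) \<or>
      (\<exists>q<n2. \<eta>0 (t q) \<noteq> 0) \<and> regular_direction n2 (local_fourier N2 c2 v \<rho>2) (rt \<eta>0)"
  shows "regular_direction n (local_fourier N (pc c1 c2) (tensor u v) (tensor_fun \<rho>1 \<rho>2)) \<eta>0"
  unfolding local_fourier_tensor[OF c \<rho>1 \<rho>2 u v, abs_def]
  using reg
proof
  assume "(\<exists>q<n1. \<eta>0 (s q) \<noteq> 0) \<and> regular_direction n1 (local_fourier N1 c1 u \<rho>1) (rs \<eta>0)"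
  then obtain q where q: "q < n1" "\<eta>0 (s q) \<noteq> 0" and r: "regular_direction n1 (local_fourier N1 c1 u \<rho>1) (rs \<eta>0)" by blast
  obtain p C where C: "C \<ge> 0" "\<And>\<eta>. norm (local_fourier N2 c2 v \<rho>2 \<eta>) \<le> C * (1 + enorm n2 \<eta>) ^ p"
    by (rule local_fourier_polynomial_bound[OF N2 c(2) \<rho>2 v]) blast
  show "regular_direction n (\<lambda>\<eta>. local_fourier N1 c1 u \<rho>1 (rs \<eta>) * local_fourier N2 c2 v \<rho>2 (rt \<eta>)) \<eta>0"
    by (rule regular_direction_product[OF st \<eta>0 q r C])
next
  assume "(\<exists>q<n2. \<eta>0 (t q) \<noteq> 0) \<and> regular_direction n2 (local_fourier N2 c2 v \<rho>2) (rt \<eta>0)"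
  then obtain q where q: "q < n2" "\<eta>0 (t q) \<noteq> 0" and r: "regular_direction n2 (local_fourier N2 c2 v \<rho>2) (rt \<eta>0)" by blast
  obtain p C where C: "C \<ge> 0" "\<And>\<eta>. norm (local_fourier N1 c1 u \<rho>1 \<eta>) \<le> C * (1 + enorm n1 \<eta>) ^ p"
    by (rule local_fourier_polynomial_bound[OF N1 c(1) \<rho>1 u]) blast
  show "regular_direction n (\<lambda>\<eta>. local_fourier N1 c1 u \<rho>1 (rs \<eta>) * local_fourier N2 c2 v \<rho>2 (rt \<eta>)) \<eta>0"
    using regular_direction_product[OF index_split_swap[OF st] \<eta>0 q r C] by (simp add: mult.commute)
qed

end

section \<open>Cutoff functions\<close>

text \<open>The polynomial factor makes the classical flat functions a family closed under
  differentiation, also at 0, where the exponential decay beats every polynomial in 1 / t. The case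
  p = 1 is the usual building block of bump functions.\<close>

definition flat :: "real poly \<Rightarrow> real \<Rightarrow> real" where
  "flat p t = (if t > 0 then poly p (1 / t) * exp (- 1 / t) else 0)"

lemma poly_times_exp_tendsto_0:
  fixes p :: "real poly"
  shows "((\<lambda>x. poly p x / exp x) \<longlongrightarrow> 0) at_top"
proof -
  have "((\<lambda>x. \<Sum>i\<le>degree p. coeff p i * (x ^ i / exp x)) \<longlongrightarrow> (\<Sum>i\<le>degree p. coeff p i * 0)) at_top"
    by (intro tendsto_intros tendsto_power_div_exp_0)
  then show ?thesis by (simp add: poly_altdef sum_divide_distrib)
qed

text \<open>For t > 0 the factor 1 / t^2 from differentiating 1 / t becomes multiplication by x^2 in
  the variable x = 1 / t, and the product rule leaves p minus its derivative. At 0 the right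
  difference quotient becomes x p(x) / exp x with x tending to infinity.\<close>

lemma flat_derivative: "(flat p has_vector_derivative flat ([:0, 0, 1:] * (p - pderiv p)) t) (at t)"
proof -
  consider "t > 0" | "t < 0" | "t = 0" by linarith
  then show ?thesis
  proof cases
    case 1
    have "((\<lambda>t. poly p (1 / t) * exp (- 1 / t)) has_real_derivative flat ([:0, 0, 1:] * (p - pderiv p)) t) (at t)"
      using 1 by (auto intro!: derivative_eq_intros simp: flat_def field_simps power2_eq_square)
    moreover have "\<forall>\<^sub>F s in nhds t. s \<in> {0<..}" using 1 by (intro eventually_nhds_in_open) auto
    then have "\<forall>\<^sub>F s in nhds t. poly p (1 / s) * exp (- 1 / s) = flat p s" by eventually_elim (simp add: flat_def)
    ultimately show ?thesis
      unfolding has_real_derivative_iff_has_vector_derivative[symmetric] by (subst DERIV_cong_ev[OF refl _ refl, symmetric])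
  next
    case 2
    have "\<forall>\<^sub>F s in nhds t. s \<in> {..<0}" using 2 by (intro eventually_nhds_in_open) auto
    then have "\<forall>\<^sub>F s in nhds t. 0 = flat p s" by eventually_elim (simp add: flat_def)
    then have "(flat p has_real_derivative 0) (at t)"
      using DERIV_cong_ev[OF refl _ refl, of "\<lambda>_. 0" "flat p" t 0] by simp
    then show ?thesis using 2 by (simp add: has_real_derivative_iff_has_vector_derivative flat_def)
  next
    case 3
    have r: "((\<lambda>s. flat p s /\<^sub>R s) \<longlongrightarrow> 0) (at_right 0)"
    proof -
      have "((\<lambda>x. poly ([:0, 1:] * p) x / exp x) \<longlongrightarrow> 0) at_top" by (rule poly_times_exp_tendsto_0)
      from filterlim_compose[OF this filterlim_inverse_at_top_right]
      have "((\<lambda>s. poly ([:0, 1:] * p) (inverse s) / exp (inverse s)) \<longlongrightarrow> 0) (at_right 0)" .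
      moreover have "\<forall>\<^sub>F s in at_right 0. poly ([:0, 1:] * p) (inverse s) / exp (inverse s) = flat p s /\<^sub>R s"
        unfolding eventually_at_filter by (intro always_eventually) (auto simp: flat_def exp_minus divide_inverse)
      ultimately show ?thesis by (rule Lim_transform_eventually)
    qed
    have l: "((\<lambda>s. flat p s /\<^sub>R s) \<longlongrightarrow> 0) (at_left 0)"
      by (rule tendsto_eventually) (simp add: eventually_at_filter flat_def)
    have "((\<lambda>s. flat p s /\<^sub>R s) \<longlongrightarrow> 0) (at 0)" using l r filterlim_split_at by blast
    then show ?thesis using 3 by (simp add: has_vector_derivative_iff_quotient flat_def)
  qed
qed

lemma smooth_flat:
  assumes "openin (Euclidean_space n) V" "smooth_on_Rn n V g"
  shows "smooth_on_Rn n V (\<lambda>y. flat p (g y))"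
  by (rule smooth_compose_family[OF assms(1) _ _ assms(2), where H="range flat"]) (auto intro: flat_derivative)

lemma smooth_prod:
  fixes f :: "'i \<Rightarrow> (nat \<Rightarrow> real) \<Rightarrow> 'b::{real_normed_algebra, comm_monoid_mult}"
  assumes "openin (Euclidean_space n) V" "\<And>i. i \<in> I \<Longrightarrow> smooth_on_Rn n V (f i)"
  shows "smooth_on_Rn n V (\<lambda>y. \<Prod>i\<in>I. f i y)"
  using assms(2) by (induction I rule: infinite_finite_induct) (auto intro: assms smooth_const smooth_mult)

lemma compact_box: "compact {z \<in> euc n. \<forall>i<n. \<bar>z i - y i\<bar> \<le> \<delta>}"
proof -
  let ?S = "\<lambda>i. if i < n then {y i - \<delta>..y i + \<delta>} else {0::real}"
  have "compactin (product_topology (\<lambda>i. euclidean) UNIV) (PiE UNIV ?S)"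
    by (subst compactin_PiE) auto
  moreover have "PiE UNIV ?S = {z \<in> euc n. \<forall>i<n. \<bar>z i - y i\<bar> \<le> \<delta>}"
  proof (intro set_eqI iffI)
    fix z assume z: "z \<in> PiE UNIV ?S"
    then have "z i \<in> ?S i" for i by (rule PiE_mem) simp
    then have "i < n \<Longrightarrow> y i - \<delta> \<le> z i \<and> z i \<le> y i + \<delta>" "n \<le> i \<Longrightarrow> z i = 0" for i
      by (metis atLeastAtMost_iff, metis not_le singletonD)
    then show "z \<in> {z \<in> euc n. \<forall>i<n. \<bar>z i - y i\<bar> \<le> \<delta>}" by (force simp: euc_def abs_le_iff)
  next
    fix z assume "z \<in> {z \<in> euc n. \<forall>i<n. \<bar>z i - y i\<bar> \<le> \<delta>}"
    then show "z \<in> PiE UNIV ?S" by (force simp: euc_def abs_le_iff not_less)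
  qed
  ultimately show ?thesis by (simp add: euclidean_product_topology)
qed

text \<open>A product of flat functions, one for each coordinate, which vanishes outside the box of
  half-width \<delta> / 2 around the image of x. The closed box is compact inside the chart image,
  so its preimage is compact and, in a Hausdorff space, closed; hence the extension by 0 is
  smooth.\<close>

lemma cutoff_exists:
  assumes N: "charted N" and c: "c \<in> atlas N" and x: "x \<in> fst c"
  obtains \<rho> where "cutoff N c \<rho>" "\<rho> x \<noteq> 0"
proof -
  let ?n = "mdim N" and ?y = "snd c x"
  note V = chart_image_open[OF N c]
  obtain \<delta> where \<delta>: "\<delta> > 0" "\<And>z. z \<in> euc ?n \<Longrightarrow> (\<And>i. i < ?n \<Longrightarrow> \<bar>z i - ?y i\<bar> < \<delta>) \<Longrightarrow> z \<in> chart_image c"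
    using openin_euc_box[OF V snd_chart_image[OF N c x]] by blast
  define B where "B = {z \<in> euc ?n. \<forall>i<?n. \<bar>z i - ?y i\<bar> \<le> \<delta> / 2}"
  have B: "compact B" "B \<subseteq> chart_image c"
    using compact_box[of ?n ?y "\<delta> / 2"] \<delta> by (auto simp: B_def) (smt (verit) field_sum_of_halves)
  define K where "K = chart_inv c ` B"
  have K: "compactin (mtop N) K" "K \<subseteq> fst c"
    using image_compactin[OF _ chart_inv_continuous[OF N c], of B] B chart_inv_in[OF N c]
    by (auto simp: K_def compactin_subtopology)
  have Kc: "closedin (mtop N) K" using compactin_imp_closedin[OF _ K(1)] N by (simp add: charted_def)
  define \<beta> where "\<beta> z = (\<Prod>i<?n. complex_of_real (flat 1 ((\<delta> / 2)\<^sup>2 - (z i - ?y i)\<^sup>2)))" for z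
  have \<beta>: "smooth_on_Rn ?n (euc ?n) \<beta>"
    unfolding \<beta>_def[abs_def]
  proof (intro smooth_prod[OF openin_euc] smooth_bounded_linear[OF openin_euc bounded_linear_of_real] smooth_flat[OF openin_euc])
    fix i
    have "smooth_on_Rn ?n (euc ?n) (\<lambda>z. (\<delta> / 2)\<^sup>2 + (-1) * ((z i + (- ?y i)) * (z i + (- ?y i))))"
      by (intro smooth_add smooth_mult smooth_const smooth_coord openin_euc)
    then show "smooth_on_Rn ?n (euc ?n) (\<lambda>z. (\<delta> / 2)\<^sup>2 - (z i - ?y i)\<^sup>2)" by (simp add: power2_eq_square)
  qed
  have \<beta>0: "\<beta> z = 0" if z: "z \<in> euc ?n" "z \<notin> B" for z
  proof -
    obtain i where i: "i < ?n" "\<not> \<bar>z i - ?y i\<bar> \<le> \<delta> / 2" using z by (auto simp: B_def)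
    then have "(\<delta> / 2)\<^sup>2 \<le> (z i - ?y i)\<^sup>2" using \<delta>(1) by (intro abs_le_square_iff[THEN iffD1]) auto
    then show ?thesis unfolding \<beta>_def by (intro prod_zero) (use i in \<open>auto simp: flat_def not_less intro!: bexI[of _ i]\<close>)
  qed
  define \<rho> where "\<rho> x = (if x \<in> fst c then \<beta> (snd c x) else 0)" for x
  have \<rho>0: "\<rho> z = 0" if "z \<notin> K" for z
  proof (cases "z \<in> fst c")
    case True
    then have "snd c z \<notin> B" using that chart_inv_snd[OF N c True] by (metis K_def image_eqI)
    moreover have "snd c z \<in> euc ?n" using True snd_chart_image[OF N c] chart_image_subset[OF N c] by auto
    ultimately show ?thesis by (simp add: \<rho>_def \<beta>0)
  qed (simp add: \<rho>_def)
  have sm: "\<rho> \<in> smooth_functions N"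
  proof (rule smooth_functions_localI[OF N])
    show "\<rho> z = 0" if "z \<notin> topspace (mtop N)" for z using that chart_subset[OF N c] by (auto simp: \<rho>_def)
    fix z assume z: "z \<in> topspace (mtop N)"
    show "\<exists>U c'. openin (mtop N) U \<and> z \<in> U \<and> c' \<in> atlas N \<and> z \<in> fst c' \<and>
        smooth_on_Rn ?n (snd c' ` (fst c' \<inter> U)) (\<lambda>y. \<rho> (chart_inv c' y))"
    proof (cases "z \<in> fst c")
      case True
      have "smooth_on_Rn ?n (chart_image c) (\<lambda>y. \<rho> (chart_inv c y))"
        by (rule smooth_cong[OF V _ smooth_subset[OF openin_euc V chart_image_subset[OF N c] \<beta>]])
          (simp add: \<rho>_def chart_inv_in[OF N c] snd_chart_inv[OF N c])
      then show ?thesis using True c chart_open[OF N c]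
        by (intro exI[of _ "fst c"] exI[of _ c]) (simp add: chart_image_def)
    next
      case False
      obtain c' where c': "c' \<in> atlas N" "z \<in> fst c'" using charted_cover[OF N z] by blast
      have U: "openin (mtop N) (topspace (mtop N) - K)" by (intro openin_diff openin_topspace Kc)
      have "smooth_on_Rn ?n (snd c' ` (fst c' \<inter> (topspace (mtop N) - K))) (\<lambda>y. \<rho> (chart_inv c' y))"
        by (rule smooth_cong[OF chart_open_image[OF N c'(1) U] _ smooth_const[OF chart_open_image[OF N c'(1) U], of 0]])
          (auto simp: chart_inv_snd[OF N c'(1)] \<rho>0)
      then show ?thesis using U c' z False K(2) by blast
    qed
  qed
  have "fun_support N \<rho> \<subseteq> K"
    unfolding fun_support_def by (rule closure_of_minimal[OF _ Kc]) (use \<rho>0 in auto)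
  then have "cutoff N c \<rho>"
    using sm K closed_compactin[OF K(1) _ fun_support_closed] by (auto simp: cutoff_def)
  moreover have "\<rho> x \<noteq> 0" using x \<delta>(1) by (auto simp: \<rho>_def \<beta>_def flat_def)
  ultimately show ?thesis by (rule that)
qed

section \<open>Powers of a manifold\<close>

lemma power_manifold_simps [simp]:
  "mtop (power_manifold M k) = product_topology (\<lambda>_. mtop M) {..<k}"
  "mdim (power_manifold M k) = k * mdim M"
  "atlas (power_manifold M k) = {product_chart M k c | c. \<forall>j<k. c j \<in> atlas M}"
  by (simp_all add: power_manifold_def)

lemma fst_product_chart [simp]: "fst (product_chart M k c) = PiE {..<k} (\<lambda>j. fst (c j))"
  by (simp add: product_chart_def)

abbreviation blk :: "nat \<Rightarrow> nat \<Rightarrow> (nat \<Rightarrow> real) \<Rightarrow> nat \<Rightarrow> real" where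
  "blk d j \<equiv> index_pull d (\<lambda>i. j * d + i)"

lemma block_index_less: "j < k \<Longrightarrow> i < d \<Longrightarrow> j * d + i < k * (d::nat)"
proof -
  assume "j < k" "i < d"
  then have "j * d + i < (j + 1) * d" by simp
  also have "\<dots> \<le> k * d" using \<open>j < k\<close> by (intro mult_right_mono) auto
  finally show ?thesis .
qed

lemma block_index_cases:
  assumes "m < k * (d::nat)"
  shows "m div d < k" "m mod d < d" "m = (m div d) * d + m mod d"
proof -
  have d: "d > 0" using assms by (cases d) auto
  then show "m div d < k" "m mod d < d" "m = (m div d) * d + m mod d"
    using assms by (auto simp: div_less_iff_less_mult)
qed

lemma snd_product_chart: "j < k \<Longrightarrow> i < mdim M \<Longrightarrow> snd (product_chart M k c) x (j * mdim M + i) = snd (c j) (x j) i"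
  using block_index_less[of j k i "mdim M"] by (simp add: product_chart_def)

lemma snd_product_chart_euc: "snd (product_chart M k c) x \<in> euc (k * mdim M)"
  by (simp add: product_chart_def euc_def)

lemma blk_eqI:
  assumes "y \<in> euc (k * d)" "y' \<in> euc (k * d)" "\<And>j. j < k \<Longrightarrow> blk d j y = blk d j y'"
  shows "y = y'"
proof
  fix m show "y m = y' m"
  proof (cases "m < k * d")
    case True
    from block_index_cases[OF this] have *: "m div d < k" "m mod d < d" "m = (m div d) * d + m mod d" by auto
    from assms(3)[OF *(1)] have "blk d (m div d) y (m mod d) = blk d (m div d) y' (m mod d)" by simp
    then show ?thesis using *(2,3) by (simp add: index_pull_def)
  qed (use assms(1,2) in \<open>simp add: euc_def\<close>)
qed

lemma blk_open:
  assumes "\<And>j. j < k \<Longrightarrow> openin (Euclidean_space d) (O' j)"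
  shows "openin (Euclidean_space (k * d)) {y \<in> euc (k * d). \<forall>j<k. blk d j y \<in> O' j}"
proof -
  have "\<exists>T. j < k \<longrightarrow> open T \<and> O' j = euc d \<inter> T" for j
    using assms[of j] by (auto simp: Euclidean_space_eq openin_open)
  then obtain T where T: "\<And>j. j < k \<Longrightarrow> open (T j) \<and> O' j = euc d \<inter> T j" by metis
  have "open (\<Inter>j<k. blk d j -` T j)"
    by (intro open_INT finite_lessThan ballI open_vimage index_pull_continuous) (use T in auto)
  then have "openin (Euclidean_space (k * d)) (euc (k * d) \<inter> (\<Inter>j<k. blk d j -` T j))"
    unfolding Euclidean_space_eq by (rule openin_open_Int)
  also have "euc (k * d) \<inter> (\<Inter>j<k. blk d j -` T j) = {y \<in> euc (k * d). \<forall>j<k. blk d j y \<in> O' j}"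
    using T by auto
  finally show ?thesis .
qed

context
  fixes M :: "('a, 'z) manifold_scheme" and k :: nat
  assumes M: "charted M"
begin

lemma blk_product_chart:
  assumes c: "\<forall>j<k. c j \<in> atlas M" and "j < k" "x j \<in> fst (c j)"
  shows "blk (mdim M) j (snd (product_chart M k c) x) = snd (c j) (x j)"
proof
  fix i
  have "snd (c j) (x j) \<in> euc (mdim M)"
    using chart_image_subset[OF M, of "c j"] assms by (auto simp: chart_image_def)
  then show "blk (mdim M) j (snd (product_chart M k c) x) i = snd (c j) (x j) i"
    using assms by (auto simp: index_pull_def snd_product_chart euc_def)
qed

lemma product_chart_image_PiE:
  assumes c: "\<forall>j<k. c j \<in> atlas M" and A: "\<And>j. j < k \<Longrightarrow> A j \<subseteq> fst (c j)"
  shows "snd (product_chart M k c) ` PiE {..<k} A = {y \<in> euc (k * mdim M). \<forall>j<k. blk (mdim M) j y \<in> snd (c j) ` A j}"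
proof (intro set_eqI iffI)
  fix y assume "y \<in> snd (product_chart M k c) ` PiE {..<k} A"
  then obtain x where x: "x \<in> PiE {..<k} A" "y = snd (product_chart M k c) x" by auto
  then have "j < k \<Longrightarrow> x j \<in> A j" for j by auto
  then show "y \<in> {y \<in> euc (k * mdim M). \<forall>j<k. blk (mdim M) j y \<in> snd (c j) ` A j}"
    using A by (auto simp: x(2) snd_product_chart_euc blk_product_chart[OF c] subset_iff)
next
  fix y assume y: "y \<in> {y \<in> euc (k * mdim M). \<forall>j<k. blk (mdim M) j y \<in> snd (c j) ` A j}"
  then obtain x where x: "\<And>j. j < k \<Longrightarrow> x j \<in> A j \<and> blk (mdim M) j y = snd (c j) (x j)" by (simp add: image_iff) metis
  have "y = snd (product_chart M k c) (restrict x {..<k})"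
  proof (rule blk_eqI[of _ k "mdim M"])
    show "blk (mdim M) j y = blk (mdim M) j (snd (product_chart M k c) (restrict x {..<k}))" if "j < k" for j
      using x[OF that] A[OF that] that by (subst blk_product_chart[OF c]) auto
  qed (use y in \<open>auto simp: snd_product_chart_euc\<close>)
  moreover have "restrict x {..<k} \<in> PiE {..<k} A" using x by auto
  ultimately show "y \<in> snd (product_chart M k c) ` PiE {..<k} A" by blast
qed

lemma chart_image_product_chart:
  assumes c: "\<forall>j<k. c j \<in> atlas M"
  shows "chart_image (product_chart M k c) = {y \<in> euc (k * mdim M). \<forall>j<k. blk (mdim M) j y \<in> chart_image (c j)}"
  unfolding chart_image_def by (simp add: product_chart_image_PiE[OF c])

lemma product_chart_inj:
  assumes c: "\<forall>j<k. c j \<in> atlas M"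
  shows "inj_on (snd (product_chart M k c)) (fst (product_chart M k c))"
proof (rule inj_onI)
  fix x x' assume x: "x \<in> fst (product_chart M k c)" "x' \<in> fst (product_chart M k c)"
    and eq: "snd (product_chart M k c) x = snd (product_chart M k c) x'"
  show "x = x'"
  proof (rule PiE_ext)
    fix j assume j: "j \<in> {..<k}"
    then have xj: "x j \<in> fst (c j)" "x' j \<in> fst (c j)" using x by auto
    have "snd (c j) (x j) = snd (c j) (x' j)"
      using eq blk_product_chart[OF c, of j x] blk_product_chart[OF c, of j x'] j xj by simp
    then show "x j = x' j" using inj_onD[OF chart_inj[OF M, of "c j"]] c j xj by auto
  qed (use x in auto)
qed

lemma chart_inv_product_chart:
  assumes c: "\<forall>j<k. c j \<in> atlas M" and y: "y \<in> chart_image (product_chart M k c)"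
  shows "chart_inv (product_chart M k c) y = (\<lambda>j\<in>{..<k}. chart_inv (c j) (blk (mdim M) j y))"
proof -
  let ?x = "\<lambda>j\<in>{..<k}. chart_inv (c j) (blk (mdim M) j y)"
  have b: "blk (mdim M) j y \<in> chart_image (c j)" if "j < k" for j
    using y that by (simp add: chart_image_product_chart[OF c])
  have x: "?x \<in> fst (product_chart M k c)" using b c chart_inv_in[OF M] by auto
  have "snd (product_chart M k c) ?x = y"
  proof (rule blk_eqI[of _ k "mdim M"])
    show "blk (mdim M) j (snd (product_chart M k c) ?x) = blk (mdim M) j y" if "j < k" for j
      using that b[OF that] c chart_inv_in[OF M] snd_chart_inv[OF M] by (subst blk_product_chart[OF c]) auto
  qed (use y in \<open>auto simp: snd_product_chart_euc chart_image_product_chart[OF c]\<close>)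
  with inv_into_f_f[OF product_chart_inj[OF c] x] show ?thesis
    by (simp only: chart_inv_def[of "product_chart M k c"])
qed

lemma product_chart_open:
  assumes c: "\<forall>j<k. c j \<in> atlas M"
  shows "openin (mtop (power_manifold M k)) (fst (product_chart M k c))"
  using c chart_open[OF M] by (auto simp: openin_PiE_gen)

text \<open>Both directions are continuous componentwise: the coordinates through the projections to
  the factors, the factors of the inverse through the blocks of coordinates.\<close>

lemma product_chart_homeomorphic:
  assumes c: "\<forall>j<k. c j \<in> atlas M"
  shows "homeomorphic_map (subtopology (mtop (power_manifold M k)) (fst (product_chart M k c)))
    (subtopology (Euclidean_space (k * mdim M)) (chart_image (product_chart M k c))) (snd (product_chart M k c))"
proof -
  let ?P = "product_chart M k c" and ?d = "mdim M"
  let ?X = "subtopology (product_topology (\<lambda>_. mtop M) {..<k}) (fst ?P)"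
  let ?Y = "subtopology (Euclidean_space (k * ?d)) (chart_image ?P)"
  let ?g = "\<lambda>y. \<lambda>j\<in>{..<k}. chart_inv (c j) (blk ?d j y)"
  have topX: "topspace ?X = fst ?P"
    using openin_subset[OF product_chart_open[OF c]] by auto
  have im: "chart_image ?P \<subseteq> euc (k * ?d)" by (auto simp: chart_image_product_chart[OF c])
  have topY: "topspace ?Y = chart_image ?P" using im by (auto simp: topspace_Euclidean_space euc_def)
  have f: "continuous_map ?X ?Y (snd ?P)"
    unfolding continuous_map_in_subtopology
  proof
    have *: "continuous_map ?X euclideanreal (\<lambda>x. snd (c (m div ?d)) (x (m div ?d)) (m mod ?d))" if "m < k * ?d" for m
    proof -
      note m = block_index_cases[OF that]
      have "continuous_map ?X (subtopology (mtop M) (fst (c (m div ?d)))) (\<lambda>x. x (m div ?d))"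
        unfolding continuous_map_in_subtopology
        using m(1) topX by (auto intro!: continuous_map_from_subtopology continuous_map_product_projection)
      from continuous_map_compose[OF this chart_continuous[OF M]] c m(1)
      have "continuous_map ?X euclidean (\<lambda>x. snd (c (m div ?d)) (x (m div ?d)))" by (simp add: o_def)
      from continuous_map_compose[OF this, of euclideanreal "\<lambda>y. y (m mod ?d)"] show ?thesis
        by (simp add: o_def continuous_on_product_coordinates)
    qed
    then show "continuous_map ?X (Euclidean_space (k * ?d)) (snd ?P)"
      unfolding product_chart_def snd_conv by (subst continuous_map_componentwise_Euclidean_space) simp
    show "snd ?P \<in> topspace ?X \<rightarrow> chart_image ?P" unfolding topX by (auto simp: chart_image_def)
  qed
  have g: "continuous_map ?Y ?X ?g"
    unfolding continuous_map_in_subtopology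
  proof
    show "continuous_map ?Y (product_topology (\<lambda>_. mtop M) {..<k}) ?g"
      unfolding continuous_map_componentwise
    proof (intro conjI ballI)
      fix j assume j: "j \<in> {..<k}"
      have "continuous_map ?Y (top_of_set (chart_image (c j))) (blk ?d j)"
        unfolding continuous_map_in_subtopology
        using j im by (auto simp: continuous_map_Euclidean_iff index_pull_continuous chart_image_product_chart[OF c] topspace_Euclidean_space)
      from continuous_map_compose[OF this chart_inv_continuous[OF M]] c j
      show "continuous_map ?Y (mtop M) (\<lambda>y. ?g y j)" by (simp add: o_def)
    qed auto
    show "?g \<in> topspace ?Y \<rightarrow> fst ?P"
      unfolding topY using c chart_inv_in[OF M] by (auto simp: chart_image_product_chart[OF c])
  qed
  have "homeomorphic_maps ?X ?Y (snd ?P) ?g"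
    unfolding homeomorphic_maps_def topX topY
  proof (intro conjI ballI f g)
    fix x assume x: "x \<in> fst ?P"
    then have y: "snd ?P x \<in> chart_image ?P" by (auto simp: chart_image_def)
    show "?g (snd ?P x) = x"
      using chart_inv_product_chart[OF c y] inv_into_f_f[OF product_chart_inj[OF c] x] by (simp add: chart_inv_def)
  next
    fix y assume y: "y \<in> chart_image ?P"
    show "snd ?P (?g y) = y"
      using chart_inv_product_chart[OF c y] f_inv_into_f[of y "snd ?P" "fst ?P"] y by (simp add: chart_inv_def chart_image_def)
  qed
  then show ?thesis by (auto simp: homeomorphic_map_maps)
qed

lemma product_chart_transition:
  assumes c: "\<forall>j<k. c j \<in> atlas M" and c': "\<forall>j<k. c' j \<in> atlas M" and m: "m < k * mdim M"
  shows "smooth_on_Rn (k * mdim M) (snd (product_chart M k c) ` (fst (product_chart M k c) \<inter> fst (product_chart M k c')))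
    (\<lambda>y. snd (product_chart M k c') (chart_inv (product_chart M k c) y) m)"
proof -
  let ?d = "mdim M" and ?W = "\<lambda>j. snd (c j) ` (fst (c j) \<inter> fst (c' j))"
  define V where "V = {y \<in> euc (k * ?d). \<forall>j<k. blk ?d j y \<in> ?W j}"
  have V: "snd (product_chart M k c) ` (fst (product_chart M k c) \<inter> fst (product_chart M k c')) = V"
    using product_chart_image_PiE[OF c, of "\<lambda>j. fst (c j) \<inter> fst (c' j)"] by (simp add: V_def PiE_Int)
  have W: "openin (Euclidean_space ?d) (?W j)" if "j < k" for j
    using c c' that by (intro chart_open_image[OF M] chart_open[OF M]) auto
  have Vo: "openin (Euclidean_space (k * ?d)) V" unfolding V_def by (rule blk_open[OF W])
  define j i where "j = m div ?d" and "i = m mod ?d"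
  have ji: "j < k" "i < ?d" "m = j * ?d + i" using block_index_cases[OF m] by (auto simp: j_def i_def)
  have "smooth_on_Rn (k * ?d) V (\<lambda>y. snd (c' j) (chart_inv (c j) (blk ?d j y)) i)"
  proof (rule smooth_compose[OF Vo W[OF ji(1)] chart_transition[OF M]])
    show "smooth_on_Rn (k * ?d) V (\<lambda>y. blk ?d j y q)" if "q < ?d" for q
      using smooth_coord[OF Vo] that by (simp add: index_pull_def)
  qed (use c c' ji in \<open>auto simp: V_def\<close>)
  then show ?thesis unfolding V
  proof (rule smooth_cong[OF Vo, rotated])
    fix y assume "y \<in> V"
    then have "y \<in> chart_image (product_chart M k c)" unfolding V[symmetric] by (auto simp: chart_image_def)
    from chart_inv_product_chart[OF c this] ji
    show "snd (c' j) (chart_inv (c j) (blk ?d j y)) i = snd (product_chart M k c') (chart_inv (product_chart M k c) y) m"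
      by (simp add: snd_product_chart)
  qed
qed

theorem power_manifold_charted: "charted (power_manifold M k)"
  unfolding charted_def
proof (intro conjI ballI allI impI)
  show "Hausdorff_space (mtop (power_manifold M k))"
    using M by (simp add: Hausdorff_space_product_topology charted_def)
  show "(\<Union>c\<in>atlas (power_manifold M k). fst c) = topspace (mtop (power_manifold M k))"
  proof (intro equalityI subsetI)
    fix x assume "x \<in> (\<Union>c\<in>atlas (power_manifold M k). fst c)"
    then obtain c where "\<forall>j<k. c j \<in> atlas M" "x \<in> PiE {..<k} (\<lambda>j. fst (c j))" by auto
    then show "x \<in> topspace (mtop (power_manifold M k))" using chart_subset[OF M] by (fastforce simp: PiE_iff)
  next
    fix x assume x: "x \<in> topspace (mtop (power_manifold M k))"
    then have "\<forall>j. \<exists>c. j < k \<longrightarrow> c \<in> atlas M \<and> x j \<in> fst c"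
      using charted_cover[OF M] by (auto simp: PiE_iff) 
    then obtain c where "\<And>j. j < k \<Longrightarrow> c j \<in> atlas M \<and> x j \<in> fst (c j)" by metis
    then have "x \<in> fst (product_chart M k c)" "product_chart M k c \<in> atlas (power_manifold M k)"
      using x by (auto simp: PiE_iff)
    then show "x \<in> (\<Union>c\<in>atlas (power_manifold M k). fst c)" by blast
  qed
next
  fix C assume "C \<in> atlas (power_manifold M k)"
  then obtain c where c: "\<forall>j<k. c j \<in> atlas M" "C = product_chart M k c" by auto
  show "openin (mtop (power_manifold M k)) (fst C)" unfolding c(2) by (rule product_chart_open[OF c(1)])
  show "openin (Euclidean_space (mdim (power_manifold M k))) (chart_image C)"
    unfolding c(2) chart_image_product_chart[OF c(1)] power_manifold_simps
    by (rule blk_open) (use c(1) chart_image_open[OF M] in auto)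
  show "homeomorphic_map (subtopology (mtop (power_manifold M k)) (fst C))
      (subtopology (Euclidean_space (mdim (power_manifold M k))) (chart_image C)) (snd C)"
    using product_chart_homeomorphic[OF c(1)] by (simp add: c(2))
next
  fix C C' i assume "C \<in> atlas (power_manifold M k)" "C' \<in> atlas (power_manifold M k)" "i < mdim (power_manifold M k)"
  then show "smooth_on_Rn (mdim (power_manifold M k)) (snd C ` (fst C \<inter> fst C')) (\<lambda>y. snd C' (chart_inv C y) i)"
    using product_chart_transition by auto
qed

end

text \<open>Each of the k indices is replaced by a block of d consecutive ones. Uniqueness of
  quotient and remainder keeps distinct blocks disjoint.\<close>

lemma index_split_blocks:
  assumes "index_split k a b \<sigma> \<tau>"
  shows "index_split (k * d) (a * d) (b * d) (\<lambda>m. \<sigma> (m div d) * d + m mod d) (\<lambda>m. \<tau> (m div d) * d + m mod d)"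
proof -
  let ?s = "\<lambda>m. \<sigma> (m div d) * d + m mod d" and ?t = "\<lambda>m. \<tau> (m div d) * d + m mod d"
  have un: "i = i' \<and> j = j'" if "i * d + j = i' * d + j'" "j < d" "j' < d" for i i' j j'
  proof -
    have "(i * d + j) div d = (i' * d + j') div d" "(i * d + j) mod d = (i' * d + j') mod d" using that(1) by simp_all
    then show ?thesis using that(2,3) by simp
  qed
  have inj: "inj_on (\<lambda>m. f (m div d) * d + m mod d) {..<e * d}" if "inj_on f {..<e}" for f e
  proof (rule inj_onI)
    fix m m' assume m: "m \<in> {..<e * d}" "m' \<in> {..<e * d}" and eq: "f (m div d) * d + m mod d = f (m' div d) * d + m' mod d"
    have mm: "m div d < e" "m mod d < d" "m' div d < e" "m' mod d < d" using m block_index_cases[of _ e d] by auto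
    from un[OF eq mm(2,4)] have "f (m div d) = f (m' div d)" "m mod d = m' mod d" by auto
    then have "m div d = m' div d" using inj_onD[OF that] mm by simp
    then show "m = m'" using \<open>m mod d = m' mod d\<close> by (metis div_mult_mod_eq)
  qed
  have im: "(\<lambda>m. f (m div d) * d + m mod d) ` {..<e * d} = {j * d + i | j i. j \<in> f ` {..<e} \<and> i < d}" for f e
  proof (intro set_eqI iffI)
    fix x assume "x \<in> (\<lambda>m. f (m div d) * d + m mod d) ` {..<e * d}"
    then show "x \<in> {j * d + i | j i. j \<in> f ` {..<e} \<and> i < d}" using block_index_cases[of _ e d] by blast
  next
    fix x assume "x \<in> {j * d + i | j i. j \<in> f ` {..<e} \<and> i < d}"
    then obtain p i where "p < e" "i < d" "x = f p * d + i" by auto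
    then show "x \<in> (\<lambda>m. f (m div d) * d + m mod d) ` {..<e * d}"
      using block_index_less[of p e i d] by (intro image_eqI[of _ _ "p * d + i"]) auto
  qed
  have "{j * d + i | j i. j \<in> {..<k} \<and> i < d} = {..<k * d}"
  proof (intro set_eqI iffI)
    fix x assume "x \<in> {..<k * d}"
    then show "x \<in> {j * d + i | j i. j \<in> {..<k} \<and> i < d}" using block_index_cases[of x k d] by blast
  qed (use block_index_less in auto)
  moreover have "?s ` {..<a * d} \<union> ?t ` {..<b * d} = {j * d + i | j i. j \<in> \<sigma> ` {..<a} \<union> \<tau> ` {..<b} \<and> i < d}"
    unfolding im by blast
  moreover have "\<sigma> ` {..<a} \<union> \<tau> ` {..<b} = {..<k}" using assms by (simp add: index_split_def)
  ultimately have "?s ` {..<a * d} \<union> ?t ` {..<b * d} = {..<k * d}" by (simp only:)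
  moreover have "?s ` {..<a * d} \<inter> ?t ` {..<b * d} = {}"
  proof (rule ccontr)
    assume "?s ` {..<a * d} \<inter> ?t ` {..<b * d} \<noteq> {}"
    then obtain x where x: "x \<in> ?s ` {..<a * d}" "x \<in> ?t ` {..<b * d}" by blast
    from x(1)[unfolded im] obtain j i where ji: "x = j * d + i" "j \<in> \<sigma> ` {..<a}" "i < d" by blast
    from x(2)[unfolded im] obtain j' i' where ji': "x = j' * d + i'" "j' \<in> \<tau> ` {..<b}" "i' < d" by blast
    have "j = j'" using un[OF _ ji(3) ji'(3), of j j'] ji(1) ji'(1) by simp
    then have "j \<in> \<sigma> ` {..<a} \<inter> \<tau> ` {..<b}" using ji(2) ji'(2) by simp
    then show False using assms unfolding index_split_def by blast
  qed
  ultimately show ?thesis using assms inj by (simp add: index_split_def)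
qed


section \<open>Identification of M^k with the product of M^a and M^b\<close>

definition block_index :: "nat \<Rightarrow> (nat \<Rightarrow> nat) \<Rightarrow> nat \<Rightarrow> nat" where
  "block_index d \<sigma> m = \<sigma> (m div d) * d + m mod d"

definition join :: "nat \<Rightarrow> nat \<Rightarrow> (nat \<Rightarrow> nat) \<Rightarrow> (nat \<Rightarrow> nat) \<Rightarrow> (nat \<Rightarrow> 'q) \<Rightarrow> (nat \<Rightarrow> 'q) \<Rightarrow> nat \<Rightarrow> 'q" where
  "join a b \<sigma> \<tau> x1 x2 = (\<lambda>j. if j \<in> \<sigma> ` {..<a} then x1 (inv_into {..<a} \<sigma> j)
    else if j \<in> \<tau> ` {..<b} then x2 (inv_into {..<b} \<tau> j) else undefined)"

definition pull_family :: "nat \<Rightarrow> (nat \<Rightarrow> nat) \<Rightarrow> (nat \<Rightarrow> 'q) \<Rightarrow> nat \<Rightarrow> 'q" where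
  "pull_family a \<sigma> x = (\<lambda>p\<in>{..<a}. x (\<sigma> p))"

text \<open>\<open>manifold_product\<close> asks for a function of two charts of the powers. Such a
  chart is a bare pair that does not come with the family of charts of M behind it, so the formula
  uses only the given domains and coordinate maps.\<close>

definition join_chart :: "nat \<Rightarrow> nat \<Rightarrow> nat \<Rightarrow> (nat \<Rightarrow> nat) \<Rightarrow> (nat \<Rightarrow> nat) \<Rightarrow> (nat \<Rightarrow> 'a) chart \<Rightarrow> (nat \<Rightarrow> 'a) chart \<Rightarrow> (nat \<Rightarrow> 'a) chart" where
  "join_chart d a b \<sigma> \<tau> C1 C2 = ((\<lambda>(x1, x2). join a b \<sigma> \<tau> x1 x2) ` (fst C1 \<times> fst C2),
    \<lambda>x m. if m \<in> block_index d \<sigma> ` {..<a * d} then snd C1 (pull_family a \<sigma> x) (inv_into {..<a * d} (block_index d \<sigma>) m)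
      else if m \<in> block_index d \<tau> ` {..<b * d} then snd C2 (pull_family b \<tau> x) (inv_into {..<b * d} (block_index d \<tau>) m)
      else 0)"

context
  fixes k a b :: nat and \<sigma> \<tau> :: "nat \<Rightarrow> nat"
  assumes st: "index_split k a b \<sigma> \<tau>"
begin

lemma split_less: "p < a \<Longrightarrow> \<sigma> p < k" "p < b \<Longrightarrow> \<tau> p < k"
  using st by (auto simp: index_split_def)

lemma split_cases: "j < k \<Longrightarrow> (\<exists>p<a. j = \<sigma> p) \<or> (\<exists>p<b. j = \<tau> p)"
proof -
  assume "j < k"
  then have "j \<in> \<sigma> ` {..<a} \<union> \<tau> ` {..<b}" using st by (simp add: index_split_def)
  then show ?thesis by auto
qed

lemma join_simps [simp]: "p < a \<Longrightarrow> join a b \<sigma> \<tau> x1 x2 (\<sigma> p) = x1 p" "p < b \<Longrightarrow> join a b \<sigma> \<tau> x1 x2 (\<tau> p) = x2 p"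
proof -
  show "p < a \<Longrightarrow> join a b \<sigma> \<tau> x1 x2 (\<sigma> p) = x1 p" using st by (simp add: join_def index_split_def)
  assume "p < b"
  moreover from this have "\<tau> p \<notin> \<sigma> ` {..<a}" using st by (force simp: index_split_def)
  ultimately show "join a b \<sigma> \<tau> x1 x2 (\<tau> p) = x2 p" using st by (simp add: join_def index_split_def)
qed

lemma join_PiE:
  assumes "x1 \<in> PiE {..<a} (\<lambda>p. A (\<sigma> p))" "x2 \<in> PiE {..<b} (\<lambda>p. A (\<tau> p))"
  shows "join a b \<sigma> \<tau> x1 x2 \<in> PiE {..<k} A"
proof (rule PiE_I)
  fix j assume "j \<in> {..<k}"
  then show "join a b \<sigma> \<tau> x1 x2 j \<in> A j" using split_cases[of j] assms by auto
next
  fix j assume "j \<notin> {..<k}"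
  then have "j \<notin> \<sigma> ` {..<a}" "j \<notin> \<tau> ` {..<b}" using split_less by force+
  then show "join a b \<sigma> \<tau> x1 x2 j = undefined" by (simp add: join_def)
qed

lemma pull_PiE:
  assumes "x \<in> PiE {..<k} A"
  shows "pull_family a \<sigma> x \<in> PiE {..<a} (\<lambda>p. A (\<sigma> p))" "pull_family b \<tau> x \<in> PiE {..<b} (\<lambda>p. A (\<tau> p))"
  using assms split_less by (auto simp: pull_family_def)

lemma pull_join:
  "x1 \<in> extensional {..<a} \<Longrightarrow> pull_family a \<sigma> (join a b \<sigma> \<tau> x1 x2) = x1"
  "x2 \<in> extensional {..<b} \<Longrightarrow> pull_family b \<tau> (join a b \<sigma> \<tau> x1 x2) = x2"
  by (auto simp: pull_family_def extensional_def fun_eq_iff restrict_def)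

lemma join_pull:
  assumes "x \<in> extensional {..<k}"
  shows "join a b \<sigma> \<tau> (pull_family a \<sigma> x) (pull_family b \<tau> x) = x"
proof
  fix j show "join a b \<sigma> \<tau> (pull_family a \<sigma> x) (pull_family b \<tau> x) j = x j"
  proof (cases "j < k")
    case True
    then show ?thesis using split_cases[OF True] by (auto simp: pull_family_def)
  next
    case False
    then have "j \<notin> \<sigma> ` {..<a}" "j \<notin> \<tau> ` {..<b}" using split_less by force+
    then show ?thesis using assms False by (simp add: join_def extensional_def)
  qed
qed

lemma join_image_PiE: "(\<lambda>(x1, x2). join a b \<sigma> \<tau> x1 x2) ` (PiE {..<a} (\<lambda>p. A (\<sigma> p)) \<times> PiE {..<b} (\<lambda>p. A (\<tau> p))) = PiE {..<k} A"
proof (intro equalityI subsetI)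
  fix x assume x: "x \<in> PiE {..<k} A"
  then have "x = join a b \<sigma> \<tau> (pull_family a \<sigma> x) (pull_family b \<tau> x)" by (intro join_pull[symmetric]) (simp add: PiE_def)
  then show "x \<in> (\<lambda>(x1, x2). join a b \<sigma> \<tau> x1 x2) ` (PiE {..<a} (\<lambda>p. A (\<sigma> p)) \<times> PiE {..<b} (\<lambda>p. A (\<tau> p)))"
    using pull_PiE[OF x] by (intro image_eqI[of _ _ "(pull_family a \<sigma> x, pull_family b \<tau> x)"]) auto
next
  fix x assume "x \<in> (\<lambda>(x1, x2). join a b \<sigma> \<tau> x1 x2) ` (PiE {..<a} (\<lambda>p. A (\<sigma> p)) \<times> PiE {..<b} (\<lambda>p. A (\<tau> p)))"
  then obtain q where q: "q \<in> PiE {..<a} (\<lambda>p. A (\<sigma> p)) \<times> PiE {..<b} (\<lambda>p. A (\<tau> p))" "x = (\<lambda>(x1, x2). join a b \<sigma> \<tau> x1 x2) q" by (rule imageE)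
  have x: "fst q \<in> PiE {..<a} (\<lambda>p. A (\<sigma> p))" "snd q \<in> PiE {..<b} (\<lambda>p. A (\<tau> p))" "x = join a b \<sigma> \<tau> (fst q) (snd q)"
    using q by (simp_all add: mem_Times_iff split_beta)
  show "x \<in> PiE {..<k} A" unfolding x(3) by (rule join_PiE[OF x(1,2)])
qed

lemma join_chart_product_chart:
  fixes M :: "('a, 'z) manifold_scheme"
  shows "join_chart (mdim M) a b \<sigma> \<tau> (product_chart M a c1) (product_chart M b c2) = product_chart M k (join a b \<sigma> \<tau> c1 c2)"
proof (rule prod_eqI)
  let ?d = "mdim M"
  let ?c = "join a b \<sigma> \<tau> c1 c2" and ?s = "block_index ?d \<sigma>" and ?t = "block_index ?d \<tau>"
  have S: "index_split (k * ?d) (a * ?d) (b * ?d) ?s ?t"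
    using index_split_blocks[OF st] by (simp add: block_index_def[abs_def])
  have "PiE {..<a} (\<lambda>p. fst (?c (\<sigma> p))) = PiE {..<a} (\<lambda>p. fst (c1 p))" "PiE {..<b} (\<lambda>p. fst (?c (\<tau> p))) = PiE {..<b} (\<lambda>p. fst (c2 p))"
    by (auto intro!: PiE_cong)
  then show "fst (join_chart ?d a b \<sigma> \<tau> (product_chart M a c1) (product_chart M b c2)) = fst (product_chart M k ?c)"
    using join_image_PiE[of "\<lambda>j. fst (?c j)"] by (simp add: join_chart_def)
  have pull: "snd (product_chart M l c) (pull_family l \<rho> x) q = snd (product_chart M k ?c) x (block_index ?d \<rho> q)"
    if "q < l * ?d" "\<rho> (q div ?d) < k" "?c (\<rho> (q div ?d)) = c (q div ?d)" for l c \<rho> x q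
    using that block_index_cases[OF that(1)] snd_product_chart[OF that(2), of "q mod ?d" M ?c x]
    by (simp add: product_chart_def[of M l] pull_family_def block_index_def)
  show "snd (join_chart ?d a b \<sigma> \<tau> (product_chart M a c1) (product_chart M b c2)) = snd (product_chart M k ?c)"
  proof (intro ext)
    fix x m
    show "snd (join_chart ?d a b \<sigma> \<tau> (product_chart M a c1) (product_chart M b c2)) x m = snd (product_chart M k ?c) x m"
    proof (cases "m < k * ?d")
      case True
      then have "m \<in> ?s ` {..<a * ?d} \<union> ?t ` {..<b * ?d}" using S by (simp add: index_split_def)
      then consider q where "q < a * ?d" "m = ?s q" | q where "q < b * ?d" "m = ?t q" by auto
      then show ?thesis
      proof cases
        case 1
        then show ?thesis
          using S block_index_cases(1)[OF 1(1)] split_less(1) by (simp add: join_chart_def index_split_def pull)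
      next
        case 2
        have "m \<notin> ?s ` {..<a * ?d}" using S 2 by (force simp: index_split_def)
        then show ?thesis
          using S 2 block_index_cases(1)[OF 2(1)] split_less(2) by (simp add: join_chart_def index_split_def pull)
      qed
    next
      case False
      then have "m \<notin> ?s ` {..<a * ?d}" "m \<notin> ?t ` {..<b * ?d}" using S by (auto simp: index_split_def)
      then show ?thesis using False by (simp add: join_chart_def product_chart_def)
    qed
  qed
qed

text \<open>The instance for which \<open>manifold_product\<close> is made, with a factors at the
  places \<sigma> and b factors at the places \<tau>. For a = 0 or b = 0 one side is the one-point
  manifold, as the scalar factors of the chain rule require.\<close>

theorem power_manifold_product:
  fixes M :: "('a, 'z) manifold_scheme"
  assumes M: "charted M"
  shows "manifold_product (power_manifold M a) (power_manifold M b) (power_manifold M k)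
    (block_index (mdim M) \<sigma>) (block_index (mdim M) \<tau>) (join a b \<sigma> \<tau>) (pull_family a \<sigma>) (pull_family b \<tau>)
    (join_chart (mdim M) a b \<sigma> \<tau>)"
proof
  let ?d = "mdim M"
  show "charted (power_manifold M a)" "charted (power_manifold M b)" "charted (power_manifold M k)"
    by (rule power_manifold_charted[OF M])+
  show S: "index_split (mdim (power_manifold M k)) (mdim (power_manifold M a)) (mdim (power_manifold M b)) (block_index ?d \<sigma>) (block_index ?d \<tau>)"
    using index_split_blocks[OF st] by (simp add: block_index_def[abs_def])
  show "continuous_map (prod_topology (mtop (power_manifold M a)) (mtop (power_manifold M b))) (mtop (power_manifold M k)) (\<lambda>(x1, x2). join a b \<sigma> \<tau> x1 x2)"
    unfolding power_manifold_simps continuous_map_componentwise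
  proof (intro conjI ballI)
    show "(\<lambda>(x1, x2). join a b \<sigma> \<tau> x1 x2) ` topspace (prod_topology (product_topology (\<lambda>_. mtop M) {..<a}) (product_topology (\<lambda>_. mtop M) {..<b})) \<subseteq> extensional {..<k}"
      using join_PiE[of _ "\<lambda>_. topspace (mtop M)"] by (fastforce simp: PiE_def)
    fix j assume "j \<in> {..<k}"
    then have "j < k" by simp
    from split_cases[OF this] show "continuous_map (prod_topology (product_topology (\<lambda>_. mtop M) {..<a}) (product_topology (\<lambda>_. mtop M) {..<b})) (mtop M) (\<lambda>x. (case x of (x1, x2) \<Rightarrow> join a b \<sigma> \<tau> x1 x2) j)"
    proof (elim disjE exE conjE)
      fix p assume p: "p < a" "j = \<sigma> p"
      have "continuous_map (prod_topology (product_topology (\<lambda>_. mtop M) {..<a}) (product_topology (\<lambda>_. mtop M) {..<b})) (mtop M) ((\<lambda>x. x p) \<circ> fst)"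
        by (rule continuous_map_compose[OF continuous_map_fst continuous_map_product_projection]) (use p in auto)
      then show ?thesis using p by (simp add: o_def split_beta)
    next
      fix p assume p: "p < b" "j = \<tau> p"
      have "continuous_map (prod_topology (product_topology (\<lambda>_. mtop M) {..<a}) (product_topology (\<lambda>_. mtop M) {..<b})) (mtop M) ((\<lambda>x. x p) \<circ> snd)"
        by (rule continuous_map_compose[OF continuous_map_snd continuous_map_product_projection]) (use p in auto)
      then show ?thesis using p by (simp add: o_def split_beta)
    qed
  qed
next
  fix C1 C2 assume "C1 \<in> atlas (power_manifold M a)" "C2 \<in> atlas (power_manifold M b)"
  then obtain c1 c2 where c: "\<forall>j<a. c1 j \<in> atlas M" "\<forall>j<b. c2 j \<in> atlas M" "C1 = product_chart M a c1" "C2 = product_chart M b c2" by auto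
  have "\<forall>j<k. join a b \<sigma> \<tau> c1 c2 j \<in> atlas M" using c(1,2) split_cases by fastforce
  then show "join_chart (mdim M) a b \<sigma> \<tau> C1 C2 \<in> atlas (power_manifold M k)"
    unfolding c(3,4) join_chart_product_chart by auto
  show "fst (join_chart (mdim M) a b \<sigma> \<tau> C1 C2) = (\<lambda>(x1, x2). join a b \<sigma> \<tau> x1 x2) ` (fst C1 \<times> fst C2)"
    by (simp add: join_chart_def)
  fix x1 x2 q assume x: "x1 \<in> fst C1" "x2 \<in> fst C2"
  then have ext: "x1 \<in> extensional {..<a}" "x2 \<in> extensional {..<b}" by (auto simp: c(3,4) PiE_def)
  have S: "index_split (k * mdim M) (a * mdim M) (b * mdim M) (block_index (mdim M) \<sigma>) (block_index (mdim M) \<tau>)"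
    using index_split_blocks[OF st] by (simp add: block_index_def[abs_def])
  show "snd (join_chart (mdim M) a b \<sigma> \<tau> C1 C2) (join a b \<sigma> \<tau> x1 x2) (block_index (mdim M) \<sigma> q) = snd C1 x1 q" if "q < mdim (power_manifold M a)"
    using S that by (simp add: join_chart_def pull_join(1)[OF ext(1)] index_split_def)
  show "snd (join_chart (mdim M) a b \<sigma> \<tau> C1 C2) (join a b \<sigma> \<tau> x1 x2) (block_index (mdim M) \<tau> q) = snd C2 x2 q" if q: "q < mdim (power_manifold M b)"
  proof -
    have "block_index (mdim M) \<tau> q \<notin> block_index (mdim M) \<sigma> ` {..<a * mdim M}" using S q by (force simp: index_split_def)
    then show ?thesis using S q by (simp add: join_chart_def pull_join(2)[OF ext(2)] index_split_def)
  qed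
next
  fix C assume "C \<in> atlas (power_manifold M k)"
  then obtain c where c: "\<forall>j<k. c j \<in> atlas M" "C = product_chart M k c" by auto
  \<comment> \<open>The joined family agrees with c below k only. This suffices, because a product
    chart of k factors reads no further.\<close>
  have eq: "join a b \<sigma> \<tau> (\<lambda>p. c (\<sigma> p)) (\<lambda>p. c (\<tau> p)) j = c j" if "j < k" for j using split_cases[OF that] by auto
  have "product_chart M k (join a b \<sigma> \<tau> (\<lambda>p. c (\<sigma> p)) (\<lambda>p. c (\<tau> p))) = product_chart M k c"
  proof (rule prod_eqI)
    show "fst (product_chart M k (join a b \<sigma> \<tau> (\<lambda>p. c (\<sigma> p)) (\<lambda>p. c (\<tau> p)))) = fst (product_chart M k c)"
      using eq by (auto intro!: PiE_cong)
    show "snd (product_chart M k (join a b \<sigma> \<tau> (\<lambda>p. c (\<sigma> p)) (\<lambda>p. c (\<tau> p)))) = snd (product_chart M k c)"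
    proof (intro ext)
      fix x m
      show "snd (product_chart M k (join a b \<sigma> \<tau> (\<lambda>p. c (\<sigma> p)) (\<lambda>p. c (\<tau> p)))) x m = snd (product_chart M k c) x m"
        using eq[OF block_index_cases(1)[of m k "mdim M"]] by (simp add: product_chart_def)
    qed
  qed
  then have "C = join_chart (mdim M) a b \<sigma> \<tau> (product_chart M a (\<lambda>p. c (\<sigma> p))) (product_chart M b (\<lambda>p. c (\<tau> p)))"
    by (simp add: join_chart_product_chart c(2))
  moreover have "product_chart M a (\<lambda>p. c (\<sigma> p)) \<in> atlas (power_manifold M a)" "product_chart M b (\<lambda>p. c (\<tau> p)) \<in> atlas (power_manifold M b)"
    using c(1) split_less by auto
  ultimately show "\<exists>c1\<in>atlas (power_manifold M a). \<exists>c2\<in>atlas (power_manifold M b). C = join_chart (mdim M) a b \<sigma> \<tau> c1 c2"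
    by blast
next
  fix x1 x2 assume "x1 \<in> topspace (mtop (power_manifold M a))" "x2 \<in> topspace (mtop (power_manifold M b))"
  then show "join a b \<sigma> \<tau> x1 x2 \<in> topspace (mtop (power_manifold M k))"
    "pull_family a \<sigma> (join a b \<sigma> \<tau> x1 x2) = x1" "pull_family b \<tau> (join a b \<sigma> \<tau> x1 x2) = x2"
    using join_PiE[of x1 "\<lambda>_. topspace (mtop M)" x2] by (auto intro!: pull_join simp: PiE_def)
next
  fix x assume "x \<in> topspace (mtop (power_manifold M k))"
  then show "pull_family a \<sigma> x \<in> topspace (mtop (power_manifold M a))" "pull_family b \<tau> x \<in> topspace (mtop (power_manifold M b))"
    "join a b \<sigma> \<tau> (pull_family a \<sigma> x) (pull_family b \<tau> x) = x"
    using pull_PiE[of x "\<lambda>_. topspace (mtop M)"] by (auto intro!: join_pull simp: PiE_def)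
qed

end

section \<open>Cotangent vectors along coordinate embeddings\<close>

lemma chart_vector_add: "(\<lambda>f. chart_vector N c x a f + chart_vector N c x b f) = chart_vector N c x (\<lambda>i. a i + b i)"
  by (auto simp: chart_vector_def sum.distrib distrib_right)

lemma chart_vector_scale: "(\<lambda>f. r * chart_vector N c x a f) = chart_vector N c x (\<lambda>i. r * a i)"
  by (auto simp: chart_vector_def sum_distrib_left mult.assoc)

lemma coord_vector_apply: "i < mdim N \<Longrightarrow> coord_vector N c x i f = (if f \<in> smooth_functions N then partial_deriv i (\<lambda>y. f (chart_inv c y)) (snd c x) else 0)"
  by (simp add: coord_vector_def chart_vector_def if_distrib[of "\<lambda>r. r * _"] cong: if_cong)

lemma chart_vector_coord_vectors: "chart_vector N c x a = (\<lambda>f. \<Sum>i<mdim N. a i * coord_vector N c x i f)"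
  by (auto simp: chart_vector_def coord_vector_apply)

text \<open>The chain rule for the transition map. It shows that the vectors of a single chart
  around x exhaust the tangent space, which is defined through all charts.\<close>

lemma chart_vector_change:
  assumes N: "charted N" and c: "c \<in> atlas N" "x \<in> fst c" and c': "c' \<in> atlas N" "x \<in> fst c'"
  shows "chart_vector N c' x a = chart_vector N c x (\<lambda>j. \<Sum>i<mdim N. a i * partial_deriv i (\<lambda>y. snd c (chart_inv c' y) j) (snd c' x))"
proof
  fix f :: "'a \<Rightarrow> real"
  let ?n = "mdim N" and ?T = "\<lambda>y. snd c (chart_inv c' y)" and ?f = "\<lambda>y. f (chart_inv c y)"
  let ?V = "snd c' ` (fst c' \<inter> fst c)"
  show "chart_vector N c' x a f = chart_vector N c x (\<lambda>j. \<Sum>i<?n. a i * partial_deriv i (\<lambda>y. ?T y j) (snd c' x)) f"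
  proof (cases "f \<in> smooth_functions N")
    case True
    have V: "openin (Euclidean_space ?n) ?V" by (rule chart_open_image[OF N c'(1) chart_open[OF N c(1)]])
    have xV: "snd c' x \<in> ?V" using c c' by auto
    have "partial_deriv i (\<lambda>y. f (chart_inv c' y)) (snd c' x) = (\<Sum>j<?n. partial_deriv i (\<lambda>y. ?T y j) (snd c' x) * partial_deriv j ?f (snd c x))"
      if i: "i < ?n" for i
    proof -
      have "partial_deriv i (\<lambda>y. f (chart_inv c' y)) (snd c' x) = partial_deriv i (\<lambda>y. ?f (?T y)) (snd c' x)"
        by (rule partial_deriv_cong[OF V i _ xV]) (auto simp: chart_inv_snd[OF N c'(1)] chart_inv_snd[OF N c(1)])
      also have "has_pd i ?V (\<lambda>y. ?f (?T y)) (\<lambda>y. \<Sum>j<?n. partial_deriv i (\<lambda>y. ?T y j) y *\<^sub>R partial_deriv j ?f (?T y))"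
        by (rule has_pd_compose[OF V chart_image_open[OF N c(1)] i smooth_functions_chart[OF True c(1)] _ smooth_has_pd[OF V chart_transition[OF N c'(1) c(1)] i]])
          (auto simp: chart_inv_snd[OF N c'(1)] chart_image_def)
      from has_pd_partial_deriv[OF this xV] have "partial_deriv i (\<lambda>y. ?f (?T y)) (snd c' x) = (\<Sum>j<?n. partial_deriv i (\<lambda>y. ?T y j) (snd c' x) * partial_deriv j ?f (snd c x))"
        by (simp add: chart_inv_snd[OF N c'])
      finally show ?thesis .
    qed
    then have "chart_vector N c' x a f = (\<Sum>i<?n. \<Sum>j<?n. a i * partial_deriv i (\<lambda>y. ?T y j) (snd c' x) * partial_deriv j ?f (snd c x))"
      using True by (simp add: chart_vector_def sum_distrib_left mult.assoc)
    also have "\<dots> = (\<Sum>j<?n. \<Sum>i<?n. a i * partial_deriv i (\<lambda>y. ?T y j) (snd c' x) * partial_deriv j ?f (snd c x))"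
      by (rule sum.swap)
    finally show ?thesis using True by (simp add: chart_vector_def sum_distrib_right)
  qed (simp add: chart_vector_def)
qed

lemma tangent_space_chart:
  assumes "charted N" "c \<in> atlas N" "x \<in> fst c"
  shows "tangent_space N x = range (chart_vector N c x)"
  using chart_vector_change[OF assms] assms(2,3) unfolding tangent_space_def charts_at_def by blast

lemma tangent_space_closed:
  assumes N: "charted N" and x: "x \<in> topspace (mtop N)"
  shows "v \<in> tangent_space N x \<Longrightarrow> w \<in> tangent_space N x \<Longrightarrow> (\<lambda>f. v f + w f) \<in> tangent_space N x"
    and "v \<in> tangent_space N x \<Longrightarrow> (\<lambda>f. r * v f) \<in> tangent_space N x"
    and "(\<lambda>f. 0) \<in> tangent_space N x"
proof -
  obtain c where c: "c \<in> atlas N" "x \<in> fst c" using charted_cover[OF N x] by blast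
  note T = tangent_space_chart[OF N c]
  show "v \<in> tangent_space N x \<Longrightarrow> w \<in> tangent_space N x \<Longrightarrow> (\<lambda>f. v f + w f) \<in> tangent_space N x"
    unfolding T using chart_vector_add[of N c x] by auto
  show "v \<in> tangent_space N x \<Longrightarrow> (\<lambda>f. r * v f) \<in> tangent_space N x" for r
    unfolding T using chart_vector_scale[of r N c x] by auto
  have "(\<lambda>f. 0) = chart_vector N c x (\<lambda>i. 0)" by (auto simp: chart_vector_def)
  then show "(\<lambda>f. 0) \<in> tangent_space N x" unfolding T by auto
qed

lemma linear_form_onD:
  assumes "linear_form_on S \<xi>"
  shows "v \<in> S \<Longrightarrow> w \<in> S \<Longrightarrow> \<xi> (\<lambda>f. v f + w f) = \<xi> v + \<xi> w"
    and "v \<in> S \<Longrightarrow> \<xi> (\<lambda>f. r * v f) = r * \<xi> v"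
  using assms by (auto simp: linear_form_on_def)

lemma linear_form_sum:
  fixes m :: nat
  assumes N: "charted N" and x: "x \<in> topspace (mtop N)" and \<xi>: "linear_form_on (tangent_space N x) \<xi>"
    and e: "\<And>i. i < m \<Longrightarrow> e i \<in> tangent_space N x"
  shows "(\<lambda>f. \<Sum>i<m. a i * e i f) \<in> tangent_space N x" "\<xi> (\<lambda>f. \<Sum>i<m. a i * e i f) = (\<Sum>i<m. a i * \<xi> (e i))"
proof -
  have "(\<lambda>f. \<Sum>i<m. a i * e i f) \<in> tangent_space N x \<and> \<xi> (\<lambda>f. \<Sum>i<m. a i * e i f) = (\<Sum>i<m. a i * \<xi> (e i))"
    using e
  proof (induction m)
    case 0
    from linear_form_onD(2)[OF \<xi> tangent_space_closed(3)[OF N x], of 0] show ?case using tangent_space_closed(3)[OF N x] by simp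
  next
    case (Suc m)
    let ?v = "\<lambda>f. \<Sum>i<m. a i * e i f" and ?w = "\<lambda>f. a m * e m f"
    have v: "?v \<in> tangent_space N x" "\<xi> ?v = (\<Sum>i<m. a i * \<xi> (e i))" using Suc by auto
    have w: "?w \<in> tangent_space N x" using Suc.prems by (intro tangent_space_closed(2)[OF N x]) auto
    have "\<xi> (\<lambda>f. ?v f + ?w f) = \<xi> ?v + \<xi> ?w" by (rule linear_form_onD(1)[OF \<xi> v(1) w])
    moreover have "\<xi> ?w = a m * \<xi> (e m)" by (rule linear_form_onD(2)[OF \<xi>]) (simp add: Suc.prems)
    ultimately show ?case using tangent_space_closed(1)[OF N x v(1) w] v(2) by simp
  qed
  then show "(\<lambda>f. \<Sum>i<m. a i * e i f) \<in> tangent_space N x" "\<xi> (\<lambda>f. \<Sum>i<m. a i * e i f) = (\<Sum>i<m. a i * \<xi> (e i))" by auto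
qed

lemma coord_vector_tangent: "c \<in> atlas N \<Longrightarrow> x \<in> fst c \<Longrightarrow> coord_vector N c x i \<in> tangent_space N x"
  by (auto simp: coord_vector_def tangent_space_def charts_at_def)

lemma cotangent_nonzero_coord:
  assumes N: "charted N" and c: "c \<in> atlas N" "x \<in> fst c" and \<xi>: "\<xi> \<in> cotangent_space N x" "\<xi> \<noteq> (\<lambda>_. 0)"
  obtains i where "i < mdim N" "cotangent_coords N c x \<xi> i \<noteq> 0"
proof -
  have x: "x \<in> topspace (mtop N)" using chart_subset[OF N c(1)] c(2) by auto
  obtain v where v: "\<xi> v \<noteq> 0" using \<xi>(2) by auto
  then have "v \<in> tangent_space N x" using \<xi>(1) by (auto simp: cotangent_space_def)
  then obtain a where a: "v = chart_vector N c x a" using tangent_space_chart[OF N c] by auto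
  have "\<xi> v = (\<Sum>i<mdim N. a i * \<xi> (coord_vector N c x i))"
    unfolding a chart_vector_coord_vectors
    by (rule linear_form_sum(2)[OF N x]) (use \<xi>(1) coord_vector_tangent[OF c] in \<open>auto simp: cotangent_space_def\<close>)
  with v obtain i where "i < mdim N" "\<xi> (coord_vector N c x i) \<noteq> 0" by (metis (no_types, lifting) lessThan_iff mult_zero_right sum.neutral)
  then show ?thesis using that by (simp add: cotangent_coords_def)
qed

section \<open>Embeddings that freeze some of the coordinates\<close>

definition insert_coords :: "nat \<Rightarrow> (nat \<Rightarrow> nat) \<Rightarrow> (nat \<Rightarrow> real) \<Rightarrow> (nat \<Rightarrow> real) \<Rightarrow> nat \<Rightarrow> real" where
  "insert_coords k s b z = (\<lambda>m. if m \<in> s ` {..<k} then z (inv_into {..<k} s m) else b m)"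

lemma insert_coords_at: "inj_on s {..<k} \<Longrightarrow> q < k \<Longrightarrow> insert_coords k s b z (s q) = z q"
  by (simp add: insert_coords_def)

lemma insert_coords_upd: "inj_on s {..<k} \<Longrightarrow> q < k \<Longrightarrow> insert_coords k s b (z(q := r)) = (insert_coords k s b z)(s q := r)"
  by (auto simp: insert_coords_def fun_eq_iff inj_on_def)

definition charts_compatible :: "('a, 'x) manifold_scheme \<Rightarrow> (nat \<Rightarrow> nat) \<Rightarrow> ('a \<Rightarrow> 'c) \<Rightarrow> 'a chart \<Rightarrow> 'c chart \<Rightarrow> bool" where
  "charts_compatible N1 s \<iota> c1 c \<longleftrightarrow> (\<exists>b. \<forall>y\<in>fst c1. \<iota> y \<in> fst c \<and> snd c (\<iota> y) = insert_coords (mdim N1) s b (snd c1 y))"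

text \<open>Two situations share this frame: M as one slot of M^k, and a power M^a as a group of
  factors of M^k with the other factors frozen. In suitable charts tangent vectors are pushed
  forward by padding with 0, and covectors are pulled back by selecting coordinates.\<close>

locale chart_embedding =
  fixes N1 :: "('a, 'x) manifold_scheme" and N :: "('c, 'z) manifold_scheme" and s :: "nat \<Rightarrow> nat" and \<iota> :: "'a \<Rightarrow> 'c"
  assumes N1: "charted N1" and N: "charted N" and s: "inj_on s {..<mdim N1}" "\<And>q. q < mdim N1 \<Longrightarrow> s q < mdim N"
    and \<iota>: "\<And>y. y \<in> topspace (mtop N1) \<Longrightarrow> \<iota> y \<in> topspace (mtop N)"
    and compatible: "\<And>c1. c1 \<in> atlas N1 \<Longrightarrow> \<exists>c\<in>atlas N. charts_compatible N1 s \<iota> c1 c"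
begin

definition restr :: "('c \<Rightarrow> real) \<Rightarrow> 'a \<Rightarrow> real" where
  "restr f = (\<lambda>y. if y \<in> topspace (mtop N1) then f (\<iota> y) else 0)"

definition push :: "'a tangent \<Rightarrow> 'c tangent" where
  "push v = (\<lambda>f. if f \<in> smooth_functions N then v (restr f) else 0)"

definition pullback :: "'a \<Rightarrow> 'c cotangent \<Rightarrow> 'a cotangent" where
  "pullback x1 \<xi> = (\<lambda>v. if v \<in> tangent_space N1 x1 then \<xi> (push v) else 0)"

context
  fixes c1 c b
  assumes c1: "c1 \<in> atlas N1" and c: "c \<in> atlas N"
    and b: "\<And>y. y \<in> fst c1 \<Longrightarrow> \<iota> y \<in> fst c \<and> snd c (\<iota> y) = insert_coords (mdim N1) s b (snd c1 y)"
begin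

lemma insert_coords_in: "z \<in> chart_image c1 \<Longrightarrow> insert_coords (mdim N1) s b z \<in> chart_image c"
  using b chart_inv_in[OF N1 c1, of z] snd_chart_inv[OF N1 c1, of z] by (metis snd_chart_image[OF N c])

lemma restr_chart: "z \<in> chart_image c1 \<Longrightarrow> restr f (chart_inv c1 z) = f (chart_inv c (insert_coords (mdim N1) s b z))"
proof -
  assume z: "z \<in> chart_image c1"
  have y: "chart_inv c1 z \<in> fst c1" by (rule chart_inv_in[OF N1 c1 z])
  have "chart_inv c (snd c (\<iota> (chart_inv c1 z))) = \<iota> (chart_inv c1 z)" using b[OF y] by (intro chart_inv_snd[OF N c]) simp
  then show ?thesis using b[OF y] y chart_subset[OF N1 c1] snd_chart_inv[OF N1 c1 z] by (auto simp: restr_def)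
qed

lemma restr_smooth_on:
  assumes "f \<in> smooth_functions N"
  shows "smooth_on_Rn (mdim N1) (chart_image c1) (\<lambda>z. restr f (chart_inv c1 z))"
proof -
  note V = chart_image_open[OF N1 c1]
  have "smooth_on_Rn (mdim N1) (chart_image c1) (\<lambda>z. f (chart_inv c (insert_coords (mdim N1) s b z)))"
  proof (rule smooth_compose[OF V chart_image_open[OF N c] smooth_functions_chart[OF assms c] insert_coords_in])
    fix m show "smooth_on_Rn (mdim N1) (chart_image c1) (\<lambda>z. insert_coords (mdim N1) s b z m)"
      by (cases "m \<in> s ` {..<mdim N1}") (auto simp: insert_coords_def intro: smooth_coord[OF V] smooth_const[OF V])
  qed
  then show ?thesis by (rule smooth_cong[OF V, rotated]) (simp add: restr_chart)
qed

lemma restr_partial: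
  assumes "q < mdim N1" "x \<in> fst c1"
  shows "partial_deriv q (\<lambda>z. restr f (chart_inv c1 z)) (snd c1 x) = partial_deriv (s q) (\<lambda>y. f (chart_inv c y)) (snd c (\<iota> x))"
proof -
  have "partial_deriv q (\<lambda>z. restr f (chart_inv c1 z)) (snd c1 x) = partial_deriv q (\<lambda>z. f (chart_inv c (insert_coords (mdim N1) s b z))) (snd c1 x)"
    by (rule partial_deriv_cong[OF chart_image_open[OF N1 c1] assms(1) restr_chart snd_chart_image[OF N1 c1 assms(2)]])
  then show ?thesis using b[OF assms(2)] assms(1) s(1)
    by (simp add: partial_deriv_def insert_coords_upd insert_coords_at)
qed

end

lemma restr_smooth: "f \<in> smooth_functions N \<Longrightarrow> restr f \<in> smooth_functions N1"
proof -
  assume f: "f \<in> smooth_functions N"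
  have "smooth_on_Rn (mdim N1) (chart_image c1) (\<lambda>z. restr f (chart_inv c1 z))" if c1: "c1 \<in> atlas N1" for c1
  proof -
    obtain c where "c \<in> atlas N" "charts_compatible N1 s \<iota> c1 c" using compatible[OF c1] by blast
    then show ?thesis unfolding charts_compatible_def using restr_smooth_on[OF c1 _ _ f] by blast
  qed
  then show ?thesis by (simp add: smooth_functions_def restr_def)
qed

lemma push_chart_vector:
  assumes c: "c1 \<in> atlas N1" "c \<in> atlas N" "charts_compatible N1 s \<iota> c1 c" and x: "x \<in> fst c1"
  shows "push (chart_vector N1 c1 x a) = chart_vector N c (\<iota> x) (insert_coords (mdim N1) s (\<lambda>m. 0) a)"
proof
  fix f
  show "push (chart_vector N1 c1 x a) f = chart_vector N c (\<iota> x) (insert_coords (mdim N1) s (\<lambda>m. 0) a) f"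
  proof (cases "f \<in> smooth_functions N")
    case True
    obtain b where b: "\<And>y. y \<in> fst c1 \<Longrightarrow> \<iota> y \<in> fst c \<and> snd c (\<iota> y) = insert_coords (mdim N1) s b (snd c1 y)"
      using c(3) by (auto simp: charts_compatible_def)
    let ?g = "\<lambda>m. insert_coords (mdim N1) s (\<lambda>m. 0) a m * partial_deriv m (\<lambda>y. f (chart_inv c y)) (snd c (\<iota> x))"
    have "push (chart_vector N1 c1 x a) f = (\<Sum>q<mdim N1. ?g (s q))"
      using True restr_smooth[OF True] s(1)
      by (auto simp: push_def chart_vector_def restr_partial[OF c(1,2) b _ x] insert_coords_at intro!: sum.cong)
    also have "\<dots> = sum ?g (s ` {..<mdim N1})" using s(1) by (simp add: sum.reindex)
    also have "\<dots> = sum ?g {..<mdim N}"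
      by (rule sum.mono_neutral_left) (use s(2) in \<open>auto simp: insert_coords_def\<close>)
    finally show ?thesis using True by (simp add: chart_vector_def)
  qed (simp add: push_def chart_vector_def)
qed

lemma push_tangent:
  assumes "x \<in> topspace (mtop N1)" "v \<in> tangent_space N1 x"
  shows "push v \<in> tangent_space N (\<iota> x)"
proof -
  obtain c1 a where c1: "c1 \<in> atlas N1" "x \<in> fst c1" "v = chart_vector N1 c1 x a"
    using assms(2) by (auto simp: tangent_space_def charts_at_def)
  obtain c where c: "c \<in> atlas N" "charts_compatible N1 s \<iota> c1 c" using compatible[OF c1(1)] by blast
  then have "\<iota> x \<in> fst c" using c1(2) by (auto simp: charts_compatible_def)
  then show ?thesis unfolding c1(3) push_chart_vector[OF c1(1) c c1(2)] tangent_space_def charts_at_def using c(1) by auto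
qed

lemma pullback_cotangent:
  assumes x: "x \<in> topspace (mtop N1)" and \<xi>: "\<xi> \<in> cotangent_space N (\<iota> x)"
  shows "pullback x \<xi> \<in> cotangent_space N1 x"
proof -
  have L: "linear_form_on (tangent_space N (\<iota> x)) \<xi>" using \<xi> by (simp add: cotangent_space_def)
  have p: "push (\<lambda>f. v f + w f) = (\<lambda>f. push v f + push w f)" "push (\<lambda>f. r * v f) = (\<lambda>f. r * push v f)" for v w r
    by (auto simp: push_def)
  have "linear_form_on (tangent_space N1 x) (pullback x \<xi>)"
    unfolding linear_form_on_def
  proof (intro conjI ballI allI)
    fix v assume v: "v \<in> tangent_space N1 x"
    show "pullback x \<xi> (\<lambda>f. r * v f) = r * pullback x \<xi> v" for r
      using L push_tangent[OF x v] v tangent_space_closed(2)[OF N1 x v, of r]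
      by (simp add: pullback_def p linear_form_on_def)
    fix w assume w: "w \<in> tangent_space N1 x"
    show "pullback x \<xi> (\<lambda>f. v f + w f) = pullback x \<xi> v + pullback x \<xi> w"
      using L push_tangent[OF x v] push_tangent[OF x w] v w tangent_space_closed(1)[OF N1 x v w]
      by (simp add: pullback_def p linear_form_on_def)
  qed
  then show ?thesis by (simp add: cotangent_space_def pullback_def)
qed

lemma pullback_coords:
  assumes c: "c1 \<in> atlas N1" "c \<in> atlas N" "charts_compatible N1 s \<iota> c1 c" and x: "x \<in> fst c1" and q: "q < mdim N1"
  shows "cotangent_coords N1 c1 x (pullback x \<xi>) q = cotangent_coords N c (\<iota> x) \<xi> (s q)"
proof -
  have "push (coord_vector N1 c1 x q) = coord_vector N c (\<iota> x) (s q)"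
    unfolding coord_vector_def push_chart_vector[OF c x]
    by (rule arg_cong[where f="chart_vector N c (\<iota> x)"]) (use s(1) q in \<open>auto simp: insert_coords_def fun_eq_iff inj_on_def\<close>)
  then show ?thesis
    using q s(2)[OF q] coord_vector_tangent[OF c(1) x, of q] by (simp add: cotangent_coords_def pullback_def)
qed

end

section \<open>Microlocal tensor products\<close>

context manifold_product
begin

lemma charts_compatible_left: "c1 \<in> atlas N1 \<Longrightarrow> c2 \<in> atlas N2 \<Longrightarrow> x2 \<in> fst c2 \<Longrightarrow> charts_compatible N1 s (\<lambda>y. J y x2) c1 (pc c1 c2)"
  unfolding charts_compatible_def
  by (rule exI[of _ "comb (\<lambda>_. 0) (snd c2 x2)"]) (auto simp: snd_pc J_in_pc insert_coords_def comb_def)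

lemma charts_compatible_right:
  assumes c: "c1 \<in> atlas N1" "c2 \<in> atlas N2" and x: "x1 \<in> fst c1"
  shows "charts_compatible N2 t (J x1) c2 (pc c1 c2)"
proof -
  have *: "comb y1 y2 = insert_coords n2 t (comb y1 (\<lambda>_. 0)) y2" for y1 y2
  proof
    fix m show "comb y1 y2 m = insert_coords n2 t (comb y1 (\<lambda>_. 0)) y2 m"
      using st_disjoint by (cases "m \<in> s ` {..<n1}"; cases "m \<in> t ` {..<n2}") (auto simp: insert_coords_def comb_def)
  qed
  have "J x1 y \<in> fst (pc c1 c2) \<and> snd (pc c1 c2) (J x1 y) = insert_coords n2 t (comb (snd c1 x1) (\<lambda>_. 0)) (snd c2 y)" if "y \<in> fst c2" for y
    unfolding snd_pc[OF c x that] *[of "snd c1 x1" "snd c2 y"] using J_in_pc[OF c x that] by simp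
  then show ?thesis unfolding charts_compatible_def by blast
qed

lemma left_embedding: "x2 \<in> X2 \<Longrightarrow> chart_embedding N1 N s (\<lambda>y. J y x2)"
proof
  assume x2: "x2 \<in> X2"
  show "inj_on s {..<n1}" using st by (simp add: index_split_def)
  obtain c2 where "c2 \<in> atlas N2" "x2 \<in> fst c2" using charted_cover[OF N2 x2] by blast
  then show "\<exists>c\<in>atlas N. charts_compatible N1 s (\<lambda>y. J y x2) c1 c" if "c1 \<in> atlas N1" for c1
    using charts_compatible_left[OF that] pc[OF that] by blast
qed (auto simp: N1 N s_less J)

lemma right_embedding: "x1 \<in> X1 \<Longrightarrow> chart_embedding N2 N t (J x1)"
proof
  assume x1: "x1 \<in> X1"
  show "inj_on t {..<n2}" using st by (simp add: index_split_def)
  obtain c1 where "c1 \<in> atlas N1" "x1 \<in> fst c1" using charted_cover[OF N1 x1] by blast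
  then show "\<exists>c\<in>atlas N. charts_compatible N2 t (J x1) c2 c" if "c2 \<in> atlas N2" for c2
    using charts_compatible_right[OF _ that] pc[OF _ that] by blast
qed (auto simp: N2 N t_less J)

end

section \<open>Slot components of covectors on M^k\<close>

lemma slot_embedding:
  assumes M: "charted M" and x: "x \<in> topspace (mtop (power_manifold M k))" and j: "j < k"
  shows "chart_embedding M (power_manifold M k) (\<lambda>i. j * mdim M + i) (\<lambda>y. x(j := y))"
proof
  show "charted M" "charted (power_manifold M k)" by (rule M power_manifold_charted[OF M])+
  show "inj_on (\<lambda>i. j * mdim M + i) {..<mdim M}" by (auto simp: inj_on_def)
  show "j * mdim M + q < mdim (power_manifold M k)" if "q < mdim M" for q
    using block_index_less[OF j that] by simp
  show "x(j := y) \<in> topspace (mtop (power_manifold M k))" if "y \<in> topspace (mtop M)" for y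
    using x j that by (auto simp: PiE_iff extensional_def)
  fix c1 assume c1: "c1 \<in> atlas M"
  have "\<forall>p. \<exists>c. p < k \<longrightarrow> c \<in> atlas M \<and> x p \<in> fst c"
    using x charted_cover[OF M] by (auto simp: PiE_iff)
  then obtain cc where cc: "\<And>p. p < k \<Longrightarrow> cc p \<in> atlas M \<and> x p \<in> fst (cc p)" by metis
  let ?c = "product_chart M k (cc(j := c1))"
  have "snd ?c (x(j := y)) m = insert_coords (mdim M) (\<lambda>i. j * mdim M + i) (snd ?c x) (snd c1 y) m" for y m
  proof (cases "m < k * mdim M")
    case True
    note m = block_index_cases[OF True]
    show ?thesis
    proof (cases "m div mdim M = j")
      case True
      then have "m = j * mdim M + m mod mdim M" using m(3) by simp
      then show ?thesis
        using m(2) \<open>m < k * mdim M\<close> True insert_coords_at[of "\<lambda>i. j * mdim M + i" "mdim M" "m mod mdim M" "snd ?c x" "snd c1 y"]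
        by (simp add: product_chart_def inj_on_def)
    next
      case False
      then have "m \<notin> (\<lambda>i. j * mdim M + i) ` {..<mdim M}" by auto
      then show ?thesis using True False by (simp add: insert_coords_def product_chart_def)
    qed
  next
    case False
    then have "m \<notin> (\<lambda>i. j * mdim M + i) ` {..<mdim M}" using block_index_less[OF j, of _ "mdim M"] by auto
    then show ?thesis using False by (simp add: insert_coords_def product_chart_def)
  qed
  then have "charts_compatible M (\<lambda>i. j * mdim M + i) (\<lambda>y. x(j := y)) c1 ?c"
    unfolding charts_compatible_def using cc x j
    by (intro exI[of _ "snd ?c x"]) (auto simp: PiE_iff extensional_def fun_eq_iff)
  moreover have "?c \<in> atlas (power_manifold M k)" using cc c1 by auto
  ultimately show "\<exists>c\<in>atlas (power_manifold M k). charts_compatible M (\<lambda>i. j * mdim M + i) (\<lambda>y. x(j := y)) c1 c" by blast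
qed

lemma slot_outside:
  "x \<in> topspace (mtop (power_manifold M k)) \<Longrightarrow> j < k \<Longrightarrow> y \<notin> topspace (mtop M) \<Longrightarrow> f \<in> smooth_functions (power_manifold M k) \<Longrightarrow> f (x(j := y)) = 0"
  by (rule smooth_functions_zero[of f "power_manifold M k"]) (auto simp: PiE_iff)

text \<open>\<open>slot_covector\<close> substitutes a point into functions on M^k, the pullback
  restricts such functions to M. The two agree because a smooth function on M^k is 0 once the
  substituted point leaves M.\<close>

lemma slot_covector_pullback:
  assumes M: "charted M" and x: "x \<in> topspace (mtop (power_manifold M k))" and j: "j < k"
  shows "slot_covector M k x \<xi> j = chart_embedding.pullback M (power_manifold M k) (\<lambda>y. x(j := y)) (x j) \<xi>"
proof -
  interpret E: chart_embedding M "power_manifold M k" "\<lambda>i. j * mdim M + i" "\<lambda>y. x(j := y)"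
    by (rule slot_embedding[OF assms])
  have "E.restr f = (\<lambda>y. f (x(j := y)))" if "f \<in> smooth_functions (power_manifold M k)" for f
    using slot_outside[OF x j _ that] by (auto simp: E.restr_def)
  then have "E.push v = (\<lambda>f. if f \<in> smooth_functions (power_manifold M k) then v (\<lambda>y. f (x(j := y))) else 0)" for v
    by (auto simp: E.push_def)
  then show ?thesis by (auto simp: slot_covector_def E.pullback_def)
qed

text \<open>Functoriality: a slot of M^a, followed by \<iota>, is a slot of M^k. Restrictions of
  functions compose, hence push-forwards of tangent vectors and pullbacks of covectors do so as
  well.\<close>

lemma slot_covector_pullback_slot:
  assumes M: "charted M" and x: "x \<in> topspace (mtop (power_manifold M a))" and p: "p < a" and q: "q < k"
    and E: "chart_embedding (power_manifold M a) (power_manifold M k) s \<iota>"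
    and \<iota>: "\<And>y. \<iota> (x(p := y)) = (\<iota> x)(q := y)"
  shows "slot_covector M a x (chart_embedding.pullback (power_manifold M a) (power_manifold M k) \<iota> x \<xi>) p = slot_covector M k (\<iota> x) \<xi> q"
proof -
  interpret E: chart_embedding "power_manifold M a" "power_manifold M k" s \<iota> by (rule E)
  interpret S: chart_embedding M "power_manifold M a" "\<lambda>i. p * mdim M + i" "\<lambda>y. x(p := y)"
    by (rule slot_embedding[OF M x p])
  have \<iota>x: "\<iota> x \<in> topspace (mtop (power_manifold M k))" by (rule E.\<iota>[OF x])
  interpret T: chart_embedding M "power_manifold M k" "\<lambda>i. q * mdim M + i" "\<lambda>y. (\<iota> x)(q := y)"
    by (rule slot_embedding[OF M \<iota>x q])
  have xp: "\<iota> x q = x p" using \<iota>[of "x p"] by (simp add: fun_upd_triv) (metis fun_upd_same)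
  have xpt: "x p \<in> topspace (mtop M)" using x p by (auto simp: PiE_iff)
  have "E.push (S.push v) f = T.push v f" for v f
  proof (cases "f \<in> smooth_functions (power_manifold M k)")
    case True
    have "S.restr (E.restr f) = T.restr f"
      by (rule ext) (use S.\<iota> in \<open>simp add: S.restr_def E.restr_def T.restr_def \<iota> del: power_manifold_simps\<close>)
    then show ?thesis using True E.restr_smooth[OF True] by (simp add: E.push_def S.push_def T.push_def)
  qed (simp add: E.push_def T.push_def)
  then have "E.push (S.push v) = T.push v" for v by (rule ext)
  then show ?thesis
    unfolding slot_covector_pullback[OF M x p] slot_covector_pullback[OF M \<iota>x q]
    using S.push_tangent[OF xpt] by (auto simp: S.pullback_def T.pullback_def E.pullback_def xp)
qed

lemma not_UpsilonD:
  "x \<in> topspace (mtop (power_manifold M k)) \<Longrightarrow> \<xi> \<in> cotangent_space (power_manifold M k) x \<Longrightarrow> \<xi> \<noteq> (\<lambda>_. 0) \<Longrightarrow> (x, \<xi>) \<notin> Upsilon M k \<Longrightarrow>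
    (\<forall>j<k. slot_covector M k x \<xi> j \<in> forward_cone M (x j)) \<or> (\<forall>j<k. slot_covector M k x \<xi> j \<in> backward_cone M (x j))"
  by (simp add: Upsilon_def)

text \<open>The slot components of the pullback are slot components of \<xi>, which lie all in
  forward cones or all in backward cones. The pullback may be 0; as \<open>Upsilon\<close> contains
  nonzero covectors only, no case distinction arises.\<close>

lemma not_Upsilon_pullback:
  assumes M: "charted M" and x: "x \<in> topspace (mtop (power_manifold M a))"
    and E: "chart_embedding (power_manifold M a) (power_manifold M k) s \<iota>"
    and \<sigma>: "\<And>p. p < a \<Longrightarrow> \<sigma> p < k" "\<And>p y. p < a \<Longrightarrow> \<iota> (x(p := y)) = (\<iota> x)(\<sigma> p := y)"
    and \<xi>: "\<xi> \<in> cotangent_space (power_manifold M k) (\<iota> x)" "\<xi> \<noteq> (\<lambda>_. 0)" "(\<iota> x, \<xi>) \<notin> Upsilon M k"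
  shows "(x, chart_embedding.pullback (power_manifold M a) (power_manifold M k) \<iota> x \<xi>) \<notin> Upsilon M a"
proof -
  have *: "slot_covector M a x (chart_embedding.pullback (power_manifold M a) (power_manifold M k) \<iota> x \<xi>) p = slot_covector M k (\<iota> x) \<xi> (\<sigma> p)" if "p < a" for p
    by (rule slot_covector_pullback_slot[OF M x that \<sigma>(1)[OF that] E \<sigma>(2)[OF that]])
  have "\<iota> x (\<sigma> p) = x p" if "p < a" for p
    using \<sigma>(2)[OF that, of "x p"] by (metis fun_upd_same fun_upd_triv)
  moreover have "\<iota> x \<in> topspace (mtop (power_manifold M k))" by (rule chart_embedding.\<iota>[OF E x])
  ultimately show ?thesis
    using not_UpsilonD[OF _ \<xi>] \<sigma>(1) * unfolding Upsilon_def by simp metis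
qed

lemma tensor_function_smooth:
  assumes M: "charted M" and H: "\<And>j. j < k \<Longrightarrow> H j \<in> smooth_functions M"
  shows "tensor_function M k H \<in> smooth_functions (power_manifold M k)"
  unfolding smooth_functions_def
proof (intro CollectI conjI allI impI ballI)
  show "tensor_function M k H x = 0" if "x \<notin> topspace (mtop (power_manifold M k))" for x
    using that by (simp add: tensor_function_def)
  fix C assume C: "C \<in> atlas (power_manifold M k)"
  then obtain c where c: "\<forall>j<k. c j \<in> atlas M" "C = product_chart M k c" by auto
  note P = power_manifold_charted[OF M, of k]
  note V = chart_image_open[OF P C]
  have V': "openin (Euclidean_space (k * mdim M)) (chart_image C)" using V by simp
  have "smooth_on_Rn (k * mdim M) (chart_image C) (\<lambda>y. complex_of_real (\<Prod>j<k. H j (chart_inv (c j) (blk (mdim M) j y))))"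
  proof (intro smooth_bounded_linear[OF V' bounded_linear_of_real] smooth_prod[OF V'])
    fix j assume "j \<in> {..<k}"
    then have j: "j < k" by simp
    show "smooth_on_Rn (k * mdim M) (chart_image C) (\<lambda>y. H j (chart_inv (c j) (blk (mdim M) j y)))"
    proof (rule smooth_compose[OF V' chart_image_open[OF M] smooth_functions_chart[OF H[OF j]]])
      show "smooth_on_Rn (k * mdim M) (chart_image C) (\<lambda>y. blk (mdim M) j y q)" if "q < mdim M" for q
        using smooth_coord[OF V'] that by (simp add: index_pull_def)
    qed (use c j chart_image_product_chart[OF M c(1)] in auto)
  qed
  then show "smooth_on_Rn (mdim (power_manifold M k)) (chart_image C) (\<lambda>y. tensor_function M k H (chart_inv C y))"
    unfolding power_manifold_simps
  proof (rule smooth_cong[OF V', rotated])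
    fix y assume y: "y \<in> chart_image C"
    have "chart_inv C y \<in> topspace (mtop (power_manifold M k))"
      using chart_subset[OF P C] chart_inv_in[OF P C y] by auto
    then show "complex_of_real (\<Prod>j<k. H j (chart_inv (c j) (blk (mdim M) j y))) = tensor_function M k H (chart_inv C y)"
      using chart_inv_product_chart[OF M c(1)] y by (simp add: tensor_function_def c(2) del: power_manifold_simps)
  qed
qed

lemma join_swap: "index_split k a b \<sigma> \<tau> \<Longrightarrow> join a b \<sigma> \<tau> x1 x2 = join b a \<tau> \<sigma> x2 x1"
  by (rule ext) (auto simp: join_def index_split_def)

text \<open>Moving one point of the first group moves exactly the corresponding point of the joined
  family; this is the compatibility of slots that \<open>not_Upsilon_pullback\<close> asks
  for.\<close>

lemma join_upd:
  assumes st: "index_split k a b \<sigma> \<tau>" and p: "p < a"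
  shows "join a b \<sigma> \<tau> (x1(p := y)) x2 = (join a b \<sigma> \<tau> x1 x2)(\<sigma> p := y)"
proof
  fix j
  have "inv_into {..<a} \<sigma> j \<noteq> p" if "j \<in> \<sigma> ` {..<a}" "j \<noteq> \<sigma> p" using f_inv_into_f[OF that(1)] that(2) by auto
  then show "join a b \<sigma> \<tau> (x1(p := y)) x2 j = ((join a b \<sigma> \<tau> x1 x2)(\<sigma> p := y)) j"
    using st p by (auto simp: join_def index_split_def)
qed

theorem tensor_microlocal:
  fixes M :: "'a spacetime"
  assumes M: "charted M" and st: "index_split k a b \<sigma> \<tau>"
    and u: "compact_distribution (power_manifold M a) u" "wavefront_set (power_manifold M a) u \<subseteq> Upsilon M a"
    and v: "compact_distribution (power_manifold M b) v" "wavefront_set (power_manifold M b) v \<subseteq> Upsilon M b"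
  obtains w where "compact_distribution (power_manifold M k) w" "wavefront_set (power_manifold M k) w \<subseteq> Upsilon M k"
    "\<And>H. (\<And>j. j < k \<Longrightarrow> H j \<in> smooth_functions M) \<Longrightarrow>
      w (tensor_function M k H) = u (tensor_function M a (\<lambda>p. H (\<sigma> p))) * v (tensor_function M b (\<lambda>p. H (\<tau> p)))"
proof -
  let ?A = "power_manifold M a" and ?B = "power_manifold M b" and ?K = "power_manifold M k"
  interpret P: manifold_product "power_manifold M a" "power_manifold M b" "power_manifold M k"
    "block_index (mdim M) \<sigma>" "block_index (mdim M) \<tau>" "join a b \<sigma> \<tau>" "pull_family a \<sigma>" "pull_family b \<tau>" "join_chart (mdim M) a b \<sigma> \<tau>"
    by (rule power_manifold_product[OF st M])
  note sl = split_less[OF st]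
  note upd1 = join_upd[OF st]
  have upd2: "join a b \<sigma> \<tau> x1 (x2(p := y)) = (join a b \<sigma> \<tau> x1 x2)(\<tau> p := y)" if "p < b" for x1 x2 :: "nat \<Rightarrow> 'a" and p y
    using join_upd[OF index_split_swap[OF st] that] by (simp add: join_swap[OF st])
  show ?thesis
  proof (rule that[of "P.tensor u v"])
    show "compact_distribution ?K (P.tensor u v)" by (rule P.tensor_distribution[OF u(1) v(1)])
    show "wavefront_set ?K (P.tensor u v) \<subseteq> Upsilon M k"
    proof (rule wavefront_subsetI[OF P.N])
      fix x \<xi> c
      assume x: "x \<in> topspace (mtop ?K)" and \<xi>: "\<xi> \<in> cotangent_space ?K x" "\<xi> \<noteq> (\<lambda>_. 0)" "(x, \<xi>) \<notin> Upsilon M k"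
        and c: "c \<in> atlas ?K" "x \<in> fst c"
      obtain c1 c2 where cc: "c1 \<in> atlas ?A" "c2 \<in> atlas ?B" "c = join_chart (mdim M) a b \<sigma> \<tau> c1 c2"
        using P.pc_surj[OF c(1)] by blast
      obtain x1 x2 where xx: "x1 \<in> fst c1" "x2 \<in> fst c2" "x = join a b \<sigma> \<tau> x1 x2"
        using c(2) unfolding cc(3) P.pc_fst[OF cc(1,2)] by auto
      have X: "x1 \<in> P.X1" "x2 \<in> P.X2" using xx chart_subset[OF P.N1 cc(1)] chart_subset[OF P.N2 cc(2)] by auto
      interpret L: chart_embedding "power_manifold M a" "power_manifold M k" "block_index (mdim M) \<sigma>" "\<lambda>y. join a b \<sigma> \<tau> y x2"
        by (rule P.left_embedding[OF X(2)])
      interpret R: chart_embedding "power_manifold M b" "power_manifold M k" "block_index (mdim M) \<tau>" "join a b \<sigma> \<tau> x1"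
        by (rule P.right_embedding[OF X(1)])
      let ?\<eta> = "cotangent_coords ?K c x \<xi>"
      let ?\<eta>1 = "cotangent_coords ?A c1 x1 (L.pullback x1 \<xi>)"
      let ?\<eta>2 = "cotangent_coords ?B c2 x2 (R.pullback x2 \<xi>)"
      note compL = P.charts_compatible_left[OF cc(1,2) xx(2), folded cc(3)]
      note compR = P.charts_compatible_right[OF cc(1,2) xx(1), folded cc(3)]
      have \<eta>1: "?\<eta>1 q = ?\<eta> (block_index (mdim M) \<sigma> q)" if "q < P.n1" for q
        using L.pullback_coords[OF cc(1) c(1) compL xx(1) that] xx(3) by simp
      have \<eta>2: "?\<eta>2 q = ?\<eta> (block_index (mdim M) \<tau> q)" if "q < P.n2" for q
        using R.pullback_coords[OF cc(2) c(1) compR xx(2) that] xx(3) by simp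
      have e: "P.rs ?\<eta> = ?\<eta>1" "P.rt ?\<eta> = ?\<eta>2"
        by (auto simp: index_pull_def fun_eq_iff \<eta>1 \<eta>2 simp del: power_manifold_simps) (auto simp: cotangent_coords_def)
      have \<xi>': "\<xi> \<in> cotangent_space ?K (join a b \<sigma> \<tau> x1 x2)" "(join a b \<sigma> \<tau> x1 x2, \<xi>) \<notin> Upsilon M k"
        using \<xi> by (simp_all add: xx(3))
      have cot: "L.pullback x1 \<xi> \<in> cotangent_space ?A x1" "R.pullback x2 \<xi> \<in> cotangent_space ?B x2"
        by (rule L.pullback_cotangent[OF X(1) \<xi>'(1)] R.pullback_cotangent[OF X(2) \<xi>'(1)])+
      have U1: "(x1, L.pullback x1 \<xi>) \<notin> wavefront_set ?A u"
        using not_Upsilon_pullback[OF M X(1) L.chart_embedding_axioms sl(1) upd1 \<xi>'(1) \<xi>(2) \<xi>'(2)] u(2) by blast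
      have U2: "(x2, R.pullback x2 \<xi>) \<notin> wavefront_set ?B v"
        using not_Upsilon_pullback[OF M X(2) R.chart_embedding_axioms sl(2) upd2 \<xi>'(1) \<xi>(2) \<xi>'(2)] v(2) by blast
      \<comment> \<open>A vanishing restriction of \<xi> says nothing about u; then any cutoff that
        is nonzero at the point serves. Hence regularity is recorded as an implication.\<close>
      obtain \<rho>1 where \<rho>1: "cutoff ?A c1 \<rho>1" "\<rho>1 x1 \<noteq> 0"
        "L.pullback x1 \<xi> \<noteq> (\<lambda>_. 0) \<Longrightarrow> regular_direction P.n1 (local_fourier ?A c1 u \<rho>1) ?\<eta>1"
        using not_wavefrontD[OF P.N1 U1 X(1) cot(1) _ cc(1) xx(1)] cutoff_exists[OF P.N1 cc(1) xx(1)] by metis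
      obtain \<rho>2 where \<rho>2: "cutoff ?B c2 \<rho>2" "\<rho>2 x2 \<noteq> 0"
        "R.pullback x2 \<xi> \<noteq> (\<lambda>_. 0) \<Longrightarrow> regular_direction P.n2 (local_fourier ?B c2 v \<rho>2) ?\<eta>2"
        using not_wavefrontD[OF P.N2 U2 X(2) cot(2) _ cc(2) xx(2)] cutoff_exists[OF P.N2 cc(2) xx(2)] by metis
      \<comment> \<open>A nonzero coordinate of \<xi> belongs to one of the two groups of factors.
        That group has a nonzero restriction and therefore a regular direction.\<close>
      obtain m where m: "m < P.n" "?\<eta> m \<noteq> 0" by (rule cotangent_nonzero_coord[OF P.N c \<xi>(1,2)])
      have nz: "?\<eta> (block_index (mdim M) \<sigma> q) = 0" if "L.pullback x1 \<xi> = (\<lambda>_. 0)" "q < P.n1" for q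
        using \<eta>1[OF that(2)] that by (simp add: cotangent_coords_def)
      have nz': "?\<eta> (block_index (mdim M) \<tau> q) = 0" if "R.pullback x2 \<xi> = (\<lambda>_. 0)" "q < P.n2" for q
        using \<eta>2[OF that(2)] that by (simp add: cotangent_coords_def)
      have "(\<exists>q<P.n1. ?\<eta> (block_index (mdim M) \<sigma> q) \<noteq> 0) \<and> regular_direction P.n1 (local_fourier ?A c1 u \<rho>1) (P.rs ?\<eta>) \<or>
        (\<exists>q<P.n2. ?\<eta> (block_index (mdim M) \<tau> q) \<noteq> 0) \<and> regular_direction P.n2 (local_fourier ?B c2 v \<rho>2) (P.rt ?\<eta>)"
        unfolding e using P.st_cases[OF m(1)] m(2) \<rho>1(3) \<rho>2(3) nz nz' by metis
      moreover have "?\<eta> \<in> euc P.n" by (simp add: cotangent_coords_def euc_def)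
      ultimately have "regular_direction P.n (local_fourier ?K c (P.tensor u v) (P.tensor_fun \<rho>1 \<rho>2)) ?\<eta>"
        unfolding cc(3) by (intro P.tensor_regular_direction[OF cc(1,2) \<rho>1(1) \<rho>2(1) u(1) v(1)])
      moreover have "cutoff ?K c (P.tensor_fun \<rho>1 \<rho>2)"
        unfolding cc(3) by (rule P.tensor_fun_cutoff[OF cc(1,2) \<rho>1(1) \<rho>2(1)])
      moreover have "P.tensor_fun \<rho>1 \<rho>2 x \<noteq> 0" unfolding xx(3) P.tensor_fun_J[OF X] using \<rho>1(2) \<rho>2(2) by simp
      ultimately show "\<exists>\<rho>. cutoff ?K c \<rho> \<and> \<rho> x \<noteq> 0 \<and> regular_direction P.n (local_fourier ?K c (P.tensor u v) \<rho>) ?\<eta>" by blast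
    qed
  next
    fix H :: "nat \<Rightarrow> 'a \<Rightarrow> real" assume H: "\<And>j. j < k \<Longrightarrow> H j \<in> smooth_functions M"
    show "P.tensor u v (tensor_function M k H) = u (tensor_function M a (\<lambda>p. H (\<sigma> p))) * v (tensor_function M b (\<lambda>p. H (\<tau> p)))"
    proof (rule P.tensor_product[OF u(1) v(1) tensor_function_smooth[OF M H[OF sl(1)]] tensor_function_smooth[OF M H[OF sl(2)]]])
      fix x1 x2 assume x: "x1 \<in> P.X1" "x2 \<in> P.X2"
      have "(\<Prod>j<k. H j (join a b \<sigma> \<tau> x1 x2 j)) = (\<Prod>p<a. H (\<sigma> p) (x1 p)) * (\<Prod>p<b. H (\<tau> p) (x2 p))"
      proof -
        let ?f = "\<lambda>j. H j (join a b \<sigma> \<tau> x1 x2 j)"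
        have "(\<Prod>j<k. ?f j) = prod ?f (\<sigma> ` {..<a}) * prod ?f (\<tau> ` {..<b})"
          using st by (subst prod.union_disjoint[symmetric]) (auto simp: index_split_def)
        then show ?thesis using st by (simp add: index_split_def prod.reindex join_simps[OF st])
      qed
      then show "tensor_function M k H (join a b \<sigma> \<tau> x1 x2) = tensor_function M a (\<lambda>p. H (\<sigma> p)) x1 * tensor_function M b (\<lambda>p. H (\<tau> p)) x2"
        using x P.J[OF x] by (simp add: tensor_function_def del: power_manifold_simps)
    qed
  qed
qed

section \<open>Light cones under negation\<close>

context
  fixes M :: "'a spacetime" and x :: 'a
  assumes M: "charted M" and x: "x \<in> topspace (mtop M)" and L: "lorentzian_at M x"
begin

lemma metric_linear: "v \<in> tangent_space M x \<Longrightarrow> linear_form_on (tangent_space M x) (metric M x v)"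
  and metric_sym: "v \<in> tangent_space M x \<Longrightarrow> w \<in> tangent_space M x \<Longrightarrow> metric M x v w = metric M x w v"
  using L by (auto simp: lorentzian_at_def)

text \<open>\<open>sharp\<close> is a definite description, so unique existence has to precede any
  computation with it. In a pseudo-orthonormal frame e the solution is forced: its i-th coefficient
  is the value of \<xi> at \<open>e i\<close> times the sign of that vector.\<close>

lemma sharp_unique:
  assumes \<xi>: "\<xi> \<in> cotangent_space M x"
  shows "\<exists>!v. v \<in> tangent_space M x \<and> (\<forall>w\<in>tangent_space M x. metric M x v w = \<xi> w)"
proof -
  obtain e where e: "\<And>i. i < mdim M \<Longrightarrow> e i \<in> tangent_space M x"
    "\<And>v. v \<in> tangent_space M x \<Longrightarrow> \<exists>a. v = (\<lambda>f. \<Sum>i<mdim M. a i * e i f)"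
    "\<And>i j. i < mdim M \<Longrightarrow> j < mdim M \<Longrightarrow> metric M x (e i) (e j) = (if i \<noteq> j then 0 else if i = 0 then - 1 else 1)"
    using L unfolding lorentzian_at_def by blast
  define \<epsilon> :: "nat \<Rightarrow> real" where "\<epsilon> i = (if i = 0 then - 1 else 1)" for i
  let ?n = "mdim M" and ?T = "tangent_space M x"
  let ?c = "\<lambda>a f. \<Sum>i<?n. a i * e i f"
  have \<epsilon>: "\<epsilon> i * \<epsilon> i = 1" for i by (simp add: \<epsilon>_def)
  have \<xi>L: "linear_form_on ?T \<xi>" using \<xi> by (simp add: cotangent_space_def)
  note S = linear_form_sum[OF M x _ e(1), of _ ?n]
  have cT: "?c a \<in> ?T" for a using S(1)[OF \<xi>L] by simp
  have g: "metric M x (e i) (?c a) = \<epsilon> i * a i" if i: "i < ?n" for i a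
  proof -
    have "metric M x (e i) (?c a) = (\<Sum>j<?n. a j * metric M x (e i) (e j))" by (rule S(2)[OF metric_linear[OF e(1)[OF i]]])
    also have "\<dots> = (\<Sum>j<?n. if j = i then \<epsilon> i * a i else 0)" by (rule sum.cong) (use i in \<open>auto simp: e(3) \<epsilon>_def\<close>)
    finally show ?thesis using i by simp
  qed
  show ?thesis
  proof (rule ex1I[of _ "?c (\<lambda>i. \<epsilon> i * \<xi> (e i))"])
    have "metric M x (?c (\<lambda>i. \<epsilon> i * \<xi> (e i))) w = \<xi> w" if w: "w \<in> ?T" for w
    proof -
      obtain a where a: "w = ?c a" using e(2)[OF w] by blast
      have "metric M x (?c (\<lambda>i. \<epsilon> i * \<xi> (e i))) w = (\<Sum>j<?n. a j * metric M x (?c (\<lambda>i. \<epsilon> i * \<xi> (e i))) (e j))"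
        unfolding a by (rule S(2)[OF metric_linear[OF cT]])
      also have "\<dots> = (\<Sum>j<?n. a j * \<xi> (e j))"
        by (rule sum.cong) (auto simp: metric_sym[OF cT e(1)] g mult.assoc[symmetric] \<epsilon>)
      also have "\<dots> = \<xi> w" unfolding a by (rule S(2)[OF \<xi>L, symmetric])
      finally show ?thesis .
    qed
    then show "?c (\<lambda>i. \<epsilon> i * \<xi> (e i)) \<in> ?T \<and> (\<forall>w\<in>?T. metric M x (?c (\<lambda>i. \<epsilon> i * \<xi> (e i))) w = \<xi> w)"
      by (rule conjI[OF cT ballI])
  next
    fix v assume v: "v \<in> ?T \<and> (\<forall>w\<in>?T. metric M x v w = \<xi> w)"
    then obtain a where a: "v = ?c a" using e(2) by blast
    have "\<epsilon> i * \<xi> (e i) = a i" if "i < ?n" for i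
      using v g[OF that, of a] metric_sym[OF e(1)[OF that], of v] e(1)[OF that] by (simp add: a[symmetric] mult.assoc[symmetric] \<epsilon>)
    then show "v = ?c (\<lambda>i. \<epsilon> i * \<xi> (e i))" unfolding a by auto
  qed
qed

lemma sharpD:
  assumes "\<xi> \<in> cotangent_space M x"
  shows "sharp M x \<xi> \<in> tangent_space M x" "w \<in> tangent_space M x \<Longrightarrow> metric M x (sharp M x \<xi>) w = \<xi> w"
  using theI'[OF sharp_unique[OF assms]] by (auto simp: sharp_def)

lemma metric_neg:
  assumes "v \<in> tangent_space M x" "w \<in> tangent_space M x"
  shows "metric M x v (\<lambda>f. - w f) = - metric M x v w" "metric M x (\<lambda>f. - v f) w = - metric M x v w"
proof -
  have *: "metric M x v (\<lambda>f. - w f) = - metric M x v w" if "v \<in> tangent_space M x" "w \<in> tangent_space M x" for v w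
    using linear_form_onD(2)[OF metric_linear[OF that(1)] that(2), of "-1"] by simp
  show "metric M x v (\<lambda>f. - w f) = - metric M x v w" by (rule *[OF assms])
  have "(\<lambda>f. - v f) \<in> tangent_space M x" using tangent_space_closed(2)[OF M x assms(1), of "-1"] by simp
  then show "metric M x (\<lambda>f. - v f) w = - metric M x v w"
    using *[OF assms(2,1)] metric_sym assms by simp
qed

lemma cotangent_neg: "\<xi> \<in> cotangent_space M x \<Longrightarrow> (\<lambda>v. - \<xi> v) \<in> cotangent_space M x"
  by (auto simp: cotangent_space_def linear_form_on_def)

lemma sharp_neg:
  assumes \<xi>: "\<xi> \<in> cotangent_space M x"
  shows "sharp M x (\<lambda>v. - \<xi> v) = (\<lambda>f. - sharp M x \<xi> f)"
  unfolding sharp_def[of M x "\<lambda>v. - \<xi> v"]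
proof (rule the1_equality[OF sharp_unique[OF cotangent_neg[OF \<xi>]]])
  show "(\<lambda>f. - sharp M x \<xi> f) \<in> tangent_space M x \<and> (\<forall>w\<in>tangent_space M x. metric M x (\<lambda>f. - sharp M x \<xi> f) w = - \<xi> w)"
    using tangent_space_closed(2)[OF M x sharpD(1)[OF \<xi>], of "-1"] sharpD[OF \<xi>] by (simp add: metric_neg)
qed

lemma cone_neg:
  assumes t: "time_field M x \<in> tangent_space M x"
  shows "\<xi> \<in> forward_cone M x \<Longrightarrow> (\<lambda>v. - \<xi> v) \<in> backward_cone M x" "\<xi> \<in> backward_cone M x \<Longrightarrow> (\<lambda>v. - \<xi> v) \<in> forward_cone M x"
proof -
  have *: "inverse_metric M x (\<lambda>v. - \<xi> v) (\<lambda>v. - \<xi> v) = inverse_metric M x \<xi> \<xi>"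
    "metric M x (time_field M x) (sharp M x (\<lambda>v. - \<xi> v)) = - metric M x (time_field M x) (sharp M x \<xi>)" if \<xi>: "\<xi> \<in> cotangent_space M x"
  proof -
    have "(\<lambda>f. - sharp M x \<xi> f) \<in> tangent_space M x" using tangent_space_closed(2)[OF M x sharpD(1)[OF \<xi>], of "-1"] by simp
    then show "inverse_metric M x (\<lambda>v. - \<xi> v) (\<lambda>v. - \<xi> v) = inverse_metric M x \<xi> \<xi>"
      "metric M x (time_field M x) (sharp M x (\<lambda>v. - \<xi> v)) = - metric M x (time_field M x) (sharp M x \<xi>)"
      using sharpD(1)[OF \<xi>] t by (simp_all add: inverse_metric_def sharp_neg[OF \<xi>] metric_neg)
  qed
  show "\<xi> \<in> forward_cone M x \<Longrightarrow> (\<lambda>v. - \<xi> v) \<in> backward_cone M x" "\<xi> \<in> backward_cone M x \<Longrightarrow> (\<lambda>v. - \<xi> v) \<in> forward_cone M x"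
    by (auto simp: forward_cone_def backward_cone_def * cotangent_neg)
qed

end

text \<open>Negation acts in all slots at once and exchanges forward and backward cones, and
  \<open>Upsilon\<close> excludes both alternatives. The symmetry is what the kernel of a complex
  conjugate functional requires.\<close>

lemma Upsilon_neg:
  assumes M: "charted M" "lorentzian_metric M" "time_oriented M"
    and \<xi>: "\<xi> \<in> cotangent_space (power_manifold M k) x" and neg: "(x, \<lambda>v. - \<xi> v) \<in> Upsilon M k"
  shows "(x, \<xi>) \<in> Upsilon M k"
proof -
  have x: "x \<in> topspace (mtop (power_manifold M k))" using neg by (simp add: Upsilon_def)
  have xj: "x j \<in> topspace (mtop M)" if "j < k" for j using x that by (auto simp: PiE_iff)
  have s: "slot_covector M k x (\<lambda>v. - \<xi> v) j = (\<lambda>v. - slot_covector M k x \<xi> j v)" for j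
    by (auto simp: slot_covector_def)
  note cn = cone_neg[OF M(1) xj]
  have L: "lorentzian_at M (x j)" "time_field M (x j) \<in> tangent_space M (x j)" if "j < k" for j
    using M(2,3) xj[OF that] by (auto simp: lorentzian_metric_def time_oriented_def)
  show ?thesis
  proof (rule ccontr)
    assume "(x, \<xi>) \<notin> Upsilon M k"
    moreover have "(\<lambda>v. - \<xi> v) \<noteq> (\<lambda>_. 0)" using neg unfolding Upsilon_def by blast
    then have "\<xi> \<noteq> (\<lambda>_. 0)" by auto
    ultimately have "(\<forall>j<k. slot_covector M k x \<xi> j \<in> forward_cone M (x j)) \<or> (\<forall>j<k. slot_covector M k x \<xi> j \<in> backward_cone M (x j))"
      by (intro not_UpsilonD[OF x \<xi>])
    then have "(\<forall>j<k. slot_covector M k x (\<lambda>v. - \<xi> v) j \<in> backward_cone M (x j)) \<or> (\<forall>j<k. slot_covector M k x (\<lambda>v. - \<xi> v) j \<in> forward_cone M (x j))"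
      unfolding s using cn(1)[OF _ L] cn(2)[OF _ L] by (elim disjE) simp_all
    then show False using neg unfolding Upsilon_def mem_Collect_eq prod.case by argo
  qed
qed

section \<open>Composition of functionals\<close>

lemma tensor_function_cong: "(\<And>j. j < k \<Longrightarrow> H j = H' j) \<Longrightarrow> tensor_function M k H = tensor_function M k H'"
  by (auto simp: tensor_function_def fun_eq_iff)

lemma wavefront_zero:
  assumes N: "charted N"
  shows "compact_distribution N (\<lambda>f. 0)" "wavefront_set N (\<lambda>f. 0) \<subseteq> S"
proof -
  show "compact_distribution N (\<lambda>f. 0)" by (simp add: compact_distribution_def)
  show "wavefront_set N (\<lambda>f. 0) \<subseteq> S"
  proof (rule wavefront_subsetI[OF N])
    fix x \<xi> c assume c: "c \<in> atlas N" "x \<in> fst c"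
    obtain \<rho> where \<rho>: "cutoff N c \<rho>" "\<rho> x \<noteq> 0" by (rule cutoff_exists[OF N c])
    have "regular_direction (mdim N) (local_fourier N c (\<lambda>f. 0) \<rho>) (cotangent_coords N c x \<xi>)"
      by (rule regular_directionI[OF openin_euc]) (auto simp: local_fourier_def cotangent_coords_def euc_def)
    with \<rho> show "\<exists>\<rho>. cutoff N c \<rho> \<and> \<rho> x \<noteq> 0 \<and> regular_direction (mdim N) (local_fourier N c (\<lambda>f. 0) \<rho>) (cotangent_coords N c x \<xi>)" by blast
  qed
qed

text \<open>M^0 has a single point, the everywhere \<open>undefined\<close> family, and dimension 0.
  There are no nonzero covectors on it, so any bound on the wave front set holds, and the empty
  tensor product is 1. A number thus becomes a kernel without directions.\<close>

lemma point_kernel: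
  assumes M: "charted M"
  shows "compact_distribution (power_manifold M 0) (\<lambda>f. a * f (\<lambda>_. undefined))"
    and "wavefront_set (power_manifold M 0) (\<lambda>f. a * f (\<lambda>_. undefined)) \<subseteq> S"
    and "a * tensor_function M 0 H (\<lambda>_. undefined) = a"
proof -
  let ?N = "power_manifold M 0" and ?o = "\<lambda>_::nat. undefined" and ?c = "product_chart M 0 (\<lambda>_. undefined)"
  note N = power_manifold_charted[OF M, of 0]
  have c: "?c \<in> atlas ?N" "?o \<in> fst ?c" by auto
  have t: "(?c, {?o}, []) \<in> tests ?N" using c by (auto simp: tests_def)
  show "compact_distribution ?N (\<lambda>f. a * f ?o)"
  proof (rule compact_distributionI[OF N, where S="{(?c, {?o}, [])}" and C="norm a"])
    fix f :: "(nat \<Rightarrow> 'a) \<Rightarrow> complex" and B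
    assume "\<And>\<tau>. \<tau> \<in> {(?c, {?o}, [])} \<Longrightarrow> test_le \<tau> f B"
    then have "norm (f ?o) \<le> B" using chart_inv_snd[OF N c] by (simp add: test_le_def)
    then show "norm (a * f ?o) \<le> norm a * B" by (simp add: norm_mult mult_left_mono)
  qed (use t in \<open>auto simp: algebra_simps\<close>)
  show "wavefront_set ?N (\<lambda>f. a * f ?o) \<subseteq> S"
  proof (rule wavefront_subsetI[OF N])
    fix x \<xi> c assume "\<xi> \<in> cotangent_space ?N x" "\<xi> \<noteq> (\<lambda>_. 0)" "c \<in> atlas ?N" "x \<in> fst c"
    then obtain i where "i < mdim ?N" using cotangent_nonzero_coord[OF N] by blast
    then show "\<exists>\<rho>. cutoff ?N c \<rho> \<and> \<rho> x \<noteq> 0 \<and> regular_direction (mdim ?N) (local_fourier ?N c (\<lambda>f. a * f ?o) \<rho>) (cotangent_coords ?N c x \<xi>)" by simp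
  qed
  show "a * tensor_function M 0 H ?o = a" by (simp add: tensor_function_def)
qed

section \<open>Functionals under real-linear maps of their values\<close>

lemma continuous_bounded_linear: "bounded_linear L \<Longrightarrow> continuous_map X euclidean f \<Longrightarrow> continuous_map X euclidean (\<lambda>x. L (f x))"
  using continuous_map_compose[of X euclidean f euclidean L] by (simp add: o_def linear_continuous_on)

text \<open>The conditions of \<open>microcausal_functionals\<close> on the derivatives, separated
  from the condition on the support: they pass to real and imaginary parts and to compositions term
  by term, while supports are compared directly.\<close>

definition microlocal_functional :: "'a spacetime \<Rightarrow> ('a \<Rightarrow> real) set \<Rightarrow> 'a functional \<Rightarrow> bool" where
  "microlocal_functional M \<U> F \<longleftrightarrow> smooth_functional M \<U> F \<and>
    (\<forall>\<phi>\<in>\<U>. \<forall>k\<ge>1. \<exists>u. is_kernel M k (\<lambda>hs. gateaux F hs \<phi>) u \<and> wavefront_set (power_manifold M k) u \<subseteq> Upsilon M k)"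

lemma gateaux_has_vector_derivative:
  assumes "smooth_functional M \<U> F" "\<phi> \<in> \<U>" "h \<in> smooth_functions M" "set hs \<subseteq> smooth_functions M"
  shows "((\<lambda>s. gateaux F hs (\<lambda>x. \<phi> x + s * h x)) has_vector_derivative gateaux F (h # hs) \<phi>) (at 0)"
  using assms unfolding smooth_functional_def by (simp add: vector_derivative_works)

context
  fixes M :: "'a spacetime" and \<U> :: "('a \<Rightarrow> real) set"
  assumes M: "charted M" and \<U>: "openin (smooth_topology M) \<U>"
begin

lemma topspace_domain: "topspace (subtopology (smooth_topology M) \<U>) = \<U>"
  using openin_subset[OF \<U>] by auto

lemma line_in_domain: "\<phi> \<in> \<U> \<Longrightarrow> h \<in> smooth_functions M \<Longrightarrow> \<forall>\<^sub>F s in nhds 0. (\<lambda>x. \<phi> x + s * h x) \<in> \<U>"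
  using line_eventually[OF M \<U>, of \<phi> h] by simp

text \<open>The line stays in the open domain for small s, so an identity known on \<U> may be
  differentiated along it. In this way values of functionals outside \<U> are kept out of all
  derivatives.\<close>

lemma derivative_along_cong:
  assumes \<phi>: "\<phi> \<in> \<U>" and h: "h \<in> smooth_functions M" and eq: "\<And>\<phi>. \<phi> \<in> \<U> \<Longrightarrow> f \<phi> = g \<phi>"
    and g: "((\<lambda>s. g (\<lambda>x. \<phi> x + s * h x)) has_vector_derivative D) (at 0)"
  shows "((\<lambda>s. f (\<lambda>x. \<phi> x + s * h x)) has_vector_derivative D) (at 0)"
proof -
  have "\<forall>\<^sub>F s in nhds 0. s \<in> UNIV \<longrightarrow> f (\<lambda>x. \<phi> x + s * h x) = g (\<lambda>x. \<phi> x + s * h x)"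
    using line_in_domain[OF \<phi> h] by eventually_elim (simp add: eq)
  from has_vector_derivative_cong_ev[OF this] show ?thesis using g eq[OF \<phi>] by simp
qed

lemma gateaux_linear:
  assumes F: "smooth_functional M \<U> F" and L: "bounded_linear L"
  shows "set hs \<subseteq> smooth_functions M \<Longrightarrow> \<phi> \<in> \<U> \<Longrightarrow> gateaux (\<lambda>\<phi>. L (F \<phi>)) hs \<phi> = L (gateaux F hs \<phi>)"
proof (induction hs arbitrary: \<phi>)
  case (Cons h hs)
  have h: "h \<in> smooth_functions M" "set hs \<subseteq> smooth_functions M" using Cons.prems by auto
  have "((\<lambda>s. L (gateaux F hs (\<lambda>x. \<phi> x + s * h x))) has_vector_derivative L (gateaux F (h # hs) \<phi>)) (at 0)"
    by (rule bounded_linear.has_vector_derivative[OF L gateaux_has_vector_derivative[OF F Cons.prems(2) h]])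
  from derivative_along_cong[OF Cons.prems(2) h(1) Cons.IH[OF h(2)] this]
  show ?case by (simp add: vector_derivative_at)
qed simp

lemma topspace_directions:
  "p \<in> topspace (prod_topology (subtopology (smooth_topology M) \<U>) (product_topology (\<lambda>_. smooth_topology M) {..<k})) \<Longrightarrow>
    fst p \<in> \<U> \<and> (\<forall>i<k. snd p i \<in> smooth_functions M)"
  unfolding topspace_prod_topology topspace_domain by (auto simp: topspace_smooth_topology PiE_iff)

lemma smooth_functional_linear:
  assumes F: "smooth_functional M \<U> F" and L: "bounded_linear L"
  shows "smooth_functional M \<U> (\<lambda>\<phi>. L (F \<phi>))"
  unfolding smooth_functional_def
proof (intro conjI ballI allI impI)
  show "continuous_map (subtopology (smooth_topology M) \<U>) euclidean (\<lambda>\<phi>. L (F \<phi>))"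
    using F by (intro continuous_bounded_linear[OF L]) (simp add: smooth_functional_def)
next
  fix \<phi> h :: "'a \<Rightarrow> real" and hs :: "('a \<Rightarrow> real) list" assume \<phi>: "\<phi> \<in> \<U>" and h: "h \<in> smooth_functions M" "set hs \<subseteq> smooth_functions M"
  show "(\<lambda>s. gateaux (\<lambda>\<phi>. L (F \<phi>)) hs (\<lambda>x. \<phi> x + s * h x)) differentiable at 0"
    by (rule differentiableI_vector, rule derivative_along_cong[OF \<phi> h(1) gateaux_linear[OF F L h(2)]],
        assumption, rule bounded_linear.has_vector_derivative[OF L gateaux_has_vector_derivative[OF F \<phi> h]])
next
  fix k :: nat assume k: "k \<ge> 1"
  let ?X = "prod_topology (subtopology (smooth_topology M) \<U>) (product_topology (\<lambda>_. smooth_topology M :: ('a \<Rightarrow> real) topology) {..<k})"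
  have "continuous_map ?X euclidean (\<lambda>p. L (case p of (\<phi>, H) \<Rightarrow> gateaux F (map H [0..<k]) \<phi>))"
    using F k by (intro continuous_bounded_linear[OF L]) (simp add: smooth_functional_def)
  then show "continuous_map ?X euclidean (\<lambda>(\<phi>, H). gateaux (\<lambda>\<phi>. L (F \<phi>)) (map H [0..<k]) \<phi>)"
  proof (rule continuous_map_eq)
    fix p assume "p \<in> topspace ?X"
    from topspace_directions[OF this]
    show "L (case p of (\<phi>, H) \<Rightarrow> gateaux F (map H [0..<k]) \<phi>) = (case p of (\<phi>, H) \<Rightarrow> gateaux (\<lambda>\<phi>. L (F \<phi>)) (map H [0..<k]) \<phi>)"
      unfolding split_beta by (intro gateaux_linear[OF F L, symmetric]) auto
  qed
qed

text \<open>Real-linear maps of the complex plane have the form given for L; real and imaginary part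
  are the cases used. Tensor functions of real directions are real, so on them the conjugate
  distribution takes the conjugate value of u, and the same combination of the two is the kernel for
  L.\<close>

lemma microlocal_functional_linear:
  assumes g: "lorentzian_metric M" "time_oriented M" and F: "microlocal_functional M \<U> F" and L: "bounded_linear L" "\<And>z. L z = \<alpha> * z + \<beta> * cnj z"
  shows "microlocal_functional M \<U> (\<lambda>\<phi>. L (F \<phi>))"
  unfolding microlocal_functional_def
proof (intro conjI ballI allI impI)
  have sF: "smooth_functional M \<U> F" using F by (simp add: microlocal_functional_def)
  then show "smooth_functional M \<U> (\<lambda>\<phi>. L (F \<phi>))" by (rule smooth_functional_linear[OF _ L(1)])
  fix \<phi> and k :: nat assume \<phi>: "\<phi> \<in> \<U>" and k: "k \<ge> 1"
  let ?N = "power_manifold M k"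
  note N = power_manifold_charted[OF M, of k]
  obtain u where u: "is_kernel M k (\<lambda>hs. gateaux F hs \<phi>) u" "wavefront_set ?N u \<subseteq> Upsilon M k"
    using F \<phi> k unfolding microlocal_functional_def by blast
  have u': "compact_distribution ?N u" using u(1) by (simp add: is_kernel_def)
  let ?v = "\<lambda>f. cnj (u (\<lambda>x. cnj (f x)))"
  note v = compact_distribution_cnj[OF N u'] wavefront_cnj[OF N u(2) Upsilon_neg[OF M g]]
  let ?w = "\<lambda>f. \<alpha> * u f + \<beta> * ?v f"
  have "compact_distribution ?N ?w"
    by (intro compact_distribution_sum2[OF N] compact_distribution_scale[OF N] u' v(1))
  moreover have "wavefront_set ?N ?w \<subseteq> Upsilon M k"
    by (intro wavefront_add[OF N] compact_distribution_scale[OF N] wavefront_scale[OF N] u' u(2) v)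
  moreover have "?w (tensor_function M k H) = gateaux (\<lambda>\<phi>. L (F \<phi>)) (map H [0..<k]) \<phi>" if H: "\<forall>j<k. H j \<in> smooth_functions M" for H
  proof -
    have "(\<lambda>x. cnj (tensor_function M k H x)) = tensor_function M k H" by (auto simp: tensor_function_def)
    moreover have "gateaux (\<lambda>\<phi>. L (F \<phi>)) (map H [0..<k]) \<phi> = L (gateaux F (map H [0..<k]) \<phi>)"
      by (rule gateaux_linear[OF sF L(1) _ \<phi>]) (use H in auto)
    ultimately show ?thesis using u(1) H by (simp add: is_kernel_def L(2))
  qed
  ultimately show "\<exists>u. is_kernel M k (\<lambda>hs. gateaux (\<lambda>\<phi>. L (F \<phi>)) hs \<phi>) u \<and> wavefront_set ?N u \<subseteq> Upsilon M k"
    unfolding is_kernel_def by blast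
qed

end

text \<open>The components of q are real, so that \<psi> is differentiated in real variables, while
  kernels belong to complex functionals; hence the hypothesis speaks of the embedded components. In
  the application N is 2n. The zeros from N on place q in \<open>Euclidean_space N\<close>.\<close>

locale functional_composition =
  fixes M :: "'a spacetime" and \<U> :: "('a \<Rightarrow> real) set" and N :: nat and q :: "('a \<Rightarrow> real) \<Rightarrow> nat \<Rightarrow> real"
    and V :: "(nat \<Rightarrow> real) set" and \<psi> :: "(nat \<Rightarrow> real) \<Rightarrow> complex"
  assumes M: "charted M" and \<U>: "openin (smooth_topology M) \<U>"
    and q: "\<And>m. m < N \<Longrightarrow> microlocal_functional M \<U> (\<lambda>\<phi>. complex_of_real (q \<phi> m))"
    and V: "openin (Euclidean_space N) V" and qV: "\<And>\<phi>. \<phi> \<in> \<U> \<Longrightarrow> q \<phi> \<in> V" and q0: "\<And>\<phi> m. N \<le> m \<Longrightarrow> q \<phi> m = 0"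
    and \<psi>: "smooth_on_Rn N V \<psi>"
begin

abbreviation Q :: "nat \<Rightarrow> 'a functional" where "Q m \<equiv> \<lambda>\<phi>. complex_of_real (q \<phi> m)"

lemma Q_smooth: "m < N \<Longrightarrow> smooth_functional M \<U> (Q m)"
  using q by (simp add: microlocal_functional_def)

text \<open>\<open>faa_di_bruno is E\<close>: \<open>E H\<close> is a sum of terms of the iterated chain rule for the directions
  \<open>H i\<close>, \<open>i\<close> in \<open>is\<close>.\<close>

inductive faa_di_bruno :: "nat list \<Rightarrow> ((nat \<Rightarrow> 'a \<Rightarrow> real) \<Rightarrow> ('a \<Rightarrow> real) \<Rightarrow> complex) \<Rightarrow> bool" where
  outer: "set js \<subseteq> {..<N} \<Longrightarrow> faa_di_bruno [] (\<lambda>H \<phi>. iter_partial js \<psi> (q \<phi>))"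
| inner: "m < N \<Longrightarrow> is \<noteq> [] \<Longrightarrow> faa_di_bruno is (\<lambda>H. gateaux (Q m) (map H is))"
| zero: "faa_di_bruno is (\<lambda>H \<phi>. 0)"
| add: "faa_di_bruno is E \<Longrightarrow> faa_di_bruno is E' \<Longrightarrow> faa_di_bruno is (\<lambda>H \<phi>. E H \<phi> + E' H \<phi>)"
| mult: "faa_di_bruno is1 E1 \<Longrightarrow> faa_di_bruno is2 E2 \<Longrightarrow> mset is = mset is1 + mset is2 \<Longrightarrow>
    faa_di_bruno is (\<lambda>H \<phi>. E1 H \<phi> * E2 H \<phi>)"

lemma faa_di_bruno_sum: "(\<And>i. i < m \<Longrightarrow> faa_di_bruno is (E i)) \<Longrightarrow> faa_di_bruno is (\<lambda>H \<phi>. \<Sum>i<m::nat. E i H \<phi>)"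
proof (induction m)
  case (Suc m)
  then have "faa_di_bruno is (\<lambda>H \<phi>. (\<Sum>i<m. E i H \<phi>) + E m H \<phi>)" by (intro add) auto
  then show ?case by simp
qed (simp add: zero)

lemma faa_di_bruno_cong: "faa_di_bruno is E \<Longrightarrow> (\<And>i. i \<in> set is \<Longrightarrow> H i = H' i) \<Longrightarrow> E H \<phi> = E H' \<phi>"
proof (induction rule: faa_di_bruno.induct)
  case (inner m "is")
  then have "map H is = map H' is" by simp
  then show ?case by (simp only:)
next
  case (mult is1 E1 is2 E2 "is")
  then have "set is = set is1 \<union> set is2" by (metis set_mset_mset set_mset_union)
  then show ?case using mult by simp
qed simp_all

text \<open>The chain rule along the curve s to q (\<phi> + s h), of which only the componentwise
  derivative at 0 is known; \<open>has_vector_derivative_along\<close> asks for no more.\<close>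

lemma outer_derivative:
  assumes \<phi>: "\<phi> \<in> \<U>" and h: "h \<in> smooth_functions M" and js: "set js \<subseteq> {..<N}"
  shows "((\<lambda>s. iter_partial js \<psi> (q (\<lambda>x. \<phi> x + s * h x))) has_vector_derivative
    (\<Sum>m<N. gateaux (Q m) [h] \<phi> * iter_partial (m # js) \<psi> (q \<phi>))) (at 0)"
proof -
  let ?\<phi> = "\<lambda>s x. \<phi> x + s * h x"
  \<comment> \<open>The derivative of the complex functional \<open>Q m\<close> is real, being that
    of a real curve. This identifies the real coefficients of the chain rule with the complex
    factors that occur as terms.\<close>
  have D: "((\<lambda>s. q (?\<phi> s) m) has_vector_derivative Re (gateaux (Q m) [h] \<phi>)) (at 0)"
    "complex_of_real (Re (gateaux (Q m) [h] \<phi>)) = gateaux (Q m) [h] \<phi>" if m: "m < N" for m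
  proof -
    have *: "((\<lambda>s. Q m (?\<phi> s)) has_vector_derivative gateaux (Q m) [h] \<phi>) (at 0)"
      using gateaux_has_vector_derivative[OF Q_smooth[OF m] \<phi> h, of "[]"] by simp
    from bounded_linear.has_vector_derivative[OF bounded_linear_Re *]
    show 1: "((\<lambda>s. q (?\<phi> s) m) has_vector_derivative Re (gateaux (Q m) [h] \<phi>)) (at 0)" by simp
    from vector_derivative_unique_at[OF bounded_linear.has_vector_derivative[OF bounded_linear_of_real 1] *]
    show "complex_of_real (Re (gateaux (Q m) [h] \<phi>)) = gateaux (Q m) [h] \<phi>" .
  qed
  note sm = smooth_iter[OF \<psi> js]
  have "((\<lambda>s. iter_partial js \<psi> (q (?\<phi> s))) has_vector_derivative
      (\<Sum>m<N. Re (gateaux (Q m) [h] \<phi>) *\<^sub>R partial_deriv m (iter_partial js \<psi>) (q (?\<phi> 0)))) (at 0)"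
  proof (rule has_vector_derivative_along[OF V smooth_has_pd[OF V sm] smooth_continuous[OF V smooth_partial[OF sm]] D(1)])
    show "\<forall>\<^sub>F s in nhds 0. q (?\<phi> s) \<in> V"
      using line_in_domain[OF M \<U> \<phi> h] by eventually_elim (rule qV)
  qed
  moreover have "(\<Sum>m<N. Re (gateaux (Q m) [h] \<phi>) *\<^sub>R partial_deriv m (iter_partial js \<psi>) (q (?\<phi> 0))) =
      (\<Sum>m<N. gateaux (Q m) [h] \<phi> * iter_partial (m # js) \<psi> (q (?\<phi> 0)))"
    by (rule sum.cong[OF refl]) (simp only: scaleR_conv_of_real D(2) lessThan_iff iter_partial.simps)
  ultimately show ?thesis by (simp only: mult_zero_left add_0_right)
qed

definition derivative_along :: "nat \<Rightarrow> ((nat \<Rightarrow> 'a \<Rightarrow> real) \<Rightarrow> ('a \<Rightarrow> real) \<Rightarrow> complex) \<Rightarrow>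
    ((nat \<Rightarrow> 'a \<Rightarrow> real) \<Rightarrow> ('a \<Rightarrow> real) \<Rightarrow> complex) \<Rightarrow> bool" where
  "derivative_along i E E' \<longleftrightarrow> (\<forall>\<phi>\<in>\<U>. \<forall>H. range H \<subseteq> smooth_functions M \<longrightarrow>
    ((\<lambda>s. E H (\<lambda>x. \<phi> x + s * H i x)) has_vector_derivative E' H \<phi>) (at 0))"

lemma derivative_alongD:
  "derivative_along i E E' \<Longrightarrow> \<phi> \<in> \<U> \<Longrightarrow> range H \<subseteq> smooth_functions M \<Longrightarrow>
    ((\<lambda>s. E H (\<lambda>x. \<phi> x + s * H i x)) has_vector_derivative E' H \<phi>) (at 0)"
  by (simp add: derivative_along_def)

text \<open>The new direction goes in front, as in \<open>gateaux\<close>, whose outermost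
  derivative is the head of the list. In a product either factor may receive it, because
  \<open>mult\<close> compares multisets and leaves the order within \<open>is\<close> open.\<close>

lemma faa_di_bruno_derivative:
  assumes "faa_di_bruno is E"
  shows "\<exists>E'. faa_di_bruno (i # is) E' \<and> derivative_along i E E'"
  using assms
proof (induction rule: faa_di_bruno.induct)
  case (outer js)
  let ?E' = "\<lambda>H \<phi>. \<Sum>m<N. gateaux (Q m) (map H [i]) \<phi> * iter_partial (m # js) \<psi> (q \<phi>)"
  have "faa_di_bruno [i] ?E'"
    by (rule faa_di_bruno_sum) (use outer in \<open>intro mult[OF faa_di_bruno.inner faa_di_bruno.outer]; auto\<close>)
  moreover have "derivative_along i (\<lambda>H \<phi>. iter_partial js \<psi> (q \<phi>)) ?E'"
    unfolding derivative_along_def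
  proof (intro ballI allI impI)
    fix \<phi> and H :: "nat \<Rightarrow> 'a \<Rightarrow> real" assume "\<phi> \<in> \<U>" "range H \<subseteq> smooth_functions M"
    then show "((\<lambda>s. iter_partial js \<psi> (q (\<lambda>x. \<phi> x + s * H i x))) has_vector_derivative ?E' H \<phi>) (at 0)"
      using outer_derivative[OF _ _ outer, of \<phi> "H i"] by auto
  qed
  ultimately show ?case by (intro exI conjI)
next
  case (inner m "is")
  have "derivative_along i (\<lambda>H. gateaux (Q m) (map H is)) (\<lambda>H. gateaux (Q m) (map H (i # is)))"
    unfolding derivative_along_def
  proof (intro ballI allI impI)
    fix \<phi> and H :: "nat \<Rightarrow> 'a \<Rightarrow> real" assume "\<phi> \<in> \<U>" "range H \<subseteq> smooth_functions M"
    then show "((\<lambda>s. gateaux (Q m) (map H is) (\<lambda>x. \<phi> x + s * H i x)) has_vector_derivative gateaux (Q m) (map H (i # is)) \<phi>) (at 0)"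
      using gateaux_has_vector_derivative[OF Q_smooth[OF inner(1)], of \<phi> "H i" "map H is"] by auto
  qed
  moreover have "faa_di_bruno (i # is) (\<lambda>H. gateaux (Q m) (map H (i # is)))" by (rule faa_di_bruno.inner[OF inner(1)]) simp
  ultimately show ?case by (intro exI conjI)
next
  case (zero "is")
  show ?case using faa_di_bruno.zero by (intro exI[of _ "\<lambda>H \<phi>. 0"]) (simp add: derivative_along_def)
next
  case (add "is" E1 E2)
  then obtain E1' E2' where *: "faa_di_bruno (i # is) E1'" "faa_di_bruno (i # is) E2'"
    and D: "derivative_along i E1 E1'" "derivative_along i E2 E2'" by blast
  have "derivative_along i (\<lambda>H \<phi>. E1 H \<phi> + E2 H \<phi>) (\<lambda>H \<phi>. E1' H \<phi> + E2' H \<phi>)"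
    unfolding derivative_along_def
    by (intro ballI allI impI has_vector_derivative_add derivative_alongD[OF D(1)] derivative_alongD[OF D(2)])
  then show ?case using faa_di_bruno.add[OF *] by (intro exI conjI)
next
  case (mult is1 E1 is2 E2 "is")
  then obtain E1' E2' where *: "faa_di_bruno (i # is1) E1'" "faa_di_bruno (i # is2) E2'"
    and D: "derivative_along i E1 E1'" "derivative_along i E2 E2'" by blast
  let ?E' = "\<lambda>H \<phi>. E1 H \<phi> * E2' H \<phi> + E1' H \<phi> * E2 H \<phi>"
  have "faa_di_bruno (i # is) ?E'"
    by (intro faa_di_bruno.add faa_di_bruno.mult[OF mult(1) *(2)] faa_di_bruno.mult[OF *(1) mult(2)]) (simp_all add: mult(3))
  moreover have "derivative_along i (\<lambda>H \<phi>. E1 H \<phi> * E2 H \<phi>) ?E'"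
    unfolding derivative_along_def
  proof (intro ballI allI impI)
    fix \<phi> and H :: "nat \<Rightarrow> 'a \<Rightarrow> real" assume "\<phi> \<in> \<U>" "range H \<subseteq> smooth_functions M"
    from has_vector_derivative_mult[OF derivative_alongD[OF D(1) this] derivative_alongD[OF D(2) this]]
    show "((\<lambda>s. E1 H (\<lambda>x. \<phi> x + s * H i x) * E2 H (\<lambda>x. \<phi> x + s * H i x)) has_vector_derivative ?E' H \<phi>) (at 0)" by simp
  qed
  ultimately show ?case by (intro exI conjI)
qed

abbreviation G :: "'a functional" where "G \<equiv> \<lambda>\<phi>. \<psi> (q \<phi>)"

text \<open>The equality is claimed on \<U> and for smooth directions only. Passing to the next
  derivative is justified since the line in a smooth direction remains in \<U> for small s.\<close>

lemma gateaux_faa_di_bruno: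
  "\<exists>E. faa_di_bruno is E \<and> (\<forall>\<phi>\<in>\<U>. \<forall>H. range H \<subseteq> smooth_functions M \<longrightarrow> gateaux G (map H is) \<phi> = E H \<phi>)"
proof (induction "is")
  case Nil
  show ?case using outer[of "[]"] by (intro exI[of _ "\<lambda>H \<phi>. \<psi> (q \<phi>)"]) simp
next
  case (Cons i "is")
  from Cons obtain E where E: "faa_di_bruno is E"
    and E_eq: "\<forall>\<phi>\<in>\<U>. \<forall>H. range H \<subseteq> smooth_functions M \<longrightarrow> gateaux G (map H is) \<phi> = E H \<phi>"
    by (elim exE conjE) (rule that)
  from faa_di_bruno_derivative[OF E, of i] obtain E' where E': "faa_di_bruno (i # is) E'"
    and D: "derivative_along i E E'"
    by blast
  have "gateaux G (map H (i # is)) \<phi> = E' H \<phi>" if \<phi>: "\<phi> \<in> \<U>" and H: "range H \<subseteq> smooth_functions M" for \<phi> H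
  proof -
    have "((\<lambda>s. gateaux G (map H is) (\<lambda>x. \<phi> x + s * H i x)) has_vector_derivative E' H \<phi>) (at 0)"
      by (rule derivative_along_cong[OF M \<U> \<phi> _ _ derivative_alongD[OF D \<phi> H]]) (use H E_eq in auto)
    then show ?thesis by (simp add: vector_derivative_at)
  qed
  then show ?case by (intro exI[of _ E'] conjI ballI allI impI E')
qed

lemma gateaux_expansion:
  obtains E where "faa_di_bruno is E" "\<And>\<phi> H. \<phi> \<in> \<U> \<Longrightarrow> range H \<subseteq> smooth_functions M \<Longrightarrow> gateaux G (map H is) \<phi> = E H \<phi>"
proof -
  assume *: thesis if "faa_di_bruno is E" "\<And>\<phi> H. \<phi> \<in> \<U> \<Longrightarrow> range H \<subseteq> smooth_functions M \<Longrightarrow> gateaux G (map H is) \<phi> = E H \<phi>" for E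
  from gateaux_faa_di_bruno[of "is"] show thesis by (elim exE conjE) (rule *, assumption, simp)
qed

lemma q_continuous: "continuous_map (subtopology (smooth_topology M) \<U>) (subtopology (Euclidean_space N) V) q"
  unfolding continuous_map_in_subtopology
proof
  have "continuous_map (subtopology (smooth_topology M) \<U>) euclideanreal (\<lambda>\<phi>. q \<phi> m)" if "m < N" for m
    using continuous_bounded_linear[OF bounded_linear_Re, of _ "Q m"] Q_smooth[OF that] by (simp add: smooth_functional_def)
  then have "continuous_map (subtopology (smooth_topology M) \<U>) (Euclidean_space N) (\<lambda>\<phi> m. if m < N then q \<phi> m else 0)"
    by (subst continuous_map_componentwise_Euclidean_space) simp
  moreover have "(\<lambda>\<phi> m. if m < N then q \<phi> m else 0) = q" using q0 by (auto simp: fun_eq_iff)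
  ultimately show "continuous_map (subtopology (smooth_topology M) \<U>) (Euclidean_space N) q" by simp
  show "q \<in> topspace (subtopology (smooth_topology M) \<U>) \<rightarrow> V" unfolding topspace_domain[OF M \<U>] using qV by auto
qed

lemma faa_di_bruno_continuous:
  assumes "faa_di_bruno is E" "set is \<subseteq> {..<k}"
  shows "continuous_map (prod_topology (subtopology (smooth_topology M) \<U>) (product_topology (\<lambda>_. smooth_topology M) {..<k}))
    euclidean (\<lambda>p. E (snd p) (fst p))" (is "continuous_map ?X _ _")
  using assms
proof (induction rule: faa_di_bruno.induct)
  case (outer js)
  have "continuous_map (subtopology (Euclidean_space N) V) euclidean (iter_partial js \<psi>)"
    using \<psi> outer(1) by (simp add: smooth_on_Rn_def)
  from continuous_map_compose[OF continuous_map_compose[OF continuous_map_fst q_continuous] this]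
  show ?case by (simp add: o_def)
next
  case (inner m "is")
  let ?l = "length is" and ?S = "subtopology (smooth_topology M) \<U>" and ?P = "\<lambda>k. product_topology (\<lambda>_. smooth_topology M :: ('a \<Rightarrow> real) topology) {..<k::nat}"
  \<comment> \<open>Selects the directions listed in \<open>is\<close> from the k given ones; the
    joint continuity of the derivative of order \<open>length is\<close> is composed with this
    projection. The order is at least 1 because \<open>inner\<close> excludes the empty
    list.\<close>
  let ?r = "\<lambda>H. \<lambda>p\<in>{..<?l}. H (is ! p)"
  have "continuous_map (?P k) (?P ?l) ?r"
    unfolding continuous_map_componentwise
  proof (intro conjI ballI)
    fix p assume "p \<in> {..<?l}"
    moreover from this have "is ! p < k" using inner(3) by (meson lessThan_iff nth_mem subsetD)
    ultimately show "continuous_map (?P k) (smooth_topology M) (\<lambda>H. ?r H p)"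
      using continuous_map_product_projection[of "is ! p" "{..<k}" "\<lambda>_. smooth_topology M :: ('a \<Rightarrow> real) topology"] by simp
  qed auto
  from continuous_map_compose[OF continuous_map_snd this]
  have r: "continuous_map ?X (?P ?l) (?r \<circ> snd)" .
  have "?l \<ge> 1" using inner(2) by (cases "is") auto
  then have g: "continuous_map (prod_topology ?S (?P ?l)) euclidean (\<lambda>(\<phi>, H). gateaux (Q m) (map H [0..<?l]) \<phi>)"
    using Q_smooth[OF inner(1)] unfolding smooth_functional_def by blast
  have "continuous_map ?X (prod_topology ?S (?P ?l)) (\<lambda>p. (fst p, (?r \<circ> snd) p))"
    by (rule continuous_map_pairedI[OF continuous_map_fst r])
  from continuous_map_compose[OF this g]
  have "continuous_map ?X euclidean (\<lambda>p. gateaux (Q m) (map (?r (snd p)) [0..<?l]) (fst p))" by (simp add: o_def)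
  moreover have "map (?r (snd p)) [0..<?l] = map (snd p) is" for p :: "('a \<Rightarrow> real) \<times> (nat \<Rightarrow> 'a \<Rightarrow> real)"
    by (rule nth_equalityI) auto
  ultimately show ?case by (simp only:)
next
  case (mult is1 E1 is2 E2 "is")
  then have "set is = set is1 \<union> set is2" by (metis set_mset_mset set_mset_union)
  then have "continuous_map ?X euclidean (\<lambda>p. E1 (snd p) (fst p))" "continuous_map ?X euclidean (\<lambda>p. E2 (snd p) (fst p))"
    using mult by auto
  then show ?case by (auto simp: continuous_map_atin intro: tendsto_mult)
qed (auto intro: continuous_map_add)

text \<open>A kernel on the power with one factor for each list entry, where factor p carries the
  direction labelled \<open>is ! p\<close>. Labels survive when a list is distributed over two
  sublists, whereas positions start again at 0 in each of them.\<close>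

definition represents :: "(((nat \<Rightarrow> 'a) \<Rightarrow> complex) \<Rightarrow> complex) \<Rightarrow> nat list \<Rightarrow> ((nat \<Rightarrow> 'a \<Rightarrow> real) \<Rightarrow> complex) \<Rightarrow> bool" where
  "represents u is D \<longleftrightarrow> compact_distribution (power_manifold M (length is)) u \<and>
    wavefront_set (power_manifold M (length is)) u \<subseteq> Upsilon M (length is) \<and>
    (\<forall>H. range H \<subseteq> smooth_functions M \<longrightarrow> u (tensor_function M (length is) (\<lambda>p. H (is ! p))) = D H)"

lemma representsD:
  assumes "represents u is D"
  shows "compact_distribution (power_manifold M (length is)) u" "wavefront_set (power_manifold M (length is)) u \<subseteq> Upsilon M (length is)"
    "range H \<subseteq> smooth_functions M \<Longrightarrow> u (tensor_function M (length is) (\<lambda>p. H (is ! p))) = D H"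
  using assms unfolding represents_def by blast+

text \<open>Distinct labels give every factor of the power its own direction, so the sublists of a
  product occupy complementary sets of factors. The kernels then arise by recursion over the term,
  the product case being \<open>tensor_microlocal\<close>.\<close>

lemma faa_di_bruno_kernel:
  assumes "faa_di_bruno is E" "distinct is" "\<phi> \<in> \<U>"
  shows "\<exists>u. represents u is (\<lambda>H. E H \<phi>)"
  using assms
proof (induction rule: faa_di_bruno.induct)
  case (outer js)
  show ?case
    unfolding represents_def list.size
    by (intro exI[of _ "\<lambda>f. iter_partial js \<psi> (q \<phi>) * f (\<lambda>_. undefined)"] conjI allI impI point_kernel[OF M])
next
  case (inner m "is")
  have l: "length is \<ge> 1" using inner(2) by (cases "is") auto
  have "\<forall>\<phi>\<in>\<U>. \<forall>k\<ge>1. \<exists>u. is_kernel M k (\<lambda>hs. gateaux (Q m) hs \<phi>) u \<and> wavefront_set (power_manifold M k) u \<subseteq> Upsilon M k"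
    using q[OF inner(1)] unfolding microlocal_functional_def by (rule conjunct2)
  from this[THEN bspec, OF inner(4), THEN spec, THEN mp, OF l] obtain u where u: "is_kernel M (length is) (\<lambda>hs. gateaux (Q m) hs \<phi>) u" "wavefront_set (power_manifold M (length is)) u \<subseteq> Upsilon M (length is)"
    by (elim exE conjE) (rule that)
  note u' = u(1)[unfolded is_kernel_def, THEN conjunct1] u(1)[unfolded is_kernel_def, THEN conjunct2, rule_format]
  have "u (tensor_function M (length is) (\<lambda>p. H (is ! p))) = gateaux (Q m) (map H is) \<phi>" if "range H \<subseteq> smooth_functions M" for H
  proof -
    have "u (tensor_function M (length is) (\<lambda>p. H (is ! p))) = gateaux (Q m) (map (\<lambda>p. H (is ! p)) [0..<length is]) \<phi>"
      by (rule u'(2)) (use that in blast)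
    also have "map (\<lambda>p. H (is ! p)) [0..<length is] = map H is" by (rule nth_equalityI) auto
    finally show ?thesis .
  qed
  then show ?case unfolding represents_def by (intro exI[of _ u] conjI allI impI u'(1) u(2))
next
  case (zero "is")
  show ?case unfolding represents_def by (intro exI[of _ "\<lambda>f. 0"] conjI allI impI wavefront_zero[OF power_manifold_charted[OF M]] refl)
next
  case (add "is" E1 E2)
  note N = power_manifold_charted[OF M, of "length is"]
  from add obtain u v where u: "represents u is (\<lambda>H. E1 H \<phi>)" and v: "represents v is (\<lambda>H. E2 H \<phi>)" by blast
  note U = representsD[OF u] and V = representsD[OF v]
  show ?case
    unfolding represents_def
    by (intro exI[of _ "\<lambda>f. u f + v f"] conjI allI impI compact_distribution_sum2[OF N U(1) V(1)] wavefront_add[OF N U(1,2) V(1,2)])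
      (simp only: U(3) V(3))
next
  case (mult is1 E1 is2 E2 "is")
  have eq: "mset is = mset (is1 @ is2)" using mult(3) by simp
  have "distinct (is1 @ is2)" using mset_eq_imp_distinct_iff[OF eq] mult(6) by simp
  then have d: "distinct is1" "distinct is2" "set is1 \<inter> set is2 = {}" by auto
  have set: "set is = set is1 \<union> set is2" using mset_eq_setD[OF eq] by simp
  let ?k = "length is" and ?a = "length is1" and ?b = "length is2"
  \<comment> \<open>The position of a label in \<open>is\<close>. It sends the entries of
    \<open>is1\<close> and \<open>is2\<close> to complementary sets of factors, which is the
    splitting that the tensor product requires.\<close>
  define pos where "pos = inv_into {..<?k} ((!) is)"
  have b: "bij_betw ((!) is) {..<?k} (set is)" using bij_betw_nth[OF mult(6)] by simp
  have pos: "bij_betw pos (set is) {..<?k}" "\<And>y. y \<in> set is \<Longrightarrow> is ! pos y = y"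
    unfolding pos_def by (rule bij_betw_inv_into[OF b]) (use b in \<open>simp add: bij_betw_inv_into_right\<close>)
  have im: "(!) is1 ` {..<?a} = set is1" "(!) is2 ` {..<?b} = set is2" by (auto simp: set_conv_nth)
  have st: "index_split ?k ?a ?b (\<lambda>p. pos (is1 ! p)) (\<lambda>p. pos (is2 ! p))"
    unfolding index_split_def
  proof (intro conjI)
    have inj: "inj_on pos (set is)" "pos ` set is = {..<?k}" using pos(1) by (simp_all add: bij_betw_def)
    have "inj_on ((!) is1) {..<?a}" "inj_on ((!) is2) {..<?b}" using d by (simp_all add: inj_on_nth)
    then show "inj_on (\<lambda>p. pos (is1 ! p)) {..<?a}" "inj_on (\<lambda>p. pos (is2 ! p)) {..<?b}"
      using inj_on_subset[OF inj(1)] comp_inj_on[of "(!) is1" _ pos] comp_inj_on[of "(!) is2" _ pos] im set by (simp_all add: o_def)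
    have e: "(\<lambda>p. pos (is1 ! p)) ` {..<?a} = pos ` set is1" "(\<lambda>p. pos (is2 ! p)) ` {..<?b} = pos ` set is2"
      by (simp_all add: im[symmetric] image_image)
    show "(\<lambda>p. pos (is1 ! p)) ` {..<?a} \<inter> (\<lambda>p. pos (is2 ! p)) ` {..<?b} = {}"
      unfolding e using inj_on_image_Int[OF inj(1), of "set is1" "set is2"] d(3) set by auto
    show "(\<lambda>p. pos (is1 ! p)) ` {..<?a} \<union> (\<lambda>p. pos (is2 ! p)) ` {..<?b} = {..<?k}"
      unfolding e inj(2)[symmetric] set by auto
  qed
  from mult d obtain u v where u: "represents u is1 (\<lambda>H. E1 H \<phi>)" and v: "represents v is2 (\<lambda>H. E2 H \<phi>)" by blast
  note U = representsD[OF u] and V = representsD[OF v]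
  obtain w where w: "compact_distribution (power_manifold M ?k) w" "wavefront_set (power_manifold M ?k) w \<subseteq> Upsilon M ?k"
    "\<And>H. (\<And>j. j < ?k \<Longrightarrow> H j \<in> smooth_functions M) \<Longrightarrow> w (tensor_function M ?k H) =
      u (tensor_function M ?a (\<lambda>p. H (pos (is1 ! p)))) * v (tensor_function M ?b (\<lambda>p. H (pos (is2 ! p))))"
    by (rule tensor_microlocal[OF M st U(1,2) V(1,2)]) blast
  have "w (tensor_function M ?k (\<lambda>p. H (is ! p))) = E1 H \<phi> * E2 H \<phi>" if H: "range H \<subseteq> smooth_functions M" for H
  proof -
    have "tensor_function M ?a (\<lambda>p. H (is ! pos (is1 ! p))) = tensor_function M ?a (\<lambda>p. H (is1 ! p))"
      "tensor_function M ?b (\<lambda>p. H (is ! pos (is2 ! p))) = tensor_function M ?b (\<lambda>p. H (is2 ! p))"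
      by (rule tensor_function_cong, use pos(2) set in simp)+
    moreover have "H i \<in> smooth_functions M" for i using H by blast
    ultimately show ?thesis
      using w(3)[of "\<lambda>p. H (is ! p)"] U(3)[OF H] V(3)[OF H] by simp
  qed
  then show ?case unfolding represents_def by (intro exI[of _ w] conjI allI impI w(1,2))
qed

theorem microlocal_functional_composition: "microlocal_functional M \<U> G"
proof -
  \<comment> \<open>The expansions speak of directions indexed by all natural numbers; finitely many
    directions are continued by the zero function, which is smooth.\<close>
  define ext where "ext k H = (\<lambda>j. if j < k then H j else (\<lambda>_. 0))" for k :: nat and H :: "nat \<Rightarrow> 'a \<Rightarrow> real"
  have ext: "range (ext k H) \<subseteq> smooth_functions M" if "\<And>j. j < k \<Longrightarrow> H j \<in> smooth_functions M" for k H
    using that smooth_functions_0[OF M] by (auto simp: ext_def)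
  have ext_map: "map (ext k H) [0..<k] = map H [0..<k]" for k H by (simp add: ext_def)
  have "smooth_functional M \<U> G"
    unfolding smooth_functional_def
  proof (intro conjI ballI allI impI)
    show "continuous_map (subtopology (smooth_topology M) \<U>) euclidean G"
      using continuous_map_compose[OF q_continuous, of euclidean \<psi>] \<psi>
      by (auto simp: o_def smooth_on_Rn_def dest: spec[of _ "[]"])
  next
    fix \<phi> h :: "'a \<Rightarrow> real" and hs :: "('a \<Rightarrow> real) list" assume \<phi>: "\<phi> \<in> \<U>" and h: "h \<in> smooth_functions M" "set hs \<subseteq> smooth_functions M"
    \<comment> \<open>The additional direction h receives the label \<open>length hs\<close>, beyond
      those of hs, although it becomes the head of the list of derivatives.\<close>
    define H where "H = ext (Suc (length hs)) (\<lambda>i. (hs @ [h]) ! i)"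
    have H: "range H \<subseteq> smooth_functions M"
      unfolding H_def by (rule ext) (use h in \<open>auto simp: nth_append less_Suc_eq\<close>)
    have Hm: "map H [0..<length hs] = hs" "H (length hs) = h"
      by (auto simp: H_def ext_def nth_append intro!: nth_equalityI)
    obtain E where E: "faa_di_bruno [0..<length hs] E" "\<And>\<phi> H. \<phi> \<in> \<U> \<Longrightarrow> range H \<subseteq> smooth_functions M \<Longrightarrow> gateaux G (map H [0..<length hs]) \<phi> = E H \<phi>"
      by (rule gateaux_expansion[of "[0..<length hs]"]) (rule that)
    from faa_di_bruno_derivative[OF E(1), of "length hs"] obtain E' where
      "derivative_along (length hs) E E'" by blast
    from derivative_alongD[OF this \<phi> H]
    have "((\<lambda>s. E H (\<lambda>x. \<phi> x + s * H (length hs) x)) has_vector_derivative E' H \<phi>) (at 0)" .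
    from derivative_along_cong[OF M \<U> \<phi> _ E(2)[OF _ H] this] h(1)
    have "((\<lambda>s. gateaux G hs (\<lambda>x. \<phi> x + s * h x)) has_vector_derivative E' H \<phi>) (at 0)" by (simp add: Hm)
    then show "(\<lambda>s. gateaux G hs (\<lambda>x. \<phi> x + s * h x)) differentiable at 0" by (rule differentiableI_vector)
  next
    fix k :: nat
    let ?X = "prod_topology (subtopology (smooth_topology M) \<U>) (product_topology (\<lambda>_. smooth_topology M :: ('a \<Rightarrow> real) topology) {..<k})"
    obtain E where E: "faa_di_bruno [0..<k] E" "\<And>\<phi> H. \<phi> \<in> \<U> \<Longrightarrow> range H \<subseteq> smooth_functions M \<Longrightarrow> gateaux G (map H [0..<k]) \<phi> = E H \<phi>"
      by (rule gateaux_expansion[of "[0..<k]"]) (rule that)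
    have "continuous_map ?X euclidean (\<lambda>p. E (snd p) (fst p))"
      by (rule faa_di_bruno_continuous[OF E(1)]) auto
    then show "continuous_map ?X euclidean (\<lambda>(\<phi>, H). gateaux G (map H [0..<k]) \<phi>)"
    proof (rule continuous_map_eq)
      fix p assume "p \<in> topspace ?X"
      note p = topspace_directions[OF M \<U> this]
      have "E (snd p) (fst p) = E (ext k (snd p)) (fst p)" by (rule faa_di_bruno_cong[OF E(1)]) (simp add: ext_def)
      also have "\<dots> = gateaux G (map (ext k (snd p)) [0..<k]) (fst p)" by (rule E(2)[symmetric]) (use p ext in auto)
      finally show "E (snd p) (fst p) = (case p of (\<phi>, H) \<Rightarrow> gateaux G (map H [0..<k]) \<phi>)" by (simp add: ext_map split_beta)
    qed
  qed
  moreover have "\<exists>u. is_kernel M k (\<lambda>hs. gateaux G hs \<phi>) u \<and> wavefront_set (power_manifold M k) u \<subseteq> Upsilon M k" if \<phi>: "\<phi> \<in> \<U>" for \<phi> k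
  proof -
    obtain E where E: "faa_di_bruno [0..<k] E" "\<And>\<phi> H. \<phi> \<in> \<U> \<Longrightarrow> range H \<subseteq> smooth_functions M \<Longrightarrow> gateaux G (map H [0..<k]) \<phi> = E H \<phi>"
      by (rule gateaux_expansion[of "[0..<k]"]) (rule that)
    obtain u where u: "represents u [0..<k] (\<lambda>H. E H \<phi>)" using faa_di_bruno_kernel[OF E(1) distinct_upt \<phi>] by blast
    note U = representsD[OF u, unfolded length_upt diff_zero]
    have "u (tensor_function M k H) = gateaux G (map H [0..<k]) \<phi>" if H: "\<forall>j<k. H j \<in> smooth_functions M" for H
    proof -
      have r: "range (ext k H) \<subseteq> smooth_functions M" by (rule ext) (use H in auto)
      have "tensor_function M k H = tensor_function M k (\<lambda>p. ext k H ([0..<k] ! p))"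
        by (rule tensor_function_cong) (simp add: ext_def)
      then show ?thesis using U(3)[OF r] E(2)[OF \<phi> r] by (simp only: ext_map)
    qed
    then show ?thesis unfolding is_kernel_def by (intro exI[of _ u] conjI allI impI U(1,2))
  qed
  ultimately show ?thesis by (simp add: microlocal_functional_def)
qed

end

section \<open>Supports of functionals and conclusion\<close>

lemma functional_support_closed: "closedin (mtop M) (functional_support M \<U> F)"
  unfolding closedin_def
proof
  show "functional_support M \<U> F \<subseteq> topspace (mtop M)" by (auto simp: functional_support_def)
  show "openin (mtop M) (topspace (mtop M) - functional_support M \<U> F)"
    unfolding openin_subopen[of _ "topspace (mtop M) - functional_support M \<U> F"]
  proof
    fix p assume p: "p \<in> topspace (mtop M) - functional_support M \<U> F"
    then obtain W where W: "openin (mtop M) W" "p \<in> W"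
      "\<And>\<psi> \<phi>. \<psi> \<in> \<U> \<Longrightarrow> (\<lambda>x. \<phi> x + \<psi> x) \<in> \<U> \<Longrightarrow> fun_support M \<phi> \<subseteq> W \<Longrightarrow> F (\<lambda>x. \<phi> x + \<psi> x) = F \<psi>"
      unfolding functional_support_def by blast
    then have "W \<subseteq> topspace (mtop M) - functional_support M \<U> F"
      using openin_subset[OF W(1)] unfolding functional_support_def by blast
    with W(1,2) show "\<exists>T. openin (mtop M) T \<and> p \<in> T \<and> T \<subseteq> topspace (mtop M) - functional_support M \<U> F" by blast
  qed
qed

text \<open>Intersect neighbourhoods of p in which none of the F j reacts to a variation: a
  variation supported there changes none of the arguments of g, whatever g is.\<close>

lemma functional_support_compose:
  "functional_support M \<U> (\<lambda>\<phi>. g (real_coords n (\<lambda>j. F j \<phi>))) \<subseteq> (\<Union>j<n. functional_support M \<U> (F j))"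
proof
  fix p assume p: "p \<in> functional_support M \<U> (\<lambda>\<phi>. g (real_coords n (\<lambda>j. F j \<phi>)))"
  have pM: "p \<in> topspace (mtop M)" using p by (simp add: functional_support_def)
  show "p \<in> (\<Union>j<n. functional_support M \<U> (F j))"
  proof (rule ccontr)
    assume "p \<notin> (\<Union>j<n. functional_support M \<U> (F j))"
    then have p': "p \<notin> functional_support M \<U> (F j)" if "j < n" for j using that by blast
    have "\<exists>W. j < n \<longrightarrow> openin (mtop M) W \<and> p \<in> W \<and>
        (\<forall>\<psi>\<in>\<U>. \<forall>\<phi>. (\<lambda>x. \<phi> x + \<psi> x) \<in> \<U> \<and> fun_support M \<phi> \<subseteq> W \<longrightarrow> F j (\<lambda>x. \<phi> x + \<psi> x) = F j \<psi>)" for j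
      using p'[of j] pM by (cases "j < n") (simp_all add: functional_support_def, blast)
    then obtain W where W: "\<And>j. j < n \<longrightarrow> openin (mtop M) (W j) \<and> p \<in> W j \<and>
        (\<forall>\<psi>\<in>\<U>. \<forall>\<phi>. (\<lambda>x. \<phi> x + \<psi> x) \<in> \<U> \<and> fun_support M \<phi> \<subseteq> W j \<longrightarrow> F j (\<lambda>x. \<phi> x + \<psi> x) = F j \<psi>)"
      by (rule choice[OF allI, THEN exE]) (rule that, erule spec)
    \<comment> \<open>The term \<open>topspace (mtop M)\<close> keeps the intersection an open set
      when n = 0.\<close>
    let ?W = "topspace (mtop M) \<inter> (\<Inter>j<n. W j)"
    have "openin (mtop M) ?W" using W by (intro openin_Int_Inter) auto
    moreover have "p \<in> ?W" using W pM by auto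
    ultimately obtain \<psi> \<phi> where *: "\<psi> \<in> \<U>" "(\<lambda>x. \<phi> x + \<psi> x) \<in> \<U>" "fun_support M \<phi> \<subseteq> ?W"
      "g (real_coords n (\<lambda>j. F j (\<lambda>x. \<phi> x + \<psi> x))) \<noteq> g (real_coords n (\<lambda>j. F j \<psi>))"
      using p unfolding functional_support_def by blast
    have "F j (\<lambda>x. \<phi> x + \<psi> x) = F j \<psi>" if "j < n" for j
      using W[of j] * that by blast
    then have "real_coords n (\<lambda>j. F j (\<lambda>x. \<phi> x + \<psi> x)) = real_coords n (\<lambda>j. F j \<psi>)"
      by (auto simp: real_coords_def fun_eq_iff)
    with *(4) show False by simp
  qed
qed

theorem theorem4p2p1:
  fixes M :: "'a spacetime"
    and \<U> :: "('a \<Rightarrow> real) set"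
    and n :: nat
    and F :: "nat \<Rightarrow> 'a functional"
    and V :: "(nat \<Rightarrow> real) set"
    and \<psi> :: "(nat \<Rightarrow> real) \<Rightarrow> complex"
  assumes "globally_hyperbolic_spacetime M"
    and "openin (smooth_topology M) \<U>"
    and "\<And>j. j < n \<Longrightarrow> F j \<in> microcausal_functionals M \<U>"
    and "openin (Euclidean_space (2 * n)) V"
    and "(\<lambda>\<phi>. real_coords n (\<lambda>j. F j \<phi>)) ` \<U> \<subseteq> V"
    and "smooth_on_Rn (2 * n) V \<psi>"
  shows "(\<lambda>\<phi>. \<psi> (real_coords n (\<lambda>j. F j \<phi>))) \<in> microcausal_functionals M \<U> \<and>
    functional_support M \<U> (\<lambda>\<phi>. \<psi> (real_coords n (\<lambda>j. F j \<phi>)))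
      \<subseteq> (\<Union>j<n. functional_support M \<U> (F j))"
proof
  let ?q = "\<lambda>\<phi>. real_coords n (\<lambda>j. F j \<phi>)"
  have M: "charted M" and g: "lorentzian_metric M" "time_oriented M"
    using assms(1) by (auto simp: globally_hyperbolic_spacetime_def oriented_manifold_def intro: smooth_manifold_charted)
  have F: "microlocal_functional M \<U> (F j)" "compactin (mtop M) (functional_support M \<U> (F j))" if "j < n" for j
    using assms(3)[OF that] by (auto simp: microcausal_functionals_def microlocal_functional_def)
  have L: "bounded_linear (\<lambda>z. complex_of_real (Re z))" "bounded_linear (\<lambda>z. complex_of_real (Im z))"
    by (rule bounded_linear_compose[OF bounded_linear_of_real] bounded_linear_Re bounded_linear_Im)+
  note lin = microlocal_functional_linear[OF M assms(2) g F(1)]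
  interpret functional_composition M \<U> "2 * n" ?q V \<psi>
  proof
    fix m assume m: "m < 2 * n"
    then have j: "m div 2 < n" by simp
    \<comment> \<open>The coefficients of z and its conjugate are 1/2 and 1/2 for the real part, and
      -\<i>/2 and \<i>/2 for the imaginary part.\<close>
    have "microlocal_functional M \<U> (\<lambda>\<phi>. complex_of_real (Re (F (m div 2) \<phi>)))"
      by (rule lin[OF j, of "\<lambda>z. of_real (Re z)" "1/2" "1/2"])
        (simp_all add: L complex_eq_iff)
    moreover have "microlocal_functional M \<U> (\<lambda>\<phi>. complex_of_real (Im (F (m div 2) \<phi>)))"
      by (rule lin[OF j, of "\<lambda>z. of_real (Im z)" "- \<i>/2" "\<i>/2"])
        (simp_all add: L complex_eq_iff)
    ultimately show "microlocal_functional M \<U> (\<lambda>\<phi>. complex_of_real (?q \<phi> m))"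
      using m by (cases "even m") (simp_all add: real_coords_def)
  qed (use M assms in \<open>auto simp: real_coords_def\<close>)
  show sub: "functional_support M \<U> (\<lambda>\<phi>. \<psi> (?q \<phi>)) \<subseteq> (\<Union>j<n. functional_support M \<U> (F j))"
    by (rule functional_support_compose)
  have "compactin (mtop M) (\<Union>j<n. functional_support M \<U> (F j))" using F(2) by (intro compactin_Union) auto
  then have "compactin (mtop M) (functional_support M \<U> (\<lambda>\<phi>. \<psi> (?q \<phi>)))"
    by (rule closed_compactin[OF _ sub functional_support_closed])
  then show "(\<lambda>\<phi>. \<psi> (?q \<phi>)) \<in> microcausal_functionals M \<U>"
    using microlocal_functional_composition by (simp add: microcausal_functionals_def microlocal_functional_def)
qed

end
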